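(* Let $A$ be an object in ${}^H\mathcal{A}_{\mathrm{fp}}$. The $\mathrm{Mod}_{\underline{K}}({}^H\mathcal{G})$-morphism $$\xi:j(\mathrm{der}(A))\longrightarrow{}^H\mathrm{Der}(A,-\sqcup A)$$ with components $\xi_{X_B}:(B\otimes\mathrm{der}(A))^{\mathbf{0}}\to{}^H\mathrm{Der}(A,B\sqcup A)$, $\xi_{X_B}(b\otimes L)(a):=b\otimes\mathrm{ev}(L\otimes a)=b\otimes\big(\sum_j L_j\,\partial_j(a)\big)$ for all $a\in A$, is an isomorphism. (Hence $\mathrm{der}(A)$ and ${}^H\mathrm{Der}(A,-\sqcup A)$ are equivalent descriptions of the infinitesimal automorphisms of the toric noncommutative space $X_A$.)
   Context: Fix a field $\mathbb{K}$ and a positive integer $n$; $\otimes$ denotes $\otimes_{\mathbb{K}}$. $H=\mathcal{O}(\mathbb{T}^n)$ is the Hopf algebra over $\mathbb{K}$ with vector space basis $\{t_{\mathbf{m}} : \mathbf{m}\in\mathbb{Z}^n\}$, product $t_{\mathbf{m}}t_{\mathbf{m}'}=t_{\mathbf{m}+\mathbf{m}'}$, unit $1_H=t_{\mathbf{0}}$, coproduct $\Delta(t_{\mathbf{m}})=t_{\mathbf{m}}\otimes t_{\mathbf{m}}$, counit $\epsilon(t_{\mathbf{m}})=1$, antipode $S(t_{\mathbf{m}})=t_{-\mathbf{m}}$. Fix a cotriangular structure on $H$, i.e. a linear map $R:H\otimes H\to\mathbb{K}$ with $R(fg\otimes h)=R(f\otimes h_{(1)})R(g\otimes h_{(2)})$,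 $R(f\otimes gh)=R(f_{(1)}\otimes h)R(f_{(2)}\otimes g)$ and $\epsilon(h)\epsilon(g)=R(h_{(1)}\otimes g_{(1)})R(g_{(2)}\otimes h_{(2)})$ (Sweedler notation). ${}^H\mathcal{M}$ is the category of left $H$-comodules $(V,\rho^V)$, $\rho^V(v)=v_{(-1)}\otimes v_{(0)}$, with $H$-equivariant linear maps; it is monoidal with $\rho^{V\otimes W}(v\otimes w)=v_{(-1)}w_{(-1)}\otimes v_{(0)}\otimes w_{(0)}$ and unit $\mathbb{K}$ with trivial coaction $c\mapsto 1_H\otimes c$, and symmetric with $\tau_{V,W}(v\otimes w)=R(w_{(-1)}\otimes v_{(-1)})\,w_{(0)}\otimes v_{(0)}$. For $V$ in ${}^H\mathcal{M}$, $V^{\mathbf{0}}:=\{v\in V:\rho^V(v)=1_H\otimes v\}$ denotes the coinvariants. ${}^H\mathcal{A}$ is the category of (associative unital) algebra objects $A$ in ${}^H\mathcal{M}$ satisfying $a\,a'=R(a'_{(-1)}\otimes a_{(-1)})\,a'_{(0)}a_{(0)}$ for all $a,a'\in A$; morphisms are the ${}^H\mathcal{M}$-morphisms preserving products and units. $F_{\mathbf{m}_1,\dots,\mathbf{m}_N}$ (with $\mathbf{m}_i\in\mathbb{Z}^n$) is the free ${}^H\mathcal{A}$-algebra on generators $x_1,\dots,x_N$ with coaction $x_i\mapsto t_{\mathbf{m}_i}\otimes x_i$, i.e. the algebra generated by the $x_i$ subject to $x_ix_j=R(t_{\mathbf{m}_j}\otimes t_{\mathbf{m}_i})x_jx_i$.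 An object of ${}^H\mathcal{A}$ is finitely presented if it is isomorphic to $F_{\mathbf{m}_1,\dots,\mathbf{m}_N}/(f_k)$ (quotient by the two-sided ideal generated) for finitely many elements $f_k$ with $f_k\mapsto t_{\mathbf{n}_k}\otimes f_k$ for some $\mathbf{n}_k\in\mathbb{Z}^n$. ${}^H\mathcal{A}_{\mathrm{fp}}$ is the full subcategory of finitely presented objects. The coproduct $A\sqcup B$ in ${}^H\mathcal{A}$ and in ${}^H\mathcal{A}_{\mathrm{fp}}$ is $A\otimes B$ with product $(a\otimes b)(a'\otimes b')=R(a'_{(-1)}\otimes b_{(-1)})\,(a\,a'_{(0)})\otimes(b_{(0)}\,b')$ and unit $1_A\otimes 1_B$. For an $H$-coinvariant $s\in A$ the localization is $A[s^{-1}]:=(A\sqcup F_{\mathbf{0}})/(s\otimes x-1)$, where $x$ is the generator of $F_{\mathbf{0}}$, with $\ell_s:A\to A[s^{-1}]$, $a\mapsto[a\otimes 1]$. For coinvariants $s_i,s_j\in A$ put $A[s_i^{-1},s_j^{-1}]:=(A[s_i^{-1}])[\ell_{s_i}(s_j)^{-1}]\simeq(A[s_j^{-1}])[\ell_{s_j}(s_i)^{-1}]$. ${}^H\mathcal{S}:=({}^H\mathcal{A}_{\mathrm{fp}})^{\mathrm{op}}$ is the category of toric noncommutative spaces; its objects are written $X_A$, and a morphism $f:X_B\to X_A$ corresponds to an ${}^H\mathcal{A}_{\mathrm{fp}}$-morphism $f^*:A\to B$. An ${}^H\mathcal{S}$-Zariski covering family is a finite family $\{f_i:X_{A[s_i^{-1}]}\to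 X_A\}$ where (i) each $s_i\in A$ is $H$-coinvariant; (ii) $f_i^*=\ell_{s_i}$; (iii) there exist $a_i\in A$ with $\sum_i a_i s_i=1_A$. A presheaf $Y:{}^H\mathcal{S}^{\mathrm{op}}\to\mathsf{Set}$ is a sheaf if for every such family $Y(X_A)\to\prod_i Y(X_{A[s_i^{-1}]})\rightrightarrows\prod_{i,j}Y(X_{A[s_i^{-1},s_j^{-1}]})$ (induced by the canonical localization morphisms) is an equalizer in $\mathsf{Set}$. ${}^H\mathcal{G}:=\mathrm{Sh}({}^H\mathcal{S})$ is the category of sheaves and natural transformations. The line object $\underline{K}:=\mathrm{Hom}_{{}^H\mathcal{S}}(-,X_{F_{\mathbf{0}}})$ is the commutative ring object in ${}^H\mathcal{G}$ given by $\underline{K}(X_B)=B^{\mathbf{0}}$ with the ring structure inherited from $B$. A $\underline{K}$-module object in ${}^H\mathcal{G}$ is a sheaf $Y$ with a $B^{\mathbf{0}}$-module structure on each $Y(X_B)$, natural in $X_B$ (for $f:X_B\to X_{B'}$ the map $Y(f):Y(X_{B'})\to Y(X_B)$ is additive and $Y(f)(b'\cdot y)=f^*(b')\cdot Y(f)(y)$ for $b'\in {B'}^{\mathbf{0}}$); morphisms are natural transformations with $B^{\mathbf{0}}$-linear components; they form $\mathrm{Mod}_{\underline{K}}({}^H\mathcal{G})$. Braided derivations. For $F=F_{\mathbf{m}_1,\dots,\mathbf{m}_N}$ let $\partial_j:F\to F$ ($j=1,\dots,N$) be the linear map determined by $\partial_j(x_i)=\delta_{ij}1$ and $\partial_j(aa')=\partial_j(a)a'+R(a_{(-1)}\otimes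 t_{-\mathbf{m}_j})\,a_{(0)}\partial_j(a')$. For $V$ in ${}^H\mathcal{M}$ let $V[\mathbf{m}]$ be the vector space $V$ with coaction $v\mapsto v_{(-1)}t_{\mathbf{m}}\otimes v_{(0)}$. For $A=F_{\mathbf{m}_1,\dots,\mathbf{m}_N}/(f_k)$ (a fixed finite presentation), $\mathrm{der}(A):=\{L\in\coprod_{j=1}^N A[-\mathbf{m}_j]:\sum_j L_j\,\partial_j(f_k)=0\ \forall k\}$, an ${}^H\mathcal{M}$-subobject of $\coprod_j A[-\mathbf{m}_j]$ (direct sum in ${}^H\mathcal{M}$), where $\partial_j(f_k)$ is read in $A$ via the quotient map; elements are written $L=\sum_jL_j\partial_j$, and $\mathrm{ev}:\mathrm{der}(A)\otimes A\to A$, $L\otimes a\mapsto\sum_j L_j\,\partial_j(a)$ is well defined. For $V$ in ${}^H\mathcal{M}$, $j(V)$ is the $\underline{K}$-module object with $j(V)(X_B):=(B\otimes V)^{\mathbf{0}}$, $j(V)(f):=f^*\otimes\mathrm{id}_V:(C\otimes V)^{\mathbf{0}}\to(B\otimes V)^{\mathbf{0}}$ for $f:X_B\to X_C$, and $B^{\mathbf{0}}$-action $b\cdot(b'\otimes v)=(bb')\otimes v$. ${}^H\mathrm{Der}(A,B\sqcup A)$ is the set of ${}^H\mathcal{M}$-morphisms $v:A\to B\sqcup A$ satisfying $v(aa')=v(a)(1_B\otimes a')+(1_B\otimes a)v(a')$ for all $a,a'\in A$. ${}^H\mathrm{Der}(A,-\sqcup A)$ is the $\underline{K}$-module object $X_B\mapsto{}^H\mathrm{Der}(A,B\sqcup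 A)$, sending $f:X_B\to X_{B'}$ to $v\mapsto(f^*\otimes\mathrm{id}_A)\circ v$, with pointwise addition and $B^{\mathbf{0}}$-action $(b\cdot v)(a)=(b\otimes 1_A)v(a)$. *)

theory Defs
  imports
    "HOL-Algebra.QuotRing"
    "HOL-Algebra.Module"
    "HOL-Library.Poly_Mapping"
    "HOL-Analysis.Finite_Cartesian_Product"
begin

text \<open>
  The ground field is a type \<open>'k\<close> of class \<open>field\<close>, and \<open>n\<close> is \<open>CARD('n)\<close>.  Vector spaces,
  comodules and algebras are HOL-Algebra records with explicit carriers; where a record is only a
  vector space or a module, its fields \<open>mult\<close> and \<open>one\<close> are ignored, as usual for \<open>module\<close>.
\<close>

section \<open>Vector spaces and tensor products\<close>

definition base_field :: "('k::field, 'k) module" where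
  "base_field = \<lparr>carrier = UNIV, mult = (*), one = 1, zero = 0, add = (+), smult = (*)\<rparr>"

abbreviation vspace :: "('k::field, 'v, 'x) module_scheme \<Rightarrow> bool" where
  "vspace V \<equiv> Module.module base_field V"

definition lin_map ::
  "('k::field, 'v, 'x) module_scheme \<Rightarrow> ('k, 'w, 'y) module_scheme \<Rightarrow> ('v \<Rightarrow> 'w) \<Rightarrow> bool" where
  "lin_map V W f \<longleftrightarrow> f \<in> carrier V \<rightarrow> carrier W \<and>
     (\<forall>v\<in>carrier V. \<forall>v'\<in>carrier V. f (v \<oplus>\<^bsub>V\<^esub> v') = f v \<oplus>\<^bsub>W\<^esub> f v') \<and>
     (\<forall>c. \<forall>v\<in>carrier V. f (c \<odot>\<^bsub>V\<^esub> v) = c \<odot>\<^bsub>W\<^esub> f v)"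

definition rep :: "'a set \<Rightarrow> 'a" where
  "rep X = (SOME x. x \<in> X)"

definition psmult :: "'k::field \<Rightarrow> ('b \<Rightarrow>\<^sub>0 'k) \<Rightarrow> ('b \<Rightarrow>\<^sub>0 'k)" where
  "psmult c p = Poly_Mapping.map (\<lambda>x. c * x) p"

text \<open>
  \<open>V \<otimes> W\<close> is the free vector space on \<open>carrier V \<times> carrier W\<close> (finite formal combinations of
  pairs) modulo the bilinearity relations; its elements are cosets.
\<close>

definition tensor_rels ::
  "('k::field, 'v, 'x) module_scheme \<Rightarrow> ('k, 'w, 'y) module_scheme \<Rightarrow> (('v \<times> 'w) \<Rightarrow>\<^sub>0 'k) set" where
  "tensor_rels V W =
     {Poly_Mapping.single (v \<oplus>\<^bsub>V\<^esub> v', w) 1 - Poly_Mapping.single (v, w) 1 - Poly_Mapping.single (v', w) 1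
        | v v' w. v \<in> carrier V \<and> v' \<in> carrier V \<and> w \<in> carrier W} \<union>
     {Poly_Mapping.single (v, w \<oplus>\<^bsub>W\<^esub> w') 1 - Poly_Mapping.single (v, w) 1 - Poly_Mapping.single (v, w') 1
        | v w w'. v \<in> carrier V \<and> w \<in> carrier W \<and> w' \<in> carrier W} \<union>
     {Poly_Mapping.single (c \<odot>\<^bsub>V\<^esub> v, w) 1 - Poly_Mapping.single (v, w) c
        | c v w. v \<in> carrier V \<and> w \<in> carrier W} \<union>
     {Poly_Mapping.single (v, c \<odot>\<^bsub>W\<^esub> w) 1 - Poly_Mapping.single (v, w) c
        | c v w. v \<in> carrier V \<and> w \<in> carrier W}"

definition tensor_class ::
  "('k::field, 'v, 'x) module_scheme \<Rightarrow> ('k, 'w, 'y) module_scheme \<Rightarrow>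
   (('v \<times> 'w) \<Rightarrow>\<^sub>0 'k) \<Rightarrow> (('v \<times> 'w) \<Rightarrow>\<^sub>0 'k) set" where
  "tensor_class V W p =
     {q. Poly_Mapping.keys q \<subseteq> carrier V \<times> carrier W \<and>
         q - p \<in> Modules.module.span psmult (tensor_rels V W)}"

definition tensor ::
  "('k::field, 'v, 'x) module_scheme \<Rightarrow> ('k, 'w, 'y) module_scheme \<Rightarrow>
   ('k, (('v \<times> 'w) \<Rightarrow>\<^sub>0 'k) set) module" where
  "tensor V W =
     \<lparr>carrier = {tensor_class V W p | p. Poly_Mapping.keys p \<subseteq> carrier V \<times> carrier W},
      mult = undefined, one = undefined,
      zero = tensor_class V W 0,
      add = (\<lambda>S T. tensor_class V W (rep S + rep T)),
      smult = (\<lambda>c S. tensor_class V W (psmult c (rep S)))\<rparr>"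

definition tens ::
  "('k::field, 'v, 'x) module_scheme \<Rightarrow> ('k, 'w, 'y) module_scheme \<Rightarrow>
   'v \<Rightarrow> 'w \<Rightarrow> (('v \<times> 'w) \<Rightarrow>\<^sub>0 'k) set" where
  "tens V W v w = tensor_class V W (Poly_Mapping.single (v, w) 1)"

text \<open>
  \<open>tlift Z \<beta>\<close> is the linear map out of a tensor product with \<open>v \<otimes> w \<mapsto> \<beta> v w\<close> induced by a bilinear
  map \<open>\<beta>\<close> into \<open>Z\<close>.  Applied to a coaction value \<open>\<rho>(v)\<close> (or to a coproduct) it is the Sweedler sum
  \<open>\<beta> v\<^sub>(\<^sub>-\<^sub>1\<^sub>) v\<^sub>(\<^sub>0\<^sub>)\<close>.
\<close>

definition tlift ::
  "('k::field, 'z, 'x) module_scheme \<Rightarrow> ('v \<Rightarrow> 'w \<Rightarrow> 'z) \<Rightarrow> (('v \<times> 'w) \<Rightarrow>\<^sub>0 'k) set \<Rightarrow> 'z" where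
  "tlift Z \<beta> T =
     (\<Oplus>\<^bsub>Z\<^esub>x\<in>Poly_Mapping.keys (rep T). Poly_Mapping.lookup (rep T) x \<odot>\<^bsub>Z\<^esub> \<beta> (fst x) (snd x))"

text \<open>\<open>tmap V' W' f g\<close> is \<open>f \<otimes> g\<close>, with values in \<open>V' \<otimes> W'\<close>.\<close>

definition tmap ::
  "('k::field, 'v1, 'x) module_scheme \<Rightarrow> ('k, 'w1, 'y) module_scheme \<Rightarrow>
   ('v \<Rightarrow> 'v1) \<Rightarrow> ('w \<Rightarrow> 'w1) \<Rightarrow> (('v \<times> 'w) \<Rightarrow>\<^sub>0 'k) set \<Rightarrow> (('v1 \<times> 'w1) \<Rightarrow>\<^sub>0 'k) set" where
  "tmap V' W' f g = tlift (tensor V' W') (\<lambda>v w. tens V' W' (f v) (g w))"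

text \<open>The canonical isomorphism from \<open>(U \<otimes> V) \<otimes> W\<close> to \<open>U \<otimes> (V \<otimes> W)\<close>.\<close>

definition tassoc ::
  "('k::field, 'u, 'x) module_scheme \<Rightarrow> ('k, 'v, 'y) module_scheme \<Rightarrow> ('k, 'w, 'z) module_scheme \<Rightarrow>
   (((('u \<times> 'v) \<Rightarrow>\<^sub>0 'k) set \<times> 'w) \<Rightarrow>\<^sub>0 'k) set \<Rightarrow> (('u \<times> (('v \<times> 'w) \<Rightarrow>\<^sub>0 'k) set) \<Rightarrow>\<^sub>0 'k) set" where
  "tassoc U V W =
     tlift (tensor U (tensor V W))
       (\<lambda>T w. tlift (tensor U (tensor V W)) (\<lambda>u v. tens U (tensor V W) u (tens V W v w)) T)"


section \<open>The Hopf algebra of functions on the torus and cotriangular structures\<close>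

text \<open>
  The group algebra of \<open>\<int>\<^sup>n\<close>: finitely supported functions on \<open>\<int>\<^sup>n\<close>, whose multiplication \<open>(*)\<close>
  from \<open>Poly_Mapping\<close> is convolution; \<open>tbasis m\<close> is the basis vector \<open>t\<^sub>m\<close>.
\<close>

type_synonym ('k, 'n) torus = "(int ^ 'n) \<Rightarrow>\<^sub>0 'k"

type_synonym ('k, 'n) torus2 = "(('k, 'n) torus \<times> ('k, 'n) torus \<Rightarrow>\<^sub>0 'k) set"

definition HT :: "('k::field, ('k, 'n::finite) torus) module" where
  "HT = \<lparr>carrier = UNIV, mult = (*), one = 1, zero = 0, add = (+), smult = psmult\<rparr>"

definition tbasis :: "int ^ 'n::finite \<Rightarrow> ('k::field, 'n) torus" where
  "tbasis m = Poly_Mapping.single m 1"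

definition comult :: "('k::field, 'n::finite) torus \<Rightarrow> ('k, 'n) torus2" where
  "comult h = (\<Oplus>\<^bsub>tensor HT HT\<^esub>m\<in>Poly_Mapping.keys h.
     Poly_Mapping.lookup h m \<odot>\<^bsub>tensor HT HT\<^esub> tens HT HT (tbasis m) (tbasis m))"

definition counit :: "('k::field, 'n::finite) torus \<Rightarrow> 'k" where
  "counit h = (\<Sum>m\<in>Poly_Mapping.keys h. Poly_Mapping.lookup h m)"

definition cotriangular :: "(('k::field, 'n::finite) torus2 \<Rightarrow> 'k) \<Rightarrow> bool" where
  "cotriangular R \<longleftrightarrow>
     lin_map (tensor HT HT) base_field R \<and>
     (\<forall>f g h. R (tens HT HT (f * g) h) =
        tlift base_field (\<lambda>h1 h2. R (tens HT HT f h1) * R (tens HT HT g h2)) (comult h)) \<and>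
     (\<forall>f g h. R (tens HT HT f (g * h)) =
        tlift base_field (\<lambda>f1 f2. R (tens HT HT f1 h) * R (tens HT HT f2 g)) (comult f)) \<and>
     (\<forall>g h. counit h * counit g =
        tlift base_field (\<lambda>h1 h2. tlift base_field
          (\<lambda>g1 g2. R (tens HT HT h1 g1) * R (tens HT HT g2 h2)) (comult g)) (comult h))"


section \<open>Comodules\<close>

record (overloaded) ('k, 'n, 'v) hobj = "('k, 'v) module" +
  coact :: "'v \<Rightarrow> ((('k, 'n) torus \<times> 'v) \<Rightarrow>\<^sub>0 'k) set"

definition hcomodule :: "('k::field, 'n::finite, 'v) hobj \<Rightarrow> bool" where
  "hcomodule V \<longleftrightarrow> vspace V \<and> lin_map V (tensor HT V) (coact V) \<and>
     (\<forall>v\<in>carrier V.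
        tmap HT (tensor HT V) id (coact V) (coact V v) =
        tassoc HT HT V (tmap (tensor HT HT) V comult id (coact V v))) \<and>
     (\<forall>v\<in>carrier V. tlift V (\<lambda>h v0. counit h \<odot>\<^bsub>V\<^esub> v0) (coact V v) = v)"

text \<open>
  Morphisms are extensional functions on the carriers (value \<open>undefined\<close> outside), so that equality of
  morphisms is equality of functions; composition is \<open>compose\<close>.
\<close>

definition comod_hom ::
  "('k::field, 'n::finite, 'v) hobj \<Rightarrow> ('k, 'n, 'w) hobj \<Rightarrow> ('v \<Rightarrow> 'w) set" where
  "comod_hom V W = {f. f \<in> extensional (carrier V) \<and> lin_map V W f \<and>
     (\<forall>v\<in>carrier V. coact W (f v) = tmap HT W id f (coact V v))}"

definition coinv :: "('k::field, 'n::finite, 'v) hobj \<Rightarrow> 'v set" where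
  "coinv V = {v \<in> carrier V. coact V v = tens HT V 1 v}"

definition add_coact ::
  "('k::field, 'v) module \<Rightarrow> ('v \<Rightarrow> ((('k, 'n::finite) torus \<times> 'v) \<Rightarrow>\<^sub>0 'k) set) \<Rightarrow> ('k, 'n, 'v) hobj" where
  "add_coact V \<rho> = \<lparr>carrier = carrier V, mult = mult V, one = one V, zero = zero V, add = add V,
                   smult = smult V, coact = \<rho>\<rparr>"

definition htensor ::
  "('k::field, 'n::finite, 'v) hobj \<Rightarrow> ('k, 'n, 'w) hobj \<Rightarrow> ('k, 'n, (('v \<times> 'w) \<Rightarrow>\<^sub>0 'k) set) hobj" where
  "htensor V W = add_coact (tensor V W)
     (tlift (tensor HT (tensor V W)) (\<lambda>v w.
        tlift (tensor HT (tensor V W)) (\<lambda>h v0.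
          tlift (tensor HT (tensor V W)) (\<lambda>g w0.
            tens HT (tensor V W) (h * g) (tens V W v0 w0)) (coact W w)) (coact V v)))"

text \<open>\<open>hshift V m\<close> is \<open>V[m]\<close>.\<close>

definition hshift ::
  "('k::field, 'n::finite, 'v) hobj \<Rightarrow> int ^ 'n \<Rightarrow> ('k, 'n, 'v) hobj" where
  "hshift V m = V\<lparr>coact := \<lambda>v. tlift (tensor HT V) (\<lambda>h v0. tens HT V (h * tbasis m) v0) (coact V v)\<rparr>"

text \<open>
  Direct sum of \<open>V 0, \<dots>, V (N - 1)\<close>; the coaction is the sum of the coactions of the components,
  transported along the inclusions of the summands.
\<close>

definition dsum_space ::
  "nat \<Rightarrow> (nat \<Rightarrow> ('k::field, 'n::finite, 'v) hobj) \<Rightarrow> ('k, nat \<Rightarrow> 'v) module" where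
  "dsum_space N V =
     \<lparr>carrier = (\<Pi>\<^sub>E j\<in>{..<N}. carrier (V j)), mult = undefined, one = undefined,
      zero = (\<lambda>j\<in>{..<N}. \<zero>\<^bsub>V j\<^esub>),
      add = (\<lambda>x y. \<lambda>j\<in>{..<N}. x j \<oplus>\<^bsub>V j\<^esub> y j),
      smult = (\<lambda>c x. \<lambda>j\<in>{..<N}. c \<odot>\<^bsub>V j\<^esub> x j)\<rparr>"

definition dsum_incl ::
  "nat \<Rightarrow> (nat \<Rightarrow> ('k::field, 'n::finite, 'v) hobj) \<Rightarrow> nat \<Rightarrow> 'v \<Rightarrow> nat \<Rightarrow> 'v" where
  "dsum_incl N V i v = (\<lambda>j\<in>{..<N}. if j = i then v else \<zero>\<^bsub>V j\<^esub>)"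

definition hdsum ::
  "nat \<Rightarrow> (nat \<Rightarrow> ('k::field, 'n::finite, 'v) hobj) \<Rightarrow> ('k, 'n, nat \<Rightarrow> 'v) hobj" where
  "hdsum N V = add_coact (dsum_space N V)
     (\<lambda>x. \<Oplus>\<^bsub>tensor HT (dsum_space N V)\<^esub>i\<in>{..<N}.
        tmap HT (dsum_space N V) id (dsum_incl N V i) (coact (V i) (x i)))"

text \<open>
  The subobject on a subspace \<open>S\<close>.  The sets \<open>H \<otimes> S\<close> and \<open>H \<otimes> V\<close> consist of different cosets, so the
  coaction of \<open>V\<close> is restricted through the injection \<open>H \<otimes> S \<rightarrow> H \<otimes> V\<close> induced by the inclusion.
\<close>

definition hsub :: "('k::field, 'n::finite, 'v) hobj \<Rightarrow> 'v set \<Rightarrow> ('k, 'n, 'v) hobj" where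
  "hsub V S = V\<lparr>carrier := S,
     coact := \<lambda>v. THE \<tau>. \<tau> \<in> carrier (tensor HT (V\<lparr>carrier := S\<rparr>)) \<and>
                          tmap HT V id id \<tau> = coact V v\<rparr>"


section \<open>Braided commutative algebras\<close>

definition halgebra ::
  "(('k::field, 'n::finite) torus2 \<Rightarrow> 'k) \<Rightarrow> ('k, 'n, 'a) hobj \<Rightarrow> bool" where
  "halgebra R A \<longleftrightarrow> hcomodule A \<and> ring A \<and>
     (\<forall>c. \<forall>a\<in>carrier A. \<forall>b\<in>carrier A.
        (c \<odot>\<^bsub>A\<^esub> a) \<otimes>\<^bsub>A\<^esub> b = c \<odot>\<^bsub>A\<^esub> (a \<otimes>\<^bsub>A\<^esub> b) \<and> a \<otimes>\<^bsub>A\<^esub> (c \<odot>\<^bsub>A\<^esub> b) = c \<odot>\<^bsub>A\<^esub> (a \<otimes>\<^bsub>A\<^esub> b)) \<and>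
     (\<forall>a\<in>carrier A. \<forall>b\<in>carrier A. coact A (a \<otimes>\<^bsub>A\<^esub> b) =
        tlift (tensor HT A) (\<lambda>h a0. tlift (tensor HT A)
          (\<lambda>g b0. tens HT A (h * g) (a0 \<otimes>\<^bsub>A\<^esub> b0)) (coact A b)) (coact A a)) \<and>
     coact A \<one>\<^bsub>A\<^esub> = tens HT A 1 \<one>\<^bsub>A\<^esub> \<and>
     (\<forall>a\<in>carrier A. \<forall>b\<in>carrier A. a \<otimes>\<^bsub>A\<^esub> b =
        tlift A (\<lambda>h b0. tlift A
          (\<lambda>g a0. R (tens HT HT h g) \<odot>\<^bsub>A\<^esub> (b0 \<otimes>\<^bsub>A\<^esub> a0)) (coact A a)) (coact A b))"

definition halg_hom ::
  "('k::field, 'n::finite, 'a) hobj \<Rightarrow> ('k, 'n, 'b) hobj \<Rightarrow> ('a \<Rightarrow> 'b) set" where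
  "halg_hom A B = {f \<in> comod_hom A B.
     (\<forall>a\<in>carrier A. \<forall>a'\<in>carrier A. f (a \<otimes>\<^bsub>A\<^esub> a') = f a \<otimes>\<^bsub>B\<^esub> f a') \<and> f \<one>\<^bsub>A\<^esub> = \<one>\<^bsub>B\<^esub>}"

definition halg_iso ::
  "('k::field, 'n::finite, 'a) hobj \<Rightarrow> ('k, 'n, 'b) hobj \<Rightarrow> ('a \<Rightarrow> 'b) set" where
  "halg_iso A B = {f \<in> halg_hom A B. \<exists>g\<in>halg_hom B A.
     compose (carrier A) g f = (\<lambda>a\<in>carrier A. a) \<and> compose (carrier B) f g = (\<lambda>b\<in>carrier B. b)}"

definition quot_space ::
  "('k::field, 'n::finite, 'a) hobj \<Rightarrow> 'a set \<Rightarrow> ('k, 'a set) module" where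
  "quot_space A I =
     \<lparr>carrier = carrier (A Quot I), mult = mult (A Quot I), one = one (A Quot I),
      zero = zero (A Quot I), add = add (A Quot I),
      smult = (\<lambda>c X. I +>\<^bsub>A\<^esub> (c \<odot>\<^bsub>A\<^esub> rep X))\<rparr>"

definition hquot :: "('k::field, 'n::finite, 'a) hobj \<Rightarrow> 'a set \<Rightarrow> ('k, 'n, 'a set) hobj" where
  "hquot A I = add_coact (quot_space A I)
     (\<lambda>X. tmap HT (quot_space A I) id (\<lambda>a. I +>\<^bsub>A\<^esub> a) (coact A (rep X)))"


subsection \<open>Free and finitely presented algebras\<close>

text \<open>
  Words in the letters \<open>0, 1, \<dots>\<close> under concatenation (written additively, so that \<open>Poly_Mapping\<close>
  provides the noncommutative polynomials as the monoid algebra).  A list \<open>ms\<close> holds the degrees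
  \<open>m\<^sub>1, \<dots>, m\<^sub>N\<close>; generators are numbered from \<open>0\<close>.
\<close>

datatype word = Word (letters: "nat list")

instantiation word :: monoid_add
begin

definition zero_word :: word where "zero_word = Word []"

definition plus_word :: "word \<Rightarrow> word \<Rightarrow> word" where "plus_word u v = Word (letters u @ letters v)"

instance
  by standard (simp_all add: zero_word_def plus_word_def)

end

type_synonym 'k ncpoly = "word \<Rightarrow>\<^sub>0 'k"

definition ncpoly_space :: "nat \<Rightarrow> ('k::field, 'k ncpoly) module" where
  "ncpoly_space N =
     \<lparr>carrier = {p. \<forall>w\<in>Poly_Mapping.keys p. set (letters w) \<subseteq> {..<N}},
      mult = (*), one = 1, zero = 0, add = (+), smult = psmult\<rparr>"

definition ncpoly_alg :: "(int ^ 'n::finite) list \<Rightarrow> ('k::field, 'n, 'k ncpoly) hobj" where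
  "ncpoly_alg ms = add_coact (ncpoly_space (length ms))
     (\<lambda>p. \<Oplus>\<^bsub>tensor HT (ncpoly_space (length ms))\<^esub>w\<in>Poly_Mapping.keys p.
        Poly_Mapping.lookup p w \<odot>\<^bsub>tensor HT (ncpoly_space (length ms))\<^esub>
        tens HT (ncpoly_space (length ms))
          (tbasis (\<Sum>i\<leftarrow>letters w. ms ! i)) (Poly_Mapping.single w 1))"

definition ncgen :: "nat \<Rightarrow> 'k::field ncpoly" where
  "ncgen i = Poly_Mapping.single (Word [i]) 1"

definition free_ideal ::
  "(('k::field, 'n::finite) torus2 \<Rightarrow> 'k) \<Rightarrow> (int ^ 'n) list \<Rightarrow> 'k ncpoly set" where
  "free_ideal R ms = genideal (ncpoly_alg ms :: ('k, 'n, 'k ncpoly) hobj)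
     {ncgen i * ncgen j - psmult (R (tens HT HT (tbasis (ms ! j)) (tbasis (ms ! i)))) (ncgen j * ncgen i)
        | i j. i < length ms \<and> j < length ms}"

definition hfree ::
  "(('k::field, 'n::finite) torus2 \<Rightarrow> 'k) \<Rightarrow> (int ^ 'n) list \<Rightarrow> ('k, 'n, 'k ncpoly set) hobj" where
  "hfree R ms = hquot (ncpoly_alg ms) (free_ideal R ms)"

definition fgen ::
  "(('k::field, 'n::finite) torus2 \<Rightarrow> 'k) \<Rightarrow> (int ^ 'n) list \<Rightarrow> nat \<Rightarrow> 'k ncpoly set" where
  "fgen R ms i = free_ideal R ms +>\<^bsub>(ncpoly_alg ms :: ('k, 'n, 'k ncpoly) hobj)\<^esub> ncgen i"

definition rel_ideal ::
  "(('k::field, 'n::finite) torus2 \<Rightarrow> 'k) \<Rightarrow> (int ^ 'n) list \<Rightarrow> 'k ncpoly set list \<Rightarrow> 'k ncpoly set set" where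
  "rel_ideal R ms fs = genideal (hfree R ms) (set fs)"

text \<open>
  A finite presentation of \<open>A\<close>: degrees \<open>ms\<close> of generators, homogeneous relations \<open>fs\<close>, and an
  isomorphism \<open>\<phi>\<close> from the presented algebra to \<open>A\<close>.
\<close>

definition hpresents ::
  "(('k::field, 'n::finite) torus2 \<Rightarrow> 'k) \<Rightarrow> ('k, 'n, 'a) hobj \<Rightarrow> (int ^ 'n) list \<Rightarrow>
   'k ncpoly set list \<Rightarrow> ('k ncpoly set set \<Rightarrow> 'a) \<Rightarrow> bool" where
  "hpresents R A ms fs \<phi> \<longleftrightarrow>
     (\<forall>f\<in>set fs. f \<in> carrier (hfree R ms) \<and>
        (\<exists>m. coact (hfree R ms) f = tens HT (hfree R ms) (tbasis m) f)) \<and>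
     \<phi> \<in> halg_iso (hquot (hfree R ms) (rel_ideal R ms fs)) A"

definition hfp ::
  "(('k::field, 'n::finite) torus2 \<Rightarrow> 'k) \<Rightarrow> ('k, 'n, 'a) hobj \<Rightarrow> bool" where
  "hfp R A \<longleftrightarrow> halgebra R A \<and> (\<exists>ms fs \<phi>. hpresents R A ms fs \<phi>)"


subsection \<open>Coproducts and localizations\<close>

definition hcoprod ::
  "(('k::field, 'n::finite) torus2 \<Rightarrow> 'k) \<Rightarrow> ('k, 'n, 'a) hobj \<Rightarrow> ('k, 'n, 'b) hobj \<Rightarrow>
   ('k, 'n, (('a \<times> 'b) \<Rightarrow>\<^sub>0 'k) set) hobj" where
  "hcoprod R A B = (htensor A B)
     \<lparr>mult := \<lambda>S T. tlift (tensor A B) (\<lambda>a b. tlift (tensor A B) (\<lambda>a' b'.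
         tlift (tensor A B) (\<lambda>h a0. tlift (tensor A B) (\<lambda>g b0.
           R (tens HT HT h g) \<odot>\<^bsub>tensor A B\<^esub> tens A B (a \<otimes>\<^bsub>A\<^esub> a0) (b0 \<otimes>\<^bsub>B\<^esub> b'))
         (coact B b)) (coact A a')) T) S,
      one := tens A B \<one>\<^bsub>A\<^esub> \<one>\<^bsub>B\<^esub>\<rparr>"

definition loc_ideal ::
  "(('k::field, 'n::finite) torus2 \<Rightarrow> 'k) \<Rightarrow> ('k, 'n, 'a) hobj \<Rightarrow> 'a \<Rightarrow>
   (('a \<times> 'k ncpoly set) \<Rightarrow>\<^sub>0 'k) set set" where
  "loc_ideal R A s = genideal (hcoprod R A (hfree R [0]))
     {tens A (hfree R [0]) s (fgen R [0] 0)
        \<ominus>\<^bsub>hcoprod R A (hfree R [0])\<^esub> \<one>\<^bsub>hcoprod R A (hfree R [0])\<^esub>}"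

definition loc ::
  "(('k::field, 'n::finite) torus2 \<Rightarrow> 'k) \<Rightarrow> ('k, 'n, 'a) hobj \<Rightarrow> 'a \<Rightarrow>
   ('k, 'n, (('a \<times> 'k ncpoly set) \<Rightarrow>\<^sub>0 'k) set set) hobj" where
  "loc R A s = hquot (hcoprod R A (hfree R [0])) (loc_ideal R A s)"

definition loc_map ::
  "(('k::field, 'n::finite) torus2 \<Rightarrow> 'k) \<Rightarrow> ('k, 'n, 'a) hobj \<Rightarrow> 'a \<Rightarrow>
   'a \<Rightarrow> (('a \<times> 'k ncpoly set) \<Rightarrow>\<^sub>0 'k) set set" where
  "loc_map R A s = (\<lambda>a\<in>carrier A.
     loc_ideal R A s +>\<^bsub>hcoprod R A (hfree R [0])\<^esub> tens A (hfree R [0]) a \<one>\<^bsub>hfree R [0]\<^esub>)"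

text \<open>
  Objects of the site have a fixed carrier type, whereas the carrier type of \<open>loc R A s\<close> depends on
  that of \<open>A\<close>.  Hence a morphism \<open>f : A \<rightarrow> B\<close> is called a localization at \<open>s\<close> if it is identified with
  \<open>loc_map R A s\<close> by an isomorphism under \<open>A\<close>.
\<close>

definition is_loc ::
  "(('k::field, 'n::finite) torus2 \<Rightarrow> 'k) \<Rightarrow> ('k, 'n, 'a) hobj \<Rightarrow> 'a \<Rightarrow> ('k, 'n, 'b) hobj \<Rightarrow>
   ('a \<Rightarrow> 'b) \<Rightarrow> bool" where
  "is_loc R A s B f \<longleftrightarrow> (\<exists>\<phi>\<in>halg_iso (loc R A s) B. f = compose (carrier A) \<phi> (loc_map R A s))"


section \<open>Sheaves on toric noncommutative spaces and their module objects\<close>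

text \<open>
  The category of toric noncommutative spaces consists of the finitely presented algebras with
  carrier in an arbitrary type \<open>'u\<close>, playing the role of a universe (every finitely presented
  algebra has an isomorphic copy in it as soon as \<open>'k ncpoly set set\<close> embeds into \<open>'u\<close>).  A
  morphism from \<open>X\<^sub>B\<close> to \<open>X\<^sub>C\<close> is an element of \<open>halg_hom C B\<close>, and the action \<open>r B C f\<close> of a presheaf on
  it maps sections over \<open>X\<^sub>C\<close> to sections over \<open>X\<^sub>B\<close>.
\<close>

definition hpresheaf ::
  "(('k::field, 'n::finite) torus2 \<Rightarrow> 'k) \<Rightarrow> (('k, 'n, 'u) hobj \<Rightarrow> 'y set) \<Rightarrow>
   (('k, 'n, 'u) hobj \<Rightarrow> ('k, 'n, 'u) hobj \<Rightarrow> ('u \<Rightarrow> 'u) \<Rightarrow> 'y \<Rightarrow> 'y) \<Rightarrow> bool" where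
  "hpresheaf R Y r \<longleftrightarrow>
     (\<forall>B C. hfp R B \<longrightarrow> hfp R C \<longrightarrow> (\<forall>f\<in>halg_hom C B. r B C f \<in> Y C \<rightarrow> Y B)) \<and>
     (\<forall>B. hfp R B \<longrightarrow> (\<forall>y\<in>Y B. r B B (\<lambda>b\<in>carrier B. b) y = y)) \<and>
     (\<forall>B C D. hfp R B \<longrightarrow> hfp R C \<longrightarrow> hfp R D \<longrightarrow>
        (\<forall>f\<in>halg_hom C B. \<forall>g\<in>halg_hom D C. \<forall>y\<in>Y D.
           r B D (compose (carrier D) f g) y = r B C f (r C D g y)))"

definition hcover ::
  "(('k::field, 'n::finite) torus2 \<Rightarrow> 'k) \<Rightarrow> ('k, 'n, 'u) hobj \<Rightarrow> nat \<Rightarrow> (nat \<Rightarrow> 'u) \<Rightarrow>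
   (nat \<Rightarrow> ('k, 'n, 'u) hobj) \<Rightarrow> (nat \<Rightarrow> 'u \<Rightarrow> 'u) \<Rightarrow> bool" where
  "hcover R A N s C f \<longleftrightarrow>
     (\<forall>i<N. s i \<in> coinv A \<and> hfp R (C i) \<and> is_loc R A (s i) (C i) (f i)) \<and>
     (\<exists>a. (\<forall>i<N. a i \<in> carrier A) \<and> (\<Oplus>\<^bsub>A\<^esub>i\<in>{..<N}. a i \<otimes>\<^bsub>A\<^esub> s i) = \<one>\<^bsub>A\<^esub>)"

text \<open>
  \<open>D i j\<close> is \<open>A[s\<^sub>i\<inverse>, s\<^sub>j\<inverse>]\<close>, as a localization of \<open>C i = A[s\<^sub>i\<inverse>]\<close> via \<open>g i j\<close> and of \<open>C j = A[s\<^sub>j\<inverse>]\<close> via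
  \<open>h i j\<close>.  The commutation condition says that the two localizations are identified by the
  canonical isomorphism, the one under \<open>A\<close>.
\<close>

definition hoverlap ::
  "(('k::field, 'n::finite) torus2 \<Rightarrow> 'k) \<Rightarrow> ('k, 'n, 'u) hobj \<Rightarrow> nat \<Rightarrow> (nat \<Rightarrow> 'u) \<Rightarrow>
   (nat \<Rightarrow> ('k, 'n, 'u) hobj) \<Rightarrow> (nat \<Rightarrow> 'u \<Rightarrow> 'u) \<Rightarrow>
   (nat \<Rightarrow> nat \<Rightarrow> ('k, 'n, 'u) hobj) \<Rightarrow> (nat \<Rightarrow> nat \<Rightarrow> 'u \<Rightarrow> 'u) \<Rightarrow> (nat \<Rightarrow> nat \<Rightarrow> 'u \<Rightarrow> 'u) \<Rightarrow> bool" where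
  "hoverlap R A N s C f D g h \<longleftrightarrow>
     (\<forall>i<N. \<forall>j<N. hfp R (D i j) \<and>
        is_loc R (C i) (f i (s j)) (D i j) (g i j) \<and>
        is_loc R (C j) (f j (s i)) (D i j) (h i j) \<and>
        compose (carrier A) (g i j) (f i) = compose (carrier A) (h i j) (f j))"

definition hsheaf ::
  "(('k::field, 'n::finite) torus2 \<Rightarrow> 'k) \<Rightarrow> (('k, 'n, 'u) hobj \<Rightarrow> 'y set) \<Rightarrow>
   (('k, 'n, 'u) hobj \<Rightarrow> ('k, 'n, 'u) hobj \<Rightarrow> ('u \<Rightarrow> 'u) \<Rightarrow> 'y \<Rightarrow> 'y) \<Rightarrow> bool" where
  "hsheaf R Y r \<longleftrightarrow> hpresheaf R Y r \<and>
     (\<forall>A N s C f D g h. hfp R A \<longrightarrow> hcover R A N s C f \<longrightarrow> hoverlap R A N s C f D g h \<longrightarrow>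
        (\<forall>y\<in>(\<Pi>\<^sub>E i\<in>{..<N}. Y (C i)).
           (\<forall>i<N. \<forall>j<N. r (D i j) (C i) (g i j) (y i) = r (D i j) (C j) (h i j) (y j)) \<longrightarrow>
           (\<exists>!x. x \<in> Y A \<and> (\<forall>i<N. r (C i) A (f i) x = y i))))"

text \<open>The value of the line object at \<open>X\<^sub>B\<close>.\<close>

definition coinv_ring :: "('k::field, 'n::finite, 'u) hobj \<Rightarrow> ('k, 'n, 'u) hobj" where
  "coinv_ring B = B\<lparr>carrier := coinv B\<rparr>"

record (overloaded) ('k, 'n, 'u, 'y) kmod =
  sect :: "('k, 'n, 'u) hobj \<Rightarrow> ('u, 'y) module"
  restr :: "('k, 'n, 'u) hobj \<Rightarrow> ('k, 'n, 'u) hobj \<Rightarrow> ('u \<Rightarrow> 'u) \<Rightarrow> 'y \<Rightarrow> 'y"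

definition kmod_obj ::
  "(('k::field, 'n::finite) torus2 \<Rightarrow> 'k) \<Rightarrow> ('k, 'n, 'u, 'y) kmod \<Rightarrow> bool" where
  "kmod_obj R Y \<longleftrightarrow>
     hsheaf R (\<lambda>B. carrier (sect Y B)) (restr Y) \<and>
     (\<forall>B. hfp R B \<longrightarrow> Module.module (coinv_ring B) (sect Y B)) \<and>
     (\<forall>B C. hfp R B \<longrightarrow> hfp R C \<longrightarrow> (\<forall>f\<in>halg_hom C B.
        (\<forall>y\<in>carrier (sect Y C). \<forall>y'\<in>carrier (sect Y C).
           restr Y B C f (y \<oplus>\<^bsub>sect Y C\<^esub> y') = restr Y B C f y \<oplus>\<^bsub>sect Y B\<^esub> restr Y B C f y') \<and>
        (\<forall>c\<in>coinv C. \<forall>y\<in>carrier (sect Y C).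
           restr Y B C f (c \<odot>\<^bsub>sect Y C\<^esub> y) = f c \<odot>\<^bsub>sect Y B\<^esub> restr Y B C f y)))"

definition kmod_hom ::
  "(('k::field, 'n::finite) torus2 \<Rightarrow> 'k) \<Rightarrow> ('k, 'n, 'u, 'y) kmod \<Rightarrow> ('k, 'n, 'u, 'z) kmod \<Rightarrow>
   (('k, 'n, 'u) hobj \<Rightarrow> 'y \<Rightarrow> 'z) \<Rightarrow> bool" where
  "kmod_hom R Y Z \<eta> \<longleftrightarrow> kmod_obj R Y \<and> kmod_obj R Z \<and>
     (\<forall>B. hfp R B \<longrightarrow>
        \<eta> B \<in> carrier (sect Y B) \<rightarrow> carrier (sect Z B) \<and>
        (\<forall>y\<in>carrier (sect Y B). \<forall>y'\<in>carrier (sect Y B).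
           \<eta> B (y \<oplus>\<^bsub>sect Y B\<^esub> y') = \<eta> B y \<oplus>\<^bsub>sect Z B\<^esub> \<eta> B y') \<and>
        (\<forall>b\<in>coinv B. \<forall>y\<in>carrier (sect Y B).
           \<eta> B (b \<odot>\<^bsub>sect Y B\<^esub> y) = b \<odot>\<^bsub>sect Z B\<^esub> \<eta> B y)) \<and>
     (\<forall>B C. hfp R B \<longrightarrow> hfp R C \<longrightarrow> (\<forall>f\<in>halg_hom C B. \<forall>y\<in>carrier (sect Y C).
        \<eta> B (restr Y B C f y) = restr Z B C f (\<eta> C y)))"

definition kmod_iso ::
  "(('k::field, 'n::finite) torus2 \<Rightarrow> 'k) \<Rightarrow> ('k, 'n, 'u, 'y) kmod \<Rightarrow> ('k, 'n, 'u, 'z) kmod \<Rightarrow>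
   (('k, 'n, 'u) hobj \<Rightarrow> 'y \<Rightarrow> 'z) \<Rightarrow> bool" where
  "kmod_iso R Y Z \<eta> \<longleftrightarrow> kmod_hom R Y Z \<eta> \<and>
     (\<exists>\<theta>. kmod_hom R Z Y \<theta> \<and>
        (\<forall>B. hfp R B \<longrightarrow> (\<forall>y\<in>carrier (sect Y B). \<theta> B (\<eta> B y) = y) \<and>
                       (\<forall>z\<in>carrier (sect Z B). \<eta> B (\<theta> B z) = z)))"

definition jmod ::
  "('k::field, 'n::finite, 'v) hobj \<Rightarrow> ('k, 'n, 'u, (('u \<times> 'v) \<Rightarrow>\<^sub>0 'k) set) kmod" where
  "jmod V =
     \<lparr>sect = (\<lambda>B. \<lparr>carrier = coinv (htensor B V), mult = undefined, one = undefined,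
        zero = \<zero>\<^bsub>tensor B V\<^esub>, add = add (tensor B V),
        smult = (\<lambda>b. tlift (tensor B V) (\<lambda>b' v. tens B V (b \<otimes>\<^bsub>B\<^esub> b') v))\<rparr>),
      restr = (\<lambda>B C f. tmap B V f id)\<rparr>"


section \<open>Braided derivations\<close>

definition is_partial ::
  "(('k::field, 'n::finite) torus2 \<Rightarrow> 'k) \<Rightarrow> (int ^ 'n) list \<Rightarrow> nat \<Rightarrow>
   ('k ncpoly set \<Rightarrow> 'k ncpoly set) \<Rightarrow> bool" where
  "is_partial R ms j d \<longleftrightarrow>
     d \<in> extensional (carrier (hfree R ms)) \<and> lin_map (hfree R ms) (hfree R ms) d \<and>
     (\<forall>i<length ms. d (fgen R ms i) = (if i = j then \<one>\<^bsub>hfree R ms\<^esub> else \<zero>\<^bsub>hfree R ms\<^esub>)) \<and>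
     (\<forall>a\<in>carrier (hfree R ms). \<forall>a'\<in>carrier (hfree R ms). d (a \<otimes>\<^bsub>hfree R ms\<^esub> a') =
        d a \<otimes>\<^bsub>hfree R ms\<^esub> a' \<oplus>\<^bsub>hfree R ms\<^esub>
        tlift (hfree R ms) (\<lambda>h a0. R (tens HT HT h (tbasis (- (ms ! j))))
           \<odot>\<^bsub>hfree R ms\<^esub> (a0 \<otimes>\<^bsub>hfree R ms\<^esub> d a')) (coact (hfree R ms) a))"

definition partial ::
  "(('k::field, 'n::finite) torus2 \<Rightarrow> 'k) \<Rightarrow> (int ^ 'n) list \<Rightarrow> nat \<Rightarrow> 'k ncpoly set \<Rightarrow> 'k ncpoly set" where
  "partial R ms j = (THE d. is_partial R ms j d)"

text \<open>The projection from the free algebra onto the algebra presented by \<open>ms\<close>, \<open>fs\<close>, \<open>\<phi>\<close>.\<close>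

definition pres_proj ::
  "(('k::field, 'n::finite) torus2 \<Rightarrow> 'k) \<Rightarrow> (int ^ 'n) list \<Rightarrow> 'k ncpoly set list \<Rightarrow>
   ('k ncpoly set set \<Rightarrow> 'a) \<Rightarrow> 'k ncpoly set \<Rightarrow> 'a" where
  "pres_proj R ms fs \<phi> w = \<phi> (rel_ideal R ms fs +>\<^bsub>hfree R ms\<^esub> w)"

definition hder ::
  "(('k::field, 'n::finite) torus2 \<Rightarrow> 'k) \<Rightarrow> ('k, 'n, 'a) hobj \<Rightarrow> (int ^ 'n) list \<Rightarrow>
   'k ncpoly set list \<Rightarrow> ('k ncpoly set set \<Rightarrow> 'a) \<Rightarrow> ('k, 'n, nat \<Rightarrow> 'a) hobj" where
  "hder R A ms fs \<phi> =
     hsub (hdsum (length ms) (\<lambda>j. hshift A (- (ms ! j))))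
       {L \<in> carrier (hdsum (length ms) (\<lambda>j. hshift A (- (ms ! j)))).
          \<forall>f\<in>set fs. (\<Oplus>\<^bsub>A\<^esub>j\<in>{..<length ms}. L j \<otimes>\<^bsub>A\<^esub> pres_proj R ms fs \<phi> (partial R ms j f)) = \<zero>\<^bsub>A\<^esub>}"

text \<open>\<open>der_ev \<dots> L a\<close> is \<open>ev (L \<otimes> a)\<close>; it does not depend on the chosen preimage \<open>w\<close> of \<open>a\<close>.\<close>

definition der_ev ::
  "(('k::field, 'n::finite) torus2 \<Rightarrow> 'k) \<Rightarrow> ('k, 'n, 'a) hobj \<Rightarrow> (int ^ 'n) list \<Rightarrow>
   'k ncpoly set list \<Rightarrow> ('k ncpoly set set \<Rightarrow> 'a) \<Rightarrow> (nat \<Rightarrow> 'a) \<Rightarrow> 'a \<Rightarrow> 'a" where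
  "der_ev R A ms fs \<phi> L a =
     (let w = (SOME w. w \<in> carrier (hfree R ms) \<and> pres_proj R ms fs \<phi> w = a)
      in \<Oplus>\<^bsub>A\<^esub>j\<in>{..<length ms}. L j \<otimes>\<^bsub>A\<^esub> pres_proj R ms fs \<phi> (partial R ms j w))"

definition hDer ::
  "(('k::field, 'n::finite) torus2 \<Rightarrow> 'k) \<Rightarrow> ('k, 'n, 'a) hobj \<Rightarrow> ('k, 'n, 'b) hobj \<Rightarrow>
   ('a \<Rightarrow> (('b \<times> 'a) \<Rightarrow>\<^sub>0 'k) set) set" where
  "hDer R A B = {v \<in> comod_hom A (hcoprod R B A).
     \<forall>a\<in>carrier A. \<forall>a'\<in>carrier A. v (a \<otimes>\<^bsub>A\<^esub> a') =
       v a \<otimes>\<^bsub>hcoprod R B A\<^esub> tens B A \<one>\<^bsub>B\<^esub> a' \<oplus>\<^bsub>hcoprod R B A\<^esub>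
       tens B A \<one>\<^bsub>B\<^esub> a \<otimes>\<^bsub>hcoprod R B A\<^esub> v a'}"

definition Dermod ::
  "(('k::field, 'n::finite) torus2 \<Rightarrow> 'k) \<Rightarrow> ('k, 'n, 'a) hobj \<Rightarrow>
   ('k, 'n, 'u, 'a \<Rightarrow> (('u \<times> 'a) \<Rightarrow>\<^sub>0 'k) set) kmod" where
  "Dermod R A =
     \<lparr>sect = (\<lambda>B. \<lparr>carrier = hDer R A B, mult = undefined, one = undefined,
        zero = (\<lambda>a\<in>carrier A. \<zero>\<^bsub>hcoprod R B A\<^esub>),
        add = (\<lambda>v w. \<lambda>a\<in>carrier A. v a \<oplus>\<^bsub>hcoprod R B A\<^esub> w a),
        smult = (\<lambda>b v. \<lambda>a\<in>carrier A. tens B A b \<one>\<^bsub>A\<^esub> \<otimes>\<^bsub>hcoprod R B A\<^esub> v a)\<rparr>),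
      restr = (\<lambda>B C f v. compose (carrier A) (tmap B A f id) v)\<rparr>"

definition xi ::
  "(('k::field, 'n::finite) torus2 \<Rightarrow> 'k) \<Rightarrow> ('k, 'n, 'a) hobj \<Rightarrow> (int ^ 'n) list \<Rightarrow>
   'k ncpoly set list \<Rightarrow> ('k ncpoly set set \<Rightarrow> 'a) \<Rightarrow>
   ('k, 'n, 'u) hobj \<Rightarrow> (('u \<times> (nat \<Rightarrow> 'a)) \<Rightarrow>\<^sub>0 'k) set \<Rightarrow> 'a \<Rightarrow> (('u \<times> 'a) \<Rightarrow>\<^sub>0 'k) set" where
  "xi R A ms fs \<phi> B T =
     (\<lambda>a\<in>carrier A. tlift (tensor B A) (\<lambda>b L. tens B A b (der_ev R A ms fs \<phi> L a)) T)"

end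

theory Submission
  imports Defs
begin

text \<open>
  A comodule over \<open>\<O>(\<bbbT>\<^sup>n)\<close> is a \<open>\<int>\<^sup>n\<close>-graded vector space and \<open>R\<close> is a bicharacter on \<open>\<int>\<^sup>n\<close>, so that all braided
  identities can be checked on homogeneous elements.

  A derivation \<open>v : A \<rightarrow> B \<squnion> A\<close> is determined by the elements \<open>v(x\<^sub>j)\<close>, which have degree \<open>m\<^sub>j\<close> in \<open>B \<otimes> A\<close>.
  They are the components of a coinvariant \<open>T\<close> of \<open>B \<otimes> \<Oplus>\<^sub>j A[- m\<^sub>j]\<close>; conversely every coinvariant \<open>T\<close> defines a
  derivation on the free algebra, by evaluation of \<open>T\<close>. This derivation descends to \<open>A\<close> if and only if evaluation
  at each relation \<open>f\<^sub>k\<close> kills \<open>T\<close>. Reading off coefficients in \<open>B\<close>, the latter means that \<open>T\<close> lies in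
  \<open>B \<otimes> der(A)\<close>, which gives the inverse of \<open>\<xi>\<close>.

  In the same way, taking coefficients in \<open>V\<close> reduces the sheaf property of \<open>j(V)\<close> to that of \<open>X\<^sub>B \<mapsto> B\<close>, where it
  follows as for commutative rings: coinvariants are central, \<open>A \<rightarrow> A[s\<^sup>-\<^sup>1]\<close> has the \<open>s\<close>-power torsion as its kernel,
  and every element of \<open>A[s\<^sup>-\<^sup>1]\<close> becomes an element of \<open>A\<close> after multiplication by a power of \<open>s\<close>. The sheaf
  property of \<open>Der\<close> is transported along \<open>\<xi>\<close>.
\<close>

section \<open>Vector spaces and linear maps\<close>

text \<open>Two features of the encoding shape the proof. A tensor product is a set of cosets
  without a basis, and the tensor product with a subspace does not lie inside the one with the whole
  space. With \<open>M\<close> the direct sum of the shifted copies of \<open>A\<close>, the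
  injectivity of \<open>B \<otimes> der(A) \<rightarrow> B \<otimes> M\<close> and a description of
  its image therefore have to be proved; a linear choice of coefficients on \<open>B\<close> gives
  both. Moreover partial derivatives, \<open>ev\<close>, quotients and localizations are given by
  choices or up to isomorphism, so each is traced back to a formula on a free object and a proof
  that an ideal is respected.

  The braiding of the Leibniz rule is absorbed at one point: in a coinvariant tensor
  \<open>b \<otimes> L\<close> the degrees of \<open>b\<close> and \<open>L\<close> are opposite, so
  the factor from moving \<open>b\<close> past \<open>a\<close> in \<open>B \<squnion> A\<close> is
  exactly the factor in the braided Leibniz rule of \<open>L\<close>. Tensors obtained by gluing or
  lifting need not be coinvariant at once; since all maps involved respect degrees, they are
  replaced by their components of degree 0.\<close>

lemma base_field_simps [simp]:
  "carrier base_field = UNIV" "mult base_field = (*)" "one base_field = 1"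
  "zero base_field = 0" "add base_field = (+)" "smult base_field = (*)"
  by (simp_all add: base_field_def)

lemma cring_base_field: "cring (base_field :: ('k::field, 'k) module)"
proof (rule cringI)
  show "abelian_group (base_field :: ('k, 'k) module)"
  proof (rule abelian_groupI)
    fix x :: 'k
    show "\<exists>y\<in>carrier base_field. y \<oplus>\<^bsub>base_field\<^esub> x = \<zero>\<^bsub>base_field\<^esub>"
      by (rule bexI[of _ "- x"]) auto
  qed (auto simp: algebra_simps)
  show "comm_monoid (base_field :: ('k, 'k) module)"
    by (rule comm_monoidI) (auto simp: algebra_simps)
qed (auto simp: algebra_simps)

lemma vspaceI:
  assumes "abelian_group V"
    and "\<And>c v. v \<in> carrier V \<Longrightarrow> c \<odot>\<^bsub>V\<^esub> v \<in> carrier V"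
    and "\<And>c d v. v \<in> carrier V \<Longrightarrow> (c + d) \<odot>\<^bsub>V\<^esub> v = c \<odot>\<^bsub>V\<^esub> v \<oplus>\<^bsub>V\<^esub> d \<odot>\<^bsub>V\<^esub> v"
    and "\<And>c v w. v \<in> carrier V \<Longrightarrow> w \<in> carrier V \<Longrightarrow> c \<odot>\<^bsub>V\<^esub> (v \<oplus>\<^bsub>V\<^esub> w) = c \<odot>\<^bsub>V\<^esub> v \<oplus>\<^bsub>V\<^esub> c \<odot>\<^bsub>V\<^esub> w"
    and "\<And>c d v. v \<in> carrier V \<Longrightarrow> (c * d) \<odot>\<^bsub>V\<^esub> v = c \<odot>\<^bsub>V\<^esub> (d \<odot>\<^bsub>V\<^esub> v)"
    and "\<And>v. v \<in> carrier V \<Longrightarrow> 1 \<odot>\<^bsub>V\<^esub> v = v"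
  shows "vspace V"
  by (rule moduleI) (use assms cring_base_field in auto)

lemma vspace_abelian_group: "vspace V \<Longrightarrow> abelian_group V"
  by (rule Module.module.axioms(2))

lemma vspace_base_field: "vspace base_field"
  by (rule vspaceI) (auto simp: algebra_simps intro: cring.axioms(1)[THEN ring.is_abelian_group, OF cring_base_field])

lemma
  assumes "vspace V"
  shows vs_add_closed: "v \<in> carrier V \<Longrightarrow> w \<in> carrier V \<Longrightarrow> v \<oplus>\<^bsub>V\<^esub> w \<in> carrier V"
    and vs_zero_closed: "\<zero>\<^bsub>V\<^esub> \<in> carrier V"
    and vs_smult_closed: "v \<in> carrier V \<Longrightarrow> c \<odot>\<^bsub>V\<^esub> v \<in> carrier V"
    and vs_smult_add_l: "v \<in> carrier V \<Longrightarrow> (c + d) \<odot>\<^bsub>V\<^esub> v = c \<odot>\<^bsub>V\<^esub> v \<oplus>\<^bsub>V\<^esub> d \<odot>\<^bsub>V\<^esub> v"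
    and vs_smult_add_r: "v \<in> carrier V \<Longrightarrow> w \<in> carrier V \<Longrightarrow> c \<odot>\<^bsub>V\<^esub> (v \<oplus>\<^bsub>V\<^esub> w) = c \<odot>\<^bsub>V\<^esub> v \<oplus>\<^bsub>V\<^esub> c \<odot>\<^bsub>V\<^esub> w"
    and vs_smult_assoc: "v \<in> carrier V \<Longrightarrow> c \<odot>\<^bsub>V\<^esub> (d \<odot>\<^bsub>V\<^esub> v) = (c * d) \<odot>\<^bsub>V\<^esub> v"
    and vs_smult_1: "v \<in> carrier V \<Longrightarrow> 1 \<odot>\<^bsub>V\<^esub> v = v"
    and vs_smult_0: "v \<in> carrier V \<Longrightarrow> 0 \<odot>\<^bsub>V\<^esub> v = \<zero>\<^bsub>V\<^esub>"
    and vs_smult_zero: "c \<odot>\<^bsub>V\<^esub> \<zero>\<^bsub>V\<^esub> = \<zero>\<^bsub>V\<^esub>"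
    and vs_zero_add: "v \<in> carrier V \<Longrightarrow> \<zero>\<^bsub>V\<^esub> \<oplus>\<^bsub>V\<^esub> v = v"
    and vs_add_zero: "v \<in> carrier V \<Longrightarrow> v \<oplus>\<^bsub>V\<^esub> \<zero>\<^bsub>V\<^esub> = v"
    and vs_finsum_closed: "g \<in> I \<rightarrow> carrier V \<Longrightarrow> (\<Oplus>\<^bsub>V\<^esub>i\<in>I. g i) \<in> carrier V"
proof -
  interpret Module.module base_field V by fact
  show "v \<in> carrier V \<Longrightarrow> w \<in> carrier V \<Longrightarrow> v \<oplus>\<^bsub>V\<^esub> w \<in> carrier V" by simp
  show "\<zero>\<^bsub>V\<^esub> \<in> carrier V" by simp
  show "v \<in> carrier V \<Longrightarrow> c \<odot>\<^bsub>V\<^esub> v \<in> carrier V" by simp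
  show "v \<in> carrier V \<Longrightarrow> (c + d) \<odot>\<^bsub>V\<^esub> v = c \<odot>\<^bsub>V\<^esub> v \<oplus>\<^bsub>V\<^esub> d \<odot>\<^bsub>V\<^esub> v"
    using smult_l_distr[of c d v] by simp
  show "v \<in> carrier V \<Longrightarrow> w \<in> carrier V \<Longrightarrow> c \<odot>\<^bsub>V\<^esub> (v \<oplus>\<^bsub>V\<^esub> w) = c \<odot>\<^bsub>V\<^esub> v \<oplus>\<^bsub>V\<^esub> c \<odot>\<^bsub>V\<^esub> w"
    using smult_r_distr[of c v w] by simp
  show "v \<in> carrier V \<Longrightarrow> c \<odot>\<^bsub>V\<^esub> (d \<odot>\<^bsub>V\<^esub> v) = (c * d) \<odot>\<^bsub>V\<^esub> v"
    using smult_assoc1[of c d v] by simp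
  show "v \<in> carrier V \<Longrightarrow> 1 \<odot>\<^bsub>V\<^esub> v = v" using smult_one[of v] by simp
  show "v \<in> carrier V \<Longrightarrow> 0 \<odot>\<^bsub>V\<^esub> v = \<zero>\<^bsub>V\<^esub>" using smult_l_null[of v] by simp
  show "c \<odot>\<^bsub>V\<^esub> \<zero>\<^bsub>V\<^esub> = \<zero>\<^bsub>V\<^esub>" by simp
  show "v \<in> carrier V \<Longrightarrow> \<zero>\<^bsub>V\<^esub> \<oplus>\<^bsub>V\<^esub> v = v" by simp
  show "v \<in> carrier V \<Longrightarrow> v \<oplus>\<^bsub>V\<^esub> \<zero>\<^bsub>V\<^esub> = v" by simp
  show "g \<in> I \<rightarrow> carrier V \<Longrightarrow> (\<Oplus>\<^bsub>V\<^esub>i\<in>I. g i) \<in> carrier V" by (rule M.finsum_closed)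
qed

lemmas vs_simps [simp] = vs_add_closed vs_zero_closed vs_smult_closed vs_smult_assoc vs_smult_1
  vs_smult_0 vs_smult_zero vs_zero_add vs_add_zero

lemma vs_add_comm: "vspace V \<Longrightarrow> v \<in> carrier V \<Longrightarrow> w \<in> carrier V \<Longrightarrow> v \<oplus>\<^bsub>V\<^esub> w = w \<oplus>\<^bsub>V\<^esub> v"
  by (meson vspace_abelian_group abelian_group.axioms(1) abelian_monoid.a_comm)

lemma vs_minus: "vspace V \<Longrightarrow> v \<in> carrier V \<Longrightarrow> \<ominus>\<^bsub>V\<^esub> v = (- 1) \<odot>\<^bsub>V\<^esub> v"
proof -
  assume V: "vspace V" and v: "v \<in> carrier V"
  interpret abelian_group V using V by (rule vspace_abelian_group)
  have "(- 1) \<odot>\<^bsub>V\<^esub> v \<oplus>\<^bsub>V\<^esub> v = (- 1 + 1) \<odot>\<^bsub>V\<^esub> v"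
    using V v by (simp only: vs_smult_add_l vs_smult_1)
  also have "\<dots> = \<zero>\<^bsub>V\<^esub>" using V v by simp
  finally show ?thesis using V v by (metis minus_equality vs_smult_closed)
qed

lemma lin_mapI:
  assumes "\<And>v. v \<in> carrier V \<Longrightarrow> f v \<in> carrier W"
    and "\<And>v w. v \<in> carrier V \<Longrightarrow> w \<in> carrier V \<Longrightarrow> f (v \<oplus>\<^bsub>V\<^esub> w) = f v \<oplus>\<^bsub>W\<^esub> f w"
    and "\<And>c v. v \<in> carrier V \<Longrightarrow> f (c \<odot>\<^bsub>V\<^esub> v) = c \<odot>\<^bsub>W\<^esub> f v"
  shows "lin_map V W f"
  using assms by (auto simp: lin_map_def)

lemma
  assumes "lin_map V W f"
  shows lin_map_closed: "v \<in> carrier V \<Longrightarrow> f v \<in> carrier W"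
    and lin_map_add: "v \<in> carrier V \<Longrightarrow> w \<in> carrier V \<Longrightarrow> f (v \<oplus>\<^bsub>V\<^esub> w) = f v \<oplus>\<^bsub>W\<^esub> f w"
    and lin_map_smult: "v \<in> carrier V \<Longrightarrow> f (c \<odot>\<^bsub>V\<^esub> v) = c \<odot>\<^bsub>W\<^esub> f v"
  using assms by (auto simp: lin_map_def)

lemma lin_map_cong:
  assumes "\<And>v. v \<in> carrier V \<Longrightarrow> f v = g v" "vspace V" "lin_map V W g"
  shows "lin_map V W f"
  by (rule lin_mapI) (use assms in \<open>auto simp: lin_map_closed lin_map_add lin_map_smult\<close>)

lemma lin_map_zero:
  assumes "vspace V" "vspace W" "lin_map V W f"
  shows "f \<zero>\<^bsub>V\<^esub> = \<zero>\<^bsub>W\<^esub>"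
proof -
  have "f (0 \<odot>\<^bsub>V\<^esub> \<zero>\<^bsub>V\<^esub>) = 0 \<odot>\<^bsub>W\<^esub> f \<zero>\<^bsub>V\<^esub>"
    using assms by (intro lin_map_smult) auto
  then show ?thesis using assms lin_map_closed[OF assms(3)] by simp
qed

lemma lin_map_diff:
  assumes "vspace V" "vspace W" "lin_map V W f" "v \<in> carrier V" "w \<in> carrier V"
  shows "f (v \<ominus>\<^bsub>V\<^esub> w) = f v \<ominus>\<^bsub>W\<^esub> f w"
  unfolding a_minus_def
  using assms lin_map_closed[OF assms(3)]
  by (simp add: vs_minus lin_map_add[OF assms(3)] lin_map_smult[OF assms(3)])

lemma lin_map_finsum:
  assumes "vspace V" "vspace W" "lin_map V W f" "g \<in> I \<rightarrow> carrier V"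
  shows "f (\<Oplus>\<^bsub>V\<^esub>i\<in>I. g i) = (\<Oplus>\<^bsub>W\<^esub>i\<in>I. f (g i))"
proof -
  interpret V: abelian_group V using assms(1) by (rule vspace_abelian_group)
  interpret W: abelian_group W using assms(2) by (rule vspace_abelian_group)
  show ?thesis using assms(4)
  proof (induction I rule: infinite_finite_induct)
    \<comment> \<open>Sums over infinite index sets are zero by convention, so the identity holds
      there because \<open>f\<close> preserves zero.\<close>
    case (infinite A)
    then show ?case using assms by (simp add: V.finsum_infinite W.finsum_infinite lin_map_zero)
  next
    case empty
    then show ?case using assms by (simp add: lin_map_zero)
  next
    case (insert x F)
    have "(\<Oplus>\<^bsub>V\<^esub>i\<in>F. g i) \<in> carrier V" using insert by (intro V.finsum_closed) auto
    then show ?case using insert lin_map_closed[OF assms(3)] lin_map_add[OF assms(3)]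
      by (simp add: Pi_iff)
  qed
qed

lemma lin_map_id: "lin_map V V (\<lambda>v. v)"
  by (simp add: lin_map_def)

lemma lin_map_comp:
  assumes "lin_map U V g" "lin_map V W f"
  shows "lin_map U W (\<lambda>u. f (g u))"
  using assms by (auto simp: lin_map_def Pi_iff)

lemma lin_map_const_zero: "vspace W \<Longrightarrow> lin_map V W (\<lambda>v. \<zero>\<^bsub>W\<^esub>)"
  by (simp add: lin_map_def)

lemma lin_map_sum2:
  assumes "vspace W" "lin_map V W f" "lin_map V W g"
  shows "lin_map V W (\<lambda>v. f v \<oplus>\<^bsub>W\<^esub> g v)"
proof (rule lin_mapI)
  interpret W: abelian_group W using assms(1) by (rule vspace_abelian_group)
  fix v w assume vw: "v \<in> carrier V" "w \<in> carrier V"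
  then show "f (v \<oplus>\<^bsub>V\<^esub> w) \<oplus>\<^bsub>W\<^esub> g (v \<oplus>\<^bsub>V\<^esub> w) = f v \<oplus>\<^bsub>W\<^esub> g v \<oplus>\<^bsub>W\<^esub> (f w \<oplus>\<^bsub>W\<^esub> g w)"
    using assms(2,3) by (simp add: lin_map_add lin_map_closed W.a_ac)
qed (use assms in \<open>auto simp: lin_map_closed lin_map_smult vs_smult_add_r\<close>)

lemma lin_map_scale:
  assumes "vspace W" "lin_map V W f"
  shows "lin_map V W (\<lambda>v. c \<odot>\<^bsub>W\<^esub> f v)"
  by (rule lin_mapI)
    (use assms in \<open>auto simp: lin_map_closed lin_map_add lin_map_smult vs_smult_add_r mult.commute\<close>)

lemma lin_map_scale_l:
  assumes "vspace W" "lin_map V base_field f" "w \<in> carrier W"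
  shows "lin_map V W (\<lambda>v. f v \<odot>\<^bsub>W\<^esub> w)"
  by (rule lin_mapI)
    (use assms in \<open>auto simp: vs_smult_add_l
      lin_map_add[OF assms(2)] lin_map_smult[OF assms(2)]\<close>)

lemma lin_map_fin:
  assumes "vspace W" "\<And>i. i \<in> I \<Longrightarrow> lin_map V W (f i)"
  shows "lin_map V W (\<lambda>v. \<Oplus>\<^bsub>W\<^esub>i\<in>I. f i v)"
proof -
  interpret W: abelian_group W using assms(1) by (rule vspace_abelian_group)
  show ?thesis using assms(2)
  proof (induction I rule: infinite_finite_induct)
    case (infinite A)
    then show ?case using assms by (simp add: W.finsum_infinite lin_map_const_zero)
  next
    case empty
    then show ?case using assms by (simp add: lin_map_const_zero)
  next
    case (insert x F)
    show ?case
    proof (rule lin_mapI)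
      have *: "v \<in> carrier V \<Longrightarrow> (\<Oplus>\<^bsub>W\<^esub>i\<in>insert x F. f i v) = f x v \<oplus>\<^bsub>W\<^esub> (\<Oplus>\<^bsub>W\<^esub>i\<in>F. f i v)" for v
        using insert.hyps lin_map_closed[OF insert.prems] by (subst W.finsum_insert) (auto simp: Pi_iff)
      have L: "lin_map V W (\<lambda>v. f x v \<oplus>\<^bsub>W\<^esub> (\<Oplus>\<^bsub>W\<^esub>i\<in>F. f i v))"
        using insert assms(1) by (intro lin_map_sum2) auto
      have clo: "v \<in> carrier V \<Longrightarrow> (\<Oplus>\<^bsub>W\<^esub>i\<in>insert x F. f i v) \<in> carrier W" for v
        using lin_map_closed[OF insert.prems] by (intro W.finsum_closed) auto
      fix v assume v: "v \<in> carrier V"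
      show "(\<Oplus>\<^bsub>W\<^esub>i\<in>insert x F. f i v) \<in> carrier W" using clo[OF v] .
      {
        fix w assume w: "w \<in> carrier V"
        show "(\<Oplus>\<^bsub>W\<^esub>i\<in>insert x F. f i (v \<oplus>\<^bsub>V\<^esub> w)) = (\<Oplus>\<^bsub>W\<^esub>i\<in>insert x F. f i v) \<oplus>\<^bsub>W\<^esub> (\<Oplus>\<^bsub>W\<^esub>i\<in>insert x F. f i w)"
        proof -
          have 1: "(\<Oplus>\<^bsub>W\<^esub>i\<in>insert x F. f i (v \<oplus>\<^bsub>V\<^esub> w)) = (\<Oplus>\<^bsub>W\<^esub>i\<in>insert x F. f i v \<oplus>\<^bsub>W\<^esub> f i w)"
            using v w lin_map_closed[OF insert.prems] lin_map_add[OF insert.prems] by (intro W.finsum_cong') auto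
          show ?thesis unfolding 1
            using v w lin_map_closed[OF insert.prems] by (intro W.finsum_addf) auto
        qed
      }
      fix c
      have S: "lin_map W W (\<lambda>w. c \<odot>\<^bsub>W\<^esub> w)" using assms(1) by (intro lin_map_scale lin_map_id)
      have 1: "(\<Oplus>\<^bsub>W\<^esub>i\<in>insert x F. f i (c \<odot>\<^bsub>V\<^esub> v)) = (\<Oplus>\<^bsub>W\<^esub>i\<in>insert x F. c \<odot>\<^bsub>W\<^esub> f i v)"
        using v assms(1) lin_map_closed[OF insert.prems] lin_map_smult[OF insert.prems] by (intro W.finsum_cong') auto
      show "(\<Oplus>\<^bsub>W\<^esub>i\<in>insert x F. f i (c \<odot>\<^bsub>V\<^esub> v)) = c \<odot>\<^bsub>W\<^esub> (\<Oplus>\<^bsub>W\<^esub>i\<in>insert x F. f i v)"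
        unfolding 1
        by (rule lin_map_finsum[OF assms(1) assms(1) S, symmetric])
          (use v lin_map_closed[OF insert.prems] in auto)
    qed
  qed
qed

text \<open>Bilinearity on carriers, split into two families of linear maps, so that the composition
  rules for \<open>lin_map\<close> apply to each argument separately.\<close>

definition bilin ::
  "('k::field, 'v, 'x) module_scheme \<Rightarrow> ('k, 'w, 'y) module_scheme \<Rightarrow> ('k, 'z, 'u) module_scheme \<Rightarrow>
   ('v \<Rightarrow> 'w \<Rightarrow> 'z) \<Rightarrow> bool" where
  "bilin V W Z \<beta> \<longleftrightarrow> (\<forall>v\<in>carrier V. lin_map W Z (\<beta> v)) \<and> (\<forall>w\<in>carrier W. lin_map V Z (\<lambda>v. \<beta> v w))"

lemma bilinI:
  assumes "\<And>v. v \<in> carrier V \<Longrightarrow> lin_map W Z (\<beta> v)"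
    and "\<And>w. w \<in> carrier W \<Longrightarrow> lin_map V Z (\<lambda>v. \<beta> v w)"
  shows "bilin V W Z \<beta>"
  using assms by (simp add: bilin_def)

lemma
  assumes "bilin V W Z \<beta>"
  shows bilin_r: "v \<in> carrier V \<Longrightarrow> lin_map W Z (\<beta> v)"
    and bilin_l: "w \<in> carrier W \<Longrightarrow> lin_map V Z (\<lambda>v. \<beta> v w)"
    and bilin_closed: "v \<in> carrier V \<Longrightarrow> w \<in> carrier W \<Longrightarrow> \<beta> v w \<in> carrier Z"
  using assms by (auto simp: bilin_def lin_map_closed)

section \<open>Finite formal combinations\<close>

lemma lookup_psmult [simp]: "Poly_Mapping.lookup (psmult c p) x = c * Poly_Mapping.lookup p x"
  unfolding psmult_def by (simp add: Poly_Mapping.map.rep_eq when_def)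

lemma keys_psmult: "Poly_Mapping.keys (psmult c p) \<subseteq> Poly_Mapping.keys p"
  by (auto simp: in_keys_iff)

lemma psmult_single [simp]: "psmult c (Poly_Mapping.single x d) = Poly_Mapping.single x (c * d)"
  by (rule poly_mapping_eqI) (simp add: lookup_single when_def)

text \<open>Formal combinations form a vector space on the whole type. Spans, subspaces and
  projections of the type-based theory thus apply to tensor relations, although \<open>V\<close> and
  \<open>W\<close> themselves live on carriers.\<close>

lemma vector_space_psmult: "vector_space (psmult :: 'k::field \<Rightarrow> ('b \<Rightarrow>\<^sub>0 'k) \<Rightarrow> ('b \<Rightarrow>\<^sub>0 'k))"
  by unfold_locales (auto intro!: poly_mapping_eqI simp: lookup_add algebra_simps)

interpretation psm: vector_space "psmult :: 'k::field \<Rightarrow> ('b \<Rightarrow>\<^sub>0 'k) \<Rightarrow> ('b \<Rightarrow>\<^sub>0 'k)"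
  by (rule vector_space_psmult)

interpretation psmp: vector_space_pair "psmult :: 'k::field \<Rightarrow> ('b \<Rightarrow>\<^sub>0 'k) \<Rightarrow> ('b \<Rightarrow>\<^sub>0 'k)"
    "psmult :: 'k::field \<Rightarrow> ('b \<Rightarrow>\<^sub>0 'k) \<Rightarrow> ('b \<Rightarrow>\<^sub>0 'k)" ..

lemma poly_mapping_single_sum: "p = (\<Sum>x\<in>Poly_Mapping.keys p. Poly_Mapping.single x (Poly_Mapping.lookup p x))"
  by (rule poly_mapping_eqI)
    (auto simp: lookup_sum lookup_single when_def in_keys_iff)

text \<open>Linear extension of \<open>g\<close> to the free vector space. The set \<open>X\<close>
  of the context below collects the basis elements at which \<open>g\<close> has a value in the
  carrier; the rules ask for supports inside \<open>X\<close>.\<close>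

definition fsum :: "('k::field, 'z, 'x) module_scheme \<Rightarrow> ('b \<Rightarrow> 'z) \<Rightarrow> ('b \<Rightarrow>\<^sub>0 'k) \<Rightarrow> 'z" where
  "fsum Z g p = (\<Oplus>\<^bsub>Z\<^esub>x\<in>Poly_Mapping.keys p. Poly_Mapping.lookup p x \<odot>\<^bsub>Z\<^esub> g x)"

context
  fixes Z :: "('k::field, 'z, 'x) module_scheme" and g :: "'b \<Rightarrow> 'z" and X :: "'b set"
  assumes Z: "vspace Z" and g: "g \<in> X \<rightarrow> carrier Z"
begin

lemma fsum_superset:
  assumes "finite F" "Poly_Mapping.keys p \<subseteq> F" "F \<subseteq> X"
  shows "fsum Z g p = (\<Oplus>\<^bsub>Z\<^esub>x\<in>F. Poly_Mapping.lookup p x \<odot>\<^bsub>Z\<^esub> g x)"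
proof -
  interpret Z: abelian_group Z using Z by (rule vspace_abelian_group)
  have g': "x \<in> X \<Longrightarrow> g x \<in> carrier Z" for x using g by auto
  show ?thesis unfolding fsum_def
    by (rule Z.add.finprod_mono_neutral_cong_left)
      (use assms Z g' in \<open>auto simp: in_keys_iff\<close>)
qed

lemma fsum_closed: "Poly_Mapping.keys p \<subseteq> X \<Longrightarrow> fsum Z g p \<in> carrier Z"
  unfolding fsum_def using Z g by (intro vs_finsum_closed) (auto simp: Pi_iff subset_iff)

lemma fsum_add:
  assumes "Poly_Mapping.keys p \<subseteq> X" "Poly_Mapping.keys q \<subseteq> X"
  shows "fsum Z g (p + q) = fsum Z g p \<oplus>\<^bsub>Z\<^esub> fsum Z g q"
proof -
  interpret Z: abelian_group Z using Z by (rule vspace_abelian_group)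
  let ?F = "Poly_Mapping.keys p \<union> Poly_Mapping.keys q"
  have g': "x \<in> X \<Longrightarrow> g x \<in> carrier Z" for x using g by auto
  have F: "finite ?F" "?F \<subseteq> X" using assms by auto
  have "fsum Z g (p + q) = (\<Oplus>\<^bsub>Z\<^esub>x\<in>?F. Poly_Mapping.lookup (p + q) x \<odot>\<^bsub>Z\<^esub> g x)"
    by (rule fsum_superset) (use F keys_add[of p q] in auto)
  also have "\<dots> = (\<Oplus>\<^bsub>Z\<^esub>x\<in>?F. Poly_Mapping.lookup p x \<odot>\<^bsub>Z\<^esub> g x \<oplus>\<^bsub>Z\<^esub> Poly_Mapping.lookup q x \<odot>\<^bsub>Z\<^esub> g x)"
    by (rule Z.finsum_cong') (use F Z g' in \<open>auto simp: lookup_add vs_smult_add_l\<close>)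
  also have "\<dots> = (\<Oplus>\<^bsub>Z\<^esub>x\<in>?F. Poly_Mapping.lookup p x \<odot>\<^bsub>Z\<^esub> g x) \<oplus>\<^bsub>Z\<^esub> (\<Oplus>\<^bsub>Z\<^esub>x\<in>?F. Poly_Mapping.lookup q x \<odot>\<^bsub>Z\<^esub> g x)"
    by (rule Z.finsum_addf) (use F Z g' in auto)
  also have "\<dots> = fsum Z g p \<oplus>\<^bsub>Z\<^esub> fsum Z g q"
    using F by (simp add: fsum_superset[of ?F])
  finally show ?thesis .
qed

lemma fsum_psmult:
  assumes "Poly_Mapping.keys p \<subseteq> X"
  shows "fsum Z g (psmult c p) = c \<odot>\<^bsub>Z\<^esub> fsum Z g p"
proof -
  interpret Z: abelian_group Z using Z by (rule vspace_abelian_group)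
  have g': "x \<in> X \<Longrightarrow> g x \<in> carrier Z" for x using g by auto
  have "fsum Z g (psmult c p) = (\<Oplus>\<^bsub>Z\<^esub>x\<in>Poly_Mapping.keys p. Poly_Mapping.lookup (psmult c p) x \<odot>\<^bsub>Z\<^esub> g x)"
    by (rule fsum_superset) (use assms keys_psmult[of c p] in auto)
  also have "\<dots> = (\<Oplus>\<^bsub>Z\<^esub>x\<in>Poly_Mapping.keys p. c \<odot>\<^bsub>Z\<^esub> (Poly_Mapping.lookup p x \<odot>\<^bsub>Z\<^esub> g x))"
    by (rule Z.finsum_cong') (use assms Z g' in auto)
  also have "\<dots> = c \<odot>\<^bsub>Z\<^esub> fsum Z g p"
    unfolding fsum_def
    by (rule lin_map_finsum[symmetric, OF Z Z lin_map_scale[OF Z lin_map_id]])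
      (use assms Z g' in auto)
  finally show ?thesis .
qed

lemma fsum_zero: "fsum Z g 0 = \<zero>\<^bsub>Z\<^esub>"
proof -
  interpret Z: abelian_group Z using Z by (rule vspace_abelian_group)
  show ?thesis by (simp add: fsum_def)
qed

lemma fsum_single: "x \<in> X \<Longrightarrow> fsum Z g (Poly_Mapping.single x c) = c \<odot>\<^bsub>Z\<^esub> g x"
proof -
  assume x: "x \<in> X"
  interpret Z: abelian_group Z using Z by (rule vspace_abelian_group)
  have "fsum Z g (Poly_Mapping.single x c) = (\<Oplus>\<^bsub>Z\<^esub>y\<in>{x}. Poly_Mapping.lookup (Poly_Mapping.single x c) y \<odot>\<^bsub>Z\<^esub> g y)"
    by (rule fsum_superset) (use x in auto)
  also have "\<dots> = c \<odot>\<^bsub>Z\<^esub> g x" using x g Z by (simp add: Pi_iff)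
  finally show ?thesis .
qed

lemma fsum_diff:
  assumes "Poly_Mapping.keys p \<subseteq> X" "Poly_Mapping.keys q \<subseteq> X"
  shows "fsum Z g (p - q) = fsum Z g p \<ominus>\<^bsub>Z\<^esub> fsum Z g q"
proof -
  have "p - q = p + psmult (- 1) q"
    by (rule poly_mapping_eqI) (simp add: lookup_add lookup_minus)
  moreover have "Poly_Mapping.keys (psmult (- 1) q) \<subseteq> X" using assms keys_psmult[of "- 1" q] by blast
  ultimately have "fsum Z g (p - q) = fsum Z g p \<oplus>\<^bsub>Z\<^esub> fsum Z g (psmult (- 1) q)"
    using assms fsum_add by metis
  then show ?thesis
    using vs_minus[OF Z fsum_closed[OF assms(2)]]
    by (simp only: fsum_psmult[OF assms(2)] a_minus_def)
qed

end

section \<open>Tensor products\<close>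

context
  fixes V :: "('k::field, 'v, 'x) module_scheme" and W :: "('k, 'w, 'y) module_scheme"
  assumes V: "vspace V" and W: "vspace W"
begin

text \<open>All generating relations are supported on \<open>carrier V \<times> carrier W\<close>,
  and combinations with such supports form a subspace. Adding a relation therefore never leaves the
  combinations that represent tensors.\<close>

lemma keys_tensor_span:
  assumes "r \<in> psm.span (tensor_rels V W)"
  shows "Poly_Mapping.keys r \<subseteq> carrier V \<times> carrier W"
proof -
  let ?S = "{p :: ('v \<times> 'w) \<Rightarrow>\<^sub>0 'k. Poly_Mapping.keys p \<subseteq> carrier V \<times> carrier W}"
  have sub: "psm.subspace ?S"
    unfolding psm.subspace_def
    using keys_add keys_psmult by (fastforce)
  have "tensor_rels V W \<subseteq> ?S"
    unfolding tensor_rels_def using V W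
    by (auto dest!: subsetD[OF keys_diff] split: if_splits)
  then show ?thesis using assms psm.span_minimal[OF _ sub] by blast
qed

lemma tensor_class_self:
  "Poly_Mapping.keys p \<subseteq> carrier V \<times> carrier W \<Longrightarrow> p \<in> tensor_class V W p"
  by (simp add: tensor_class_def psm.span_zero)

lemma tensor_class_eqI:
  assumes "q - p \<in> psm.span (tensor_rels V W)"
  shows "tensor_class V W q = tensor_class V W p"
proof -
  have "r - q \<in> psm.span (tensor_rels V W) \<longleftrightarrow> r - p \<in> psm.span (tensor_rels V W)" for r
    using psm.span_add[OF _ assms, of "r - q"] psm.span_diff[OF _ assms, of "r - p"] by auto
  then show ?thesis by (simp add: tensor_class_def)
qed

text \<open>The operations of \<open>tensor\<close> act on an arbitrarily chosen element of a coset.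
  That it differs from \<open>p\<close> by a relation is all that independence of the choice
  requires.\<close>

lemma tensor_rep:
  assumes "Poly_Mapping.keys p \<subseteq> carrier V \<times> carrier W"
  shows "Poly_Mapping.keys (rep (tensor_class V W p)) \<subseteq> carrier V \<times> carrier W"
    and "rep (tensor_class V W p) - p \<in> psm.span (tensor_rels V W)"
proof -
  have "rep (tensor_class V W p) \<in> tensor_class V W p"
    unfolding rep_def using tensor_class_self[OF assms] by (rule someI)
  then show "Poly_Mapping.keys (rep (tensor_class V W p)) \<subseteq> carrier V \<times> carrier W"
    "rep (tensor_class V W p) - p \<in> psm.span (tensor_rels V W)"
    by (auto simp: tensor_class_def)
qed

lemma tensor_carrierE:
  assumes "T \<in> carrier (tensor V W)"
  obtains p where "T = tensor_class V W p" "Poly_Mapping.keys p \<subseteq> carrier V \<times> carrier W"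
  using assms by (auto simp: tensor_def)

lemma tensor_class_closed:
  "Poly_Mapping.keys p \<subseteq> carrier V \<times> carrier W \<Longrightarrow> tensor_class V W p \<in> carrier (tensor V W)"
  by (auto simp: tensor_def)

lemma tensor_class_add:
  assumes "Poly_Mapping.keys p \<subseteq> carrier V \<times> carrier W" "Poly_Mapping.keys q \<subseteq> carrier V \<times> carrier W"
  shows "tensor_class V W p \<oplus>\<^bsub>tensor V W\<^esub> tensor_class V W q = tensor_class V W (p + q)"
proof -
  have "rep (tensor_class V W p) + rep (tensor_class V W q) - (p + q) \<in> psm.span (tensor_rels V W)"
    using psm.span_add[OF tensor_rep(2)[OF assms(1)] tensor_rep(2)[OF assms(2)]]
    by (simp add: algebra_simps)
  then show ?thesis by (simp add: tensor_def tensor_class_eqI)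
qed

lemma tensor_class_smult:
  assumes "Poly_Mapping.keys p \<subseteq> carrier V \<times> carrier W"
  shows "c \<odot>\<^bsub>tensor V W\<^esub> tensor_class V W p = tensor_class V W (psmult c p)"
proof -
  have "psmult c (rep (tensor_class V W p)) - psmult c p \<in> psm.span (tensor_rels V W)"
    using psm.span_scale[OF tensor_rep(2)[OF assms], of c] by (simp add: psm.scale_right_diff_distrib)
  then show ?thesis by (simp add: tensor_def tensor_class_eqI)
qed

lemma tensor_class_zero: "\<zero>\<^bsub>tensor V W\<^esub> = tensor_class V W 0"
  by (simp add: tensor_def)

lemma vspace_tensor: "vspace (tensor V W)"
proof -
  have k: "Poly_Mapping.keys (p + q) \<subseteq> carrier V \<times> carrier W"
    if "Poly_Mapping.keys p \<subseteq> carrier V \<times> carrier W" "Poly_Mapping.keys q \<subseteq> carrier V \<times> carrier W" for p q :: "('v \<times> 'w) \<Rightarrow>\<^sub>0 'k"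
    using keys_add[of p q] that by blast
  have s: "Poly_Mapping.keys (psmult c p) \<subseteq> carrier V \<times> carrier W"
    if "Poly_Mapping.keys p \<subseteq> carrier V \<times> carrier W" for c and p :: "('v \<times> 'w) \<Rightarrow>\<^sub>0 'k"
    using keys_psmult[of c p] that by blast
  show ?thesis
  proof (rule vspaceI)
    show "abelian_group (tensor V W)"
    proof (rule abelian_groupI)
      show "\<zero>\<^bsub>tensor V W\<^esub> \<in> carrier (tensor V W)"
        by (simp add: tensor_class_zero tensor_class_closed)
      fix S assume "S \<in> carrier (tensor V W)"
      then obtain p where p: "S = tensor_class V W p" "Poly_Mapping.keys p \<subseteq> carrier V \<times> carrier W"
        by (rule tensor_carrierE)
      show "\<zero>\<^bsub>tensor V W\<^esub> \<oplus>\<^bsub>tensor V W\<^esub> S = S"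
        using p by (simp add: tensor_class_zero tensor_class_add)
      show "\<exists>y\<in>carrier (tensor V W). y \<oplus>\<^bsub>tensor V W\<^esub> S = \<zero>\<^bsub>tensor V W\<^esub>"
        by (rule bexI[of _ "tensor_class V W (- p)"])
          (use p in \<open>auto simp: tensor_class_zero tensor_class_add tensor_class_closed\<close>)
      fix T assume "T \<in> carrier (tensor V W)"
      then obtain q where q: "T = tensor_class V W q" "Poly_Mapping.keys q \<subseteq> carrier V \<times> carrier W"
        by (rule tensor_carrierE)
      show "S \<oplus>\<^bsub>tensor V W\<^esub> T \<in> carrier (tensor V W)"
        using p q k by (simp add: tensor_class_add tensor_class_closed)
      show "S \<oplus>\<^bsub>tensor V W\<^esub> T = T \<oplus>\<^bsub>tensor V W\<^esub> S"
        using p q by (simp add: tensor_class_add add.commute)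
      fix U assume "U \<in> carrier (tensor V W)"
      then obtain r where r: "U = tensor_class V W r" "Poly_Mapping.keys r \<subseteq> carrier V \<times> carrier W"
        by (rule tensor_carrierE)
      show "S \<oplus>\<^bsub>tensor V W\<^esub> T \<oplus>\<^bsub>tensor V W\<^esub> U = S \<oplus>\<^bsub>tensor V W\<^esub> (T \<oplus>\<^bsub>tensor V W\<^esub> U)"
        using p q r k by (simp add: tensor_class_add add.assoc)
    qed
    fix S and c d :: 'k assume "S \<in> carrier (tensor V W)"
    then obtain p where p: "S = tensor_class V W p" "Poly_Mapping.keys p \<subseteq> carrier V \<times> carrier W"
      by (rule tensor_carrierE)
    show "c \<odot>\<^bsub>tensor V W\<^esub> S \<in> carrier (tensor V W)"
      using p s by (simp add: tensor_class_smult tensor_class_closed)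
    show "(c + d) \<odot>\<^bsub>tensor V W\<^esub> S = c \<odot>\<^bsub>tensor V W\<^esub> S \<oplus>\<^bsub>tensor V W\<^esub> d \<odot>\<^bsub>tensor V W\<^esub> S"
      using p s by (simp add: tensor_class_smult tensor_class_add psm.scale_left_distrib)
    show "(c * d) \<odot>\<^bsub>tensor V W\<^esub> S = c \<odot>\<^bsub>tensor V W\<^esub> (d \<odot>\<^bsub>tensor V W\<^esub> S)"
      using p s by (simp add: tensor_class_smult)
    show "1 \<odot>\<^bsub>tensor V W\<^esub> S = S"
      using p s by (simp add: tensor_class_smult)
    fix T assume "T \<in> carrier (tensor V W)"
    then obtain q where q: "T = tensor_class V W q" "Poly_Mapping.keys q \<subseteq> carrier V \<times> carrier W"
      by (rule tensor_carrierE)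
    show "c \<odot>\<^bsub>tensor V W\<^esub> (S \<oplus>\<^bsub>tensor V W\<^esub> T) = c \<odot>\<^bsub>tensor V W\<^esub> S \<oplus>\<^bsub>tensor V W\<^esub> c \<odot>\<^bsub>tensor V W\<^esub> T"
      using p q s k by (simp add: tensor_class_smult tensor_class_add psm.scale_right_distrib)
  qed
qed

lemma tens_closed: "v \<in> carrier V \<Longrightarrow> w \<in> carrier W \<Longrightarrow> tens V W v w \<in> carrier (tensor V W)"
  by (simp add: tens_def tensor_class_closed)

lemma bilin_tens: "bilin V W (tensor V W) (tens V W)"
proof (rule bilinI; rule lin_mapI)
  have e: "tensor_class V W q = tensor_class V W p" if "q - p \<in> tensor_rels V W" for p q
    using that by (intro tensor_class_eqI psm.span_base)
  fix v w assume v: "v \<in> carrier V" and w: "w \<in> carrier W"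
  show "tens V W v w \<in> carrier (tensor V W)" "tens V W v w \<in> carrier (tensor V W)"
    using v w by (auto simp: tens_closed)
  {
    fix v' assume v': "v' \<in> carrier V"
    have "Poly_Mapping.single (v \<oplus>\<^bsub>V\<^esub> v', w) 1 - (Poly_Mapping.single (v, w) 1 + Poly_Mapping.single (v', w) 1) \<in> tensor_rels V W"
      using v v' w unfolding tensor_rels_def diff_diff_eq[symmetric] by blast
    from e[OF this] show "tens V W (v \<oplus>\<^bsub>V\<^esub> v') w = tens V W v w \<oplus>\<^bsub>tensor V W\<^esub> tens V W v' w"
      using v v' w unfolding tens_def by (subst tensor_class_add) auto
  }
  {
    fix w' assume w': "w' \<in> carrier W"
    have "Poly_Mapping.single (v, w \<oplus>\<^bsub>W\<^esub> w') 1 - (Poly_Mapping.single (v, w) 1 + Poly_Mapping.single (v, w') 1) \<in> tensor_rels V W"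
      using v w' w unfolding tensor_rels_def diff_diff_eq[symmetric] by blast
    from e[OF this] show "tens V W v (w \<oplus>\<^bsub>W\<^esub> w') = tens V W v w \<oplus>\<^bsub>tensor V W\<^esub> tens V W v w'"
      using v w' w unfolding tens_def by (subst tensor_class_add) auto
  }
  fix c
  have "Poly_Mapping.single (c \<odot>\<^bsub>V\<^esub> v, w) 1 - Poly_Mapping.single (v, w) c \<in> tensor_rels V W"
    using v w unfolding tensor_rels_def by blast
  from e[OF this] show "tens V W (c \<odot>\<^bsub>V\<^esub> v) w = c \<odot>\<^bsub>tensor V W\<^esub> tens V W v w"
    using v w unfolding tens_def by (subst tensor_class_smult) auto
  have "Poly_Mapping.single (v, c \<odot>\<^bsub>W\<^esub> w) 1 - Poly_Mapping.single (v, w) c \<in> tensor_rels V W"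
    using v w unfolding tensor_rels_def by blast
  from e[OF this] show "tens V W v (c \<odot>\<^bsub>W\<^esub> w) = c \<odot>\<^bsub>tensor V W\<^esub> tens V W v w"
    using v w unfolding tens_def by (subst tensor_class_smult) auto
qed

lemma tensor_class_fsum:
  assumes "Poly_Mapping.keys p \<subseteq> carrier V \<times> carrier W"
  shows "tensor_class V W p = fsum (tensor V W) (\<lambda>x. tens V W (fst x) (snd x)) p"
proof -
  let ?g = "\<lambda>x. tens V W (fst x) (snd x)" and ?X = "carrier V \<times> carrier W"
  have g: "?g \<in> ?X \<rightarrow> carrier (tensor V W)" by (auto simp: tens_closed)
  have "finite F \<Longrightarrow> F \<subseteq> ?X \<Longrightarrow> Poly_Mapping.keys (\<Sum>x\<in>F. Poly_Mapping.single x (Poly_Mapping.lookup p x)) \<subseteq> ?X \<and>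
     tensor_class V W (\<Sum>x\<in>F. Poly_Mapping.single x (Poly_Mapping.lookup p x)) =
     fsum (tensor V W) ?g (\<Sum>x\<in>F. Poly_Mapping.single x (Poly_Mapping.lookup p x))" for F
  proof (induction F rule: finite_induct)
    case empty
    then show ?case using fsum_zero[OF vspace_tensor g] by (simp add: tensor_class_zero)
  next
    case (insert x F)
    let ?p = "\<Sum>x\<in>F. Poly_Mapping.single x (Poly_Mapping.lookup p x)"
    let ?q = "Poly_Mapping.single x (Poly_Mapping.lookup p x)"
    have q: "Poly_Mapping.keys ?q \<subseteq> ?X" using insert by auto
    have "tensor_class V W (?q + ?p) = tensor_class V W ?q \<oplus>\<^bsub>tensor V W\<^esub> tensor_class V W ?p"
      by (rule tensor_class_add[symmetric]) (use insert q in auto)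
    moreover have "tensor_class V W ?q = fsum (tensor V W) ?g ?q"
    proof -
      have "?q = psmult (Poly_Mapping.lookup p x) (Poly_Mapping.single x 1)" by simp
      then show ?thesis using insert fsum_single[OF vspace_tensor g, of x "Poly_Mapping.lookup p x"]
        by (cases x) (auto simp: tens_def tensor_class_smult)
    qed
    moreover have "fsum (tensor V W) ?g (?q + ?p) = fsum (tensor V W) ?g ?q \<oplus>\<^bsub>tensor V W\<^esub> fsum (tensor V W) ?g ?p"
      by (rule fsum_add[OF vspace_tensor g]) (use insert q in auto)
    moreover have "Poly_Mapping.keys (?q + ?p) \<subseteq> ?X"
      using keys_add[of ?q ?p] q insert by blast
    ultimately show ?case using insert by simp
  qed
  from this[of "Poly_Mapping.keys p"] show ?thesis
    using assms poly_mapping_single_sum[of p] by simp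
qed

text \<open>Scalars are absorbed into the first factor, so there is no case for them; the empty sum
  is covered by the pure tensor of two zeros.\<close>

lemma tensor_induct [consumes 1, case_names tens add]:
  assumes T: "T \<in> carrier (tensor V W)"
    and tens: "\<And>v w. v \<in> carrier V \<Longrightarrow> w \<in> carrier W \<Longrightarrow> P (tens V W v w)"
    and add: "\<And>S T. S \<in> carrier (tensor V W) \<Longrightarrow> T \<in> carrier (tensor V W) \<Longrightarrow> P S \<Longrightarrow> P T \<Longrightarrow> P (S \<oplus>\<^bsub>tensor V W\<^esub> T)"
  shows "P T"
proof -
  interpret t: abelian_group "tensor V W" by (rule vspace_abelian_group[OF vspace_tensor])
  obtain p where p: "T = tensor_class V W p" "Poly_Mapping.keys p \<subseteq> carrier V \<times> carrier W"
    using T by (rule tensor_carrierE)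
  have zero: "P \<zero>\<^bsub>tensor V W\<^esub>"
  proof -
    have "tens V W \<zero>\<^bsub>V\<^esub> \<zero>\<^bsub>W\<^esub> = \<zero>\<^bsub>tensor V W\<^esub>"
      using lin_map_zero[OF W vspace_tensor bilin_r[OF bilin_tens]] V by simp
    then show ?thesis using tens[of "\<zero>\<^bsub>V\<^esub>" "\<zero>\<^bsub>W\<^esub>"] V W by simp
  qed
  have "finite F \<Longrightarrow> F \<subseteq> carrier V \<times> carrier W \<Longrightarrow>
     P (\<Oplus>\<^bsub>tensor V W\<^esub>x\<in>F. Poly_Mapping.lookup p x \<odot>\<^bsub>tensor V W\<^esub> tens V W (fst x) (snd x))" for F
  proof (induction F rule: finite_induct)
    case empty
    then show ?case using zero by simp
  next
    case (insert x F)
    let ?f = "\<lambda>x. Poly_Mapping.lookup p x \<odot>\<^bsub>tensor V W\<^esub> tens V W (fst x) (snd x)"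
    have f: "x \<in> carrier V \<times> carrier W \<Longrightarrow> ?f x \<in> carrier (tensor V W)" for x
      using vspace_tensor by (auto simp: tens_closed)
    have "?f x = tens V W (Poly_Mapping.lookup p x \<odot>\<^bsub>V\<^esub> fst x) (snd x)"
      using insert lin_map_smult[OF bilin_l[OF bilin_tens]] by auto
    then have "P (?f x)" using insert V by (auto intro!: tens)
    then show ?case using insert f
      by (subst t.finsum_insert) (auto intro!: add t.finsum_closed)
  qed
  from this[of "Poly_Mapping.keys p"] show ?thesis
    using p by (simp add: tensor_class_fsum fsum_def)
qed

section \<open>The universal property of the tensor product\<close>

lemma fsum_tensor_span:
  assumes Z: "vspace Z" and b: "bilin V W Z \<beta>" and r: "r \<in> psm.span (tensor_rels V W)"
  shows "fsum Z (\<lambda>x. \<beta> (fst x) (snd x)) r = \<zero>\<^bsub>Z\<^esub>"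
proof -
  interpret Z: abelian_group Z by (rule vspace_abelian_group[OF Z])
  let ?g = "\<lambda>x. \<beta> (fst x) (snd x)" and ?X = "carrier V \<times> carrier W"
  have g: "?g \<in> ?X \<rightarrow> carrier Z" using b by (auto simp: bilin_closed)
  note fs = fsum_single[OF Z g] fsum_diff[OF Z g] fsum_closed[OF Z g]
  have kd: "Poly_Mapping.keys (p - q) \<subseteq> ?X" if "Poly_Mapping.keys p \<subseteq> ?X" "Poly_Mapping.keys q \<subseteq> ?X"
    for p q :: "('v \<times> 'w) \<Rightarrow>\<^sub>0 'k"
    using keys_diff[of p q] that by blast
  have ks: "Poly_Mapping.keys (Poly_Mapping.single (v, w) c) \<subseteq> ?X" if "v \<in> carrier V" "w \<in> carrier W" for v w and c :: 'k
    using that by auto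
  let ?S = "{p :: ('v \<times> 'w) \<Rightarrow>\<^sub>0 'k. Poly_Mapping.keys p \<subseteq> ?X \<and> fsum Z ?g p = \<zero>\<^bsub>Z\<^esub>}"
  have sub: "psm.subspace ?S"
    unfolding psm.subspace_def
  proof (intro conjI ballI allI)
    show "0 \<in> ?S" by (simp add: fsum_zero[OF Z g])
  next
    fix x y assume "x \<in> ?S" "y \<in> ?S"
    then show "x + y \<in> ?S" using keys_add[of x y] fsum_add[OF Z g, of x y] Z by auto
  next
    fix c x assume "x \<in> ?S"
    then show "psmult c x \<in> ?S" using keys_psmult[of c x] fsum_psmult[OF Z g, of x c] Z by auto
  qed
  have 1: "x \<ominus>\<^bsub>Z\<^esub> x = \<zero>\<^bsub>Z\<^esub>" if "x \<in> carrier Z" for x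
    using that by (simp add: a_minus_def Z.r_neg)
  have 2: "x \<oplus>\<^bsub>Z\<^esub> y \<ominus>\<^bsub>Z\<^esub> x = y" if "x \<in> carrier Z" "y \<in> carrier Z" for x y
    using that Z.a_comm[of x y] by (simp add: a_minus_def Z.a_assoc Z.r_neg)
  have 0: "x \<oplus>\<^bsub>Z\<^esub> y \<ominus>\<^bsub>Z\<^esub> x \<ominus>\<^bsub>Z\<^esub> y = \<zero>\<^bsub>Z\<^esub>" if "x \<in> carrier Z" "y \<in> carrier Z" for x y
    using that by (simp add: 1 2)
  have "fsum Z ?g x = \<zero>\<^bsub>Z\<^esub>" if "x \<in> tensor_rels V W" for x
    using that unfolding tensor_rels_def
    by (elim UnE CollectE exE conjE)
      (simp_all add: fs kd ks V W Z bilin_closed[OF b] lin_map_add[OF bilin_l[OF b]] lin_map_add[OF bilin_r[OF b]]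
        lin_map_smult[OF bilin_l[OF b]] lin_map_smult[OF bilin_r[OF b]] 0 1
        del: keys_single)
  then have "tensor_rels V W \<subseteq> ?S"
    using keys_tensor_span[OF psm.span_base] by blast
  then show ?thesis using r psm.span_minimal[OF _ sub] by blast
qed

text \<open>\<open>tlift\<close> sums over the chosen representative. Two representatives differ by
  a relation, which a bilinear map kills, so any \<open>p\<close> in the coset may be used for the
  computation.\<close>

lemma tlift_tensor_class:
  assumes Z: "vspace Z" and b: "bilin V W Z \<beta>" and p: "Poly_Mapping.keys p \<subseteq> carrier V \<times> carrier W"
  shows "tlift Z \<beta> (tensor_class V W p) = fsum Z (\<lambda>x. \<beta> (fst x) (snd x)) p"
proof -
  interpret Z: abelian_group Z by (rule vspace_abelian_group[OF Z])
  let ?g = "\<lambda>x. \<beta> (fst x) (snd x)" and ?q = "rep (tensor_class V W p)"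
  have g: "?g \<in> carrier V \<times> carrier W \<rightarrow> carrier Z" using b by (auto simp: bilin_closed)
  have "fsum Z ?g (?q - p + p) = fsum Z ?g (?q - p) \<oplus>\<^bsub>Z\<^esub> fsum Z ?g p"
    by (rule fsum_add[OF Z g]) (use tensor_rep[OF p] keys_tensor_span p in auto)
  also have "\<dots> = fsum Z ?g p"
    using fsum_tensor_span[OF Z b tensor_rep(2)[OF p]] fsum_closed[OF Z g p] by simp
  finally show ?thesis by (simp add: tlift_def fsum_def)
qed

lemma tlift_tens:
  assumes "vspace Z" "bilin V W Z \<beta>" "v \<in> carrier V" "w \<in> carrier W"
  shows "tlift Z \<beta> (tens V W v w) = \<beta> v w"
proof -
  have g: "(\<lambda>x. \<beta> (fst x) (snd x)) \<in> carrier V \<times> carrier W \<rightarrow> carrier Z"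
    using assms by (auto simp: bilin_closed)
  show ?thesis using assms unfolding tens_def
    by (subst tlift_tensor_class) (auto simp: fsum_single[OF assms(1) g] bilin_closed)
qed

lemma lin_tlift:
  assumes Z: "vspace Z" and b: "bilin V W Z \<beta>"
  shows "lin_map (tensor V W) Z (tlift Z \<beta>)"
proof (rule lin_mapI)
  have g: "(\<lambda>x. \<beta> (fst x) (snd x)) \<in> carrier V \<times> carrier W \<rightarrow> carrier Z"
    using b by (auto simp: bilin_closed)
  fix S assume "S \<in> carrier (tensor V W)"
  then obtain p where p: "S = tensor_class V W p" "Poly_Mapping.keys p \<subseteq> carrier V \<times> carrier W"
    by (rule tensor_carrierE)
  show "tlift Z \<beta> S \<in> carrier Z"
    using p by (simp add: tlift_tensor_class[OF Z b] fsum_closed[OF Z g])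
  fix c
  have "Poly_Mapping.keys (psmult c p) \<subseteq> carrier V \<times> carrier W" using p keys_psmult[of c p] by auto
  then show "tlift Z \<beta> (c \<odot>\<^bsub>tensor V W\<^esub> S) = c \<odot>\<^bsub>Z\<^esub> tlift Z \<beta> S"
    using p by (simp add: tlift_tensor_class[OF Z b] fsum_psmult[OF Z g] tensor_class_smult)
  fix T assume "T \<in> carrier (tensor V W)"
  then obtain q where q: "T = tensor_class V W q" "Poly_Mapping.keys q \<subseteq> carrier V \<times> carrier W"
    by (rule tensor_carrierE)
  have "Poly_Mapping.keys (p + q) \<subseteq> carrier V \<times> carrier W" using p q keys_add[of p q] by auto
  then show "tlift Z \<beta> (S \<oplus>\<^bsub>tensor V W\<^esub> T) = tlift Z \<beta> S \<oplus>\<^bsub>Z\<^esub> tlift Z \<beta> T"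
    using p q by (simp add: tlift_tensor_class[OF Z b] fsum_add[OF Z g] tensor_class_add)
qed

lemma tensor_lin_eqI:
  assumes "vspace Z" "lin_map (tensor V W) Z f" "lin_map (tensor V W) Z g"
    and "\<And>v w. v \<in> carrier V \<Longrightarrow> w \<in> carrier W \<Longrightarrow> f (tens V W v w) = g (tens V W v w)"
    and "T \<in> carrier (tensor V W)"
  shows "f T = g T"
  using assms(5)
proof (induction rule: tensor_induct)
  case (add S T)
  then show ?case using lin_map_add[OF assms(2)] lin_map_add[OF assms(3)] by simp
qed (use assms in auto)

text \<open>Here the tensor is fixed and the bilinear map varies. This is what makes nested Sweedler
  sums linear in the variables that enter only through the inner map.\<close>

lemma lin_tlift_param:
  assumes Z: "vspace Z" and T: "T \<in> carrier (tensor V W)"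
    and b: "\<And>u. u \<in> carrier U \<Longrightarrow> bilin V W Z (\<beta> u)"
    and l: "\<And>v w. v \<in> carrier V \<Longrightarrow> w \<in> carrier W \<Longrightarrow> lin_map U Z (\<lambda>u. \<beta> u v w)"
    and U: "vspace U"
  shows "lin_map U Z (\<lambda>u. tlift Z (\<beta> u) T)"
  using T
proof (induction rule: tensor_induct)
  case (tens v w)
  show ?case by (rule lin_map_cong[OF _ U l]) (use tens in \<open>auto simp: tlift_tens Z b\<close>)
next
  case (add S T)
  show ?case
    by (rule lin_map_cong[OF _ U lin_map_sum2[OF Z add(3,4)]])
      (use add in \<open>auto simp: lin_map_add[OF lin_tlift[OF Z b]]\<close>)
qed

end

lemma lin_bilin_l:
  assumes "bilin V W Z \<beta>" "lin_map U V f" "w \<in> carrier W"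
  shows "lin_map U Z (\<lambda>u. \<beta> (f u) w)"
  using lin_map_comp[OF assms(2) bilin_l[OF assms(1,3)]] .

lemma lin_bilin_r:
  assumes "bilin V W Z \<beta>" "lin_map U W f" "v \<in> carrier V"
  shows "lin_map U Z (\<lambda>u. \<beta> v (f u))"
  using lin_map_comp[OF assms(2) bilin_r[OF assms(1,3)]] .

lemma bilin_comp:
  assumes "bilin V W Z \<beta>" "lin_map V0 V f" "lin_map W0 W g"
  shows "bilin V0 W0 Z (\<lambda>v w. \<beta> (f v) (g w))"
  using assms lin_map_closed[OF assms(2)] lin_map_closed[OF assms(3)]
  by (intro bilinI lin_bilin_l[OF assms(1)] lin_bilin_r[OF assms(1)])

lemma bilin_lin:
  assumes "bilin V W Z \<beta>" "lin_map Z Z' f"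
  shows "bilin V W Z' (\<lambda>v w. f (\<beta> v w))"
  by (intro bilinI lin_map_comp[OF _ assms(2)]) (auto intro: bilin_l[OF assms(1)] bilin_r[OF assms(1)])

lemma bilin_scale: "vspace W \<Longrightarrow> lin_map V base_field f \<Longrightarrow> bilin V W W (\<lambda>v w. f v \<odot>\<^bsub>W\<^esub> w)"
  by (intro bilinI lin_map_scale lin_map_id lin_map_scale_l)

lemma bilin_scale_r: "vspace V \<Longrightarrow> lin_map W base_field f \<Longrightarrow> bilin V W V (\<lambda>v w. f w \<odot>\<^bsub>V\<^esub> v)"
  by (intro bilinI lin_map_scale lin_map_id lin_map_scale_l)

context
  fixes V :: "('k::field, 'v, 'x) module_scheme" and W :: "('k, 'w, 'y) module_scheme"
    and V' :: "('k::field, 'v1, 'x1) module_scheme" and W' :: "('k, 'w1, 'y1) module_scheme"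
  assumes V: "vspace V" and W: "vspace W" and V': "vspace V'" and W': "vspace W'"
begin

lemma tmap_tens:
  assumes "lin_map V V' f" "lin_map W W' g" "v \<in> carrier V" "w \<in> carrier W"
  shows "tmap V' W' f g (tens V W v w) = tens V' W' (f v) (g w)"
  unfolding tmap_def
  by (rule tlift_tens[OF V W vspace_tensor[OF V' W'] bilin_comp[OF bilin_tens[OF V' W']]]) (use assms in auto)

lemma lin_tmap:
  assumes "lin_map V V' f" "lin_map W W' g"
  shows "lin_map (tensor V W) (tensor V' W') (tmap V' W' f g)"
  unfolding tmap_def
  by (rule lin_tlift[OF V W vspace_tensor[OF V' W'] bilin_comp[OF bilin_tens[OF V' W']]]) (use assms in auto)

end

section \<open>Dual bases and slices of tensors\<close>

text \<open>
  No linear independence is required: a linear choice of coefficients suffices to read off a tensor from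
  its slices, which replaces flatness over a field.
\<close>

definition dbasis :: "('k::field, 'v, 'x) module_scheme \<Rightarrow> ('i \<Rightarrow> 'v) \<Rightarrow> ('v \<Rightarrow> ('i \<Rightarrow>\<^sub>0 'k)) \<Rightarrow> bool" where
  "dbasis V u \<sigma> \<longleftrightarrow>
     (\<forall>v\<in>carrier V. u ` Poly_Mapping.keys (\<sigma> v) \<subseteq> carrier V \<and> fsum V u (\<sigma> v) = v) \<and>
     (\<forall>v\<in>carrier V. \<forall>w\<in>carrier V. \<sigma> (v \<oplus>\<^bsub>V\<^esub> w) = \<sigma> v + \<sigma> w) \<and>
     (\<forall>c. \<forall>v\<in>carrier V. \<sigma> (c \<odot>\<^bsub>V\<^esub> v) = psmult c (\<sigma> v))"

text \<open>A linear section of the evaluation map from the free vector space on \<open>carrier V\<close>.\<close>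

lemma ex_dbasis:
  fixes V :: "('k::field, 'v, 'x) module_scheme"
  assumes V: "vspace V"
  shows "\<exists>\<sigma>. dbasis V (\<lambda>v. v) \<sigma>"
proof -
  interpret V: abelian_group V by (rule vspace_abelian_group[OF V])
  have g: "(\<lambda>v. v) \<in> carrier V \<rightarrow> carrier V" by auto
  note fs = fsum_add[OF V g] fsum_psmult[OF V g] fsum_single[OF V g] fsum_zero[OF V g] fsum_diff[OF V g]
  define N where "N = {p :: 'v \<Rightarrow>\<^sub>0 'k. Poly_Mapping.keys p \<subseteq> carrier V \<and> fsum V (\<lambda>v. v) p = \<zero>\<^bsub>V\<^esub>}"
  have N: "psm.subspace N"
    unfolding psm.subspace_def
  proof (intro conjI ballI allI)
    show "0 \<in> N" by (simp add: N_def fs)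
    fix x y assume "x \<in> N" "y \<in> N"
    then show "x + y \<in> N" using keys_add[of x y] fs(1)[of x y] V by (auto simp: N_def)
  next
    fix c x assume "x \<in> N"
    then show "psmult c x \<in> N" using keys_psmult[of c x] fs(2)[of x c] V by (auto simp: N_def)
  qed
  \<comment> \<open>Over a field, the kernel \<open>N\<close> of the evaluation map is the image of
    a linear projection \<open>\<pi>\<close>. Subtracting from the formal vector \<open>v\<close>
    its part in \<open>N\<close> keeps the evaluation and makes the result depend linearly on
    \<open>v\<close>.\<close>
  obtain \<pi> where \<pi>: "\<pi> ` UNIV \<subseteq> N" "Vector_Spaces.linear psmult psmult \<pi>" "\<forall>v\<in>N. \<pi> v = v"
    using psmp.linear_exists_left_inverse_on[OF psm.linear_id N] by auto
  interpret \<pi>: Vector_Spaces.linear psmult psmult \<pi> by (rule \<pi>(2))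
  define \<sigma> where "\<sigma> v = Poly_Mapping.single v 1 - \<pi> (Poly_Mapping.single v 1)" for v
  have inN: "\<pi> p \<in> N" for p using \<pi>(1) by auto
  have "dbasis V (\<lambda>v. v) \<sigma>"
    unfolding dbasis_def
  proof (intro conjI ballI allI)
    fix v assume v: "v \<in> carrier V"
    have k: "Poly_Mapping.keys (Poly_Mapping.single v (1::'k)) \<subseteq> carrier V" using v by simp
    have k': "Poly_Mapping.keys (\<pi> p) \<subseteq> carrier V" "fsum V (\<lambda>v. v) (\<pi> p) = \<zero>\<^bsub>V\<^esub>" for p
      using inN[of p] by (auto simp: N_def)
    show "(\<lambda>v. v) ` Poly_Mapping.keys (\<sigma> v) \<subseteq> carrier V"
      unfolding \<sigma>_def using keys_diff k k' by fastforce
    show "fsum V (\<lambda>v. v) (\<sigma> v) = v"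
      unfolding \<sigma>_def using v V k k' by (simp add: fs a_minus_def del: keys_single)
    {
      fix w assume w: "w \<in> carrier V"
      let ?r = "Poly_Mapping.single (v \<oplus>\<^bsub>V\<^esub> w) (1::'k) - (Poly_Mapping.single v 1 + Poly_Mapping.single w 1)"
      have "Poly_Mapping.keys (Poly_Mapping.single v (1::'k) + Poly_Mapping.single w 1) \<subseteq> carrier V"
        using keys_add[of "Poly_Mapping.single v (1::'k)" "Poly_Mapping.single w 1"] v w by auto
      moreover have "Poly_Mapping.keys ?r \<subseteq> carrier V"
        using keys_diff[of "Poly_Mapping.single (v \<oplus>\<^bsub>V\<^esub> w) (1::'k)" "Poly_Mapping.single v 1 + Poly_Mapping.single w 1"]
          calculation v w V by auto
      ultimately have "?r \<in> N"
        unfolding N_def using v w V by (simp add: fs a_minus_def V.r_neg)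
      \<comment> \<open>The defect \<open>?r\<close> of additivity evaluates to zero, hence lies in
        \<open>N\<close> and is fixed by \<open>\<pi>\<close>; so it cancels in
        \<open>\<sigma>\<close>.\<close>
      then have "\<pi> ?r = ?r" using \<pi>(3) by blast
      then show "\<sigma> (v \<oplus>\<^bsub>V\<^esub> w) = \<sigma> v + \<sigma> w"
        unfolding \<sigma>_def by (simp add: \<pi>.diff \<pi>.add algebra_simps)
    }
    fix c
    let ?r = "Poly_Mapping.single (c \<odot>\<^bsub>V\<^esub> v) (1::'k) - psmult c (Poly_Mapping.single v 1)"
    have "Poly_Mapping.keys ?r \<subseteq> carrier V"
      using keys_diff[of "Poly_Mapping.single (c \<odot>\<^bsub>V\<^esub> v) (1::'k)" "psmult c (Poly_Mapping.single v 1)"] v V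
      by (auto split: if_splits)
    then have "?r \<in> N"
      unfolding N_def using v V by (simp add: fs a_minus_def V.r_neg)
    then have "\<pi> ?r = ?r" using \<pi>(3) by blast
    then show "\<sigma> (c \<odot>\<^bsub>V\<^esub> v) = psmult c (\<sigma> v)"
      unfolding \<sigma>_def by (simp add: \<pi>.diff \<pi>.scale psm.scale_right_diff_distrib algebra_simps del: psmult_single)
  qed
  then show ?thesis by blast
qed

lemma dbasis_lin:
  "dbasis V u \<sigma> \<Longrightarrow> lin_map V base_field (\<lambda>v. Poly_Mapping.lookup (\<sigma> v) i)"
  by (rule lin_mapI) (auto simp: dbasis_def lookup_add)

text \<open>Contraction of the left factor with the coordinate functional of index \<open>i\<close>;
  \<open>rsl\<close> contracts the right factor. For the coaction of a comodule these slices are the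
  graded components.\<close>

definition lsl :: "('v \<Rightarrow> ('i \<Rightarrow>\<^sub>0 'k)) \<Rightarrow> ('k::field, 'w, 'y) module_scheme \<Rightarrow> 'i \<Rightarrow> (('v \<times> 'w) \<Rightarrow>\<^sub>0 'k) set \<Rightarrow> 'w" where
  "lsl \<sigma> W i = tlift W (\<lambda>v w. Poly_Mapping.lookup (\<sigma> v) i \<odot>\<^bsub>W\<^esub> w)"

definition rsl :: "('w \<Rightarrow> ('i \<Rightarrow>\<^sub>0 'k)) \<Rightarrow> ('k::field, 'v, 'y) module_scheme \<Rightarrow> 'i \<Rightarrow> (('v \<times> 'w) \<Rightarrow>\<^sub>0 'k) set \<Rightarrow> 'v" where
  "rsl \<sigma> V i = tlift V (\<lambda>v w. Poly_Mapping.lookup (\<sigma> w) i \<odot>\<^bsub>V\<^esub> v)"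

context
  fixes V :: "('k::field, 'v, 'x) module_scheme" and W :: "('k, 'w, 'y) module_scheme"
  assumes V: "vspace V" and W: "vspace W"
begin

lemma lin_lsl: "dbasis V u \<sigma> \<Longrightarrow> lin_map (tensor V W) W (lsl \<sigma> W i)"
  unfolding lsl_def by (intro lin_tlift[OF V W W] bilin_scale[OF W] dbasis_lin)

lemma lsl_tens:
  "dbasis V u \<sigma> \<Longrightarrow> v \<in> carrier V \<Longrightarrow> w \<in> carrier W \<Longrightarrow> lsl \<sigma> W i (tens V W v w) = Poly_Mapping.lookup (\<sigma> v) i \<odot>\<^bsub>W\<^esub> w"
  unfolding lsl_def by (rule tlift_tens[OF V W W bilin_scale[OF W dbasis_lin]])

lemma lin_rsl: "dbasis W u \<sigma> \<Longrightarrow> lin_map (tensor V W) V (rsl \<sigma> V i)"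
  unfolding rsl_def by (intro lin_tlift[OF V W V] bilin_scale_r[OF V] dbasis_lin)

lemma rsl_tens:
  "dbasis W u \<sigma> \<Longrightarrow> v \<in> carrier V \<Longrightarrow> w \<in> carrier W \<Longrightarrow> rsl \<sigma> V i (tens V W v w) = Poly_Mapping.lookup (\<sigma> w) i \<odot>\<^bsub>V\<^esub> v"
  unfolding rsl_def by (rule tlift_tens[OF V W V bilin_scale_r[OF V dbasis_lin]])

lemma tens_zero_l: "w \<in> carrier W \<Longrightarrow> tens V W \<zero>\<^bsub>V\<^esub> w = \<zero>\<^bsub>tensor V W\<^esub>"
  using lin_map_zero[OF V vspace_tensor[OF V W] bilin_l[OF bilin_tens[OF V W]]] .

lemma tens_zero_r: "v \<in> carrier V \<Longrightarrow> tens V W v \<zero>\<^bsub>W\<^esub> = \<zero>\<^bsub>tensor V W\<^esub>"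
  using lin_map_zero[OF W vspace_tensor[OF V W] bilin_r[OF bilin_tens[OF V W]]] .

lemma dbasis_expand:
  fixes u :: "'i \<Rightarrow> 'v"
  assumes "dbasis V u \<sigma>" "v \<in> carrier V" "finite F" "Poly_Mapping.keys (\<sigma> v) \<subseteq> F" "u ` F \<subseteq> carrier V"
  shows "v = (\<Oplus>\<^bsub>V\<^esub>i\<in>F. Poly_Mapping.lookup (\<sigma> v) i \<odot>\<^bsub>V\<^esub> u i)"
proof -
  have "u \<in> F \<rightarrow> carrier V" using assms by auto
  then have "fsum V u (\<sigma> v) = (\<Oplus>\<^bsub>V\<^esub>i\<in>F. Poly_Mapping.lookup (\<sigma> v) i \<odot>\<^bsub>V\<^esub> u i)"
    by (rule fsum_superset[OF V]) (use assms in auto)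
  then show ?thesis using assms by (simp add: dbasis_def)
qed

end

text \<open>The expansion is asserted for every finite index set above \<open>F\<close>, since the
  sum of two tensors has to be expanded over an index set common to both.\<close>

lemma tensor_lsl_aux:
  fixes V :: "('k::field, 'v, 'x) module_scheme" and W :: "('k, 'w, 'y) module_scheme" and u :: "'i \<Rightarrow> 'v"
  assumes V: "vspace V" and W: "vspace W"
    and d: "dbasis V u \<sigma>" and T: "T \<in> carrier (tensor V W)"
  shows "\<exists>F. finite F \<and> u ` F \<subseteq> carrier V \<and> (\<forall>i. i \<notin> F \<longrightarrow> lsl \<sigma> W i T = \<zero>\<^bsub>W\<^esub>) \<and>
    (\<forall>F'. finite F' \<longrightarrow> F \<subseteq> F' \<longrightarrow> u ` F' \<subseteq> carrier V \<longrightarrow> T = (\<Oplus>\<^bsub>tensor V W\<^esub>i\<in>F'. tens V W (u i) (lsl \<sigma> W i T)))"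
proof -
  interpret t: abelian_group "tensor V W" by (rule vspace_abelian_group[OF vspace_tensor[OF V W]])
  note tV = vspace_tensor[OF V W] and bt = bilin_tens[OF V W]
  show ?thesis using T
  proof (induction rule: tensor_induct[OF V W, consumes 1, case_names tens add])
    case (tens v w)
    note vw = tens
    have u: "u ` Poly_Mapping.keys (\<sigma> v) \<subseteq> carrier V" using d vw by (auto simp: dbasis_def)
    show ?case
    proof (intro exI[of _ "Poly_Mapping.keys (\<sigma> v)"] conjI allI impI)
      show "finite (Poly_Mapping.keys (\<sigma> v))" "u ` Poly_Mapping.keys (\<sigma> v) \<subseteq> carrier V"
        using u by auto
      show "lsl \<sigma> W i (tens V W v w) = \<zero>\<^bsub>W\<^esub>" if "i \<notin> Poly_Mapping.keys (\<sigma> v)" for i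
        using that vw W by (simp add: lsl_tens[OF V W d] in_keys_iff)
      fix F' assume F': "finite F'" "Poly_Mapping.keys (\<sigma> v) \<subseteq> F'" "u ` F' \<subseteq> carrier V"
      have uF: "i \<in> F' \<Longrightarrow> u i \<in> carrier V" for i using F' by auto
      have "tens V W v w = tens V W (\<Oplus>\<^bsub>V\<^esub>i\<in>F'. Poly_Mapping.lookup (\<sigma> v) i \<odot>\<^bsub>V\<^esub> u i) w"
        using dbasis_expand[OF V W d _ F']  vw by simp
      also have "\<dots> = (\<Oplus>\<^bsub>tensor V W\<^esub>i\<in>F'. tens V W (Poly_Mapping.lookup (\<sigma> v) i \<odot>\<^bsub>V\<^esub> u i) w)"
        by (rule lin_map_finsum[OF V tV bilin_l[OF bt]]) (use vw V uF in auto)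
      also have "\<dots> = (\<Oplus>\<^bsub>tensor V W\<^esub>i\<in>F'. tens V W (u i) (lsl \<sigma> W i (tens V W v w)))"
        using vw uF V W tV
        by (intro t.finsum_cong')
          (auto simp: lsl_tens[OF V W d] lin_map_smult[OF bilin_l[OF bt]] lin_map_smult[OF bilin_r[OF bt]] tens_closed)
      finally show "tens V W v w = (\<Oplus>\<^bsub>tensor V W\<^esub>i\<in>F'. tens V W (u i) (lsl \<sigma> W i (tens V W v w)))" .
    qed
  next
    case (add S T)
    then obtain F G where
      F: "finite F" "u ` F \<subseteq> carrier V" "\<forall>i. i \<notin> F \<longrightarrow> lsl \<sigma> W i S = \<zero>\<^bsub>W\<^esub>"
        "\<forall>F'. finite F' \<longrightarrow> F \<subseteq> F' \<longrightarrow> u ` F' \<subseteq> carrier V \<longrightarrow> S = (\<Oplus>\<^bsub>tensor V W\<^esub>i\<in>F'. tens V W (u i) (lsl \<sigma> W i S))" and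
      G: "finite G" "u ` G \<subseteq> carrier V" "\<forall>i. i \<notin> G \<longrightarrow> lsl \<sigma> W i T = \<zero>\<^bsub>W\<^esub>"
        "\<forall>F'. finite F' \<longrightarrow> G \<subseteq> F' \<longrightarrow> u ` F' \<subseteq> carrier V \<longrightarrow> T = (\<Oplus>\<^bsub>tensor V W\<^esub>i\<in>F'. tens V W (u i) (lsl \<sigma> W i T))"
      by (elim exE conjE)
    note lc = lin_map_closed[OF lin_lsl[OF V W d]] and la = lin_map_add[OF lin_lsl[OF V W d]]
    show ?case
    proof (intro exI[of _ "F \<union> G"] conjI allI impI)
      show "finite (F \<union> G)" "u ` (F \<union> G) \<subseteq> carrier V" using F G by auto
      show "lsl \<sigma> W i (S \<oplus>\<^bsub>tensor V W\<^esub> T) = \<zero>\<^bsub>W\<^esub>" if "i \<notin> F \<union> G" for i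
        using that F G add W by (simp add: la)
      fix F' assume F': "finite F'" "F \<union> G \<subseteq> F'" "u ` F' \<subseteq> carrier V"
      have uF: "i \<in> F' \<Longrightarrow> u i \<in> carrier V" for i using F' by auto
      have "S = (\<Oplus>\<^bsub>tensor V W\<^esub>i\<in>F'. tens V W (u i) (lsl \<sigma> W i S))"
        "T = (\<Oplus>\<^bsub>tensor V W\<^esub>i\<in>F'. tens V W (u i) (lsl \<sigma> W i T))"
        by (rule F(4)[rule_format]; use F' in simp) (rule G(4)[rule_format]; use F' in simp)
      then have "S \<oplus>\<^bsub>tensor V W\<^esub> T =
         (\<Oplus>\<^bsub>tensor V W\<^esub>i\<in>F'. tens V W (u i) (lsl \<sigma> W i S)) \<oplus>\<^bsub>tensor V W\<^esub>
         (\<Oplus>\<^bsub>tensor V W\<^esub>i\<in>F'. tens V W (u i) (lsl \<sigma> W i T))" by simp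
      also have "\<dots> = (\<Oplus>\<^bsub>tensor V W\<^esub>i\<in>F'. tens V W (u i) (lsl \<sigma> W i S) \<oplus>\<^bsub>tensor V W\<^esub> tens V W (u i) (lsl \<sigma> W i T))"
        by (rule t.finsum_addf[symmetric]) (use add uF V W in \<open>auto intro!: tens_closed lc\<close>)
      also have "\<dots> = (\<Oplus>\<^bsub>tensor V W\<^esub>i\<in>F'. tens V W (u i) (lsl \<sigma> W i (S \<oplus>\<^bsub>tensor V W\<^esub> T)))"
        using add uF V W tV
        by (intro t.finsum_cong') (auto simp: lc la lin_map_add[OF bilin_r[OF bt]] intro!: tens_closed)
      finally show "S \<oplus>\<^bsub>tensor V W\<^esub> T = (\<Oplus>\<^bsub>tensor V W\<^esub>i\<in>F'. tens V W (u i) (lsl \<sigma> W i (S \<oplus>\<^bsub>tensor V W\<^esub> T)))" .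
    qed
  qed
qed

lemma tensor_lsl:
  fixes V :: "('k::field, 'v, 'x) module_scheme" and W :: "('k, 'w, 'y) module_scheme" and u :: "'i \<Rightarrow> 'v"
  assumes "vspace V" "vspace W" "dbasis V u \<sigma>" "T \<in> carrier (tensor V W)"
  shows "\<exists>F. finite F \<and> u ` F \<subseteq> carrier V \<and> (\<forall>i. i \<notin> F \<longrightarrow> lsl \<sigma> W i T = \<zero>\<^bsub>W\<^esub>) \<and>
    T = (\<Oplus>\<^bsub>tensor V W\<^esub>i\<in>F. tens V W (u i) (lsl \<sigma> W i T))"
proof -
  from tensor_lsl_aux[OF assms] obtain F where F: "finite F" "u ` F \<subseteq> carrier V"
    "\<forall>i. i \<notin> F \<longrightarrow> lsl \<sigma> W i T = \<zero>\<^bsub>W\<^esub>"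
    "\<forall>F'. finite F' \<longrightarrow> F \<subseteq> F' \<longrightarrow> u ` F' \<subseteq> carrier V \<longrightarrow> T = (\<Oplus>\<^bsub>tensor V W\<^esub>i\<in>F'. tens V W (u i) (lsl \<sigma> W i T))"
    by (elim exE conjE)
  show ?thesis
    by (intro exI[of _ F] conjI) (rule F(1), rule F(2), rule F(3), rule F(4)[rule_format, OF F(1) subset_refl F(2)])
qed

lemma lin_tswap:
  assumes "vspace V" "vspace W"
  shows "lin_map (tensor V W) (tensor W V) (tlift (tensor W V) (\<lambda>v w. tens W V w v))"
  using assms by (intro lin_tlift bilinI vspace_tensor bilin_l[OF bilin_tens] bilin_r[OF bilin_tens])

lemma tswap_tens:
  assumes "vspace V" "vspace W" "v \<in> carrier V" "w \<in> carrier W"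
  shows "tlift (tensor W V) (\<lambda>v w. tens W V w v) (tens V W v w) = tens W V w v"
  using assms by (intro tlift_tens bilinI vspace_tensor bilin_l[OF bilin_tens] bilin_r[OF bilin_tens])

text \<open>Transported along the exchange of the factors, under which right slices become left
  slices.\<close>

lemma tensor_rsl:
  fixes V :: "('k::field, 'v, 'x) module_scheme" and W :: "('k, 'w, 'y) module_scheme" and u :: "'i \<Rightarrow> 'w"
  assumes V: "vspace V" and W: "vspace W" and d: "dbasis W u \<sigma>" and T: "T \<in> carrier (tensor V W)"
  shows "\<exists>F. finite F \<and> u ` F \<subseteq> carrier W \<and> (\<forall>i. i \<notin> F \<longrightarrow> rsl \<sigma> V i T = \<zero>\<^bsub>V\<^esub>) \<and>
    T = (\<Oplus>\<^bsub>tensor V W\<^esub>i\<in>F. tens V W (rsl \<sigma> V i T) (u i))"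
proof -
  let ?s = "tlift (tensor W V) (\<lambda>v w. tens W V w v)" and ?t = "tlift (tensor V W) (\<lambda>w v. tens V W v w)"
  note tVW = vspace_tensor[OF V W] and tWV = vspace_tensor[OF W V]
  interpret t: abelian_group "tensor V W" by (rule vspace_abelian_group[OF tVW])
  have sT: "?s T \<in> carrier (tensor W V)" by (rule lin_map_closed[OF lin_tswap[OF V W] T])
  have ts: "?t (?s T) = T"
    by (rule tensor_lin_eqI[OF V W tVW lin_map_comp[OF lin_tswap[OF V W] lin_tswap[OF W V]] lin_map_id _ T])
      (use V W in \<open>auto simp: tswap_tens\<close>)
  have rs: "rsl \<sigma> V i T = lsl \<sigma> V i (?s T)" for i
    by (rule tensor_lin_eqI[OF V W V lin_rsl[OF V W d] lin_map_comp[OF lin_tswap[OF V W] lin_lsl[OF W V d]] _ T])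
      (use V W in \<open>auto simp: tswap_tens rsl_tens[OF V W d] lsl_tens[OF W V d]\<close>)
  obtain F where F: "finite F" "u ` F \<subseteq> carrier W" "\<forall>i. i \<notin> F \<longrightarrow> lsl \<sigma> V i (?s T) = \<zero>\<^bsub>V\<^esub>"
    "?s T = (\<Oplus>\<^bsub>tensor W V\<^esub>i\<in>F. tens W V (u i) (lsl \<sigma> V i (?s T)))"
    using tensor_lsl[OF W V d sT] by (elim exE conjE)
  have lc: "lsl \<sigma> V i (?s T) \<in> carrier V" for i by (rule lin_map_closed[OF lin_lsl[OF W V d] sT])
  have "T = ?t (\<Oplus>\<^bsub>tensor W V\<^esub>i\<in>F. tens W V (u i) (lsl \<sigma> V i (?s T)))"
    unfolding F(4)[symmetric] ts ..
  also have "\<dots> = (\<Oplus>\<^bsub>tensor V W\<^esub>i\<in>F. ?t (tens W V (u i) (lsl \<sigma> V i (?s T))))"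
    by (rule lin_map_finsum[OF tWV tVW lin_tswap[OF W V]]) (use F lc V W in \<open>auto intro!: tens_closed\<close>)
  also have "\<dots> = (\<Oplus>\<^bsub>tensor V W\<^esub>i\<in>F. tens V W (lsl \<sigma> V i (?s T)) (u i))"
    by (rule t.finsum_cong') (use F lc V W in \<open>auto intro!: tens_closed simp: tswap_tens image_subset_iff\<close>)
  finally have "T = (\<Oplus>\<^bsub>tensor V W\<^esub>i\<in>F. tens V W (rsl \<sigma> V i T) (u i))" by (simp only: rs)
  then show ?thesis
    by (intro exI[of _ F] conjI) (use F(1,2,3) in \<open>simp_all only: rs\<close>)
qed

text \<open>Both tensors are rebuilt from their slices over the union of their index sets. Slices
  thus separate tensors, which turns equations in \<open>V \<otimes> W\<close> into families of
  equations in \<open>W\<close>.\<close>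

lemma tensor_eq_lsl:
  fixes V :: "('k::field, 'v, 'x) module_scheme" and W :: "('k, 'w, 'y) module_scheme" and u :: "'i \<Rightarrow> 'v"
  assumes V: "vspace V" and W: "vspace W" and d: "dbasis V u \<sigma>"
    and S: "S \<in> carrier (tensor V W)" and T: "T \<in> carrier (tensor V W)"
    and eq: "\<And>i. lsl \<sigma> W i S = lsl \<sigma> W i T"
  shows "S = T"
proof -
  obtain F where F: "finite F" "u ` F \<subseteq> carrier V" "\<forall>F'. finite F' \<longrightarrow> F \<subseteq> F' \<longrightarrow> u ` F' \<subseteq> carrier V \<longrightarrow> S = (\<Oplus>\<^bsub>tensor V W\<^esub>i\<in>F'. tens V W (u i) (lsl \<sigma> W i S))"
    using tensor_lsl_aux[OF V W d S] by (elim exE conjE)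
  obtain G where G: "finite G" "u ` G \<subseteq> carrier V" "\<forall>F'. finite F' \<longrightarrow> G \<subseteq> F' \<longrightarrow> u ` F' \<subseteq> carrier V \<longrightarrow> T = (\<Oplus>\<^bsub>tensor V W\<^esub>i\<in>F'. tens V W (u i) (lsl \<sigma> W i T))"
    using tensor_lsl_aux[OF V W d T] by (elim exE conjE)
  have "S = (\<Oplus>\<^bsub>tensor V W\<^esub>i\<in>F\<union>G. tens V W (u i) (lsl \<sigma> W i S))"
    by (rule F(3)[rule_format]) (use F G in auto)
  also have "\<dots> = (\<Oplus>\<^bsub>tensor V W\<^esub>i\<in>F\<union>G. tens V W (u i) (lsl \<sigma> W i T))" by (simp only: eq)
  also have "\<dots> = T"
    by (rule G(3)[rule_format, symmetric]) (use F G in auto)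
  finally show ?thesis .
qed

lemma tensor_eq_rsl:
  fixes V :: "('k::field, 'v, 'x) module_scheme" and W :: "('k, 'w, 'y) module_scheme" and u :: "'i \<Rightarrow> 'w"
  assumes V: "vspace V" and W: "vspace W" and d: "dbasis W u \<sigma>"
    and S: "S \<in> carrier (tensor V W)" and T: "T \<in> carrier (tensor V W)"
    and eq: "\<And>i. rsl \<sigma> V i S = rsl \<sigma> V i T"
  shows "S = T"
proof -
  let ?s = "tlift (tensor W V) (\<lambda>v w. tens W V w v)" and ?t = "tlift (tensor V W) (\<lambda>w v. tens V W v w)"
  have ts: "?t (?s T) = T" if "T \<in> carrier (tensor V W)" for T
    by (rule tensor_lin_eqI[OF V W vspace_tensor[OF V W] lin_map_comp[OF lin_tswap[OF V W] lin_tswap[OF W V]] lin_map_id _ that])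
      (use V W in \<open>auto simp: tswap_tens\<close>)
  have rs: "rsl \<sigma> V i T = lsl \<sigma> V i (?s T)" if "T \<in> carrier (tensor V W)" for i T
    by (rule tensor_lin_eqI[OF V W V lin_rsl[OF V W d] lin_map_comp[OF lin_tswap[OF V W] lin_lsl[OF W V d]] _ that])
      (use V W in \<open>auto simp: tswap_tens rsl_tens[OF V W d] lsl_tens[OF W V d]\<close>)
  have "?s S = ?s T"
    by (rule tensor_eq_lsl[OF W V d]) (use S T eq rs in \<open>auto intro: lin_map_closed[OF lin_tswap[OF V W]]\<close>)
  then show ?thesis using ts S T by metis
qed

text \<open>Contracting one factor commutes with a linear map on the other. With separation by
  slices, this is how statements about \<open>id \<otimes> f\<close> are reduced to statements about
  \<open>f\<close>.\<close>

lemma lsl_tmap: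
  assumes "vspace V" "vspace W" "vspace W'" "dbasis V u \<sigma>" "lin_map W W' f" "T \<in> carrier (tensor V W)"
  shows "lsl \<sigma> W' i (tmap V W' id f T) = f (lsl \<sigma> W i T)"
  by (rule tensor_lin_eqI[OF assms(1,2,3) lin_map_comp[OF lin_tmap lin_lsl] lin_map_comp[OF lin_lsl assms(5)] _ assms(6)])
    (use assms in \<open>auto simp: tmap_tens id_def lin_map_id lsl_tens lin_map_smult[OF assms(5)] lin_map_closed[OF assms(5)]\<close>)

lemma rsl_tmap:
  assumes "vspace V" "vspace W" "vspace V'" "dbasis W u \<sigma>" "lin_map V V' f" "T \<in> carrier (tensor V W)"
  shows "rsl \<sigma> V' i (tmap V' W f id T) = f (rsl \<sigma> V i T)"
  by (rule tensor_lin_eqI[OF assms(1,2,3) lin_map_comp[OF lin_tmap lin_rsl] lin_map_comp[OF lin_rsl assms(5)] _ assms(6)])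
    (use assms in \<open>auto simp: tmap_tens id_def lin_map_id rsl_tens lin_map_smult[OF assms(5)] lin_map_closed[OF assms(5)]\<close>)

section \<open>Subspaces\<close>

definition lsubspace :: "'v set \<Rightarrow> ('k::field, 'v, 'x) module_scheme \<Rightarrow> bool" where
  "lsubspace S V \<longleftrightarrow> S \<subseteq> carrier V \<and> \<zero>\<^bsub>V\<^esub> \<in> S \<and>
     (\<forall>v\<in>S. \<forall>w\<in>S. v \<oplus>\<^bsub>V\<^esub> w \<in> S) \<and> (\<forall>c. \<forall>v\<in>S. c \<odot>\<^bsub>V\<^esub> v \<in> S)"

lemma vspace_sub:
  fixes V :: "('k::field, 'v, 'x) module_scheme"
  assumes V: "vspace V" and S: "lsubspace S V"
  shows "vspace (V\<lparr>carrier := S\<rparr>)"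
proof -
  interpret V: abelian_group V by (rule vspace_abelian_group[OF V])
  have c: "v \<in> S \<Longrightarrow> v \<in> carrier V" for v using S by (auto simp: lsubspace_def)
  show ?thesis
  proof (rule vspaceI)
    show "abelian_group (V\<lparr>carrier := S\<rparr>)"
    proof (rule abelian_groupI)
      fix v assume v: "v \<in> carrier (V\<lparr>carrier := S\<rparr>)"
      have "\<ominus>\<^bsub>V\<^esub> v \<in> S" using S v V vs_minus[OF V, of v] by (auto simp: lsubspace_def)
      then show "\<exists>y\<in>carrier (V\<lparr>carrier := S\<rparr>). y \<oplus>\<^bsub>V\<lparr>carrier := S\<rparr>\<^esub> v = \<zero>\<^bsub>V\<lparr>carrier := S\<rparr>\<^esub>"
        using v c by (intro bexI[of _ "\<ominus>\<^bsub>V\<^esub> v"]) (auto simp: V.l_neg)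
    qed (use S c in \<open>auto simp: lsubspace_def V.a_ac\<close>)
  qed (use S c V in \<open>auto simp: lsubspace_def vs_smult_add_l vs_smult_add_r\<close>)
qed

lemma lin_incl: "lsubspace S V \<Longrightarrow> lin_map (V\<lparr>carrier := S\<rparr>) V id"
  by (rule lin_mapI) (auto simp: lsubspace_def)

text \<open>Exactness of \<open>V \<otimes> -\<close>: the slices of a tensor in
  \<open>V \<otimes> S\<close> and of its image in \<open>V \<otimes> W\<close> are the same
  elements, and slices separate.\<close>

lemma tensor_sub_inj:
  assumes V: "vspace V" and W: "vspace W" and S: "lsubspace S W"
    and T: "T \<in> carrier (tensor V (W\<lparr>carrier := S\<rparr>))" "T' \<in> carrier (tensor V (W\<lparr>carrier := S\<rparr>))"
    and eq: "tmap V W id id T = tmap V W id id T'"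
  shows "T = T'"
proof -
  obtain \<sigma> where d: "dbasis V (\<lambda>v. v) \<sigma>" using ex_dbasis[OF V] by blast
  show ?thesis
  proof (rule tensor_eq_lsl[OF V vspace_sub[OF W S] d T])
    fix i
    have "lsl \<sigma> W i (tmap V W id id T) = id (lsl \<sigma> (W\<lparr>carrier := S\<rparr>) i T)"
      "lsl \<sigma> W i (tmap V W id id T') = id (lsl \<sigma> (W\<lparr>carrier := S\<rparr>) i T')"
      using lsl_tmap[OF V vspace_sub[OF W S] W d lin_incl[OF S]] T by auto
    then show "lsl \<sigma> (W\<lparr>carrier := S\<rparr>) i T = lsl \<sigma> (W\<lparr>carrier := S\<rparr>) i T'" using eq by simp
  qed
qed

text \<open>Membership in the image of \<open>V \<otimes> S\<close> can be tested slice by slice,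
  because the expansion of \<open>T\<close> has its slices as right factors and may be read in
  \<open>V \<otimes> S\<close>. This is the step from equations over the coefficients to elements of
  \<open>B \<otimes> der(A)\<close>.\<close>

lemma tensor_sub_surj:
  assumes V: "vspace V" and W: "vspace W" and S: "lsubspace S W" and d: "dbasis V u \<sigma>"
    and T: "T \<in> carrier (tensor V W)" and sl: "\<And>i. lsl \<sigma> W i T \<in> S"
  shows "\<exists>T'\<in>carrier (tensor V (W\<lparr>carrier := S\<rparr>)). tmap V W id id T' = T"
proof -
  let ?W = "W\<lparr>carrier := S\<rparr>"
  note W' = vspace_sub[OF W S]
  interpret t: abelian_group "tensor V W" by (rule vspace_abelian_group[OF vspace_tensor[OF V W]])
  obtain F where F: "finite F" "u ` F \<subseteq> carrier V" "T = (\<Oplus>\<^bsub>tensor V W\<^esub>i\<in>F. tens V W (u i) (lsl \<sigma> W i T))"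
    using tensor_lsl[OF V W d T] by (elim exE conjE)
  have id: "lin_map V V id" by (simp add: id_def lin_map_id)
  define T' where "T' = (\<Oplus>\<^bsub>tensor V ?W\<^esub>i\<in>F. tens V ?W (u i) (lsl \<sigma> W i T))"
  have c: "(\<lambda>i. tens V ?W (u i) (lsl \<sigma> W i T)) \<in> F \<rightarrow> carrier (tensor V ?W)"
    using F sl by (auto intro!: tens_closed[OF V W'])
  have "tmap V W id id T' = (\<Oplus>\<^bsub>tensor V W\<^esub>i\<in>F. tmap V W id id (tens V ?W (u i) (lsl \<sigma> W i T)))"
    unfolding T'_def
    by (rule lin_map_finsum[OF vspace_tensor[OF V W'] vspace_tensor[OF V W] lin_tmap[OF V W' V W id lin_incl[OF S]] c])
  also have "\<dots> = (\<Oplus>\<^bsub>tensor V W\<^esub>i\<in>F. tens V W (u i) (lsl \<sigma> W i T))"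
  proof (rule t.finsum_cong')
    show "(\<lambda>i. tens V W (u i) (lsl \<sigma> W i T)) \<in> F \<rightarrow> carrier (tensor V W)"
      using F sl S by (auto intro!: tens_closed[OF V W] simp: lsubspace_def)
    show "tmap V W id id (tens V ?W (u i) (lsl \<sigma> W i T)) = tens V W (u i) (lsl \<sigma> W i T)" if "i \<in> F" for i
      using that F sl by (subst tmap_tens[OF V W' V W id lin_incl[OF S]]) auto
  qed simp
  also have "\<dots> = T" by (rule F(3)[symmetric])
  finally have "tmap V W id id T' = T" .
  moreover have "T' \<in> carrier (tensor V ?W)"
    unfolding T'_def using c by (rule vs_finsum_closed[OF vspace_tensor[OF V W']])
  ultimately show ?thesis by blast
qed

section \<open>Comodules over the torus as graded vector spaces\<close>

lemma abelian_group_cong: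
  assumes "carrier V = carrier V'" "zero V = zero V'" "add V = add V'" and "abelian_group V"
  shows "abelian_group V'"
proof -
  interpret V: abelian_group V by fact
  show ?thesis
  proof (rule abelian_groupI)
    fix x assume "x \<in> carrier V'"
    then have "\<ominus>\<^bsub>V\<^esub> x \<in> carrier V'" "(\<ominus>\<^bsub>V\<^esub> x) \<oplus>\<^bsub>V'\<^esub> x = \<zero>\<^bsub>V'\<^esub>"
      unfolding assms(1-3)[symmetric] by (simp_all add: V.l_neg)
    then show "\<exists>y\<in>carrier V'. y \<oplus>\<^bsub>V'\<^esub> x = \<zero>\<^bsub>V'\<^esub>" by blast
  qed (unfold assms(1-3)[symmetric], simp_all add: V.a_ac)
qed

lemma vspace_cong:
  assumes "carrier V = carrier V'" "zero V = zero V'" "add V = add V'" "smult V = smult V'"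
  shows "vspace V \<longleftrightarrow> vspace V'"
proof -
  have ab: "abelian_group V \<longleftrightarrow> abelian_group V'"
    using abelian_group_cong[of V V'] abelian_group_cong[of V' V] assms by metis
  show ?thesis
    unfolding Module.module_def module_axioms_def ab using assms by simp
qed

text \<open>The cosets are determined by the carriers, additions and scalar multiplications of the
  factors. Changing a coaction, a product or a unit therefore gives the same tensor product, not
  merely an isomorphic one.\<close>

lemma tensor_cong_r:
  assumes "carrier V = carrier V'" "add V = add V'" "smult V = smult V'"
  shows "tensor U V = tensor U V'" "tens U V = tens U V'"
proof -
  have "tensor_class U V = tensor_class U V'"
    unfolding tensor_class_def[abs_def] tensor_rels_def using assms by simp
  then show "tensor U V = tensor U V'" "tens U V = tens U V'"
    by (simp_all add: tensor_def tens_def[abs_def] assms)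
qed

lemma tensor_cong_l:
  assumes "carrier V = carrier V'" "add V = add V'" "smult V = smult V'"
  shows "tensor V U = tensor V' U" "tens V U = tens V' U"
proof -
  have "tensor_class V U = tensor_class V' U"
    unfolding tensor_class_def[abs_def] tensor_rels_def using assms by simp
  then show "tensor V U = tensor V' U" "tens V U = tens V' U"
    by (simp_all add: tensor_def tens_def[abs_def] assms)
qed

lemma tlift_cong:
  assumes "carrier Z = carrier Z'" "add Z = add Z'" "zero Z = zero Z'" "smult Z = smult Z'"
  shows "tlift Z = tlift Z'"
  by (intro ext) (simp add: tlift_def finsum_def finprod_def assms)

lemma lin_map_cong_spaces:
  assumes "carrier V = carrier V'" "add V = add V'" "smult V = smult V'"
    and "carrier W = carrier W'" "add W = add W'" "smult W = smult W'"
  shows "lin_map V W f \<longleftrightarrow> lin_map V' W' f"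
  by (simp add: lin_map_def assms)

lemma add_coact_fields [simp]:
  "carrier (add_coact V \<rho>) = carrier V" "zero (add_coact V \<rho>) = zero V" "add (add_coact V \<rho>) = add V"
  "smult (add_coact V \<rho>) = smult V" "coact (add_coact V \<rho>) = \<rho>" "mult (add_coact V \<rho>) = mult V"
  "one (add_coact V \<rho>) = one V"
  by (simp_all add: add_coact_def)

lemma finsum_cong_spaces:
  assumes "carrier V = carrier V'" "add V = add V'" "zero V = zero V'"
  shows "finsum V = finsum V'"
  by (intro ext) (simp add: finsum_def finprod_def assms)

lemma add_coact_simps [simp]:
  "vspace (add_coact V \<rho>) \<longleftrightarrow> vspace V"
  "tensor U (add_coact V \<rho>) = tensor U V" "tens U (add_coact V \<rho>) = tens U V"
  "tensor (add_coact V \<rho>) W = tensor V W" "tens (add_coact V \<rho>) W = tens V W"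
  "lin_map (add_coact V \<rho>) X f \<longleftrightarrow> lin_map V X f" "lin_map Y (add_coact V \<rho>) g \<longleftrightarrow> lin_map Y V g"
  "finsum (add_coact V \<rho>) = finsum V" "tlift (add_coact V \<rho>) = tlift V"
  by (rule vspace_cong tensor_cong_r tensor_cong_l lin_map_cong_spaces finsum_cong_spaces tlift_cong; simp)+

section \<open>The torus Hopf algebra on its group-like basis\<close>

lemma HT_simps [simp]:
  "carrier HT = UNIV" "zero HT = 0" "add HT = (+)" "smult HT = psmult" "mult HT = (*)" "one HT = 1"
  by (simp_all add: HT_def)

lemma vspace_HT: "vspace (HT :: ('k::field, ('k, 'n::finite) torus) module)"
proof (rule vspaceI)
  show "abelian_group (HT :: ('k, ('k, 'n) torus) module)"
  proof (rule abelian_groupI)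
    fix x :: "('k, 'n) torus"
    show "\<exists>y\<in>carrier HT. y \<oplus>\<^bsub>HT\<^esub> x = \<zero>\<^bsub>HT\<^esub>" by (rule bexI[of _ "- x"]) auto
  qed (auto simp: algebra_simps)
qed (auto simp: psm.scale_left_distrib psm.scale_right_distrib)

lemma finsum_HT: "finite F \<Longrightarrow> finsum HT f F = sum f F"
proof (induction F rule: finite_induct)
  case empty
  interpret abelian_group HT by (rule vspace_abelian_group[OF vspace_HT])
  show ?case by simp
next
  case (insert x F)
  interpret abelian_group HT by (rule vspace_abelian_group[OF vspace_HT])
  show ?case using insert by (subst finsum_insert) auto
qed

text \<open>An element of the group algebra is its own coefficient function, so the left slice at
  \<open>m\<close> of a tensor over \<open>HT\<close> is the coefficient of
  \<open>t_m\<close>.\<close>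

lemma dbasis_HT: "dbasis HT tbasis (\<lambda>h :: ('k::field, 'n::finite) torus. h)"
proof -
  have "fsum HT tbasis h = h" for h :: "('k, 'n) torus"
    unfolding fsum_def
    by (subst finsum_HT) (simp_all add: tbasis_def poly_mapping_single_sum[of h, symmetric])
  then show ?thesis by (auto simp: dbasis_def)
qed

lemma HT_lin_eqI:
  fixes f :: "('k::field, 'n::finite) torus \<Rightarrow> 'z"
  assumes "vspace Z" "lin_map HT Z f" "lin_map HT Z g" "\<And>m. f (tbasis m) = g (tbasis m)"
  shows "f h = g h"
proof -
  have e: "h = (\<Oplus>\<^bsub>HT\<^esub>m\<in>Poly_Mapping.keys h. Poly_Mapping.lookup h m \<odot>\<^bsub>HT\<^esub> tbasis m)"
  proof -
    have "dbasis HT tbasis (\<lambda>h :: ('k, 'n) torus. h)" by (rule dbasis_HT)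
    then show ?thesis by (simp add: dbasis_def fsum_def)
  qed
  have "f h = (\<Oplus>\<^bsub>Z\<^esub>m\<in>Poly_Mapping.keys h. f (Poly_Mapping.lookup h m \<odot>\<^bsub>HT\<^esub> tbasis m))"
    by (subst e, subst lin_map_finsum[OF vspace_HT assms(1,2)]) auto
  also have "\<dots> = (\<Oplus>\<^bsub>Z\<^esub>m\<in>Poly_Mapping.keys h. g (Poly_Mapping.lookup h m \<odot>\<^bsub>HT\<^esub> tbasis m))"
    using lin_map_smult[OF assms(2), of "tbasis _"] lin_map_smult[OF assms(3), of "tbasis _"] assms(4) by auto
  also have "\<dots> = g h"
    by (subst (2) e, subst lin_map_finsum[OF vspace_HT assms(1,3)]) auto
  finally show ?thesis .
qed

lemma lin_counit: "lin_map HT base_field (counit :: ('k::field, 'n::finite) torus \<Rightarrow> 'k)"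
proof -
  have g: "(\<lambda>_ :: int ^ 'n. 1 :: 'k) \<in> UNIV \<rightarrow> carrier base_field" by auto
  have "counit h = fsum base_field (\<lambda>_. 1) h" for h :: "('k, 'n) torus"
  proof -
    interpret b: abelian_group base_field by (rule vspace_abelian_group[OF vspace_base_field])
    have "finite F \<Longrightarrow> (\<Oplus>\<^bsub>base_field\<^esub>i\<in>F. f i) = sum f F" for F and f :: "(int ^ 'n) \<Rightarrow> 'k"
      by (induction F rule: finite_induct) auto
    then show ?thesis by (simp add: counit_def fsum_def)
  qed
  then show ?thesis
    using fsum_add[OF vspace_base_field g] fsum_psmult[OF vspace_base_field g]
    by (intro lin_mapI) auto
qed

lemma counit_tbasis [simp]: "counit (tbasis m) = 1"
  by (simp add: counit_def tbasis_def)

lemma lin_comult: "lin_map HT (tensor HT HT) (comult :: ('k::field, 'n::finite) torus \<Rightarrow> _)"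
proof -
  note t = vspace_tensor[OF vspace_HT vspace_HT]
  let ?g = "\<lambda>m :: int ^ 'n. tens HT HT (tbasis m :: ('k, 'n) torus) (tbasis m :: ('k, 'n) torus)"
  have g: "?g \<in> UNIV \<rightarrow> carrier (tensor HT HT)"
    using tens_closed[OF vspace_HT vspace_HT] by auto
  have "comult h = fsum (tensor HT HT) ?g h" for h :: "('k, 'n) torus"
    by (simp add: comult_def fsum_def)
  then show ?thesis
    using fsum_add[OF t g] fsum_psmult[OF t g] fsum_closed[OF t g]
    by (intro lin_mapI) auto
qed

lemma comult_tbasis: "comult (tbasis m :: ('k::field, 'n::finite) torus) = tens HT HT (tbasis m) (tbasis m)"
proof -
  note t = vspace_tensor[OF vspace_HT vspace_HT]
  interpret t: abelian_group "tensor (HT :: ('k, ('k, 'n) torus) module) (HT :: ('k, ('k, 'n) torus) module)"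
    by (rule vspace_abelian_group[OF t])
  show ?thesis
    by (simp add: comult_def tbasis_def t tens_closed[OF vspace_HT vspace_HT])
qed

section \<open>Homogeneous elements and projections onto degrees\<close>

definition homog :: "('k::field, 'n::finite, 'v) hobj \<Rightarrow> int ^ 'n \<Rightarrow> 'v \<Rightarrow> bool" where
  "homog V m v \<longleftrightarrow> v \<in> carrier V \<and> coact V v = tens HT V (tbasis m) v"

text \<open>Nonempty sums of elements of \<open>G\<close>, without scalars: sets of homogeneous
  elements absorb scalars anyway, and the induction rule stays short. As the empty sum is absent,
  zero is often inserted into \<open>G\<close>.\<close>

inductive_set aspan :: "('k, 'v, 'x) module_scheme \<Rightarrow> 'v set \<Rightarrow> 'v set"
  for V :: "('k, 'v, 'x) module_scheme" and G :: "'v set" where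
  base: "g \<in> G \<Longrightarrow> g \<in> aspan V G"
| add: "v \<in> aspan V G \<Longrightarrow> w \<in> aspan V G \<Longrightarrow> v \<oplus>\<^bsub>V\<^esub> w \<in> aspan V G"

lemma aspan_mono: "G \<subseteq> G' \<Longrightarrow> aspan V G \<subseteq> aspan V G'"
proof
  fix v assume "G \<subseteq> G'" "v \<in> aspan V G"
  from this(2,1) show "v \<in> aspan V G'"
    by (induction) (auto intro: aspan.intros)
qed

lemma aspan_closed:
  assumes "vspace V" "G \<subseteq> carrier V" "v \<in> aspan V G"
  shows "v \<in> carrier V"
  using assms(3) by induction (use assms in auto)

text \<open>A grading expressed through the coaction. Coassociativity and counitality are encoded by
  the spanning condition, since both hold on homogeneous elements.\<close>

definition gr :: "('k::field, 'n::finite, 'v) hobj \<Rightarrow> bool" where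
  "gr V \<longleftrightarrow> vspace V \<and> lin_map V (tensor HT V) (coact V) \<and> carrier V \<subseteq> aspan V {v. \<exists>m. homog V m v}"

lemma gr_vspace: "gr V \<Longrightarrow> vspace V"
  and gr_coact: "gr V \<Longrightarrow> lin_map V (tensor HT V) (coact V)"
  by (auto simp: gr_def)

lemma homog_closed: "homog V m v \<Longrightarrow> v \<in> carrier V"
  by (simp add: homog_def)

lemma gr_induct [consumes 2, case_names homog add]:
  assumes "gr V" "v \<in> carrier V"
    and "\<And>m v. homog V m v \<Longrightarrow> P v"
    and "\<And>v w. v \<in> carrier V \<Longrightarrow> w \<in> carrier V \<Longrightarrow> P v \<Longrightarrow> P w \<Longrightarrow> P (v \<oplus>\<^bsub>V\<^esub> w)"
  shows "P v"
proof -
  have "v \<in> aspan V {v. \<exists>m. homog V m v}" using assms by (auto simp: gr_def)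
  then have "v \<in> carrier V \<and> P v"
  proof induction
    case (base g) then show ?case using assms(3) by (auto simp: homog_closed)
  next
    case (add v w) then show ?case using assms(1,4) by (auto simp: gr_vspace)
  qed
  then show ?thesis by simp
qed

lemma grI:
  assumes "vspace V" "lin_map V (tensor HT V) (coact V)"
    and "carrier V \<subseteq> aspan V (\<Union>m. G m)" "\<And>m g. g \<in> G m \<Longrightarrow> homog V m g"
  shows "gr V"
  using assms aspan_mono[of "\<Union>m. G m" "{v. \<exists>m. homog V m v}" V] by (fastforce simp: gr_def)

text \<open>The component of degree \<open>m\<close>.\<close>

definition hpr :: "('k::field, 'n::finite, 'v) hobj \<Rightarrow> int ^ 'n \<Rightarrow> 'v \<Rightarrow> 'v" where
  "hpr V m v = lsl (\<lambda>h. h) V m (coact V v)"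

lemma tlift_homog:
  assumes "vspace V" "vspace Z" "bilin HT V Z \<beta>" "homog V m v"
  shows "tlift Z \<beta> (coact V v) = \<beta> (tbasis m) v"
  using assms tlift_tens[OF vspace_HT assms(1,2,3)] by (simp add: homog_def)

context
  fixes V :: "('k::field, 'n::finite, 'v) hobj"
  assumes V: "gr V"
begin

lemma lin_hpr: "lin_map V V (hpr V m)"
  unfolding hpr_def
  by (rule lin_map_comp[OF gr_coact[OF V] lin_lsl[OF vspace_HT gr_vspace[OF V] dbasis_HT]])

lemma hpr_closed: "v \<in> carrier V \<Longrightarrow> hpr V m v \<in> carrier V"
  by (rule lin_map_closed[OF lin_hpr])

lemma hpr_homog: "homog V n v \<Longrightarrow> hpr V m v = (if m = n then v else \<zero>\<^bsub>V\<^esub>)"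
  using lsl_tens[OF vspace_HT gr_vspace[OF V] dbasis_HT, of "tbasis n" v m] gr_vspace[OF V]
  by (auto simp: hpr_def homog_def tbasis_def lookup_single when_def)

lemma homog_zero: "homog V m \<zero>\<^bsub>V\<^esub>"
  using lin_map_zero[OF gr_vspace[OF V] vspace_tensor[OF vspace_HT gr_vspace[OF V]] gr_coact[OF V]]
    tens_zero_r[OF vspace_HT gr_vspace[OF V], of "tbasis m"] gr_vspace[OF V]
  by (simp add: homog_def)

lemma homog_add: "homog V m v \<Longrightarrow> homog V m w \<Longrightarrow> homog V m (v \<oplus>\<^bsub>V\<^esub> w)"
  by (simp add: homog_def lin_map_add[OF gr_coact[OF V]] gr_vspace[OF V]
    lin_map_add[OF bilin_r[OF bilin_tens[OF vspace_HT gr_vspace[OF V]]]])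

lemma homog_smult: "homog V m v \<Longrightarrow> homog V m (c \<odot>\<^bsub>V\<^esub> v)"
  by (simp add: homog_def lin_map_smult[OF gr_coact[OF V]] gr_vspace[OF V]
    lin_map_smult[OF bilin_r[OF bilin_tens[OF vspace_HT gr_vspace[OF V]]]])

lemma homog_hpr: "v \<in> carrier V \<Longrightarrow> homog V m (hpr V m v)"
proof (induction rule: gr_induct[OF V, consumes 1, case_names homog add])
  case (homog n v)
  then show ?case by (simp add: hpr_homog homog_zero)
next
  case (add v w)
  then show ?case by (simp add: lin_map_add[OF lin_hpr] homog_add)
qed

lemma homog_iff_hpr: "homog V m v \<longleftrightarrow> v \<in> carrier V \<and> hpr V m v = v"
  using hpr_homog homog_hpr homog_closed by metis

text \<open>The counit recovers \<open>v\<close> from its coaction, and the coaction is the sum of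
  the \<open>t_m \<otimes> hpr V m v\<close>; applying the counit to each term leaves the
  components.\<close>

lemma hpr_expand:
  assumes v: "v \<in> carrier V"
  shows "\<exists>F. finite F \<and> (\<forall>m. m \<notin> F \<longrightarrow> hpr V m v = \<zero>\<^bsub>V\<^esub>) \<and> v = (\<Oplus>\<^bsub>V\<^esub>m\<in>F. hpr V m v)"
proof -
  note vV = gr_vspace[OF V]
  interpret V: abelian_group V by (rule vspace_abelian_group[OF vV])
  let ?c = "tlift V (\<lambda>h v. counit h \<odot>\<^bsub>V\<^esub> v)"
  have c: "bilin HT V V (\<lambda>h v. counit h \<odot>\<^bsub>V\<^esub> v)" by (rule bilin_scale[OF vV lin_counit])
  note lc = lin_tlift[OF vspace_HT vV vV c]
  have cv: "?c (coact V w) = w" if "w \<in> carrier V" for w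
    using that
  proof (induction rule: gr_induct[OF V, consumes 1, case_names homog add])
    case (homog m w)
    then show ?case using vV by (simp add: tlift_homog[OF vV vV c] homog_closed)
  next
    case (add v w)
    then show ?case using lin_map_add[OF lin_map_comp[OF gr_coact[OF V] lc]] by simp
  qed
  have t: "coact V v \<in> carrier (tensor HT V)" using v by (rule lin_map_closed[OF gr_coact[OF V]])
  obtain F where F: "finite F" "\<forall>m. m \<notin> F \<longrightarrow> hpr V m v = \<zero>\<^bsub>V\<^esub>"
    "coact V v = (\<Oplus>\<^bsub>tensor HT V\<^esub>m\<in>F. tens HT V (tbasis m) (hpr V m v))"
    using tensor_lsl[OF vspace_HT vV dbasis_HT t] unfolding hpr_def by (elim exE conjE)
  have "v = ?c (\<Oplus>\<^bsub>tensor HT V\<^esub>m\<in>F. tens HT V (tbasis m) (hpr V m v))"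
    using cv[OF v] unfolding F(3)[symmetric] by simp
  also have "\<dots> = (\<Oplus>\<^bsub>V\<^esub>m\<in>F. ?c (tens HT V (tbasis m) (hpr V m v)))"
    by (rule lin_map_finsum[OF vspace_tensor[OF vspace_HT vV] vV lc])
      (use v in \<open>auto intro!: tens_closed[OF vspace_HT vV] hpr_closed\<close>)
  also have "\<dots> = (\<Oplus>\<^bsub>V\<^esub>m\<in>F. hpr V m v)"
    by (rule V.finsum_cong')
      (use v hpr_closed vV in \<open>auto simp: tlift_tens[OF vspace_HT vV vV c]\<close>)
  finally have "v = (\<Oplus>\<^bsub>V\<^esub>m\<in>F. hpr V m v)" .
  then show ?thesis by (intro exI[of _ F] conjI) (use F in simp_all)
qed

end

lemma coinv_homog: "coinv V = {v. homog V 0 v}"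
  by (auto simp: coinv_def homog_def tbasis_def)

text \<open>A map that shifts all degrees by \<open>n\<close> commutes with the projections up to
  this shift. Used to show that ideals and kernels are graded and to pass to components of degree
  0.\<close>

lemma hpr_map:
  assumes V: "gr V" and W: "gr W" and f: "lin_map V W f"
    and h: "\<And>m v. homog V m v \<Longrightarrow> homog W (m + n) (f v)" and v: "v \<in> carrier V"
  shows "f (hpr V m v) = hpr W (m + n) (f v)"
  using v
proof (induction rule: gr_induct[OF V, consumes 1, case_names homog add])
  case (homog k v)
  then show ?case
    using lin_map_zero[OF gr_vspace[OF V] gr_vspace[OF W] f] h[OF homog]
    by (simp add: hpr_homog[OF V] hpr_homog[OF W])
next
  case (add v w)
  then show ?case
    using lin_map_closed[OF f] hpr_closed[OF V]
    by (simp add: lin_map_add[OF lin_hpr[OF V]] lin_map_add[OF lin_hpr[OF W]] lin_map_add[OF f])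
qed

text \<open>Projecting a sum of homogeneous generators to degree \<open>m\<close> keeps the
  generators of degree \<open>m\<close> and turns the others into zero, hence the inserted
  zero.\<close>

lemma homog_aspan:
  assumes V: "gr V" and G: "carrier V \<subseteq> aspan V (\<Union>m. G m)" "\<And>m g. g \<in> G m \<Longrightarrow> homog V m g"
    and v: "homog V m v"
  shows "v \<in> aspan V (insert \<zero>\<^bsub>V\<^esub> (G m))"
proof -
  have "v \<in> aspan V (\<Union>m. G m)" using homog_closed[OF v] G(1) by (rule subsetD[rotated])
  then have "v \<in> carrier V \<and> hpr V m v \<in> aspan V (insert \<zero>\<^bsub>V\<^esub> (G m))"
  proof induction
    case (base g)
    then obtain n where n: "g \<in> G n" by blast
    then have "homog V n g" by (rule G)
    then show ?case using n by (auto simp: hpr_homog[OF V] homog_closed intro: aspan.base)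
  next
    case (add v w)
    then show ?case using gr_vspace[OF V] by (auto simp: lin_map_add[OF lin_hpr[OF V]] intro: aspan.add)
  qed
  then show ?thesis using v by (simp add: homog_iff_hpr[OF V])
qed

lemma bilin_tassoc:
  assumes "vspace U" "vspace V" "vspace W"
  shows "bilin (tensor U V) W (tensor U (tensor V W))
    (\<lambda>T w. tlift (tensor U (tensor V W)) (\<lambda>u v. tens U (tensor V W) u (tens V W v w)) T)"
proof -
  have b: "bilin U V (tensor U (tensor V W)) (\<lambda>u v. tens U (tensor V W) u (tens V W v w))"
    if "w \<in> carrier W" for w
    using that assms bilin_comp[OF bilin_tens[OF assms(1) vspace_tensor[OF assms(2,3)]] lin_map_id bilin_l[OF bilin_tens[OF assms(2,3)]]]
    by auto
  note t = vspace_tensor[OF assms(1) vspace_tensor[OF assms(2,3)]]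
  show ?thesis
  proof (rule bilinI)
    show "lin_map (tensor U V) (tensor U (tensor V W)) (\<lambda>T. tlift (tensor U (tensor V W)) (\<lambda>u v. tens U (tensor V W) u (tens V W v w)) T)"
      if "w \<in> carrier W" for w
      by (rule lin_tlift[OF assms(1,2) t b[OF that]])
    show "lin_map W (tensor U (tensor V W)) (\<lambda>w. tlift (tensor U (tensor V W)) (\<lambda>u v. tens U (tensor V W) u (tens V W v w)) T)"
      if "T \<in> carrier (tensor U V)" for T
      by (rule lin_tlift_param[OF assms(1,2) t that b _ assms(3)])
        (auto intro: lin_bilin_r[OF bilin_tens[OF assms(1) vspace_tensor[OF assms(2,3)]] bilin_r[OF bilin_tens[OF assms(2,3)]]])
  qed
qed

text \<open>Coassociativity says that the coefficient of \<open>t_m\<close> in the coaction of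
  \<open>v\<close> is homogeneous of degree \<open>m\<close>; counitality says that \<open>v\<close>
  is the sum of these coefficients.\<close>

lemma hcomodule_gr:
  fixes V :: "('k::field, 'n::finite, 'v) hobj"
  assumes "hcomodule V"
  shows "gr V"
proof -
  have V: "vspace V" and co: "lin_map V (tensor HT V) (coact V)"
    and ass: "\<And>v. v \<in> carrier V \<Longrightarrow> tmap HT (tensor HT V) id (coact V) (coact V v) =
        tassoc HT HT V (tmap (tensor HT HT) V comult id (coact V v))"
    and cou: "\<And>v. v \<in> carrier V \<Longrightarrow> tlift V (\<lambda>h v0. counit h \<odot>\<^bsub>V\<^esub> v0) (coact V v) = v"
    using assms by (auto simp: hcomodule_def)
  interpret V: abelian_group V by (rule vspace_abelian_group[OF V])
  note tV = vspace_tensor[OF vspace_HT V] and tt = vspace_tensor[OF vspace_HT vspace_HT]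
  note tV' = vspace_tensor[OF vspace_HT tV]
  let ?l = "\<lambda>m. lsl (\<lambda>h :: ('k, 'n) torus. h) V m"
  have id: "lin_map HT HT id" "lin_map V V id" by (simp_all add: id_def lin_map_id)
  have lin1: "lin_map (tensor HT V) (tensor HT (tensor HT V)) (\<lambda>\<tau> :: ((('k, 'n) torus \<times> 'v) \<Rightarrow>\<^sub>0 'k) set. tassoc HT HT V (tmap (tensor HT HT) V comult id \<tau>))"
    unfolding tassoc_def
    by (rule lin_map_comp[OF lin_tmap[OF vspace_HT V tt V lin_comult id(2)]
          lin_tlift[OF tt V tV' bilin_tassoc[OF vspace_HT vspace_HT V]]])
  \<comment> \<open>The coefficient of \<open>t_m\<close> in the first leg of
    \<open>(\<Delta> \<otimes> id) \<tau>\<close>. As \<open>t_n\<close> is group-like, the second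
    leg must carry the same \<open>t_m\<close>.\<close>
  have key: "lsl (\<lambda>h. h) (tensor HT V) m (tassoc HT HT V (tmap (tensor HT HT) V comult id \<tau>)) =
     tens HT V (tbasis m) (?l m \<tau>)" if "\<tau> \<in> carrier (tensor HT V)" for m and \<tau> :: "((('k, 'n) torus \<times> 'v) \<Rightarrow>\<^sub>0 'k) set"
  proof (rule tensor_lin_eqI[OF vspace_HT V tV _ _ _ that])
    let ?f = "\<lambda>\<tau> :: ((('k, 'n) torus \<times> 'v) \<Rightarrow>\<^sub>0 'k) set. lsl (\<lambda>h. h) (tensor HT V) m (tassoc HT HT V (tmap (tensor HT HT) V comult id \<tau>))"
    let ?g = "\<lambda>\<tau> :: ((('k, 'n) torus \<times> 'v) \<Rightarrow>\<^sub>0 'k) set. tens HT V (tbasis m) (?l m \<tau>)"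
    show f: "lin_map (tensor HT V) (tensor HT V) ?f"
      by (rule lin_map_comp[OF lin1 lin_lsl[OF vspace_HT tV dbasis_HT]])
    show g: "lin_map (tensor HT V) (tensor HT V) ?g"
      by (rule lin_bilin_r[OF bilin_tens[OF vspace_HT V] lin_lsl[OF vspace_HT V dbasis_HT]]) simp
    fix h :: "('k, 'n) torus" and v assume v: "v \<in> carrier V"
    note bl = bilin_l[OF bilin_tens[OF vspace_HT V] v]
    show "?f (tens HT V h v) = ?g (tens HT V h v)"
    proof (rule HT_lin_eqI[OF tV lin_map_comp[OF bl f] lin_map_comp[OF bl g]])
      fix n :: "int ^ 'n"
      have 1: "tmap (tensor HT HT) V comult id (tens HT V (tbasis n) v) = tens (tensor HT HT) V (tens HT HT (tbasis n) (tbasis n)) v"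
        using v by (simp add: tmap_tens[OF vspace_HT V tt V lin_comult id(2)] comult_tbasis)
      have bl2: "bilin HT HT (tensor HT (tensor HT V)) (\<lambda>u v'. tens HT (tensor HT V) u (tens HT V v' v))"
        by (rule bilin_comp[OF bilin_tens[OF vspace_HT tV] lin_map_id bl])
      have 2: "tassoc HT HT V (tens (tensor HT HT) V (tens HT HT (tbasis n) (tbasis n)) v) =
          tens HT (tensor HT V) (tbasis n) (tens HT V (tbasis n) v)"
        unfolding tassoc_def using v
        by (simp add: tlift_tens[OF tt V tV' bilin_tassoc[OF vspace_HT vspace_HT V]] tens_closed[OF vspace_HT vspace_HT]
            tlift_tens[OF vspace_HT vspace_HT tV' bl2])
      show "?f (tens HT V (tbasis n) v) = ?g (tens HT V (tbasis n) v)"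
        unfolding 1 2 using v V
        by (simp add: tV lsl_tens[OF vspace_HT tV dbasis_HT] lsl_tens[OF vspace_HT V dbasis_HT] tens_closed[OF vspace_HT V]
            tbasis_def lookup_single when_def tens_zero_r[OF vspace_HT V])
    qed
  qed
  have hom: "homog V m (?l m (coact V v))" if v: "v \<in> carrier V" for m v
  proof -
    have cv: "coact V v \<in> carrier (tensor HT V)" using v by (rule lin_map_closed[OF co])
    have "coact V (?l m (coact V v)) = lsl (\<lambda>h. h) (tensor HT V) m (tmap HT (tensor HT V) id (coact V) (coact V v))"
      using lsl_tmap[OF vspace_HT V tV dbasis_HT co cv] by simp
    also have "\<dots> = tens HT V (tbasis m) (?l m (coact V v))"
      unfolding ass[OF v] by (rule key[OF cv])
    finally show ?thesis
      using lin_map_closed[OF lin_lsl[OF vspace_HT V dbasis_HT] cv] by (simp add: homog_def)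
  qed
  have zero: "homog V 0 \<zero>\<^bsub>V\<^esub>"
    using lin_map_zero[OF V tV co] V by (simp add: homog_def tens_zero_r[OF vspace_HT V])
  show ?thesis
    unfolding gr_def
  proof (intro conjI subsetI)
    fix v assume v: "v \<in> carrier V"
    have t: "coact V v \<in> carrier (tensor HT V)" using v by (rule lin_map_closed[OF co])
    obtain F where F: "finite F"
      "coact V v = (\<Oplus>\<^bsub>tensor HT V\<^esub>m\<in>F. tens HT V (tbasis m) (?l m (coact V v)))"
      using tensor_lsl[OF vspace_HT V dbasis_HT t] by (elim exE conjE)
    let ?c = "tlift V (\<lambda>h v. counit h \<odot>\<^bsub>V\<^esub> v)"
    have c: "bilin HT V V (\<lambda>h v. counit h \<odot>\<^bsub>V\<^esub> v)" by (rule bilin_scale[OF V lin_counit])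
    have lv: "?l m (coact V v) \<in> carrier V" for m by (rule homog_closed[OF hom[OF v]])
    have "v = ?c (\<Oplus>\<^bsub>tensor HT V\<^esub>m\<in>F. tens HT V (tbasis m) (?l m (coact V v)))"
      using cou[OF v] unfolding F(2)[symmetric] by simp
    also have "\<dots> = (\<Oplus>\<^bsub>V\<^esub>m\<in>F. ?c (tens HT V (tbasis m) (?l m (coact V v))))"
      by (rule lin_map_finsum[OF tV V lin_tlift[OF vspace_HT V V c]])
        (use lv in \<open>auto intro!: tens_closed[OF vspace_HT V]\<close>)
    also have "\<dots> = (\<Oplus>\<^bsub>V\<^esub>m\<in>F. ?l m (coact V v))"
      by (rule V.finsum_cong') (use lv V in \<open>auto simp: tlift_tens[OF vspace_HT V V c]\<close>)
    finally have *: "v = (\<Oplus>\<^bsub>V\<^esub>m\<in>F. ?l m (coact V v))" .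
    have "(\<Oplus>\<^bsub>V\<^esub>m\<in>F. ?l m (coact V v)) \<in> aspan V {v. \<exists>m. homog V m v}"
      using F(1)
    proof (induction F rule: finite_induct)
      case empty
      then show ?case using zero by (auto intro: aspan.base)
    next
      case (insert m F)
      then show ?case using lv hom[OF v] by (subst V.finsum_insert) (auto intro!: aspan.add intro: aspan.base)
    qed
    with * show "v \<in> aspan V {v. \<exists>m. homog V m v}" by simp
  qed (use V co in auto)
qed

lemma tmap_add_coact [simp]: "tmap V (add_coact U \<rho>) f g = tmap V U f g"
  by (simp add: tmap_def)

lemma tbasis_0: "tbasis 0 = 1"
  by (simp add: tbasis_def)

lemma tbasis_mult: "tbasis m * tbasis n = tbasis (m + n)"
  by (simp add: tbasis_def mult_single)

section \<open>The bicharacter of a cotriangular structure\<close>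

definition bch :: "(('k::field, 'n::finite) torus2 \<Rightarrow> 'k) \<Rightarrow> int ^ 'n \<Rightarrow> int ^ 'n \<Rightarrow> 'k" where
  "bch R m n = R (tens HT HT (tbasis m) (tbasis n))"

context
  fixes R :: "('k::field, 'n::finite) torus2 \<Rightarrow> 'k"
  assumes R: "cotriangular R"
begin

lemma lin_R: "lin_map (tensor HT HT) base_field R"
  using R by (simp add: cotriangular_def)

text \<open>Basis vectors are group-like, so a Sweedler sum over their coproduct has one term. Each
  axiom of a cotriangular structure thereby becomes an identity between values of
  \<open>bch\<close>.\<close>

lemma tlift_comult:
  assumes "bilin HT HT base_field \<beta>"
  shows "tlift base_field \<beta> (comult (tbasis m :: ('k, 'n) torus)) = \<beta> (tbasis m) (tbasis m)"
  by (simp add: comult_tbasis tlift_tens[OF vspace_HT vspace_HT vspace_base_field assms])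

lemma bilin_R: "bilin HT HT base_field (\<lambda>h g. R (tens HT HT h g))"
  by (rule bilin_lin[OF bilin_tens[OF vspace_HT vspace_HT] lin_R])

lemma lin_R_l: "lin_map HT base_field (\<lambda>h. R (tens HT HT h g))"
  and lin_R_r: "lin_map HT base_field (\<lambda>g. R (tens HT HT h g))"
  using bilin_l[OF bilin_R] bilin_r[OF bilin_R] by auto

lemma bilin_R_mult:
  "lin_map HT base_field f \<Longrightarrow> lin_map HT base_field g \<Longrightarrow> bilin HT HT base_field (\<lambda>x y :: ('k, 'n) torus. f x * g y)"
  using bilin_comp[of base_field base_field base_field "(*)" HT f HT g]
  by (auto simp: bilin_def lin_map_def algebra_simps)

lemma bch_add_l: "bch R (m + n) l = bch R m l * bch R n l"
proof -
  have "R (tens HT HT (tbasis m * tbasis n) (tbasis l)) =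
      tlift base_field (\<lambda>h1 h2. R (tens HT HT (tbasis m) h1) * R (tens HT HT (tbasis n) h2)) (comult (tbasis l))"
    using R by (simp add: cotriangular_def)
  then show ?thesis
    by (simp add: tlift_comult[OF bilin_R_mult[OF lin_R_r lin_R_r]] bch_def tbasis_mult)
qed

lemma bch_add_r: "bch R l (m + n) = bch R l m * bch R l n"
proof -
  have "R (tens HT HT (tbasis l) (tbasis m * tbasis n)) =
      tlift base_field (\<lambda>f1 f2. R (tens HT HT f1 (tbasis n)) * R (tens HT HT f2 (tbasis m))) (comult (tbasis l))"
    using R by (simp add: cotriangular_def)
  then show ?thesis
    by (simp add: tlift_comult[OF bilin_R_mult[OF lin_R_l lin_R_l]] bch_def tbasis_mult mult.commute)
qed

lemma bch_swap: "bch R m n * bch R n m = 1"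
proof -
  have "counit (tbasis m :: ('k, 'n) torus) * counit (tbasis n :: ('k, 'n) torus) =
        tlift base_field (\<lambda>h1 h2. tlift base_field
          (\<lambda>g1 g2. R (tens HT HT h1 g1) * R (tens HT HT g2 h2)) (comult (tbasis n))) (comult (tbasis m))"
    using R unfolding cotriangular_def by blast
  also have "\<dots> = tlift base_field (\<lambda>h1 h2. R (tens HT HT h1 (tbasis n)) * R (tens HT HT (tbasis n) h2)) (comult (tbasis m))"
    by (simp add: tlift_comult[OF bilin_R_mult[OF lin_R_r lin_R_l]])
  also have "\<dots> = bch R m n * bch R n m"
    by (simp add: tlift_comult[OF bilin_R_mult[OF lin_R_l lin_R_r]] bch_def)
  finally show ?thesis by simp
qed

lemma bch_nz: "bch R m n \<noteq> 0"
  using bch_swap[of m n] by auto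

lemma bch_0_l: "bch R 0 n = 1"
  using bch_add_l[of 0 0 n] bch_nz[of 0 n] by simp

lemma bch_0_r: "bch R n 0 = 1"
  using bch_add_r[of n 0 0] bch_nz[of n 0] by simp

text \<open>Both \<open>bch R m (- n)\<close> and \<open>bch R n m\<close> are inverse to
  \<open>bch R m n\<close>, by the bicharacter property and by symmetry.\<close>

lemma bch_minus_r: "bch R m (- n) = bch R n m"
  using bch_add_r[of m n "- n"] bch_swap[of m n] bch_nz[of m n] by (metis bch_0_r add.right_inverse mult_left_cancel)

lemma bch_minus_l: "bch R (- m) n = bch R n m"
  using bch_add_l[of m "- m" n] bch_swap[of m n] bch_nz[of m n] by (metis bch_0_l add.right_inverse mult_left_cancel)

end

section \<open>Tensor products of comodules\<close>

text \<open>Coactions of tensor products, products in a coproduct of algebras and braided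
  commutativity are all double Sweedler sums of this shape. On homogeneous arguments such a sum
  collapses to the single term at \<open>t_m\<close> and \<open>t_n\<close>; bilinearity carries
  this over to arbitrary arguments.\<close>

lemma
  assumes V: "gr V" and W: "gr W" and Z: "vspace Z"
    and b1: "\<And>h v. v \<in> carrier V \<Longrightarrow> bilin HT W Z (\<beta> h v)"
    and b2: "\<And>g w. w \<in> carrier W \<Longrightarrow> bilin HT V Z (\<lambda>h v. \<beta> h v g w)"
  shows sweedler2_bilin: "bilin V W Z (\<lambda>v w. tlift Z (\<lambda>h v0. tlift Z (\<beta> h v0) (coact W w)) (coact V v))"
    and sweedler2_homog: "homog V m v \<Longrightarrow> homog W n w \<Longrightarrow>
      tlift Z (\<lambda>h v0. tlift Z (\<beta> h v0) (coact W w)) (coact V v) = \<beta> (tbasis m) v (tbasis n) w"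
proof -
  note vV = gr_vspace[OF V] and vW = gr_vspace[OF W]
  have c: "coact W w \<in> carrier (tensor HT W)" if "w \<in> carrier W" for w
    by (rule lin_map_closed[OF gr_coact[OF W] that])
  have b3: "bilin HT V Z (\<lambda>h v0. tlift Z (\<beta> h v0) T)" if T: "T \<in> carrier (tensor HT W)" for T
  proof (rule bilinI)
    show "lin_map V Z (\<lambda>v0. tlift Z (\<beta> h v0) T)" for h
      by (rule lin_tlift_param[OF vspace_HT vW Z T b1 bilin_r[OF b2] vV]) auto
    show "lin_map HT Z (\<lambda>h. tlift Z (\<beta> h v0) T)" if "v0 \<in> carrier V" for v0
      by (rule lin_tlift_param[OF vspace_HT vW Z T b1[OF that] bilin_l[OF b2 that] vspace_HT]) auto
  qed
  show "bilin V W Z (\<lambda>v w. tlift Z (\<lambda>h v0. tlift Z (\<beta> h v0) (coact W w)) (coact V v))"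
  proof (rule bilinI)
    show "lin_map V Z (\<lambda>v. tlift Z (\<lambda>h v0. tlift Z (\<beta> h v0) (coact W w)) (coact V v))" if "w \<in> carrier W" for w
      by (rule lin_map_comp[OF gr_coact[OF V] lin_tlift[OF vspace_HT vV Z b3[OF c[OF that]]]])
    show "lin_map W Z (\<lambda>w. tlift Z (\<lambda>h v0. tlift Z (\<beta> h v0) (coact W w)) (coact V v))" if v: "v \<in> carrier V" for v
      by (rule lin_tlift_param[OF vspace_HT vV Z lin_map_closed[OF gr_coact[OF V] v] b3[OF c] _ vW])
        (auto intro: lin_map_comp[OF gr_coact[OF W] lin_tlift[OF vspace_HT vW Z b1]])
  qed
  assume v: "homog V m v" and w: "homog W n w"
  show "tlift Z (\<lambda>h v0. tlift Z (\<beta> h v0) (coact W w)) (coact V v) = \<beta> (tbasis m) v (tbasis n) w"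
    using tlift_homog[OF vV Z b3[OF c[OF homog_closed[OF w]]] v] tlift_homog[OF vW Z b1[OF homog_closed[OF v]] w]
    by simp
qed

text \<open>Provides linearity in the outer factors of a product
  \<open>(a \<otimes> b)(a' \<otimes> b')\<close>, whose coactions are not involved in the
  sum.\<close>

lemma sweedler2_param:
  assumes V: "gr V" and W: "gr W" and Z: "vspace Z" and U: "vspace U"
    and b1: "\<And>u h v. u \<in> carrier U \<Longrightarrow> v \<in> carrier V \<Longrightarrow> bilin HT W Z (\<beta> u h v)"
    and b2: "\<And>u g w. u \<in> carrier U \<Longrightarrow> w \<in> carrier W \<Longrightarrow> bilin HT V Z (\<lambda>h v. \<beta> u h v g w)"
    and l: "\<And>h v g w. v \<in> carrier V \<Longrightarrow> w \<in> carrier W \<Longrightarrow> lin_map U Z (\<lambda>u. \<beta> u h v g w)"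
    and v: "v \<in> carrier V" and w: "w \<in> carrier W"
  shows "lin_map U Z (\<lambda>u. tlift Z (\<lambda>h v0. tlift Z (\<beta> u h v0) (coact W w)) (coact V v))"
proof -
  note vV = gr_vspace[OF V] and vW = gr_vspace[OF W]
  have cv: "coact V v \<in> carrier (tensor HT V)" and cw: "coact W w \<in> carrier (tensor HT W)"
    using lin_map_closed[OF gr_coact[OF V] v] lin_map_closed[OF gr_coact[OF W] w] .
  have b3: "bilin HT V Z (\<lambda>h v0. tlift Z (\<beta> u h v0) (coact W w))" if u: "u \<in> carrier U" for u
  proof (rule bilinI)
    show "lin_map V Z (\<lambda>v0. tlift Z (\<beta> u h v0) (coact W w))" for h
      by (rule lin_tlift_param[OF vspace_HT vW Z cw b1[OF u] bilin_r[OF b2[OF u]] vV]) auto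
    show "lin_map HT Z (\<lambda>h. tlift Z (\<beta> u h v0) (coact W w))" if "v0 \<in> carrier V" for v0
      by (rule lin_tlift_param[OF vspace_HT vW Z cw b1[OF u that] bilin_l[OF b2[OF u] that] vspace_HT]) auto
  qed
  show ?thesis
    by (rule lin_tlift_param[OF vspace_HT vV Z cv b3 _ U])
      (auto intro: lin_tlift_param[OF vspace_HT vW Z cw b1 l U])
qed

lemma lin_times_HT: "lin_map HT HT (\<lambda>g. h * g)" "lin_map HT HT (\<lambda>g. g * h)"
  for h :: "('k::field, 'n::finite) torus"
proof -
  have "psmult c x = Poly_Mapping.single 0 c * x" for c and x :: "('k, 'n) torus"
    unfolding psmult_def by (rule mult_map_scale_conv_mult)
  then show "lin_map HT HT (\<lambda>g. h * g)" "lin_map HT HT (\<lambda>g. g * h)"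
    by (auto simp: lin_map_def algebra_simps)
qed

lemma htensor_simps [simp]:
  "carrier (htensor V W) = carrier (tensor V W)" "zero (htensor V W) = zero (tensor V W)"
  "add (htensor V W) = add (tensor V W)" "smult (htensor V W) = smult (tensor V W)"
  "vspace (htensor V W) \<longleftrightarrow> vspace (tensor V W)"
  "tensor U (htensor V W) = tensor U (tensor V W)" "tens U (htensor V W) = tens U (tensor V W)"
  "lin_map (htensor V W) X f \<longleftrightarrow> lin_map (tensor V W) X f" "lin_map Y (htensor V W) g \<longleftrightarrow> lin_map Y (tensor V W) g"
  by (simp_all add: htensor_def)

section \<open>Degrees in a tensor product of comodules\<close>

definition tgen ::
  "('k::field, 'n::finite, 'v) hobj \<Rightarrow> ('k, 'n, 'w) hobj \<Rightarrow> int ^ 'n \<Rightarrow> (('v \<times> 'w) \<Rightarrow>\<^sub>0 'k) set set" where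
  "tgen V W l = {tens V W v w | v w m n. homog V m v \<and> homog W n w \<and> m + n = l}"

context
  fixes V :: "('k::field, 'n::finite, 'v) hobj" and W :: "('k, 'n, 'w) hobj"
  assumes V: "gr V" and W: "gr W"
begin

lemma htensor_coact:
  shows lin_htensor_coact: "lin_map (tensor V W) (tensor HT (tensor V W)) (coact (htensor V W))"
    and homog_tens: "homog V m v \<Longrightarrow> homog W n w \<Longrightarrow> homog (htensor V W) (m + n) (tens V W v w)"
proof -
  note vV = gr_vspace[OF V] and vW = gr_vspace[OF W]
  note t = vspace_tensor[OF vV vW] and bt = bilin_tens[OF vV vW]
  note tt = vspace_tensor[OF vspace_HT t] and btt = bilin_tens[OF vspace_HT t]
  let ?Z = "tensor HT (tensor V W)"
  let ?\<beta> = "\<lambda>h v0 g w0. tens HT (tensor V W) (h * g) (tens V W v0 w0)"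
  have b1: "bilin HT W ?Z (?\<beta> h v0)" if "v0 \<in> carrier V" for h v0
    by (rule bilin_comp[OF btt lin_times_HT(1) bilin_r[OF bt that]])
  have b2: "bilin HT V ?Z (\<lambda>h v. ?\<beta> h v g w)" if "w \<in> carrier W" for g w
    by (rule bilin_comp[OF btt lin_times_HT(2) bilin_l[OF bt that]])
  note b = sweedler2_bilin[OF V W tt b1 b2]
  show "lin_map (tensor V W) ?Z (coact (htensor V W))"
    unfolding htensor_def add_coact_fields by (rule lin_tlift[OF vV vW tt b])
  assume v: "homog V m v" and w: "homog W n w"
  show "homog (htensor V W) (m + n) (tens V W v w)"
    using tlift_tens[OF vV vW tt b homog_closed[OF v] homog_closed[OF w]]
      sweedler2_homog[OF V W tt b1 b2 v w]
    unfolding homog_def htensor_def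
    by (simp add: tens_closed[OF vV vW] homog_closed[OF v] homog_closed[OF w] tbasis_mult)
qed

lemma tensor_homog_induct [consumes 1, case_names tens add]:
  assumes "T \<in> carrier (tensor V W)"
    and "\<And>m v n w. homog V m v \<Longrightarrow> homog W n w \<Longrightarrow> P (tens V W v w)"
    and add: "\<And>S T. S \<in> carrier (tensor V W) \<Longrightarrow> T \<in> carrier (tensor V W) \<Longrightarrow> P S \<Longrightarrow> P T \<Longrightarrow> P (S \<oplus>\<^bsub>tensor V W\<^esub> T)"
  shows "P T"
proof -
  note vV = gr_vspace[OF V] and vW = gr_vspace[OF W]
  note bt = bilin_tens[OF vV vW]
  have 1: "P (tens V W v w)" if v: "homog V m v" and w: "w \<in> carrier W" for m v w
    using w
  proof (induction rule: gr_induct[OF W, consumes 1, case_names homog add])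
    case (homog n w)
    then show ?case using assms(2) v by blast
  next
    case (add w w')
    then show ?case using assms(3) lin_map_add[OF bilin_r[OF bt homog_closed[OF v]]] tens_closed[OF vV vW homog_closed[OF v]]
      by simp
  qed
  have 2: "P (tens V W v w)" if v: "v \<in> carrier V" and w: "w \<in> carrier W" for v w
    using v
  proof (induction rule: gr_induct[OF V, consumes 1, case_names homog add])
    case (homog n v)
    then show ?case using 1 w by blast
  next
    case (add v v')
    then show ?case using assms(3) lin_map_add[OF bilin_l[OF bt w]] tens_closed[OF vV vW _ w]
      by simp
  qed
  show ?thesis using assms(1)
    by (induction rule: tensor_induct[OF vV vW, consumes 1, case_names tens add]) (use 2 add in auto)
qed

lemma tensor_aspan: "carrier (tensor V W) \<subseteq> aspan (htensor V W) (\<Union>l. tgen V W l)"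
proof
  fix T assume "T \<in> carrier (tensor V W)"
  then show "T \<in> aspan (htensor V W) (\<Union>l. tgen V W l)"
  proof (induction rule: tensor_homog_induct)
    case (tens m v n w)
    then have "tens V W v w \<in> tgen V W (m + n)" unfolding tgen_def by blast
    then show ?case by (auto intro: aspan.base)
  next
    case (add S T)
    then show ?case using aspan.add[of S "htensor V W"] by simp
  qed
qed

lemma homog_tgen: "T \<in> tgen V W l \<Longrightarrow> homog (htensor V W) l T"
  by (auto simp: tgen_def intro: homog_tens)

lemma gr_htensor: "gr (htensor V W)"
  by (rule grI[of _ "tgen V W"])
    (use tensor_aspan lin_htensor_coact homog_tgen in \<open>auto simp: vspace_tensor gr_vspace V W\<close>)

text \<open>No zero has to be inserted: the tensor of two zeros is a generator in every degree,
  since zero is homogeneous of every degree.\<close>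

lemma homog_htensor_aspan:
  assumes T: "homog (htensor V W) l T"
  shows "T \<in> aspan (htensor V W) (tgen V W l)"
proof -
  have "homog V 0 \<zero>\<^bsub>V\<^esub> \<and> homog W l \<zero>\<^bsub>W\<^esub> \<and> 0 + l = l"
    by (simp add: homog_zero[OF V] homog_zero[OF W])
  then have "\<zero>\<^bsub>tensor V W\<^esub> \<in> tgen V W l"
    unfolding tgen_def using tens_zero_l[OF gr_vspace[OF V] gr_vspace[OF W], of "\<zero>\<^bsub>W\<^esub>"] gr_vspace[OF W]
    by (simp, metis)
  then have "insert \<zero>\<^bsub>htensor V W\<^esub> (tgen V W l) = tgen V W l" by auto
  then show ?thesis
    using homog_aspan[OF gr_htensor, of "tgen V W", OF _ homog_tgen T] tensor_aspan by simp
qed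

end

text \<open>\<open>hcoprod\<close> is \<open>htensor\<close> with product and unit overwritten, and
  none of these notions looks at product or unit.\<close>

lemma tens_mult_cong:
  fixes A :: "('k::field, 'n::finite, 'a) hobj"
  shows "tensor (A\<lparr>mult := f, one := e\<rparr>) B = tensor A B" "tens (A\<lparr>mult := f, one := e\<rparr>) B = tens A B"
    "tensor U (A\<lparr>mult := f, one := e\<rparr>) = tensor U A" "tens U (A\<lparr>mult := f, one := e\<rparr>) = tens U A"
    "vspace (A\<lparr>mult := f, one := e\<rparr>) \<longleftrightarrow> vspace A"
    "homog (A\<lparr>mult := f, one := e\<rparr>) m a \<longleftrightarrow> homog A m a"
    "aspan (A\<lparr>mult := f, one := e\<rparr>) G = aspan A G"
    "gr (A\<lparr>mult := f, one := e\<rparr>) \<longleftrightarrow> gr A"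
    "hpr (A\<lparr>mult := f, one := e\<rparr>) = hpr A"
proof -
  let ?A = "A\<lparr>mult := f, one := e\<rparr>"
  show 1: "tensor ?A B = tensor A B" "tens ?A B = tens A B" "tensor U ?A = tensor U A" "tens U ?A = tens U A"
    for U :: "('k, 'u, 'z) module_scheme"
    by (rule tensor_cong_l tensor_cong_r; simp)+
  show v: "vspace ?A \<longleftrightarrow> vspace A" by (rule vspace_cong) auto
  show h: "homog ?A m a \<longleftrightarrow> homog A m a" for m a by (simp add: homog_def 1)
  have *: "aspan V G \<subseteq> aspan V' G" if "add V = add V'" for V V' :: "('k, 'n, 'a) hobj" and G
  proof
    fix v assume "v \<in> aspan V G" then show "v \<in> aspan V' G"
      by induction (use that in \<open>auto intro: aspan.intros\<close>)
  qed
  show s: "aspan ?A G = aspan A G" for G using *[of ?A A G] *[of A ?A G] by auto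
  show "gr ?A \<longleftrightarrow> gr A" unfolding gr_def v h s 1 by (simp add: lin_map_def 1)
  show "hpr ?A = hpr A" by (intro ext) (simp add: hpr_def lsl_def tlift_def finsum_def finprod_def)
qed

section \<open>Graded algebras\<close>

text \<open>Algebra objects, without braided commutativity.\<close>

definition galg :: "('k::field, 'n::finite, 'a) hobj \<Rightarrow> bool" where
  "galg A \<longleftrightarrow> gr A \<and> ring A \<and>
     (\<forall>c. \<forall>a\<in>carrier A. \<forall>b\<in>carrier A.
        (c \<odot>\<^bsub>A\<^esub> a) \<otimes>\<^bsub>A\<^esub> b = c \<odot>\<^bsub>A\<^esub> (a \<otimes>\<^bsub>A\<^esub> b) \<and> a \<otimes>\<^bsub>A\<^esub> (c \<odot>\<^bsub>A\<^esub> b) = c \<odot>\<^bsub>A\<^esub> (a \<otimes>\<^bsub>A\<^esub> b)) \<and>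
     (\<forall>m n a b. homog A m a \<longrightarrow> homog A n b \<longrightarrow> homog A (m + n) (a \<otimes>\<^bsub>A\<^esub> b)) \<and>
     homog A 0 \<one>\<^bsub>A\<^esub>"

lemma
  assumes "galg A"
  shows galg_gr: "gr A" and galg_vspace: "vspace A" and galg_ring: "ring A"
    and galg_smult_l: "a \<in> carrier A \<Longrightarrow> b \<in> carrier A \<Longrightarrow> (c \<odot>\<^bsub>A\<^esub> a) \<otimes>\<^bsub>A\<^esub> b = c \<odot>\<^bsub>A\<^esub> (a \<otimes>\<^bsub>A\<^esub> b)"
    and galg_smult_r: "a \<in> carrier A \<Longrightarrow> b \<in> carrier A \<Longrightarrow> a \<otimes>\<^bsub>A\<^esub> (c \<odot>\<^bsub>A\<^esub> b) = c \<odot>\<^bsub>A\<^esub> (a \<otimes>\<^bsub>A\<^esub> b)"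
    and galg_homog_mult: "homog A m a \<Longrightarrow> homog A n b \<Longrightarrow> homog A (m + n) (a \<otimes>\<^bsub>A\<^esub> b)"
    and galg_homog_one: "homog A 0 \<one>\<^bsub>A\<^esub>"
    and galg_mult_closed: "a \<in> carrier A \<Longrightarrow> b \<in> carrier A \<Longrightarrow> a \<otimes>\<^bsub>A\<^esub> b \<in> carrier A"
    and galg_one_closed: "\<one>\<^bsub>A\<^esub> \<in> carrier A"
  using assms by (auto simp: galg_def gr_vspace ring.ring_simprules)

lemma bilin_mult: "galg A \<Longrightarrow> bilin A A A (\<otimes>\<^bsub>A\<^esub>)"
  by (intro bilinI lin_mapI)
    (auto simp: galg_mult_closed galg_smult_l galg_smult_r ring.ring_simprules(13,23) galg_ring)

lemma galgI:
  assumes "gr A" "ring A"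
    and "\<And>c a b. a \<in> carrier A \<Longrightarrow> b \<in> carrier A \<Longrightarrow> (c \<odot>\<^bsub>A\<^esub> a) \<otimes>\<^bsub>A\<^esub> b = c \<odot>\<^bsub>A\<^esub> (a \<otimes>\<^bsub>A\<^esub> b)"
    and "\<And>c a b. a \<in> carrier A \<Longrightarrow> b \<in> carrier A \<Longrightarrow> a \<otimes>\<^bsub>A\<^esub> (c \<odot>\<^bsub>A\<^esub> b) = c \<odot>\<^bsub>A\<^esub> (a \<otimes>\<^bsub>A\<^esub> b)"
    and G: "carrier A \<subseteq> aspan A (\<Union>m. G m)" "\<And>m g. g \<in> G m \<Longrightarrow> homog A m g"
    and GG: "\<And>m n g g'. g \<in> G m \<Longrightarrow> g' \<in> G n \<Longrightarrow> homog A (m + n) (g \<otimes>\<^bsub>A\<^esub> g')"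
    and "homog A 0 \<one>\<^bsub>A\<^esub>"
  shows "galg A"
proof -
  interpret A: ring A by fact
  note A = \<open>gr A\<close>
  have "homog A (m + n) (a \<otimes>\<^bsub>A\<^esub> b)" if a: "homog A m a" and b: "homog A n b" for m n a b
  proof -
    have a': "a \<in> aspan A (insert \<zero>\<^bsub>A\<^esub> (G m))"
      by (rule homog_aspan[OF A G a])
    have b': "b \<in> aspan A (insert \<zero>\<^bsub>A\<^esub> (G n))"
      by (rule homog_aspan[OF A G b])
    have 1: "b \<in> carrier A \<and> homog A (m + n) (g \<otimes>\<^bsub>A\<^esub> b)" if g: "g \<in> G m" for g
      using b'
    proof induction
      case (base x)
      then show ?case using homog_closed[OF G(2)[OF g]] homog_closed[OF G(2)[of x n]] GG[OF g] homog_zero[OF A] by auto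
    next
      case (add v w)
      then show ?case using homog_closed[OF G(2)[OF g]] by (auto simp: A.r_distr intro: homog_add[OF A])
    qed
    have "a \<in> carrier A \<and> homog A (m + n) (a \<otimes>\<^bsub>A\<^esub> b)" using a'
    proof induction
      case (base x)
      then show ?case using 1 homog_closed[OF G(2)[of x m]] homog_zero[OF A] homog_closed[OF b] by auto
    next
      case (add v w)
      then show ?case by (auto simp: A.l_distr homog_closed[OF b] intro: homog_add[OF A])
    qed
    then show ?thesis ..
  qed
  then show ?thesis using assms by (simp add: galg_def)
qed

lemma halgebra_galg:
  fixes A :: "('k::field, 'n::finite, 'a) hobj"
  assumes "halgebra R A"
  shows "galg A"
proof -
  have A: "gr A" and r: "ring A"
    and s: "\<forall>c. \<forall>a\<in>carrier A. \<forall>b\<in>carrier A.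
        (c \<odot>\<^bsub>A\<^esub> a) \<otimes>\<^bsub>A\<^esub> b = c \<odot>\<^bsub>A\<^esub> (a \<otimes>\<^bsub>A\<^esub> b) \<and> a \<otimes>\<^bsub>A\<^esub> (c \<odot>\<^bsub>A\<^esub> b) = c \<odot>\<^bsub>A\<^esub> (a \<otimes>\<^bsub>A\<^esub> b)"
    and m: "\<forall>a\<in>carrier A. \<forall>b\<in>carrier A. coact A (a \<otimes>\<^bsub>A\<^esub> b) =
        tlift (tensor HT A) (\<lambda>h a0. tlift (tensor HT A)
          (\<lambda>g b0. tens HT A (h * g) (a0 \<otimes>\<^bsub>A\<^esub> b0)) (coact A b)) (coact A a)"
    and o: "coact A \<one>\<^bsub>A\<^esub> = tens HT A 1 \<one>\<^bsub>A\<^esub>"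
    using assms by (auto simp: halgebra_def hcomodule_gr)
  interpret A: ring A by fact
  note vA = gr_vspace[OF A]
  have bm: "bilin A A A (\<otimes>\<^bsub>A\<^esub>)"
    by (intro bilinI lin_mapI) (use s in \<open>auto simp: A.l_distr A.r_distr\<close>)
  note t = vspace_tensor[OF vspace_HT vA] and bt = bilin_tens[OF vspace_HT vA]
  have "homog A (m + n) (a \<otimes>\<^bsub>A\<^esub> b)" if a: "homog A m a" and b: "homog A n b" for m n a b
  proof -
    have "coact A (a \<otimes>\<^bsub>A\<^esub> b) = tens HT A (tbasis m * tbasis n) (a \<otimes>\<^bsub>A\<^esub> b)"
      unfolding m[rule_format, OF homog_closed[OF a] homog_closed[OF b]]
      by (rule sweedler2_homog[OF A A t _ _ a b])
        (auto intro: bilin_comp[OF bt lin_times_HT(1) bilin_r[OF bm]] bilin_comp[OF bt lin_times_HT(2) bilin_l[OF bm]])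
    then show ?thesis using a b by (simp add: homog_def tbasis_mult)
  qed
  then show ?thesis
    using A r s o by (simp add: galg_def homog_def tbasis_0)
qed

lemma halgebra_braid:
  fixes A :: "('k::field, 'n::finite, 'a) hobj"
  assumes R: "cotriangular R" and A: "halgebra R A" and a: "homog A m a" and b: "homog A n b"
  shows "a \<otimes>\<^bsub>A\<^esub> b = bch R n m \<odot>\<^bsub>A\<^esub> (b \<otimes>\<^bsub>A\<^esub> a)"
proof -
  note gA = halgebra_galg[OF A]
  note grA = galg_gr[OF gA] and vA = galg_vspace[OF gA] and bm = bilin_mult[OF gA]
  have "a \<otimes>\<^bsub>A\<^esub> b = tlift A (\<lambda>h b0. tlift A
          (\<lambda>g a0. R (tens HT HT h g) \<odot>\<^bsub>A\<^esub> (b0 \<otimes>\<^bsub>A\<^esub> a0)) (coact A a)) (coact A b)"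
    using A homog_closed[OF a] homog_closed[OF b] by (simp add: halgebra_def)
  also have "\<dots> = R (tens HT HT (tbasis n) (tbasis m)) \<odot>\<^bsub>A\<^esub> (b \<otimes>\<^bsub>A\<^esub> a)"
    by (rule sweedler2_homog[OF grA grA vA _ _ b a])
      (auto intro!: bilinI lin_map_scale_l[OF vA] lin_map_scale[OF vA] bilin_r[OF bm] bilin_l[OF bm] lin_R_r[OF R] lin_R_l[OF R] galg_mult_closed[OF gA])
  finally show ?thesis by (simp add: bch_def)
qed

lemma hcoprod_simps [simp]:
  "carrier (hcoprod R A B) = carrier (tensor A B)" "zero (hcoprod R A B) = zero (tensor A B)"
  "add (hcoprod R A B) = add (tensor A B)" "smult (hcoprod R A B) = smult (tensor A B)"
  "vspace (hcoprod R A B) \<longleftrightarrow> vspace (tensor A B)"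
  "lin_map (hcoprod R A B) X f \<longleftrightarrow> lin_map (tensor A B) X f" "lin_map Y (hcoprod R A B) g \<longleftrightarrow> lin_map Y (tensor A B) g"
  "tensor U (hcoprod R A B) = tensor U (tensor A B)" "tens U (hcoprod R A B) = tens U (tensor A B)"
  "coact (hcoprod R A B) = coact (htensor A B)" "one (hcoprod R A B) = tens A B \<one>\<^bsub>A\<^esub> \<one>\<^bsub>B\<^esub>"
  by (simp_all add: hcoprod_def tens_mult_cong lin_map_def)

lemma homog_hcoprod [simp]: "homog (hcoprod R A B) = homog (htensor A B)"
  by (intro ext) (simp add: homog_def)

lemma gr_hcoprod [simp]: "gr (hcoprod R A B) \<longleftrightarrow> gr (htensor A B)"
  unfolding hcoprod_def by (rule tens_mult_cong)

lemma aspan_hcoprod [simp]: "aspan (hcoprod R A B) G = aspan (htensor A B) G"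
  unfolding hcoprod_def by (rule tens_mult_cong)

context
  fixes R :: "('k::field, 'n::finite) torus2 \<Rightarrow> 'k"
    and A :: "('k, 'n, 'a) hobj" and B :: "('k, 'n, 'b) hobj"
  assumes R: "cotriangular R" and A: "galg A" and B: "galg B"
begin

text \<open>The product is a fourfold nested lift, and evaluating any layer requires bilinearity of
  that layer. \<open>Q1\<close> treats the pair \<open>a'\<close>, \<open>b\<close> that is braided,
  \<open>Q2\<close> and \<open>Q3\<close> the outer factors; \<open>P1\<close> and \<open>P2\<close>
  regroup them in the order of nesting. Only \<open>a'\<close> and \<open>b\<close> are exchanged,
  so only they have to be homogeneous in the evaluation rule.\<close>

lemma hcoprod_aux:
  shows bilin_hcoprod: "bilin (tensor A B) (tensor A B) (tensor A B) (\<otimes>\<^bsub>hcoprod R A B\<^esub>)"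
    and hcoprod_tens: "a \<in> carrier A \<Longrightarrow> homog B n b \<Longrightarrow> homog A m' a' \<Longrightarrow> b' \<in> carrier B \<Longrightarrow>
      tens A B a b \<otimes>\<^bsub>hcoprod R A B\<^esub> tens A B a' b' = bch R m' n \<odot>\<^bsub>tensor A B\<^esub> tens A B (a \<otimes>\<^bsub>A\<^esub> a') (b \<otimes>\<^bsub>B\<^esub> b')"
proof -
  note gA = galg_gr[OF A] and gB = galg_gr[OF B] and vA = galg_vspace[OF A] and vB = galg_vspace[OF B]
  note mA = bilin_mult[OF A] and mB = bilin_mult[OF B]
  note t = vspace_tensor[OF vA vB] and bt = bilin_tens[OF vA vB]
  let ?T = "tensor A B"
  let ?\<beta> = "\<lambda>a b' h a0 g b0. R (tens HT HT h g) \<odot>\<^bsub>?T\<^esub> tens A B (a \<otimes>\<^bsub>A\<^esub> a0) (b0 \<otimes>\<^bsub>B\<^esub> b')"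
  let ?Q = "\<lambda>a b' a' b. tlift ?T (\<lambda>h a0. tlift ?T (?\<beta> a b' h a0) (coact B b)) (coact A a')"
  have lA: "a \<in> carrier A \<Longrightarrow> b \<in> carrier B \<Longrightarrow> b' \<in> carrier B \<Longrightarrow> lin_map A ?T (\<lambda>x. tens A B (a \<otimes>\<^bsub>A\<^esub> x) (b \<otimes>\<^bsub>B\<^esub> b'))"
    and lA': "a \<in> carrier A \<Longrightarrow> b \<in> carrier B \<Longrightarrow> b' \<in> carrier B \<Longrightarrow> lin_map A ?T (\<lambda>x. tens A B (x \<otimes>\<^bsub>A\<^esub> a) (b \<otimes>\<^bsub>B\<^esub> b'))"
    and lB: "a \<in> carrier A \<Longrightarrow> a' \<in> carrier A \<Longrightarrow> b \<in> carrier B \<Longrightarrow> lin_map B ?T (\<lambda>x. tens A B (a \<otimes>\<^bsub>A\<^esub> a') (b \<otimes>\<^bsub>B\<^esub> x))"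
    and lB': "a \<in> carrier A \<Longrightarrow> a' \<in> carrier A \<Longrightarrow> b \<in> carrier B \<Longrightarrow> lin_map B ?T (\<lambda>x. tens A B (a \<otimes>\<^bsub>A\<^esub> a') (x \<otimes>\<^bsub>B\<^esub> b))"
    for a a' b b'
    by (auto intro!: lin_bilin_l[OF bt] lin_bilin_r[OF bt] bilin_l[OF mA] bilin_r[OF mA] bilin_l[OF mB] bilin_r[OF mB]
        simp: galg_mult_closed[OF A] galg_mult_closed[OF B])
  have cl: "a \<in> carrier A \<Longrightarrow> a' \<in> carrier A \<Longrightarrow> b \<in> carrier B \<Longrightarrow> b' \<in> carrier B \<Longrightarrow>
      tens A B (a \<otimes>\<^bsub>A\<^esub> a') (b \<otimes>\<^bsub>B\<^esub> b') \<in> carrier ?T" for a a' b b'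
    by (auto intro!: tens_closed[OF vA vB] galg_mult_closed[OF A] galg_mult_closed[OF B])
  have b1: "bilin HT B ?T (?\<beta> a b' h v)" if "a \<in> carrier A" "b' \<in> carrier B" "v \<in> carrier A" for a b' h v
    using that by (intro bilinI lin_map_scale_l[OF t] lin_map_scale[OF t] lin_R_l[OF R] lin_R_r[OF R] lB' cl)
  have b2: "bilin HT A ?T (\<lambda>h v. ?\<beta> a b' h v g w)" if "a \<in> carrier A" "b' \<in> carrier B" "w \<in> carrier B" for a b' g w
    using that by (intro bilinI lin_map_scale_l[OF t] lin_map_scale[OF t] lin_R_l[OF R] lin_R_r[OF R] lA cl)
  have Q1: "bilin A B ?T (\<lambda>a' b. ?Q a b' a' b)" if "a \<in> carrier A" "b' \<in> carrier B" for a b'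
    using that by (intro sweedler2_bilin[OF gA gB t] b1 b2)
  have Q2: "lin_map A ?T (\<lambda>a. ?Q a b' a' b)" if "b' \<in> carrier B" "a' \<in> carrier A" "b \<in> carrier B" for b' a' b
    using that by (intro sweedler2_param[OF gA gB t vA] b1 b2 lin_map_scale[OF t] lA')
  have Q3: "lin_map B ?T (\<lambda>b'. ?Q a b' a' b)" if "a \<in> carrier A" "a' \<in> carrier A" "b \<in> carrier B" for a a' b
    using that by (intro sweedler2_param[OF gA gB t vB] b1 b2 lin_map_scale[OF t] lB)
  have P1: "bilin A B ?T (\<lambda>a' b'. ?Q a b' a' b)" if "a \<in> carrier A" "b \<in> carrier B" for a b
    using that by (intro bilinI Q3 bilin_l[OF Q1])
  have P2: "bilin A B ?T (\<lambda>a b. tlift ?T (\<lambda>a' b'. ?Q a b' a' b) T)" if "T \<in> carrier ?T" for T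
    using that
    by (intro bilinI lin_tlift_param[OF vA vB t that P1])
      (auto intro!: Q2 bilin_r[OF Q1] vA vB)
  have m: "S \<otimes>\<^bsub>hcoprod R A B\<^esub> T = tlift ?T (\<lambda>a b. tlift ?T (\<lambda>a' b'. ?Q a b' a' b) T) S" for S T
    by (simp add: hcoprod_def)
  show "bilin ?T ?T ?T (\<otimes>\<^bsub>hcoprod R A B\<^esub>)"
  proof (rule bilinI)
    show "lin_map ?T ?T (\<lambda>S. S \<otimes>\<^bsub>hcoprod R A B\<^esub> T)" if "T \<in> carrier ?T" for T
      unfolding m by (rule lin_tlift[OF vA vB t P2[OF that]])
    show "lin_map ?T ?T ((\<otimes>\<^bsub>hcoprod R A B\<^esub>) S)" if "S \<in> carrier ?T" for S
      unfolding m[abs_def]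
      by (rule lin_tlift_param[OF vA vB t that P2 _ t]) (auto intro: lin_tlift[OF vA vB t P1])
  qed
  assume a: "a \<in> carrier A" and b: "homog B n b" and a': "homog A m' a'" and b': "b' \<in> carrier B"
  note b0 = homog_closed[OF b] and a0 = homog_closed[OF a']
  have "tens A B a b \<otimes>\<^bsub>hcoprod R A B\<^esub> tens A B a' b' = ?Q a b' a' b"
    unfolding m
    using tlift_tens[OF vA vB t P2[OF tens_closed[OF vA vB a0 b']] a b0] tlift_tens[OF vA vB t P1[OF a b0] a0 b']
    by simp
  also have "\<dots> = ?\<beta> a b' (tbasis m') a' (tbasis n) b"
    by (rule sweedler2_homog[OF gA gB t b1[OF a b'] b2[OF a b'] a' b])
  finally show "tens A B a b \<otimes>\<^bsub>hcoprod R A B\<^esub> tens A B a' b' = bch R m' n \<odot>\<^bsub>tensor A B\<^esub> tens A B (a \<otimes>\<^bsub>A\<^esub> a') (b \<otimes>\<^bsub>B\<^esub> b')"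
    by (simp add: bch_def)
qed

lemma galg_hcoprod: "galg (hcoprod R A B)"
proof -
  note gA = galg_gr[OF A] and gB = galg_gr[OF B] and vA = galg_vspace[OF A] and vB = galg_vspace[OF B]
  interpret A: ring A by (rule galg_ring[OF A])
  interpret B: ring B by (rule galg_ring[OF B])
  note t = vspace_tensor[OF vA vB] and bt = bilin_tens[OF vA vB] and bm = bilin_hcoprod
  note lr = lin_map_add[OF bilin_r[OF bm]] and ll = lin_map_add[OF bilin_l[OF bm]]
  note sr = lin_map_smult[OF bilin_r[OF bm]] and sl = lin_map_smult[OF bilin_l[OF bm]]
  note mc = bilin_closed[OF bm] and tc = tens_closed[OF vA vB]
  let ?P = "hcoprod R A B" and ?T = "tensor A B"
  have mt: "tens A B a b \<otimes>\<^bsub>?P\<^esub> tens A B a' b' = bch R m' n \<odot>\<^bsub>?T\<^esub> tens A B (a \<otimes>\<^bsub>A\<^esub> a') (b \<otimes>\<^bsub>B\<^esub> b')"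
    if "homog A m a" "homog B n b" "homog A m' a'" "homog B n' b'" for a b a' b' m n m' n'
    by (rule hcoprod_tens) (use that homog_closed in auto)
  have one: "\<one>\<^bsub>?P\<^esub> \<in> carrier ?T" by (simp add: tc)
  \<comment> \<open>On homogeneous pure tensors the two bracketings carry the factors
    \<open>bch R m' n * bch R m'' (n + n')\<close> and
    \<open>bch R m'' n' * bch R (m' + m'') n\<close>, which agree because \<open>bch\<close> is a
    bicharacter.\<close>
  have assoc: "S \<otimes>\<^bsub>?P\<^esub> T \<otimes>\<^bsub>?P\<^esub> U = S \<otimes>\<^bsub>?P\<^esub> (T \<otimes>\<^bsub>?P\<^esub> U)"
    if S: "S \<in> carrier ?T" and T: "T \<in> carrier ?T" and U: "U \<in> carrier ?T" for S T U
    using S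
  proof (induction rule: tensor_homog_induct[OF gA gB, consumes 1, case_names tens add])
    case (tens m a n b)
    note 1 = tens
    have c1: "tens A B a b \<in> carrier ?T" using 1 by (simp add: tc homog_closed)
    show ?case using T
    proof (induction rule: tensor_homog_induct[OF gA gB, consumes 1, case_names tens add])
      case (tens m' a' n' b')
      note 2 = tens
      have c2: "tens A B a' b' \<in> carrier ?T" using 2 by (simp add: tc homog_closed)
      show ?case using U
      proof (induction rule: tensor_homog_induct[OF gA gB, consumes 1, case_names tens add])
        case (tens m'' a'' n'' b'')
        note 3 = tens
        have "tens A B a b \<otimes>\<^bsub>?P\<^esub> tens A B a' b' \<otimes>\<^bsub>?P\<^esub> tens A B a'' b'' =
          (bch R m' n * bch R m'' (n + n')) \<odot>\<^bsub>?T\<^esub> tens A B (a \<otimes>\<^bsub>A\<^esub> a' \<otimes>\<^bsub>A\<^esub> a'') (b \<otimes>\<^bsub>B\<^esub> b' \<otimes>\<^bsub>B\<^esub> b'')"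
          using 1 2 3 t
          by (simp add: mt[OF 1 2] homog_closed tc sl
              mt[OF galg_homog_mult[OF A 1(1) 2(1)] galg_homog_mult[OF B 1(2) 2(2)] 3])
        moreover have "tens A B a b \<otimes>\<^bsub>?P\<^esub> (tens A B a' b' \<otimes>\<^bsub>?P\<^esub> tens A B a'' b'') =
          (bch R m'' n' * bch R (m' + m'') n) \<odot>\<^bsub>?T\<^esub> tens A B (a \<otimes>\<^bsub>A\<^esub> (a' \<otimes>\<^bsub>A\<^esub> a'')) (b \<otimes>\<^bsub>B\<^esub> (b' \<otimes>\<^bsub>B\<^esub> b''))"
          using 1 2 3 t
          by (simp add: mt[OF 2 3] homog_closed tc sr
              mt[OF 1 galg_homog_mult[OF A 2(1) 3(1)] galg_homog_mult[OF B 2(2) 3(2)]])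
        ultimately show ?case
          using 1 2 3 by (simp add: A.m_assoc B.m_assoc homog_closed bch_add_l[OF R] bch_add_r[OF R] mult_ac)
      next
        case (add S T)
        then show ?case using c1 c2 by (simp add: lr mc)
      qed
    next
      case (add S T)
      then show ?case using c1 U by (simp add: lr ll mc)
    qed
  next
    case (add S S')
    then show ?case using T U by (simp add: ll mc)
  qed
  have onel: "\<one>\<^bsub>?P\<^esub> \<otimes>\<^bsub>?P\<^esub> S = S" if "S \<in> carrier ?T" for S
    using that
  proof (induction rule: tensor_homog_induct[OF gA gB, consumes 1, case_names tens add])
    case (tens m a n b)
    then show ?case using mt[OF galg_homog_one[OF A] galg_homog_one[OF B] tens] t
      by (simp add: homog_closed bch_0_r[OF R] tc)
  next
    case (add S T)
    then show ?case using lr[OF one] by simp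
  qed
  have oner: "S \<otimes>\<^bsub>?P\<^esub> \<one>\<^bsub>?P\<^esub> = S" if "S \<in> carrier ?T" for S
    using that
  proof (induction rule: tensor_homog_induct[OF gA gB, consumes 1, case_names tens add])
    case (tens m a n b)
    then show ?case using mt[OF tens galg_homog_one[OF A] galg_homog_one[OF B]] t
      by (simp add: homog_closed bch_0_l[OF R] tc)
  next
    case (add S T)
    then show ?case using ll[OF one] by simp
  qed
  have ring: "ring ?P"
  proof (rule ringI)
    show "abelian_group ?P" by (rule vspace_abelian_group) (simp add: t)
    show "Group.monoid ?P" by (rule Group.monoidI) (use mc one assoc onel oner in auto)
  qed (auto simp: ll lr)
  show ?thesis
  proof (rule galgI[where G="tgen A B"])
    show "gr ?P" by (simp add: gr_htensor gA gB)
    show "carrier ?P \<subseteq> aspan ?P (\<Union>l. tgen A B l)"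
      using tensor_aspan[OF gA gB] by simp
    show "homog ?P m g" if "g \<in> tgen A B m" for g m
      using that homog_tgen[OF gA gB] by simp
    show "homog ?P 0 \<one>\<^bsub>?P\<^esub>"
      using homog_tens[OF gA gB galg_homog_one[OF A] galg_homog_one[OF B]] by simp
    fix k l g g'
    assume "g \<in> tgen A B k" "g' \<in> tgen A B l"
    then obtain a b m n a' b' m' n' where g: "g = tens A B a b" "homog A m a" "homog B n b" "m + n = k"
        "g' = tens A B a' b'" "homog A m' a'" "homog B n' b'" "m' + n' = l"
      unfolding tgen_def by blast
    have "homog (htensor A B) (m + m' + (n + n')) (g \<otimes>\<^bsub>?P\<^esub> g')"
      using homog_smult[OF gr_htensor[OF gA gB]
          homog_tens[OF gA gB galg_homog_mult[OF A g(2,6)] galg_homog_mult[OF B g(3,7)]]]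
      by (simp add: g(1,5) mt[OF g(2,3,6,7)])
    moreover have "m + m' + (n + n') = k + l" by (simp add: g(4,8)[symmetric] algebra_simps)
    ultimately show "homog ?P (k + l) (g \<otimes>\<^bsub>?P\<^esub> g')" by simp
  qed (use ring sl sr in auto)
qed

end

section \<open>Quotients by graded ideals\<close>

definition graded_ideal :: "'a set \<Rightarrow> ('k::field, 'n::finite, 'a) hobj \<Rightarrow> bool" where
  "graded_ideal I A \<longleftrightarrow> ideal I A \<and> (\<forall>x\<in>I. \<forall>m. hpr A m x \<in> I)"

lemma ring_cong:
  assumes "ring A" "carrier A = carrier B" "add A = add B" "mult A = mult B" "zero A = zero B" "one A = one B"
  shows "ring B"
proof -
  interpret A: ring A by fact
  have "abelian_group B" by (rule abelian_group_cong[OF assms(2,5,3) A.is_abelian_group])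
  moreover have "Group.monoid B"
    by (rule Group.monoidI; unfold assms(2-6)[symmetric]; simp add: A.m_assoc)
  ultimately show ?thesis
    by (rule ringI) (unfold assms(2-6)[symmetric], simp_all add: A.l_distr A.r_distr)
qed

text \<open>The elements all of whose components lie in the ideal again form an ideal, since
  multiplication by a homogeneous element only shifts components. It contains \<open>S\<close>, so
  minimality of the generated ideal applies.\<close>

lemma genideal_graded:
  fixes A :: "('k::field, 'n::finite, 'a) hobj"
  assumes A: "galg A" and S: "\<And>s. s \<in> S \<Longrightarrow> \<exists>m. homog A m s"
  shows "graded_ideal (genideal A S) A"
proof -
  interpret A: ring A by (rule galg_ring[OF A])
  note gA = galg_gr[OF A] and vA = galg_vspace[OF A] and bm = bilin_mult[OF A]
  have SA: "S \<subseteq> carrier A"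
  proof
    fix s assume "s \<in> S"
    then obtain m where "homog A m s" using S by blast
    then show "s \<in> carrier A" by (rule homog_closed)
  qed
  let ?I = "genideal A S"
  have I: "ideal ?I A" using SA by (rule A.genideal_ideal)
  interpret I: ideal ?I A by (rule I)
  note la = lin_map_add[OF lin_hpr[OF gA]]
  let ?K = "{x \<in> carrier A. \<forall>m. hpr A m x \<in> ?I}"
  have hz: "hpr A m \<zero>\<^bsub>A\<^esub> = \<zero>\<^bsub>A\<^esub>" for m by (rule lin_map_zero[OF vA vA lin_hpr[OF gA]])
  have "ideal ?K A"
  proof (rule idealI)
    show "ring A" by (rule A.ring_axioms)
    show "subgroup ?K (add_monoid A)"
    proof (rule A.add.subgroupI)
      show "?K \<subseteq> carrier A" by auto
      show "?K \<noteq> {}" using hz I.zero_closed by (auto intro: exI[of _ "\<zero>\<^bsub>A\<^esub>"])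
      show "\<ominus>\<^bsub>A\<^esub> a \<in> ?K" if "a \<in> ?K" for a
      proof -
        have "hpr A m (\<ominus>\<^bsub>A\<^esub> a) = \<ominus>\<^bsub>A\<^esub> (hpr A m a)" for m
          using that vA hpr_closed[OF gA] by (simp add: vs_minus[OF vA] lin_map_smult[OF lin_hpr[OF gA]])
        then show ?thesis using that I.a_inv_closed by auto
      qed
      show "a \<oplus>\<^bsub>A\<^esub> b \<in> ?K" if "a \<in> ?K" "b \<in> ?K" for a b using that by (auto simp: la)
    qed
    fix x a assume x: "x \<in> ?K" and a: "a \<in> carrier A"
    show "a \<otimes>\<^bsub>A\<^esub> x \<in> ?K" using a
    proof (induction rule: gr_induct[OF gA, consumes 1, case_names homog add])
      case (homog n a)
      have "a \<otimes>\<^bsub>A\<^esub> hpr A m x = hpr A (m + n) (a \<otimes>\<^bsub>A\<^esub> x)" for m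
      proof (rule hpr_map[OF gA gA bilin_r[OF bm homog_closed[OF homog]]])
        show "homog A (k + n) (a \<otimes>\<^bsub>A\<^esub> v)" if "homog A k v" for k v
          using galg_homog_mult[OF A homog that] by (simp add: add.commute)
      qed (use x in simp)
      from this[of "_ - n"] have "hpr A m (a \<otimes>\<^bsub>A\<^esub> x) = a \<otimes>\<^bsub>A\<^esub> hpr A (m - n) x" for m by simp
      then show ?case using x homog_closed[OF homog] by (auto intro: I.I_l_closed)
    next
      case (add a b)
      then show ?case using x by (auto simp: A.l_distr la)
    qed
    show "x \<otimes>\<^bsub>A\<^esub> a \<in> ?K" using a
    proof (induction rule: gr_induct[OF gA, consumes 1, case_names homog add])
      case (homog n a)
      have "hpr A m x \<otimes>\<^bsub>A\<^esub> a = hpr A (m + n) (x \<otimes>\<^bsub>A\<^esub> a)" for m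
        by (rule hpr_map[OF gA gA bilin_l[OF bm homog_closed[OF homog]]])
          (use x galg_homog_mult[OF A _ homog] in auto)
      from this[of "_ - n"] have "hpr A m (x \<otimes>\<^bsub>A\<^esub> a) = hpr A (m - n) x \<otimes>\<^bsub>A\<^esub> a" for m by simp
      then show ?case using x homog_closed[OF homog] by (auto intro: I.I_r_closed)
    next
      case (add a b)
      then show ?case using x by (auto simp: A.r_distr la)
    qed
  qed
  moreover have "S \<subseteq> ?K"
  proof
    fix s assume s: "s \<in> S"
    then obtain n where n: "homog A n s" using S by blast
    have "s \<in> ?I" using A.genideal_self[OF SA] s by blast
    then show "s \<in> ?K" using n I.zero_closed by (auto simp: hpr_homog[OF gA n] homog_closed)
  qed
  ultimately have "?I \<subseteq> ?K" by (rule A.genideal_minimal)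
  then show ?thesis unfolding graded_ideal_def using I by blast
qed

context
  fixes A :: "('k::field, 'n::finite, 'a) hobj" and I :: "'a set"
  assumes A: "galg A" and I: "graded_ideal I A"
begin

interpretation A: ring A by (rule galg_ring[OF A])
interpretation I: ideal I A using I by (simp add: graded_ideal_def)

text \<open>A ring ideal of an algebra is a subspace because scaling \<open>x\<close> by
  \<open>c\<close> is multiplication by the scalar multiple \<open>c\<close> of the unit.\<close>

lemma ideal_smult: "x \<in> I \<Longrightarrow> c \<odot>\<^bsub>A\<^esub> x \<in> I"
  using I.I_l_closed[of x "c \<odot>\<^bsub>A\<^esub> \<one>\<^bsub>A\<^esub>"] I.Icarr[of x] galg_vspace[OF A]
  by (simp add: galg_smult_l[OF A])

lemma coset_eq_iff:
  assumes a: "a \<in> carrier A" and b: "b \<in> carrier A"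
  shows "I +>\<^bsub>A\<^esub> a = I +>\<^bsub>A\<^esub> b \<longleftrightarrow> a \<ominus>\<^bsub>A\<^esub> b \<in> I"
proof -
  have "I +>\<^bsub>A\<^esub> a = I +>\<^bsub>A\<^esub> b \<longleftrightarrow> a \<in> I +>\<^bsub>A\<^esub> b"
    using I.a_rcos_self[OF a] I.a_repr_independence'[OF _ b] by metis
  then show ?thesis using I.a_rcos_module_minus[OF A.ring_axioms b a] by simp
qed

lemma coset_rep:
  assumes a: "a \<in> carrier A"
  shows "rep (I +>\<^bsub>A\<^esub> a) \<in> carrier A" "rep (I +>\<^bsub>A\<^esub> a) \<ominus>\<^bsub>A\<^esub> a \<in> I"
proof -
  have r: "rep (I +>\<^bsub>A\<^esub> a) \<in> I +>\<^bsub>A\<^esub> a"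
    unfolding rep_def by (rule someI[of "\<lambda>x. x \<in> I +>\<^bsub>A\<^esub> a", OF I.a_rcos_self[OF a]])
  then show c: "rep (I +>\<^bsub>A\<^esub> a) \<in> carrier A"
    using A.a_r_coset_subset_G[OF I.a_subset a] by blast
  show "rep (I +>\<^bsub>A\<^esub> a) \<ominus>\<^bsub>A\<^esub> a \<in> I"
    using r I.a_rcos_module_minus[OF A.ring_axioms a c] by simp
qed

lemma hquot_fields [simp]:
  "carrier (hquot A I) = (+>\<^bsub>A\<^esub>) I ` carrier A"
  "zero (hquot A I) = I" "add (hquot A I) = set_add A" "mult (hquot A I) = rcoset_mult A I"
  "one (hquot A I) = I +>\<^bsub>A\<^esub> \<one>\<^bsub>A\<^esub>"
  by (auto simp: hquot_def quot_space_def FactRing_def A_RCOSETS_def')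

lemma coset_zero: "I +>\<^bsub>A\<^esub> a = I \<longleftrightarrow> a \<in> I" if "a \<in> carrier A"
  using coset_eq_iff[OF that A.zero_closed] I.a_rcos_const[OF I.zero_closed] that
  by (simp add: a_minus_def)

lemma coset_add: "a \<in> carrier A \<Longrightarrow> b \<in> carrier A \<Longrightarrow>
    (I +>\<^bsub>A\<^esub> a) \<oplus>\<^bsub>hquot A I\<^esub> (I +>\<^bsub>A\<^esub> b) = I +>\<^bsub>A\<^esub> (a \<oplus>\<^bsub>A\<^esub> b)"
  by (simp add: I.a_rcos_sum)

lemma coset_mult: "a \<in> carrier A \<Longrightarrow> b \<in> carrier A \<Longrightarrow>
    (I +>\<^bsub>A\<^esub> a) \<otimes>\<^bsub>hquot A I\<^esub> (I +>\<^bsub>A\<^esub> b) = I +>\<^bsub>A\<^esub> (a \<otimes>\<^bsub>A\<^esub> b)"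
  by (simp add: I.rcoset_mult_add)

lemma coset_smult:
  assumes a: "a \<in> carrier A"
  shows "c \<odot>\<^bsub>hquot A I\<^esub> (I +>\<^bsub>A\<^esub> a) = I +>\<^bsub>A\<^esub> (c \<odot>\<^bsub>A\<^esub> a)"
proof -
  note vA = galg_vspace[OF A]
  let ?r = "rep (I +>\<^bsub>A\<^esub> a)"
  have "c \<odot>\<^bsub>A\<^esub> (?r \<ominus>\<^bsub>A\<^esub> a) = c \<odot>\<^bsub>A\<^esub> ?r \<ominus>\<^bsub>A\<^esub> c \<odot>\<^bsub>A\<^esub> a"
    by (rule lin_map_diff[OF vA vA lin_map_scale[OF vA lin_map_id]]) (use coset_rep[OF a] a in auto)
  then have "c \<odot>\<^bsub>A\<^esub> ?r \<ominus>\<^bsub>A\<^esub> c \<odot>\<^bsub>A\<^esub> a \<in> I" using ideal_smult[OF coset_rep(2)[OF a], of c] by simp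
  then have "I +>\<^bsub>A\<^esub> (c \<odot>\<^bsub>A\<^esub> ?r) = I +>\<^bsub>A\<^esub> (c \<odot>\<^bsub>A\<^esub> a)"
    using coset_eq_iff coset_rep[OF a] a vA by simp
  then show ?thesis by (simp add: hquot_def quot_space_def)
qed

lemma ring_hquot: "ring (hquot A I)"
  by (rule ring_cong[OF I.quotient_is_ring]) (auto simp: FactRing_def A_RCOSETS_def')

lemma vspace_hquot: "vspace (hquot A I)"
proof (rule vspaceI)
  note vA = galg_vspace[OF A]
  show "abelian_group (hquot A I)" using ring_hquot by (rule ring.is_abelian_group)
  fix X c d assume "X \<in> carrier (hquot A I)"
  then obtain a where a: "a \<in> carrier A" "X = I +>\<^bsub>A\<^esub> a" by auto
  show "c \<odot>\<^bsub>hquot A I\<^esub> X \<in> carrier (hquot A I)"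
    using a vA by (auto simp: coset_smult)
  show "(c + d) \<odot>\<^bsub>hquot A I\<^esub> X = c \<odot>\<^bsub>hquot A I\<^esub> X \<oplus>\<^bsub>hquot A I\<^esub> d \<odot>\<^bsub>hquot A I\<^esub> X"
    using a vA by (simp add: coset_smult coset_add vs_smult_add_l del: hquot_fields)
  show "(c * d) \<odot>\<^bsub>hquot A I\<^esub> X = c \<odot>\<^bsub>hquot A I\<^esub> (d \<odot>\<^bsub>hquot A I\<^esub> X)"
    using a vA by (simp add: coset_smult)
  show "1 \<odot>\<^bsub>hquot A I\<^esub> X = X" using a vA by (simp add: coset_smult)
  fix Y assume "Y \<in> carrier (hquot A I)"
  then obtain b where b: "b \<in> carrier A" "Y = I +>\<^bsub>A\<^esub> b" by auto
  show "c \<odot>\<^bsub>hquot A I\<^esub> (X \<oplus>\<^bsub>hquot A I\<^esub> Y) = c \<odot>\<^bsub>hquot A I\<^esub> X \<oplus>\<^bsub>hquot A I\<^esub> c \<odot>\<^bsub>hquot A I\<^esub> Y"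
    using a b vA by (simp add: coset_smult coset_add vs_smult_add_r del: hquot_fields)
qed

lemma lin_coset: "lin_map A (hquot A I) ((+>\<^bsub>A\<^esub>) I)"
  by (rule lin_mapI) (auto simp: coset_add coset_smult simp del: hquot_fields(3))

text \<open>The coaction of the quotient is defined on a chosen representative. Two representatives
  differ by an element of \<open>I\<close>; its components lie in \<open>I\<close> as well, so each
  of them maps to zero. This is where gradedness of the ideal enters.\<close>

lemma coact_hquot:
  assumes a: "a \<in> carrier A"
  shows "coact (hquot A I) (I +>\<^bsub>A\<^esub> a) = tmap HT (hquot A I) id ((+>\<^bsub>A\<^esub>) I) (coact A a)"
proof -
  note vA = galg_vspace[OF A] and gA = galg_gr[OF A]
  let ?Q = "hquot A I" and ?\<pi> = "(+>\<^bsub>A\<^esub>) I"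
  note t = vspace_tensor[OF vspace_HT vspace_hquot]
  interpret t: abelian_group "tensor HT ?Q" by (rule vspace_abelian_group[OF t])
  define \<kappa> where "\<kappa> a = tmap HT ?Q id ?\<pi> (coact A a)" for a
  have \<kappa>: "lin_map A (tensor HT ?Q) \<kappa>"
    unfolding \<kappa>_def
    by (rule lin_map_comp[OF gr_coact[OF gA] lin_tmap[OF vspace_HT vA vspace_HT vspace_hquot _ lin_coset]])
      (simp add: id_def lin_map_id)
  have \<kappa>0: "\<kappa> x = \<zero>\<^bsub>tensor HT ?Q\<^esub>" if x: "x \<in> I" for x
  proof -
    have xA: "x \<in> carrier A" using x by (rule I.Icarr)
    obtain F where F: "x = (\<Oplus>\<^bsub>A\<^esub>m\<in>F. hpr A m x)" using hpr_expand[OF gA xA] by (elim exE conjE)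
    have h: "homog A m (hpr A m x)" for m by (rule homog_hpr[OF gA xA])
    have k: "\<kappa> (hpr A m x) = \<zero>\<^bsub>tensor HT ?Q\<^esub>" for m
    proof -
      have "hpr A m x \<in> I" using x I by (simp add: graded_ideal_def)
      then have "?\<pi> (hpr A m x) = \<zero>\<^bsub>?Q\<^esub>" using coset_zero[OF homog_closed[OF h]] by simp
      then show ?thesis
        using h[of m] tmap_tens[OF vspace_HT vA vspace_HT vspace_hquot _ lin_coset, of id "tbasis m" "hpr A m x"]
          tens_zero_r[OF vspace_HT vspace_hquot, of "tbasis m"]
        by (simp add: \<kappa>_def homog_def id_def lin_map_id)
    qed
    have "\<kappa> x = \<kappa> (\<Oplus>\<^bsub>A\<^esub>m\<in>F. hpr A m x)" by (rule arg_cong[OF F])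
    also have "\<dots> = (\<Oplus>\<^bsub>tensor HT ?Q\<^esub>m\<in>F. \<kappa> (hpr A m x))"
      by (rule lin_map_finsum[OF vA t \<kappa>]) (use hpr_closed[OF gA xA] in auto)
    finally show ?thesis by (simp add: k t.finsum_zero)
  qed
  let ?r = "rep (I +>\<^bsub>A\<^esub> a)"
  note r = coset_rep[OF a]
  have "\<kappa> ?r = \<kappa> (?r \<ominus>\<^bsub>A\<^esub> a \<oplus>\<^bsub>A\<^esub> a)"
    using r a by (simp add: a_minus_def A.a_assoc A.l_neg)
  also have "\<dots> = \<kappa> (?r \<ominus>\<^bsub>A\<^esub> a) \<oplus>\<^bsub>tensor HT ?Q\<^esub> \<kappa> a"
    by (rule lin_map_add[OF \<kappa>]) (use r a in auto)
  also have "\<dots> = \<kappa> a" using \<kappa>0[OF r(2)] lin_map_closed[OF \<kappa> a] by simp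
  finally show ?thesis by (simp add: \<kappa>_def hquot_def)
qed

lemma homog_coset: "homog A m a \<Longrightarrow> homog (hquot A I) m (I +>\<^bsub>A\<^esub> a)"
  using coact_hquot[of a] tmap_tens[OF vspace_HT galg_vspace[OF A] vspace_HT vspace_hquot _ lin_coset, of id "tbasis m" a]
  by (simp add: homog_def id_def lin_map_id)

lemma lin_coact_hquot: "lin_map (hquot A I) (tensor HT (hquot A I)) (coact (hquot A I))"
proof (rule lin_mapI)
  note vA = galg_vspace[OF A] and gA = galg_gr[OF A]
  let ?Q = "hquot A I" and ?\<pi> = "(+>\<^bsub>A\<^esub>) I"
  have \<kappa>: "lin_map A (tensor HT ?Q) (\<lambda>a. tmap HT ?Q id ?\<pi> (coact A a))"
    by (rule lin_map_comp[OF gr_coact[OF gA] lin_tmap[OF vspace_HT vA vspace_HT vspace_hquot _ lin_coset]])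
      (simp add: id_def lin_map_id)
  fix X c assume "X \<in> carrier ?Q"
  then obtain a where a: "a \<in> carrier A" "X = I +>\<^bsub>A\<^esub> a" by auto
  show "coact ?Q X \<in> carrier (tensor HT ?Q)"
    using a lin_map_closed[OF \<kappa>] by (simp add: coact_hquot)
  show "coact ?Q (c \<odot>\<^bsub>?Q\<^esub> X) = c \<odot>\<^bsub>tensor HT ?Q\<^esub> coact ?Q X"
    using a vA lin_map_smult[OF \<kappa>] by (simp add: coset_smult coact_hquot)
  fix Y assume "Y \<in> carrier ?Q"
  then obtain b where b: "b \<in> carrier A" "Y = I +>\<^bsub>A\<^esub> b" by auto
  show "coact ?Q (X \<oplus>\<^bsub>?Q\<^esub> Y) = coact ?Q X \<oplus>\<^bsub>tensor HT ?Q\<^esub> coact ?Q Y"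
    using a b vA lin_map_add[OF \<kappa>] by (simp add: coset_add coact_hquot del: hquot_fields)
qed

lemma galg_hquot: "galg (hquot A I)"
proof -
  note vA = galg_vspace[OF A] and gA = galg_gr[OF A]
  let ?Q = "hquot A I" and ?\<pi> = "(+>\<^bsub>A\<^esub>) I"
  let ?G = "\<lambda>m. ?\<pi> ` {a. homog A m a}"
  have span: "carrier ?Q \<subseteq> aspan ?Q (\<Union>m. ?G m)"
  proof
    fix X assume "X \<in> carrier ?Q"
    then obtain a where a: "a \<in> carrier A" "X = I +>\<^bsub>A\<^esub> a" by auto
    have "I +>\<^bsub>A\<^esub> a \<in> aspan ?Q (\<Union>m. ?G m)" using a(1)
    proof (induction rule: gr_induct[OF gA, consumes 1, case_names homog add])
      case (homog m v)
      then show ?case by (auto intro!: aspan.base)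
    next
      case (add v w)
      then show ?case using aspan.add[OF add(3,4)] by (simp add: coset_add del: hquot_fields)
    qed
    then show "X \<in> aspan ?Q (\<Union>m. ?G m)" using a by simp
  qed
  have gr: "gr ?Q"
    by (rule grI[OF vspace_hquot lin_coact_hquot span]) (auto intro: homog_coset)
  show ?thesis
  proof (rule galgI[OF gr ring_hquot _ _ span])
    fix X Y c assume "X \<in> carrier ?Q" "Y \<in> carrier ?Q"
    then obtain a b where ab: "a \<in> carrier A" "X = I +>\<^bsub>A\<^esub> a" "b \<in> carrier A" "Y = I +>\<^bsub>A\<^esub> b" by auto
    show "(c \<odot>\<^bsub>?Q\<^esub> X) \<otimes>\<^bsub>?Q\<^esub> Y = c \<odot>\<^bsub>?Q\<^esub> (X \<otimes>\<^bsub>?Q\<^esub> Y)" "X \<otimes>\<^bsub>?Q\<^esub> (c \<odot>\<^bsub>?Q\<^esub> Y) = c \<odot>\<^bsub>?Q\<^esub> (X \<otimes>\<^bsub>?Q\<^esub> Y)"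
      using ab vA by (simp_all add: coset_smult coset_mult galg_smult_l[OF A] galg_smult_r[OF A] del: hquot_fields)
  next
    show "homog ?Q m g" if "g \<in> ?G m" for m g using that homog_coset by auto
    show "homog ?Q (m + n) (g \<otimes>\<^bsub>?Q\<^esub> g')" if "g \<in> ?G m" "g' \<in> ?G n" for m n g g'
      using that homog_coset galg_homog_mult[OF A]
      by (auto simp: coset_mult homog_closed simp del: hquot_fields)
    show "homog ?Q 0 \<one>\<^bsub>?Q\<^esub>" using homog_coset[OF galg_homog_one[OF A]] by simp
  qed
qed

end

section \<open>Noncommutative polynomials and free algebras\<close>

definition words :: "nat \<Rightarrow> word set" where
  "words N = {w. set (letters w) \<subseteq> {..<N}}"

definition wdeg :: "(int ^ 'n::finite) list \<Rightarrow> word \<Rightarrow> int ^ 'n" where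
  "wdeg ms w = (\<Sum>i\<leftarrow>letters w. ms ! i)"

lemma letters_plus [simp]: "letters (u + v) = letters u @ letters v" "letters 0 = []"
  by (simp_all add: plus_word_def zero_word_def)

lemma words_plus [simp]: "u + v \<in> words N \<longleftrightarrow> u \<in> words N \<and> v \<in> words N" "0 \<in> words N"
  by (auto simp: words_def)

lemma wdeg_plus [simp]: "wdeg ms (u + v) = wdeg ms u + wdeg ms v" "wdeg ms 0 = 0"
  by (simp_all add: wdeg_def)

lemma ncpoly_alg_fields [simp]:
  "carrier (ncpoly_alg ms) = {p. Poly_Mapping.keys p \<subseteq> words (length ms)}"
  "zero (ncpoly_alg ms) = 0" "add (ncpoly_alg ms) = (+)" "mult (ncpoly_alg ms) = (*)"
  "one (ncpoly_alg ms) = 1" "smult (ncpoly_alg ms) = psmult"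
  by (auto simp: ncpoly_alg_def ncpoly_space_def words_def)

text \<open>A scalar acts as the constant polynomial at the empty word, which commutes with every
  word.\<close>

lemma psmult_mult:
  fixes p q :: "'k::field ncpoly"
  shows "psmult c p * q = psmult c (p * q)" "p * psmult c q = psmult c (p * q)"
proof -
  have 1: "psmult c x = Poly_Mapping.single 0 c * x" for x :: "'k ncpoly"
    unfolding psmult_def by (rule mult_map_scale_conv_mult)
  have "Poly_Mapping.single w d * Poly_Mapping.single 0 c = Poly_Mapping.single 0 c * Poly_Mapping.single w d" for w :: word and d
    by (simp add: mult_single mult.commute)
  then have 2: "x * Poly_Mapping.single 0 c = Poly_Mapping.single 0 c * x" for x :: "'k ncpoly"
    by (subst (1 2) poly_mapping_single_sum) (simp add: sum_distrib_left sum_distrib_right)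
  show "psmult c p * q = psmult c (p * q)" by (simp add: 1 mult.assoc)
  show "p * psmult c q = psmult c (p * q)" unfolding 1 by (metis 2 mult.assoc)
qed

lemma ncpoly_keys:
  fixes p q :: "'k::field ncpoly"
  shows "Poly_Mapping.keys p \<subseteq> words N \<Longrightarrow> Poly_Mapping.keys q \<subseteq> words N \<Longrightarrow> Poly_Mapping.keys (p + q) \<subseteq> words N"
    and "Poly_Mapping.keys p \<subseteq> words N \<Longrightarrow> Poly_Mapping.keys q \<subseteq> words N \<Longrightarrow> Poly_Mapping.keys (p * q) \<subseteq> words N"
    and "Poly_Mapping.keys p \<subseteq> words N \<Longrightarrow> Poly_Mapping.keys (psmult c p) \<subseteq> words N"
proof -
  assume *: "Poly_Mapping.keys p \<subseteq> words N"
  then show "Poly_Mapping.keys (psmult c p) \<subseteq> words N" using keys_psmult[of c p] by auto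
  assume **: "Poly_Mapping.keys q \<subseteq> words N"
  show "Poly_Mapping.keys (p + q) \<subseteq> words N" using * ** keys_add[of p q] by auto
  show "Poly_Mapping.keys (p * q) \<subseteq> words N"
  proof
    fix w assume "w \<in> Poly_Mapping.keys (p * q)"
    then obtain u v where "w = u + v" "u \<in> Poly_Mapping.keys p" "v \<in> Poly_Mapping.keys q"
      using keys_mult[of p q] by auto
    then show "w \<in> words N" using * ** by auto
  qed
qed

lemma vspace_ncpoly: "vspace (ncpoly_alg ms :: ('k::field, 'n::finite, 'k ncpoly) hobj)"
proof (rule vspaceI)
  show "abelian_group (ncpoly_alg ms :: ('k, 'n, 'k ncpoly) hobj)"
  proof (rule abelian_groupI)
    fix x :: "'k ncpoly"
    assume "x \<in> carrier (ncpoly_alg ms :: ('k, 'n, 'k ncpoly) hobj)"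
    then show "\<exists>y\<in>carrier (ncpoly_alg ms :: ('k, 'n, 'k ncpoly) hobj). y \<oplus>\<^bsub>ncpoly_alg ms :: ('k, 'n, 'k ncpoly) hobj\<^esub> x = \<zero>\<^bsub>ncpoly_alg ms :: ('k, 'n, 'k ncpoly) hobj\<^esub>"
      by (intro bexI[of _ "- x"]) auto
  qed (auto simp: algebra_simps ncpoly_keys)
qed (auto simp: psm.scale_left_distrib psm.scale_right_distrib ncpoly_keys)

lemma ring_ncpoly: "ring (ncpoly_alg ms :: ('k::field, 'n::finite, 'k ncpoly) hobj)"
proof (rule ringI)
  show "abelian_group (ncpoly_alg ms :: ('k, 'n, 'k ncpoly) hobj)"
    by (rule vspace_abelian_group[OF vspace_ncpoly])
  show "Group.monoid (ncpoly_alg ms :: ('k, 'n, 'k ncpoly) hobj)"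
    by (rule Group.monoidI) (auto simp: ncpoly_keys mult.assoc)
qed (auto simp: algebra_simps)

lemma ncpoly_induct [consumes 1, case_names single add]:
  fixes p :: "'k::field ncpoly"
  assumes "Poly_Mapping.keys p \<subseteq> words N"
    and "\<And>w c. w \<in> words N \<Longrightarrow> P (Poly_Mapping.single w c)"
    and "\<And>p q. Poly_Mapping.keys p \<subseteq> words N \<Longrightarrow> Poly_Mapping.keys q \<subseteq> words N \<Longrightarrow> P p \<Longrightarrow> P q \<Longrightarrow> P (p + q)"
  shows "P p"
proof -
  have "finite F \<Longrightarrow> F \<subseteq> words N \<Longrightarrow> Poly_Mapping.keys (\<Sum>w\<in>F. Poly_Mapping.single w (Poly_Mapping.lookup p w)) \<subseteq> words N \<and>
    P (\<Sum>w\<in>F. Poly_Mapping.single w (Poly_Mapping.lookup p w))" for F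
  proof (induction F rule: finite_induct)
    case empty
    have "(0 :: 'k ncpoly) = Poly_Mapping.single 0 0" by simp
    then show ?case using assms(2)[of 0 0] by simp
  next
    case (insert w F)
    have "Poly_Mapping.keys (Poly_Mapping.single w (Poly_Mapping.lookup p w)) \<subseteq> words N" using insert by simp
    then show ?case using insert assms(2)[of w] assms(3) by (simp add: ncpoly_keys(1) del: keys_single)
  qed
  from this[of "Poly_Mapping.keys p"] show ?thesis
    using assms(1) by (simp add: poly_mapping_single_sum[of p, symmetric])
qed

lemma ncpoly_aspan:
  assumes "p \<in> carrier (ncpoly_alg ms :: ('k::field, 'n::finite, 'k ncpoly) hobj)"
  shows "p \<in> aspan (ncpoly_alg ms :: ('k, 'n, 'k ncpoly) hobj) {Poly_Mapping.single w c | w c. w \<in> words (length ms)}"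
proof -
  have "Poly_Mapping.keys p \<subseteq> words (length ms)" using assms by simp
  then show ?thesis
  proof (induction rule: ncpoly_induct)
    case (single w c)
    then show ?case by (intro aspan.base) auto
  next
    case (add p q)
    then show ?case using aspan.add[OF add(3,4)] by simp
  qed
qed

lemma ncpoly_coact:
  fixes ms :: "(int ^ 'n::finite) list"
  defines "A \<equiv> ncpoly_alg ms :: ('k::field, 'n, 'k ncpoly) hobj"
  shows lin_ncpoly_coact: "lin_map A (tensor HT A) (coact A)"
    and homog_single: "w \<in> words (length ms) \<Longrightarrow> homog A (wdeg ms w) (Poly_Mapping.single w c)"
proof -
  let ?g = "\<lambda>w. tens HT A (tbasis (wdeg ms w)) (Poly_Mapping.single w (1 :: 'k))"
  have vA: "vspace A" unfolding A_def by (rule vspace_ncpoly)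
  note t = vspace_tensor[OF vspace_HT vA]
  have g: "?g \<in> words (length ms) \<rightarrow> carrier (tensor HT A)"
    by (auto intro!: tens_closed[OF vspace_HT vA]) (auto simp: A_def)
  have co: "coact A p = fsum (tensor HT A) ?g p" for p
    by (simp add: A_def ncpoly_alg_def fsum_def wdeg_def)
  show "lin_map A (tensor HT A) (coact A)"
    unfolding co[abs_def] using fsum_add[OF t g] fsum_psmult[OF t g] fsum_closed[OF t g]
    by (intro lin_mapI) (auto simp: A_def)
  assume w: "w \<in> words (length ms)"
  have s: "Poly_Mapping.single w c = c \<odot>\<^bsub>A\<^esub> Poly_Mapping.single w 1" by (simp add: A_def)
  have "Poly_Mapping.single w 1 \<in> carrier A" using w by (simp add: A_def)
  then show "homog A (wdeg ms w) (Poly_Mapping.single w c)"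
    unfolding homog_def s co
    using fsum_single[OF t g w, of c] vA w
    by (simp add: lin_map_smult[OF bilin_r[OF bilin_tens[OF vspace_HT vA]]]) (simp add: A_def ncpoly_keys)
qed

lemma galg_ncpoly: "galg (ncpoly_alg ms :: ('k::field, 'n::finite, 'k ncpoly) hobj)"
proof -
  let ?A = "ncpoly_alg ms :: ('k, 'n, 'k ncpoly) hobj"
  let ?G = "\<lambda>m. {Poly_Mapping.single w c | w c. w \<in> words (length ms) \<and> wdeg ms w = m}"
  have e: "(\<Union>m. ?G m) = {Poly_Mapping.single w c | w c. w \<in> words (length ms)}" by auto
  have span: "carrier ?A \<subseteq> aspan ?A (\<Union>m. ?G m)" unfolding e using ncpoly_aspan by blast
  have gr: "gr ?A"
    by (rule grI[OF vspace_ncpoly lin_ncpoly_coact span]) (auto intro: homog_single)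
  show ?thesis
  proof (rule galgI[OF gr ring_ncpoly _ _ span])
    show "homog ?A m g" if "g \<in> ?G m" for m g using that by (auto intro: homog_single)
    show "homog ?A (m + n) (g \<otimes>\<^bsub>?A\<^esub> g')" if "g \<in> ?G m" "g' \<in> ?G n" for m n g g'
    proof -
      from that obtain u c v d where "g = Poly_Mapping.single u c" "u \<in> words (length ms)" "wdeg ms u = m"
        "g' = Poly_Mapping.single v d" "v \<in> words (length ms)" "wdeg ms v = n" by blast
      then show ?thesis using homog_single[of "u + v" ms "c * d"] by (simp add: mult_single)
    qed
    show "homog ?A 0 \<one>\<^bsub>?A\<^esub>"
      using homog_single[of 0 ms 1] by (simp)
  qed (auto simp: psmult_mult)
qed

text \<open>Algebra morphisms with equivariance expressed by degrees and without extensionality, so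
  that plain composition stays inside the notion. \<open>halg_hom_ghom\<close> and
  \<open>halg_homI\<close> translate to and from \<open>halg_hom\<close>.\<close>

definition ghom :: "('k::field, 'n::finite, 'a) hobj \<Rightarrow> ('k, 'n, 'b) hobj \<Rightarrow> ('a \<Rightarrow> 'b) \<Rightarrow> bool" where
  "ghom A B f \<longleftrightarrow> lin_map A B f \<and> (\<forall>m a. homog A m a \<longrightarrow> homog B m (f a)) \<and>
     (\<forall>a\<in>carrier A. \<forall>a'\<in>carrier A. f (a \<otimes>\<^bsub>A\<^esub> a') = f a \<otimes>\<^bsub>B\<^esub> f a') \<and> f \<one>\<^bsub>A\<^esub> = \<one>\<^bsub>B\<^esub>"

lemma
  assumes "ghom A B f"
  shows ghom_lin: "lin_map A B f" and ghom_homog: "homog A m a \<Longrightarrow> homog B m (f a)"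
    and ghom_mult: "a \<in> carrier A \<Longrightarrow> a' \<in> carrier A \<Longrightarrow> f (a \<otimes>\<^bsub>A\<^esub> a') = f a \<otimes>\<^bsub>B\<^esub> f a'"
    and ghom_one: "f \<one>\<^bsub>A\<^esub> = \<one>\<^bsub>B\<^esub>"
    and ghom_closed: "a \<in> carrier A \<Longrightarrow> f a \<in> carrier B"
  using assms by (auto simp: ghom_def lin_map_closed)

lemma comod_hom_homog:
  assumes V: "vspace V" and W: "vspace W" and f: "f \<in> comod_hom V W" and v: "homog V m v"
  shows "homog W m (f v)"
proof -
  have l: "lin_map V W f" and c: "coact W (f v) = tmap HT W id f (coact V v)"
    using f v by (auto simp: comod_hom_def homog_def)
  show ?thesis
    using v c tmap_tens[OF vspace_HT V vspace_HT W _ l, of id "tbasis m" v] lin_map_closed[OF l]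
    by (simp add: homog_def id_def lin_map_id)
qed

text \<open>Equivariance is an equation between linear maps and so may be tested on homogeneous
  elements, where it says that degrees are preserved.\<close>

lemma comod_homI:
  assumes V: "gr V" and W: "gr W" and l: "lin_map V W f" and e: "f \<in> extensional (carrier V)"
    and h: "\<And>m v. homog V m v \<Longrightarrow> homog W m (f v)"
  shows "f \<in> comod_hom V W"
proof -
  note vV = gr_vspace[OF V] and vW = gr_vspace[OF W]
  have id: "lin_map HT HT id" by (simp add: id_def lin_map_id)
  have lt: "lin_map V (tensor HT W) (\<lambda>v. tmap HT W id f (coact V v))"
    by (rule lin_map_comp[OF gr_coact[OF V] lin_tmap[OF vspace_HT vV vspace_HT vW id l]])
  note lc = lin_map_comp[OF l gr_coact[OF W]]
  have "coact W (f v) = tmap HT W id f (coact V v)" if "v \<in> carrier V" for v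
    using that
  proof (induction rule: gr_induct[OF V, consumes 1, case_names homog add])
    case (homog m v)
    then show ?case
      using h[OF homog] tmap_tens[OF vspace_HT vV vspace_HT vW id l, of "tbasis m" v]
      by (simp add: homog_def id_def)
  next
    case (add v w)
    then show ?case by (simp add: lin_map_add[OF lt[unfolded id_def]] lin_map_add[OF lc] id_def)
  qed
  then show ?thesis using l e by (simp add: comod_hom_def)
qed

lemma halg_hom_ghom: "galg A \<Longrightarrow> galg B \<Longrightarrow> f \<in> halg_hom A B \<Longrightarrow> ghom A B f"
  using comod_hom_homog[OF galg_vspace galg_vspace, of A B f]
  by (auto simp: ghom_def halg_hom_def comod_hom_def)

lemma ghom_comp: "ghom A B f \<Longrightarrow> ghom B C g \<Longrightarrow> ghom A C (\<lambda>a. g (f a))"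
  by (auto simp: ghom_def lin_map_closed intro: lin_map_comp)

lemma ghom_cong: "ghom A B g \<Longrightarrow> vspace A \<Longrightarrow> \<one>\<^bsub>A\<^esub> \<in> carrier A \<Longrightarrow>
    (\<And>a b. a \<in> carrier A \<Longrightarrow> b \<in> carrier A \<Longrightarrow> a \<otimes>\<^bsub>A\<^esub> b \<in> carrier A) \<Longrightarrow>
    (\<And>a. a \<in> carrier A \<Longrightarrow> f a = g a) \<Longrightarrow> ghom A B f"
  by (auto simp: ghom_def homog_closed intro: lin_map_cong)

lemma ghom_coset:
  assumes A: "galg A" and I: "graded_ideal I A"
  shows "ghom A (hquot A I) ((+>\<^bsub>A\<^esub>) I)"
  unfolding ghom_def
  using lin_coset[OF A I] homog_coset[OF A I] coset_mult[OF A I] hquot_fields(5)[OF A I]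
  by auto

lemma halg_isoE:
  assumes "f \<in> halg_iso A B"
  shows "f \<in> halg_hom A B" "inj_on f (carrier A)" "f ` carrier A = carrier B"
proof -
  obtain g where g: "g \<in> halg_hom B A" "compose (carrier A) g f = (\<lambda>a\<in>carrier A. a)"
    "compose (carrier B) f g = (\<lambda>b\<in>carrier B. b)"
    using assms by (auto simp: halg_iso_def)
  show f: "f \<in> halg_hom A B" using assms by (simp add: halg_iso_def)
  have gf: "g (f a) = a" if "a \<in> carrier A" for a
    using fun_cong[OF g(2), of a] that by (simp add: compose_def)
  have fg: "f (g b) = b" if "b \<in> carrier B" for b
    using fun_cong[OF g(3), of b] that by (simp add: compose_def)
  show "inj_on f (carrier A)" using gf by (rule inj_on_inverseI)
  have "f a \<in> carrier B" if "a \<in> carrier A" for a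
    using f that by (auto simp: halg_hom_def comod_hom_def lin_map_def)
  moreover have "g b \<in> carrier A" if "b \<in> carrier B" for b
    using g(1) that by (auto simp: halg_hom_def comod_hom_def lin_map_def)
  ultimately show "f ` carrier A = carrier B" using fg by force
qed

section \<open>Free algebras and presentations\<close>

context
  fixes R :: "('k::field, 'n::finite) torus2 \<Rightarrow> 'k" and ms :: "(int ^ 'n) list"
begin

lemma free_rel_homog:
  assumes "i < length ms" "j < length ms"
  shows "homog (ncpoly_alg ms) (ms ! i + ms ! j)
    (ncgen i * ncgen j - psmult (R (tens HT HT (tbasis (ms ! j)) (tbasis (ms ! i)))) (ncgen j * ncgen i))"
proof -
  let ?A = "ncpoly_alg ms :: ('k, 'n, 'k ncpoly) hobj"
  let ?r = "R (tens HT HT (tbasis (ms ! j)) (tbasis (ms ! i)))"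
  have w: "Word [i] + Word [j] \<in> words (length ms)" "Word [j] + Word [i] \<in> words (length ms)"
    using assms by (auto simp: words_def)
  have d: "wdeg ms (Word [i] + Word [j]) = ms ! i + ms ! j" "wdeg ms (Word [j] + Word [i]) = ms ! i + ms ! j"
    by (simp_all add: wdeg_def algebra_simps)
  have "homog ?A (ms ! i + ms ! j) (Poly_Mapping.single (Word [i] + Word [j]) 1 \<oplus>\<^bsub>?A\<^esub> Poly_Mapping.single (Word [j] + Word [i]) (- ?r))"
    using homog_single[OF w(1), of 1] homog_single[OF w(2), of "- ?r"] homog_add[OF galg_gr[OF galg_ncpoly]]
    unfolding d by blast
  then show ?thesis by (simp add: ncgen_def mult_single single_uminus)
qed

lemma graded_free_ideal: "graded_ideal (free_ideal R ms) (ncpoly_alg ms)"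
  unfolding free_ideal_def by (rule genideal_graded[OF galg_ncpoly]) (use free_rel_homog in blast)

lemma galg_hfree: "galg (hfree R ms)"
  unfolding hfree_def by (rule galg_hquot[OF galg_ncpoly graded_free_ideal])

definition fpr :: "'k ncpoly \<Rightarrow> 'k ncpoly set" where
  "fpr p = free_ideal R ms +>\<^bsub>(ncpoly_alg ms :: ('k, 'n, 'k ncpoly) hobj)\<^esub> p"

lemma ghom_fpr: "ghom (ncpoly_alg ms) (hfree R ms) fpr"
  unfolding hfree_def fpr_def[abs_def] by (rule ghom_coset[OF galg_ncpoly graded_free_ideal])

lemma carrier_hfree: "carrier (hfree R ms) = fpr ` {p. Poly_Mapping.keys p \<subseteq> words (length ms)}"
  unfolding hfree_def fpr_def[abs_def] using hquot_fields(1)[OF galg_ncpoly graded_free_ideal] by simp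

lemma
  assumes "Poly_Mapping.keys p \<subseteq> words (length ms)"
  shows fpr_closed: "fpr p \<in> carrier (hfree R ms)"
    and fpr_smult: "fpr (psmult c p) = c \<odot>\<^bsub>hfree R ms\<^esub> fpr p"
    and fpr_add: "Poly_Mapping.keys q \<subseteq> words (length ms) \<Longrightarrow> fpr (p + q) = fpr p \<oplus>\<^bsub>hfree R ms\<^esub> fpr q"
    and fpr_mult: "Poly_Mapping.keys q \<subseteq> words (length ms) \<Longrightarrow> fpr (p * q) = fpr p \<otimes>\<^bsub>hfree R ms\<^esub> fpr q"
  using assms lin_map_closed[OF ghom_lin[OF ghom_fpr]] lin_map_smult[OF ghom_lin[OF ghom_fpr]]
    lin_map_add[OF ghom_lin[OF ghom_fpr]] ghom_mult[OF ghom_fpr] by simp_all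

lemma fpr_one: "fpr 1 = \<one>\<^bsub>hfree R ms\<^esub>" and fpr_zero: "fpr 0 = \<zero>\<^bsub>hfree R ms\<^esub>"
  using ghom_one[OF ghom_fpr] lin_map_zero[OF vspace_ncpoly galg_vspace[OF galg_hfree] ghom_lin[OF ghom_fpr]] by simp_all

lemma fpr_eq_iff:
  assumes "Poly_Mapping.keys p \<subseteq> words (length ms)" "Poly_Mapping.keys q \<subseteq> words (length ms)"
  shows "fpr p = fpr q \<longleftrightarrow> p - q \<in> free_ideal R ms"
proof -
  let ?A = "ncpoly_alg ms :: ('k, 'n, 'k ncpoly) hobj"
  have "p \<ominus>\<^bsub>?A\<^esub> q = p - q"
    using vs_minus[OF vspace_ncpoly, of q ms] assms by (simp add: a_minus_def)
  then show ?thesis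
    unfolding fpr_def using coset_eq_iff[OF galg_ncpoly graded_free_ideal, of p q] assms by simp
qed

lemma fpr_single_closed: "w \<in> words (length ms) \<Longrightarrow> fpr (Poly_Mapping.single w c) \<in> carrier (hfree R ms)"
  by (rule fpr_closed) auto

lemma fpr_single_homog: "w \<in> words (length ms) \<Longrightarrow> homog (hfree R ms) (wdeg ms w) (fpr (Poly_Mapping.single w c))"
  by (rule ghom_homog[OF ghom_fpr homog_single])

lemma hfree_induct [consumes 1, case_names single add]:
  assumes "X \<in> carrier (hfree R ms)"
    and "\<And>w c. w \<in> words (length ms) \<Longrightarrow> P (fpr (Poly_Mapping.single w c))"
    and "\<And>X Y. X \<in> carrier (hfree R ms) \<Longrightarrow> Y \<in> carrier (hfree R ms) \<Longrightarrow> P X \<Longrightarrow> P Y \<Longrightarrow> P (X \<oplus>\<^bsub>hfree R ms\<^esub> Y)"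
  shows "P X"
proof -
  obtain p where p: "X = fpr p" "Poly_Mapping.keys p \<subseteq> words (length ms)" using assms(1) carrier_hfree by auto
  have "P (fpr p)" using p(2)
  proof (induction rule: ncpoly_induct)
    case (single w c)
    then show ?case by (rule assms(2))
  next
    case (add p q)
    then show ?case using assms(3) by (simp add: fpr_add fpr_closed)
  qed
  then show ?thesis using p by simp
qed

lemma fgen_fpr: "fgen R ms i = fpr (ncgen i)"
  by (simp add: fgen_def fpr_def)

lemma ncgen_keys: "i < length ms \<Longrightarrow> Poly_Mapping.keys (ncgen i :: 'k ncpoly) \<subseteq> words (length ms)"
  by (auto simp: ncgen_def words_def)

text \<open>Words are built by multiplying with one generator on the left. This fits the braided
  Leibniz rule, whose scalar factor is determined by the degree of the left factor.\<close>

lemma hfree_gen_induct [consumes 1, case_names one gen smult add]: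
  assumes X: "X \<in> carrier (hfree R ms)"
    and one: "P \<one>\<^bsub>hfree R ms\<^esub>"
    and gen: "\<And>i X. i < length ms \<Longrightarrow> X \<in> carrier (hfree R ms) \<Longrightarrow> P X \<Longrightarrow> P (fgen R ms i \<otimes>\<^bsub>hfree R ms\<^esub> X)"
    and smult: "\<And>c X. X \<in> carrier (hfree R ms) \<Longrightarrow> P X \<Longrightarrow> P (c \<odot>\<^bsub>hfree R ms\<^esub> X)"
    and add: "\<And>X Y. X \<in> carrier (hfree R ms) \<Longrightarrow> Y \<in> carrier (hfree R ms) \<Longrightarrow> P X \<Longrightarrow> P Y \<Longrightarrow> P (X \<oplus>\<^bsub>hfree R ms\<^esub> Y)"
  shows "P X"
proof -
  have w: "P (fpr (Poly_Mapping.single (Word l) 1))" if "Word l \<in> words (length ms)" for l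
    using that
  proof (induction l)
    case Nil
    have "Poly_Mapping.single (Word []) 1 = (1 :: 'k ncpoly)"
      using zero_word_def by (metis single_one)
    then show ?case using one by (simp add: fpr_one)
  next
    case (Cons i l)
    then have l: "Word l \<in> words (length ms)" and i: "i < length ms" by (auto simp: words_def)
    have "Word (i # l) = Word [i] + Word l" by (simp add: plus_word_def)
    then have "Poly_Mapping.single (Word (i # l)) 1 = ncgen i * (Poly_Mapping.single (Word l) 1 :: 'k ncpoly)"
      by (simp add: ncgen_def mult_single)
    then show ?case
      using gen[OF i fpr_single_closed[OF l] Cons.IH[OF l]] fpr_mult[OF ncgen_keys[OF i], of "Poly_Mapping.single (Word l) 1"] l
      by (simp add: fgen_fpr)
  qed
  show ?thesis using X
  proof (induction rule: hfree_induct)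
    case (single w c)
    obtain l where l: "w = Word l" by (cases w)
    have "fpr (Poly_Mapping.single w c) = c \<odot>\<^bsub>hfree R ms\<^esub> fpr (Poly_Mapping.single w 1)"
      using single fpr_smult[of "Poly_Mapping.single w 1" c] by simp
    then show ?case using smult[OF fpr_single_closed w] single l by simp
  next
    case (add X Y)
    then show ?case by (rule assms(5))
  qed
qed

lemma fgen_closed: "i < length ms \<Longrightarrow> fgen R ms i \<in> carrier (hfree R ms)"
  unfolding fgen_fpr by (intro fpr_closed ncgen_keys)

lemma fgen_homog: "i < length ms \<Longrightarrow> homog (hfree R ms) (ms ! i) (fgen R ms i)"
  using fpr_single_homog[of "Word [i]" 1] by (simp add: fgen_fpr ncgen_def wdeg_def words_def)

lemma graded_rel_ideal:
  assumes "hpresents R A ms fs \<phi>"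
  shows "graded_ideal (rel_ideal R ms fs) (hfree R ms)"
  unfolding rel_ideal_def
  by (rule genideal_graded[OF galg_hfree]) (use assms in \<open>auto simp: hpresents_def homog_def\<close>)

text \<open>As \<open>\<phi>\<close> is an isomorphism, its composite with the quotient map is onto
  \<open>A\<close> with kernel exactly the ideal of relations. Elements of \<open>A\<close> are
  handled below through preimages in the free algebra.\<close>

lemma
  assumes A: "galg A" and p: "hpresents R A ms fs \<phi>"
  shows pres_ghom: "ghom (hfree R ms) A (pres_proj R ms fs \<phi>)"
    and pres_surj: "pres_proj R ms fs \<phi> ` carrier (hfree R ms) = carrier A"
    and pres_ker: "w \<in> carrier (hfree R ms) \<Longrightarrow> pres_proj R ms fs \<phi> w = \<zero>\<^bsub>A\<^esub> \<longleftrightarrow> w \<in> rel_ideal R ms fs"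
proof -
  let ?F = "hfree R ms" and ?I = "rel_ideal R ms fs"
  note gI = graded_rel_ideal[OF p]
  note gQ = galg_hquot[OF galg_hfree gI]
  have \<phi>: "\<phi> \<in> halg_iso (hquot ?F ?I) A" using p by (simp add: hpresents_def)
  note iso = halg_isoE[OF \<phi>]
  have g\<phi>: "ghom (hquot ?F ?I) A \<phi>" by (rule halg_hom_ghom[OF gQ A iso(1)])
  have e: "pres_proj R ms fs \<phi> = (\<lambda>w. \<phi> (?I +>\<^bsub>?F\<^esub> w))" by (intro ext) (simp add: pres_proj_def)
  show "ghom (hfree R ms) A (pres_proj R ms fs \<phi>)"
    unfolding e by (rule ghom_comp[OF ghom_coset[OF galg_hfree gI] g\<phi>])
  note c = hquot_fields(1)[OF galg_hfree gI]
  show "pres_proj R ms fs \<phi> ` carrier ?F = carrier A"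
    unfolding e iso(3)[symmetric] c by (simp add: image_image)
  assume w: "w \<in> carrier ?F"
  have z: "\<phi> ?I = \<zero>\<^bsub>A\<^esub>"
    using lin_map_zero[OF galg_vspace[OF gQ] galg_vspace[OF A] ghom_lin[OF g\<phi>]] hquot_fields(2)[OF galg_hfree gI] by simp
  have "?I \<in> carrier (hquot ?F ?I)"
    using vs_zero_closed[OF galg_vspace[OF gQ]] hquot_fields(2)[OF galg_hfree gI] by simp
  then have "\<phi> (?I +>\<^bsub>?F\<^esub> w) = \<zero>\<^bsub>A\<^esub> \<longleftrightarrow> ?I +>\<^bsub>?F\<^esub> w = ?I"
    unfolding z[symmetric] using inj_onD[OF iso(2), of "?I +>\<^bsub>?F\<^esub> w" ?I] w c by auto
  then show "pres_proj R ms fs \<phi> w = \<zero>\<^bsub>A\<^esub> \<longleftrightarrow> w \<in> ?I"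
    using coset_zero[OF galg_hfree gI w] by (simp add: e)
qed

end

lemma homog_diff:
  assumes V: "gr V" and v: "homog V m v" and w: "homog V m w"
  shows "homog V m (v \<ominus>\<^bsub>V\<^esub> w)"
  using homog_add[OF V v homog_smult[OF V w, of "- 1"]] vs_minus[OF gr_vspace[OF V] homog_closed[OF w]]
  by (simp add: a_minus_def)

text \<open>Exchanging \<open>s\<close> with an element of degree \<open>m\<close> costs
  \<open>bch R m 0 = 1\<close>, so coinvariants are central. This is what makes commutative
  arguments available for localizations.\<close>

lemma coinv_central:
  fixes A :: "('k::field, 'n::finite, 'a) hobj"
  assumes R: "cotriangular R" and A: "halgebra R A" and s: "homog A 0 s" and a: "a \<in> carrier A"
  shows "s \<otimes>\<^bsub>A\<^esub> a = a \<otimes>\<^bsub>A\<^esub> s"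
  using a
proof (induction rule: gr_induct[OF galg_gr[OF halgebra_galg[OF A]], consumes 1, case_names homog add])
  case (homog m a)
  note g = halgebra_galg[OF A]
  show ?case
    using halgebra_braid[OF R A s homog] bch_0_r[OF R] galg_vspace[OF g] galg_mult_closed[OF g]
      homog_closed[OF homog] homog_closed[OF s] by simp
next
  case (add v w)
  interpret A: ring A by (rule galg_ring[OF halgebra_galg[OF A]])
  show ?case using add homog_closed[OF s] by (simp add: A.l_distr A.r_distr)
qed

section \<open>Localizations\<close>

lemma ghom_pow:
  assumes A: "ring A" and B: "ring B" and f: "ghom A B f" and s: "s \<in> carrier A"
  shows "f (s [^]\<^bsub>A\<^esub> (k :: nat)) = f s [^]\<^bsub>B\<^esub> k"
proof -
  interpret A: ring A by fact
  interpret B: ring B by fact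
  show ?thesis by (induction k) (use s in \<open>auto simp: ghom_one[OF f] ghom_mult[OF f]\<close>)
qed

lemma central_pow:
  assumes "ring A" "s \<in> carrier A" "\<And>a. a \<in> carrier A \<Longrightarrow> s \<otimes>\<^bsub>A\<^esub> a = a \<otimes>\<^bsub>A\<^esub> s" "a \<in> carrier A"
  shows "s [^]\<^bsub>A\<^esub> (k :: nat) \<otimes>\<^bsub>A\<^esub> a = a \<otimes>\<^bsub>A\<^esub> s [^]\<^bsub>A\<^esub> k"
proof -
  interpret A: ring A by fact
  show ?thesis
  proof (induction k)
    case (Suc k)
    have "s [^]\<^bsub>A\<^esub> Suc k \<otimes>\<^bsub>A\<^esub> a = s [^]\<^bsub>A\<^esub> k \<otimes>\<^bsub>A\<^esub> a \<otimes>\<^bsub>A\<^esub> s"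
      using assms(2,4) assms(3)[OF assms(4)] by (simp add: A.m_assoc)
    also have "\<dots> = a \<otimes>\<^bsub>A\<^esub> s [^]\<^bsub>A\<^esub> Suc k" using assms(2,4) Suc by (simp add: A.m_assoc)
    finally show ?case .
  qed (use assms in simp)
qed

lemma pow_kill:
  assumes "ring A" "s \<in> carrier A" "a \<in> carrier A" "s [^]\<^bsub>A\<^esub> (k :: nat) \<otimes>\<^bsub>A\<^esub> a = \<zero>\<^bsub>A\<^esub>" "k \<le> l"
  shows "s [^]\<^bsub>A\<^esub> l \<otimes>\<^bsub>A\<^esub> a = \<zero>\<^bsub>A\<^esub>"
proof -
  interpret A: ring A by fact
  have "s [^]\<^bsub>A\<^esub> l = s [^]\<^bsub>A\<^esub> (l - k) \<otimes>\<^bsub>A\<^esub> s [^]\<^bsub>A\<^esub> k"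
    using assms by (simp add: A.nat_pow_mult)
  then show ?thesis using assms by (simp add: A.m_assoc)
qed

definition xpow :: "(('k::field, 'n::finite) torus2 \<Rightarrow> 'k) \<Rightarrow> nat \<Rightarrow> 'k ncpoly set" where
  "xpow R k = fpr R [0] (Poly_Mapping.single (Word (replicate k 0)) 1)"

context
  fixes R :: "('k::field, 'n::finite) torus2 \<Rightarrow> 'k"
    and A :: "('k, 'n, 'a) hobj" and s :: 'a
  assumes R: "cotriangular R" and A: "halgebra R A" and s: "homog A 0 s"
begin

lemma words_1: "w \<in> words (Suc 0) \<Longrightarrow> w = Word (replicate (length (letters w)) 0)"
  by (cases w) (auto simp: words_def subset_iff intro!: replicate_eqI)

text \<open>With one generator of degree 0 the only commutation relation reads
  \<open>x * x = x * x\<close>, because \<open>R\<close> is 1 on units. Hence the free algebra is an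
  ordinary polynomial ring and its cosets are singletons.\<close>

lemma free_ideal_0: "free_ideal R [0] = {0}"
proof -
  interpret ring "ncpoly_alg [0] :: ('k, 'n, 'k ncpoly) hobj" by (rule ring_ncpoly)
  have "R (tens HT HT (tbasis 0) (tbasis 0)) = 1"
    using bch_0_l[OF R, of 0] by (simp add: bch_def)
  then have "{ncgen i * ncgen j - psmult (R (tens HT HT (tbasis ([0] ! j)) (tbasis ([0] ! i)))) (ncgen j * ncgen i)
        | i j. i < length [0 :: int ^ 'n] \<and> j < length [0 :: int ^ 'n]} = {0 :: 'k ncpoly}"
    by auto
  then show ?thesis unfolding free_ideal_def using genideal_zero by simp
qed

lemma fpr_0: "fpr R [0] p = {p}"
  by (simp add: fpr_def free_ideal_0 a_r_coset_def')

lemma xpow_closed: "xpow R k \<in> carrier (hfree R [0])"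
  and xpow_homog: "homog (hfree R [0]) 0 (xpow R k)"
  and xpow_single: "xpow R k = {Poly_Mapping.single (Word (replicate k 0)) 1}"
proof -
  have w: "Word (replicate k 0) \<in> words (length [0 :: int ^ 'n])" by (auto simp: words_def)
  have d: "wdeg [0 :: int ^ 'n] (Word (replicate k 0)) = 0" by (induction k) (auto simp: wdeg_def)
  show "xpow R k \<in> carrier (hfree R [0])" "homog (hfree R [0]) 0 (xpow R k)"
    using fpr_single_closed[OF w] fpr_single_homog[OF w] d by (simp_all add: xpow_def)
qed (simp add: xpow_def fpr_0)

lemma xpow_mult: "xpow R k \<otimes>\<^bsub>hfree R [0]\<^esub> xpow R l = xpow R (k + l)"
proof -
  have w: "Poly_Mapping.keys (Poly_Mapping.single (Word (replicate k 0)) (1::'k)) \<subseteq> words (length [0 :: int ^ 'n])" for k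
    by (auto simp: words_def)
  show ?thesis
    unfolding xpow_def fpr_mult[OF w w, symmetric] by (simp add: mult_single plus_word_def replicate_add)
qed

lemma xpow_0: "xpow R 0 = \<one>\<^bsub>hfree R [0]\<^esub>"
proof -
  have "Poly_Mapping.single (Word []) 1 = (1 :: 'k ncpoly)" using zero_word_def by (metis single_one)
  then show ?thesis by (simp add: xpow_def fpr_one)
qed

lemma xpow_1: "xpow R (Suc 0) = fgen R [0] 0"
  by (simp add: xpow_def fgen_fpr ncgen_def)

section \<open>Polynomials over \<open>A\<close> in the central variable of degree 0\<close>

private abbreviation (input) "P \<equiv> hcoprod R A (hfree R [0])"
private abbreviation (input) "T \<equiv> tensor A (hfree R [0])"
private abbreviation (input) "ax a k \<equiv> tens A (hfree R [0]) a (xpow R k)"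

interpretation A: ring A by (rule galg_ring[OF halgebra_galg[OF A]])

lemmas loc_gA = halgebra_galg[OF A]
lemmas loc_gP = galg_hcoprod[OF R loc_gA galg_hfree]
lemmas loc_vA = galg_vspace[OF loc_gA]
lemmas loc_vF = galg_vspace[OF galg_hfree[of R "[0]"]]

lemma s_closed: "s \<in> carrier A"
  by (rule homog_closed[OF s])

lemma s_central: "a \<in> carrier A \<Longrightarrow> s \<otimes>\<^bsub>A\<^esub> a = a \<otimes>\<^bsub>A\<^esub> s"
  by (rule coinv_central[OF R A s])

lemma s_pow_central: "a \<in> carrier A \<Longrightarrow> s [^]\<^bsub>A\<^esub> (k :: nat) \<otimes>\<^bsub>A\<^esub> a = a \<otimes>\<^bsub>A\<^esub> s [^]\<^bsub>A\<^esub> k"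
  by (rule central_pow[OF A.ring_axioms s_closed]) (use s_central in auto)

lemma ax_closed: "a \<in> carrier A \<Longrightarrow> ax a k \<in> carrier T"
  by (rule tens_closed[OF loc_vA loc_vF _ xpow_closed])

text \<open>The powers of the variable have degree 0, so moving them past \<open>a'\<close> gives no
  braiding factor.\<close>

lemma ax_mult:
  assumes a: "a \<in> carrier A" and a': "a' \<in> carrier A"
  shows "ax a k \<otimes>\<^bsub>P\<^esub> ax a' l = ax (a \<otimes>\<^bsub>A\<^esub> a') (k + l)"
  using a'
proof (induction rule: gr_induct[OF galg_gr[OF loc_gA], consumes 1, case_names homog add])
  case (homog m b)
  show ?case
    using hcoprod_tens[OF R loc_gA galg_hfree a xpow_homog homog xpow_closed] homog_closed[OF homog] a
      vspace_tensor[OF loc_vA loc_vF] ax_closed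
    by (simp add: bch_0_r[OF R] xpow_mult)
next
  case (add v w)
  note bl = lin_map_add[OF bilin_l[OF bilin_tens[OF loc_vA loc_vF] xpow_closed]]
  show ?case using add a ax_closed lin_map_add[OF bilin_r[OF bilin_hcoprod[OF R loc_gA galg_hfree] ax_closed[OF a]]]
    by (simp add: bl A.r_distr)
qed

lemma ax_induct [consumes 1, case_names ax add]:
  assumes z: "z \<in> carrier T"
    and ax: "\<And>a k. a \<in> carrier A \<Longrightarrow> Q (ax a k)"
    and add: "\<And>y z. y \<in> carrier T \<Longrightarrow> z \<in> carrier T \<Longrightarrow> Q y \<Longrightarrow> Q z \<Longrightarrow> Q (y \<oplus>\<^bsub>T\<^esub> z)"
  shows "Q z"
  using z
proof (induction rule: tensor_induct[OF loc_vA loc_vF, consumes 1, case_names tens add])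
  case (tens a X)
  note bt = bilin_tens[OF loc_vA loc_vF]
  show ?case using tens(2)
  proof (induction rule: hfree_induct)
    case (single w c)
    have "fpr R [0] (Poly_Mapping.single w c) = c \<odot>\<^bsub>hfree R [0]\<^esub> xpow R (length (letters w))"
      using fpr_smult[of "Poly_Mapping.single w 1" "[0]" R c] single words_1[of w] by (simp add: xpow_def)
    then have "tens A (hfree R [0]) a (fpr R [0] (Poly_Mapping.single w c)) = ax (c \<odot>\<^bsub>A\<^esub> a) (length (letters w))"
      using tens xpow_closed lin_map_smult[OF bilin_l[OF bt]] lin_map_smult[OF bilin_r[OF bt]] by simp
    then show ?case using ax tens loc_vA by simp
  next
    case (add X Y)
    then show ?case
      using tens assms(3) lin_map_add[OF bilin_r[OF bt tens(1)]] tens_closed[OF loc_vA loc_vF tens(1)] by simp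
  qed
next
  case (add S T)
  then show ?case by (rule assms(3))
qed

text \<open>
  Homogenization: for \<open>m\<close> above the degree in \<open>x\<close>, this is \<open>s\<^sup>m\<close> times the value at \<open>x = 1/s\<close>, computed
  inside \<open>A\<close>. It detects the kernel of the localization map.
\<close>

definition hgz :: "nat \<Rightarrow> (('a \<times> 'k ncpoly set) \<Rightarrow>\<^sub>0 'k) set \<Rightarrow> 'a" where
  "hgz m = tlift A (\<lambda>a X. fsum A (\<lambda>w. s [^]\<^bsub>A\<^esub> (m - length (letters w)) \<otimes>\<^bsub>A\<^esub> a) (rep X))"

text \<open>Cosets in the polynomial ring are singletons, so \<open>rep\<close> returns the
  polynomial itself and linearity in \<open>X\<close> is that of \<open>fsum\<close>. Truncated
  subtraction gives monomials above degree \<open>m\<close> the factor \<open>s\<close> to the power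
  0; linearity thus holds for every \<open>m\<close>.\<close>

lemma bilin_hgz:
  "bilin A (hfree R [0]) A (\<lambda>a X. fsum A (\<lambda>w. s [^]\<^bsub>A\<^esub> (m - length (letters w)) \<otimes>\<^bsub>A\<^esub> a) (rep X))"
proof (rule bilinI)
  have rep: "rep {p} = p" for p :: "'k ncpoly" by (simp add: rep_def)
  have sa: "s [^]\<^bsub>A\<^esub> k \<in> carrier A" for k :: nat using s_closed by simp
  fix a assume a: "a \<in> carrier A"
  let ?g = "\<lambda>w. s [^]\<^bsub>A\<^esub> (m - length (letters w)) \<otimes>\<^bsub>A\<^esub> a"
  have g: "?g \<in> UNIV \<rightarrow> carrier A" using a sa by auto
  show "lin_map (hfree R [0]) A (\<lambda>X. fsum A ?g (rep X))"
  proof (rule lin_mapI)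
    fix X c assume X: "X \<in> carrier (hfree R [0])"
    then obtain p where p: "X = fpr R [0] p" "Poly_Mapping.keys p \<subseteq> words (length [0 :: int ^ 'n])"
      unfolding carrier_hfree by auto
    show "fsum A ?g (rep X) \<in> carrier A" using fsum_closed[OF loc_vA g] by simp
    have e: "c \<odot>\<^bsub>hfree R [0]\<^esub> X = fpr R [0] (psmult c p)" unfolding p(1) by (rule fpr_smult[OF p(2), symmetric])
    show "fsum A ?g (rep (c \<odot>\<^bsub>hfree R [0]\<^esub> X)) = c \<odot>\<^bsub>A\<^esub> fsum A ?g (rep X)"
      unfolding e unfolding p(1) fpr_0 rep using fsum_psmult[OF loc_vA g] by simp
    fix Y assume Y: "Y \<in> carrier (hfree R [0])"
    then obtain q where q: "Y = fpr R [0] q" "Poly_Mapping.keys q \<subseteq> words (length [0 :: int ^ 'n])"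
      unfolding carrier_hfree by auto
    have e: "X \<oplus>\<^bsub>hfree R [0]\<^esub> Y = fpr R [0] (p + q)" unfolding p(1) q(1) by (rule fpr_add[OF p(2) q(2), symmetric])
    show "fsum A ?g (rep (X \<oplus>\<^bsub>hfree R [0]\<^esub> Y)) = fsum A ?g (rep X) \<oplus>\<^bsub>A\<^esub> fsum A ?g (rep Y)"
      unfolding e unfolding p(1) q(1) fpr_0 rep using fsum_add[OF loc_vA g] by simp
  qed
next
  fix X
  show "lin_map A A (\<lambda>a. fsum A (\<lambda>w. s [^]\<^bsub>A\<^esub> (m - length (letters w)) \<otimes>\<^bsub>A\<^esub> a) (rep X))"
    unfolding fsum_def
    by (intro lin_map_fin lin_map_scale loc_vA bilin_r[OF bilin_mult[OF loc_gA]]) (simp add: s_closed)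
qed

lemma lin_hgz: "lin_map T A (hgz m)"
  unfolding hgz_def by (rule lin_tlift[OF loc_vA loc_vF loc_vA bilin_hgz])

lemma hgz_ax: "a \<in> carrier A \<Longrightarrow> hgz m (ax a k) = s [^]\<^bsub>A\<^esub> (m - k) \<otimes>\<^bsub>A\<^esub> a"
proof -
  assume a: "a \<in> carrier A"
  let ?g = "\<lambda>w. s [^]\<^bsub>A\<^esub> (m - length (letters w)) \<otimes>\<^bsub>A\<^esub> a"
  have g: "?g \<in> UNIV \<rightarrow> carrier A" using a s_closed by auto
  have r: "rep (xpow R k) = Poly_Mapping.single (Word (replicate k 0)) 1"
    by (simp add: xpow_single rep_def)
  show ?thesis
    unfolding hgz_def tlift_tens[OF loc_vA loc_vF loc_vA bilin_hgz a xpow_closed] r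
    using fsum_single[OF loc_vA g] a s_closed loc_vA by simp
qed

text \<open>Multiplication by \<open>b x^k\<close> uses up \<open>k\<close> of the \<open>m\<close>
  available powers of \<open>s\<close>. The underlying identity
  \<open>m - (k + l) = m - k - l\<close> also holds for truncated subtraction, so \<open>m\<close>
  needs no lower bound.\<close>

lemma hgz_mult:
  assumes z: "z \<in> carrier T" and b: "b \<in> carrier A"
  shows "hgz m (ax b k \<otimes>\<^bsub>P\<^esub> z) = b \<otimes>\<^bsub>A\<^esub> hgz (m - k) z"
    and "hgz m (z \<otimes>\<^bsub>P\<^esub> ax b k) = hgz (m - k) z \<otimes>\<^bsub>A\<^esub> b"
proof -
  note bm = bilin_hcoprod[OF R loc_gA galg_hfree[of R "[0]"]]
  note cp = s_pow_central
  show "hgz m (ax b k \<otimes>\<^bsub>P\<^esub> z) = b \<otimes>\<^bsub>A\<^esub> hgz (m - k) z"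
    using z
  proof (induction rule: ax_induct)
    case (ax a l)
    then show ?case
      using b s_closed cp[OF b, of "m - k - l", symmetric]
      by (simp add: ax_mult hgz_ax A.m_assoc[symmetric])
  next
    case (add y z)
    then show ?case
      using b ax_closed[OF b] lin_map_closed[OF lin_hgz] bilin_closed[OF bm ax_closed[OF b]]
      by (simp add: lin_map_add[OF bilin_r[OF bm ax_closed[OF b]]] lin_map_add[OF lin_hgz] A.r_distr)
  qed
  show "hgz m (z \<otimes>\<^bsub>P\<^esub> ax b k) = hgz (m - k) z \<otimes>\<^bsub>A\<^esub> b"
    using z
  proof (induction rule: ax_induct)
    case (ax a l)
    then show ?case using b s_closed by (simp add: ax_mult hgz_ax A.m_assoc add.commute)
  next
    case (add y z)
    then show ?case
      using b ax_closed[OF b] lin_map_closed[OF lin_hgz] bilin_closed[OF bm _ ax_closed[OF b]]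
      by (simp add: lin_map_add[OF bilin_l[OF bm ax_closed[OF b]]] lin_map_add[OF lin_hgz] A.l_distr)
  qed
qed

section \<open>Kernel and fractions of a localization\<close>

lemma graded_loc_ideal: "graded_ideal (loc_ideal R A s) P"
  unfolding loc_ideal_def
proof (rule genideal_graded[OF loc_gP])
  let ?x = "tens A (hfree R [0]) s (fgen R [0] 0)"
  have "homog P (0 + 0) ?x"
    using homog_tens[OF galg_gr[OF loc_gA] galg_gr[OF galg_hfree] s xpow_homog[of "Suc 0"]] by (simp add: xpow_1)
  then have "homog P 0 (?x \<ominus>\<^bsub>P\<^esub> \<one>\<^bsub>P\<^esub>)"
    using homog_diff[OF galg_gr[OF loc_gP] _ galg_homog_one[OF loc_gP]] by simp
  then show "\<exists>m. homog P m t" if "t \<in> {?x \<ominus>\<^bsub>P\<^esub> \<one>\<^bsub>P\<^esub>}" for t using that by auto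
qed

text \<open>The polynomials whose homogenizations are \<open>s\<close>-power torsion for all large
  \<open>m\<close> form a two-sided ideal \<open>J\<close>, by \<open>hgz_mult\<close> and
  centrality of \<open>s\<close>. It contains the generator \<open>s x - 1\<close>, whose
  homogenization vanishes, and so contains the localization ideal.\<close>

lemma loc_ideal_torsion:
  assumes z: "z \<in> loc_ideal R A s"
  shows "\<exists>n. \<forall>m\<ge>n. \<exists>k :: nat. s [^]\<^bsub>A\<^esub> k \<otimes>\<^bsub>A\<^esub> hgz m z = \<zero>\<^bsub>A\<^esub>"
proof -
  interpret P: ring P by (rule galg_ring[OF loc_gP])
  note vT = vspace_tensor[OF loc_vA loc_vF]
  note cp = s_pow_central
  define tor where "tor a \<longleftrightarrow> a \<in> carrier A \<and> (\<exists>k :: nat. s [^]\<^bsub>A\<^esub> k \<otimes>\<^bsub>A\<^esub> a = \<zero>\<^bsub>A\<^esub>)" for a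
  have tor_add: "tor (a \<oplus>\<^bsub>A\<^esub> b)" if a: "tor a" and b: "tor b" for a b
  proof -
    obtain k l :: nat where "s [^]\<^bsub>A\<^esub> k \<otimes>\<^bsub>A\<^esub> a = \<zero>\<^bsub>A\<^esub>" "s [^]\<^bsub>A\<^esub> l \<otimes>\<^bsub>A\<^esub> b = \<zero>\<^bsub>A\<^esub>"
      using a b by (auto simp: tor_def)
    then have "s [^]\<^bsub>A\<^esub> (k + l) \<otimes>\<^bsub>A\<^esub> a = \<zero>\<^bsub>A\<^esub>" "s [^]\<^bsub>A\<^esub> (k + l) \<otimes>\<^bsub>A\<^esub> b = \<zero>\<^bsub>A\<^esub>"
      using a b s_closed by (auto simp: tor_def intro: pow_kill[OF A.ring_axioms])
    then have "s [^]\<^bsub>A\<^esub> (k + l) \<otimes>\<^bsub>A\<^esub> (a \<oplus>\<^bsub>A\<^esub> b) = \<zero>\<^bsub>A\<^esub>"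
      using a b s_closed by (simp add: tor_def A.r_distr)
    then show ?thesis using a b unfolding tor_def by blast
  qed
  have tor_l: "tor (b \<otimes>\<^bsub>A\<^esub> a)" if a: "tor a" and b: "b \<in> carrier A" for a b
  proof -
    obtain k :: nat where k: "s [^]\<^bsub>A\<^esub> k \<otimes>\<^bsub>A\<^esub> a = \<zero>\<^bsub>A\<^esub>" using a by (auto simp: tor_def)
    have "s [^]\<^bsub>A\<^esub> k \<otimes>\<^bsub>A\<^esub> (b \<otimes>\<^bsub>A\<^esub> a) = b \<otimes>\<^bsub>A\<^esub> (s [^]\<^bsub>A\<^esub> k \<otimes>\<^bsub>A\<^esub> a)"
      using a b s_closed cp[OF b, of k] by (simp add: tor_def A.m_assoc[symmetric])
    then show ?thesis using a b k by (auto simp: tor_def)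
  qed
  have tor_r: "tor (a \<otimes>\<^bsub>A\<^esub> b)" if a: "tor a" and b: "b \<in> carrier A" for a b
  proof -
    obtain k :: nat where k: "s [^]\<^bsub>A\<^esub> k \<otimes>\<^bsub>A\<^esub> a = \<zero>\<^bsub>A\<^esub>" using a by (auto simp: tor_def)
    have "s [^]\<^bsub>A\<^esub> k \<otimes>\<^bsub>A\<^esub> (a \<otimes>\<^bsub>A\<^esub> b) = s [^]\<^bsub>A\<^esub> k \<otimes>\<^bsub>A\<^esub> a \<otimes>\<^bsub>A\<^esub> b"
      using a b s_closed by (simp add: tor_def A.m_assoc)
    then show ?thesis using a b k by (auto simp: tor_def)
  qed
  define J where "J = {z \<in> carrier T. \<exists>n. \<forall>m\<ge>n. tor (hgz m z)}"
  have J_add: "y \<oplus>\<^bsub>T\<^esub> z \<in> J" if y: "y \<in> J" and z: "z \<in> J" for y z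
  proof -
    obtain n n' where "\<forall>m\<ge>n. tor (hgz m y)" "\<forall>m\<ge>n'. tor (hgz m z)" using y z by (auto simp: J_def)
    then have "\<forall>m\<ge>max n n'. tor (hgz m (y \<oplus>\<^bsub>T\<^esub> z))"
      using y z tor_add by (simp add: J_def lin_map_add[OF lin_hgz])
    moreover have "y \<oplus>\<^bsub>T\<^esub> z \<in> carrier T" using y z vT by (simp add: J_def)
    ultimately show ?thesis unfolding J_def by blast
  qed
  have J_zero: "\<zero>\<^bsub>T\<^esub> \<in> J"
  proof -
    have "tor \<zero>\<^bsub>A\<^esub>" using s_closed by (auto simp: tor_def intro!: exI[of _ 0])
    then show ?thesis using vT by (simp add: J_def lin_map_zero[OF vT loc_vA lin_hgz])
  qed
  have J_l: "ax b k \<otimes>\<^bsub>P\<^esub> z \<in> J" and J_r: "z \<otimes>\<^bsub>P\<^esub> ax b k \<in> J" if z: "z \<in> J" and b: "b \<in> carrier A" for b k z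
  proof -
    obtain n where n: "\<forall>m\<ge>n. tor (hgz m z)" using z by (auto simp: J_def)
    have "\<forall>m\<ge>n+k. tor (hgz m (ax b k \<otimes>\<^bsub>P\<^esub> z)) \<and> tor (hgz m (z \<otimes>\<^bsub>P\<^esub> ax b k))"
    proof (intro allI impI)
      fix m assume "n + k \<le> m"
      then have t: "tor (hgz (m - k) z)" using n by simp
      have zT: "z \<in> carrier T" using z by (simp add: J_def)
      show "tor (hgz m (ax b k \<otimes>\<^bsub>P\<^esub> z)) \<and> tor (hgz m (z \<otimes>\<^bsub>P\<^esub> ax b k))"
        using tor_l[OF t b] tor_r[OF t b] by (simp add: hgz_mult[OF zT b])
    qed
    then show "ax b k \<otimes>\<^bsub>P\<^esub> z \<in> J" "z \<otimes>\<^bsub>P\<^esub> ax b k \<in> J"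
      using z bilin_closed[OF bilin_hcoprod[OF R loc_gA galg_hfree]] ax_closed[OF b] unfolding J_def by auto
  qed
  have "ideal J P"
  proof (rule idealI)
    show "ring P" by (rule P.ring_axioms)
    show "subgroup J (add_monoid P)"
    proof (rule P.add.subgroupI)
      show "J \<subseteq> carrier P" by (auto simp: J_def)
      show "J \<noteq> {}" using J_zero by blast
      show "y \<oplus>\<^bsub>P\<^esub> z \<in> J" if "y \<in> J" "z \<in> J" for y z using J_add that by simp
      show "\<ominus>\<^bsub>P\<^esub> z \<in> J" if z: "z \<in> J" for z
      proof -
        have zT: "z \<in> carrier T" using z by (simp add: J_def)
        have "\<ominus>\<^bsub>P\<^esub> z = (- 1) \<odot>\<^bsub>P\<^esub> z" using vs_minus[OF galg_vspace[OF loc_gP]] zT by simp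
        also have "\<dots> = (- 1) \<odot>\<^bsub>P\<^esub> (\<one>\<^bsub>P\<^esub> \<otimes>\<^bsub>P\<^esub> z)" using zT P.l_one[of z] by simp
        also have "\<dots> = ((- 1) \<odot>\<^bsub>P\<^esub> \<one>\<^bsub>P\<^esub>) \<otimes>\<^bsub>P\<^esub> z"
          by (rule galg_smult_l[OF loc_gP galg_one_closed[OF loc_gP], symmetric]) (use zT in simp)
        also have "(- 1) \<odot>\<^bsub>P\<^esub> \<one>\<^bsub>P\<^esub> = ax ((- 1) \<odot>\<^bsub>A\<^esub> \<one>\<^bsub>A\<^esub>) 0"
          using lin_map_smult[OF bilin_l[OF bilin_tens[OF loc_vA loc_vF] xpow_closed]]
          by (simp add: xpow_0[symmetric])
        finally show ?thesis using J_l[OF z] loc_vA by simp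
      qed
    qed
    fix z y assume z: "z \<in> J" and "y \<in> carrier P"
    then have y: "y \<in> carrier T" by simp
    have zT: "z \<in> carrier T" using z by (simp add: J_def)
    show "y \<otimes>\<^bsub>P\<^esub> z \<in> J" using y
      by (induction rule: ax_induct)
        (use z zT J_l J_add lin_map_add[OF bilin_l[OF bilin_hcoprod[OF R loc_gA galg_hfree] zT]] in auto)
    show "z \<otimes>\<^bsub>P\<^esub> y \<in> J" using y
      by (induction rule: ax_induct)
        (use z zT J_r J_add lin_map_add[OF bilin_r[OF bilin_hcoprod[OF R loc_gA galg_hfree] zT]] in auto)
  qed
  moreover have "tens A (hfree R [0]) s (fgen R [0] 0) \<ominus>\<^bsub>P\<^esub> \<one>\<^bsub>P\<^esub> \<in> J"
  proof -
    have e: "tens A (hfree R [0]) s (fgen R [0] 0) = ax s (Suc 0)" "\<one>\<^bsub>P\<^esub> = ax \<one>\<^bsub>A\<^esub> 0"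
      unfolding xpow_1 xpow_0 by simp_all
    have c: "ax s (Suc 0) \<in> carrier P" "ax \<one>\<^bsub>A\<^esub> 0 \<in> carrier P" using ax_closed s_closed by auto
    have lP: "lin_map P A (hgz m)" for m using lin_hgz by simp
    \<comment> \<open>The bound matters: for \<open>m = 0\<close> truncated subtraction would
      produce \<open>s - 1\<close> instead of zero.\<close>
    have "hgz m (ax s (Suc 0) \<ominus>\<^bsub>P\<^esub> ax \<one>\<^bsub>A\<^esub> 0) = \<zero>\<^bsub>A\<^esub>" if m: "m \<ge> 1" for m
    proof -
      have "hgz m (ax s (Suc 0) \<ominus>\<^bsub>P\<^esub> ax \<one>\<^bsub>A\<^esub> 0) = hgz m (ax s (Suc 0)) \<ominus>\<^bsub>A\<^esub> hgz m (ax \<one>\<^bsub>A\<^esub> 0)"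
        by (rule lin_map_diff[OF galg_vspace[OF loc_gP] loc_vA lP c])
      also have "\<dots> = s [^]\<^bsub>A\<^esub> (m - 1) \<otimes>\<^bsub>A\<^esub> s \<ominus>\<^bsub>A\<^esub> s [^]\<^bsub>A\<^esub> m"
        using s_closed by (simp add: hgz_ax)
      also have "s [^]\<^bsub>A\<^esub> (m - 1) \<otimes>\<^bsub>A\<^esub> s = s [^]\<^bsub>A\<^esub> m" using m by (cases m) auto
      finally show ?thesis using s_closed by (simp add: a_minus_def A.r_neg)
    qed
    moreover have "tor \<zero>\<^bsub>A\<^esub>" using s_closed by (auto simp: tor_def intro!: exI[of _ 0])
    moreover have "ax s (Suc 0) \<ominus>\<^bsub>P\<^esub> ax \<one>\<^bsub>A\<^esub> 0 \<in> carrier T" using P.minus_closed[OF c] by simp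
    ultimately show ?thesis unfolding e J_def by (auto intro!: exI[of _ 1])
  qed
  ultimately have "loc_ideal R A s \<subseteq> J"
    unfolding loc_ideal_def by (intro P.genideal_minimal) auto
  then show ?thesis using z unfolding J_def tor_def by blast
qed

text \<open>What the descent argument knows about a localization, which is given only up to
  isomorphism. The image of the variable is inverse to \<open>f s\<close>, which gives cancellation;
  multiplying by powers of \<open>f s\<close> removes the variable from a polynomial, which gives
  fractions; the kernel is read off from \<open>loc_ideal_torsion\<close>.\<close>

lemma is_locD:
  assumes C: "galg C" and loc: "is_loc R A s C f"
  shows is_loc_ghom: "ghom A C f"
    and is_loc_cancel: "c \<in> carrier C \<Longrightarrow> f s \<otimes>\<^bsub>C\<^esub> c = \<zero>\<^bsub>C\<^esub> \<Longrightarrow> c = \<zero>\<^bsub>C\<^esub>"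
    and is_loc_frac: "c \<in> carrier C \<Longrightarrow> \<exists>k :: nat. \<exists>a\<in>carrier A. f s [^]\<^bsub>C\<^esub> k \<otimes>\<^bsub>C\<^esub> c = f a"
    and is_loc_ker: "a \<in> carrier A \<Longrightarrow> f a = \<zero>\<^bsub>C\<^esub> \<Longrightarrow> \<exists>k :: nat. s [^]\<^bsub>A\<^esub> k \<otimes>\<^bsub>A\<^esub> a = \<zero>\<^bsub>A\<^esub>"
proof -
  interpret P: ring P by (rule galg_ring[OF loc_gP])
  interpret C: ring C by (rule galg_ring[OF C])
  let ?I = "loc_ideal R A s"
  note gI = graded_loc_ideal and gL = galg_hquot[OF loc_gP graded_loc_ideal]
  note vC = galg_vspace[OF C]
  obtain \<phi> where \<phi>: "\<phi> \<in> halg_iso (loc R A s) C" and f: "f = compose (carrier A) \<phi> (loc_map R A s)"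
    using loc by (auto simp: is_loc_def)
  note iso = halg_isoE[OF \<phi>[unfolded loc_def]]
  note g\<phi> = halg_hom_ghom[OF gL C iso(1)]
  define \<psi> where "\<psi> z = \<phi> (?I +>\<^bsub>P\<^esub> z)" for z
  have g\<psi>: "ghom P C \<psi>" unfolding \<psi>_def by (rule ghom_comp[OF ghom_coset[OF loc_gP gI] g\<phi>])
  have f\<psi>: "f a = \<psi> (ax a 0)" if "a \<in> carrier A" for a
    using that unfolding f by (simp add: compose_def loc_map_def \<psi>_def xpow_0)
  have gax: "ghom A P (\<lambda>a. ax a 0)"
    unfolding ghom_def
  proof (intro conjI allI impI ballI)
    show "lin_map A P (\<lambda>a. ax a 0)"
      using bilin_l[OF bilin_tens[OF loc_vA loc_vF] xpow_closed] by simp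
    show "homog P m (ax a 0)" if "homog A m a" for m a
      using homog_tens[OF galg_gr[OF loc_gA] galg_gr[OF galg_hfree] that xpow_homog] by simp
    show "ax (a \<otimes>\<^bsub>A\<^esub> a') 0 = ax a 0 \<otimes>\<^bsub>P\<^esub> ax a' 0" if "a \<in> carrier A" "a' \<in> carrier A" for a a'
      using ax_mult[OF that, of 0 0] by simp
    show "ax \<one>\<^bsub>A\<^esub> 0 = \<one>\<^bsub>P\<^esub>" by (simp add: xpow_0)
  qed
  show gf: "ghom A C f"
    by (rule ghom_cong[OF ghom_comp[OF gax g\<psi>] loc_vA]) (auto simp: f\<psi>)
  have fs: "f s = \<psi> (ax s 0)" by (rule f\<psi>[OF s_closed])
  have zC: "\<phi> ?I = \<zero>\<^bsub>C\<^esub>"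
    using lin_map_zero[OF galg_vspace[OF gL] vC ghom_lin[OF g\<phi>]] hquot_fields(2)[OF loc_gP gI] by simp
  have cQ: "carrier (hquot P ?I) = (+>\<^bsub>P\<^esub>) ?I ` carrier P" by (rule hquot_fields(1)[OF loc_gP gI])
  have \<psi>_surj: "\<exists>z\<in>carrier T. c = \<psi> z" if "c \<in> carrier C" for c
    using that unfolding iso(3)[symmetric] cQ \<psi>_def by auto
  have \<psi>_ker: "z \<in> ?I" if "z \<in> carrier T" "\<psi> z = \<zero>\<^bsub>C\<^esub>" for z
  proof -
    have zP: "z \<in> carrier P" using that by simp
    have "?I \<in> carrier (hquot P ?I)"
      using vs_zero_closed[OF galg_vspace[OF gL]] hquot_fields(2)[OF loc_gP gI] by simp
    then have "?I +>\<^bsub>P\<^esub> z = ?I"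
      using inj_onD[OF iso(2), of "?I +>\<^bsub>P\<^esub> z" ?I] that zP cQ zC by (auto simp: \<psi>_def)
    then show ?thesis using coset_zero[OF loc_gP gI zP] by simp
  qed
  have \<psi>_closed: "\<psi> z \<in> carrier C" if "z \<in> carrier T" for z using ghom_closed[OF g\<psi>, of z] that by simp
  have \<psi>_mult: "\<psi> (y \<otimes>\<^bsub>P\<^esub> z) = \<psi> y \<otimes>\<^bsub>C\<^esub> \<psi> z" if "y \<in> carrier T" "z \<in> carrier T" for y z
    using ghom_mult[OF g\<psi>, of y z] that by simp
  have sx: "\<psi> (ax s (Suc 0)) = \<one>\<^bsub>C\<^esub>"
  proof -
    let ?g = "tens A (hfree R [0]) s (fgen R [0] 0) \<ominus>\<^bsub>P\<^esub> \<one>\<^bsub>P\<^esub>"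
    have e: "tens A (hfree R [0]) s (fgen R [0] 0) = ax s (Suc 0)" by (simp only: xpow_1)
    have c: "ax s (Suc 0) \<in> carrier P" using ax_closed[OF s_closed] by simp
    have g: "?g \<in> carrier P" unfolding e using P.minus_closed[OF c P.one_closed] .
    have "?g \<in> ?I" unfolding loc_ideal_def using P.genideal_self[of "{?g}"] g by blast
    then have "\<psi> ?g = \<zero>\<^bsub>C\<^esub>"
      using coset_zero[OF loc_gP gI g] zC by (simp add: \<psi>_def)
    moreover have "\<psi> ?g = \<psi> (ax s (Suc 0)) \<ominus>\<^bsub>C\<^esub> \<psi> \<one>\<^bsub>P\<^esub>"
      unfolding e by (rule lin_map_diff[OF galg_vspace[OF loc_gP] vC ghom_lin[OF g\<psi>] c P.one_closed])
    ultimately have "\<psi> (ax s (Suc 0)) \<ominus>\<^bsub>C\<^esub> \<one>\<^bsub>C\<^esub> = \<zero>\<^bsub>C\<^esub>" using ghom_one[OF g\<psi>] by simp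
    then have "\<psi> (ax s (Suc 0)) \<ominus>\<^bsub>C\<^esub> \<one>\<^bsub>C\<^esub> \<oplus>\<^bsub>C\<^esub> \<one>\<^bsub>C\<^esub> = \<one>\<^bsub>C\<^esub>" by simp
    then show ?thesis using \<psi>_closed[of "ax s (Suc 0)"] ax_closed[OF s_closed] by (simp add: a_minus_def C.a_assoc C.l_neg)
  qed
  have fsC: "f s \<in> carrier C" by (rule ghom_closed[OF gf s_closed])
  {
    fix c assume c: "c \<in> carrier C" "f s \<otimes>\<^bsub>C\<^esub> c = \<zero>\<^bsub>C\<^esub>"
    have "\<psi> (ax \<one>\<^bsub>A\<^esub> (Suc 0)) \<otimes>\<^bsub>C\<^esub> f s = \<one>\<^bsub>C\<^esub>"
      using \<psi>_mult[of "ax \<one>\<^bsub>A\<^esub> (Suc 0)" "ax s 0"] ax_mult[of "\<one>\<^bsub>A\<^esub>" s "Suc 0" 0] s_closed sx ax_closed by (simp add: fs)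
    moreover have x: "\<psi> (ax \<one>\<^bsub>A\<^esub> (Suc 0)) \<in> carrier C" by (intro \<psi>_closed ax_closed) simp
    ultimately have "c = \<psi> (ax \<one>\<^bsub>A\<^esub> (Suc 0)) \<otimes>\<^bsub>C\<^esub> (f s \<otimes>\<^bsub>C\<^esub> c)"
      using C.m_assoc[OF x fsC c(1)] C.l_one[OF c(1)] by metis
    then show "c = \<zero>\<^bsub>C\<^esub>" unfolding c(2) using C.r_null[OF x] by simp
  }
  {
    fix c assume "c \<in> carrier C"
    then obtain z where z: "z \<in> carrier T" "c = \<psi> z" using \<psi>_surj by blast
    have "\<exists>k :: nat. \<exists>a\<in>carrier A. f s [^]\<^bsub>C\<^esub> k \<otimes>\<^bsub>C\<^esub> \<psi> z = f a" using z(1)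
    proof (induction rule: ax_induct)
      case (ax a k)
      \<comment> \<open>One factor \<open>s\<close> cancels one power of the variable at a time,
        since \<open>s x\<close> maps to 1.\<close>
      have "f s [^]\<^bsub>C\<^esub> k \<otimes>\<^bsub>C\<^esub> \<psi> (ax a k) = f a"
      proof (induction k)
        case 0
        then show ?case using f\<psi>[OF ax] \<psi>_closed ax_closed[OF ax] by simp
      next
        case (Suc k)
        have "f s \<otimes>\<^bsub>C\<^esub> \<psi> (ax a (Suc k)) = \<psi> (ax (s \<otimes>\<^bsub>A\<^esub> a) (Suc k))"
          using \<psi>_mult[of "ax s 0" "ax a (Suc k)"] ax_mult[OF s_closed ax, of 0 "Suc k"] ax_closed s_closed ax by (simp add: fs)
        also have "\<dots> = \<psi> (ax a k \<otimes>\<^bsub>P\<^esub> ax s (Suc 0))"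
          using ax_mult[OF ax s_closed, of k "Suc 0"] s_central[OF ax] by simp
        also have "\<dots> = \<psi> (ax a k)"
          using \<psi>_mult[of "ax a k" "ax s (Suc 0)"] ax_closed s_closed ax sx \<psi>_closed by simp
        finally show ?case
          using Suc fsC \<psi>_closed ax_closed[OF ax] by (simp add: C.m_assoc)
      qed
      then show ?case using ax by blast
    next
      case (add y z)
      then obtain k l :: nat and a b where a: "a \<in> carrier A" "f s [^]\<^bsub>C\<^esub> k \<otimes>\<^bsub>C\<^esub> \<psi> y = f a"
        and b: "b \<in> carrier A" "f s [^]\<^bsub>C\<^esub> l \<otimes>\<^bsub>C\<^esub> \<psi> z = f b" by blast
      have ps: "f s [^]\<^bsub>C\<^esub> n \<in> carrier C" for n :: nat using fsC by simp
      have lk: "f s [^]\<^bsub>C\<^esub> (k + l) = f s [^]\<^bsub>C\<^esub> l \<otimes>\<^bsub>C\<^esub> f s [^]\<^bsub>C\<^esub> k" "f s [^]\<^bsub>C\<^esub> (k + l) = f s [^]\<^bsub>C\<^esub> k \<otimes>\<^bsub>C\<^esub> f s [^]\<^bsub>C\<^esub> l"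
        using fsC by (simp_all add: C.nat_pow_mult add.commute)
      have 1: "f s [^]\<^bsub>C\<^esub> (k + l) \<otimes>\<^bsub>C\<^esub> \<psi> y = f (s [^]\<^bsub>A\<^esub> l \<otimes>\<^bsub>A\<^esub> a)"
        unfolding lk(1) using add a ps \<psi>_closed s_closed
        by (simp add: C.m_assoc ghom_mult[OF gf] ghom_pow[OF A.ring_axioms C.ring_axioms gf])
      have 2: "f s [^]\<^bsub>C\<^esub> (k + l) \<otimes>\<^bsub>C\<^esub> \<psi> z = f (s [^]\<^bsub>A\<^esub> k \<otimes>\<^bsub>A\<^esub> b)"
        unfolding lk(2) using add b ps \<psi>_closed s_closed
        by (simp add: C.m_assoc ghom_mult[OF gf] ghom_pow[OF A.ring_axioms C.ring_axioms gf])
      have "f s [^]\<^bsub>C\<^esub> (k + l) \<otimes>\<^bsub>C\<^esub> \<psi> (y \<oplus>\<^bsub>T\<^esub> z) = f s [^]\<^bsub>C\<^esub> (k + l) \<otimes>\<^bsub>C\<^esub> \<psi> y \<oplus>\<^bsub>C\<^esub> f s [^]\<^bsub>C\<^esub> (k + l) \<otimes>\<^bsub>C\<^esub> \<psi> z"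
        using lin_map_add[OF ghom_lin[OF g\<psi>], of y z] add ps \<psi>_closed by (simp add: C.r_distr)
      also have "\<dots> = f (s [^]\<^bsub>A\<^esub> l \<otimes>\<^bsub>A\<^esub> a \<oplus>\<^bsub>A\<^esub> s [^]\<^bsub>A\<^esub> k \<otimes>\<^bsub>A\<^esub> b)"
        unfolding 1 2 using lin_map_add[OF ghom_lin[OF gf]] a b s_closed by simp
      finally show ?case using a b s_closed
        by (intro exI[of _ "k + l"] bexI[of _ "s [^]\<^bsub>A\<^esub> l \<otimes>\<^bsub>A\<^esub> a \<oplus>\<^bsub>A\<^esub> s [^]\<^bsub>A\<^esub> k \<otimes>\<^bsub>A\<^esub> b"]) auto
    qed
    then show "\<exists>k :: nat. \<exists>a\<in>carrier A. f s [^]\<^bsub>C\<^esub> k \<otimes>\<^bsub>C\<^esub> c = f a" using z by simp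
  }
  {
    fix a assume a: "a \<in> carrier A" "f a = \<zero>\<^bsub>C\<^esub>"
    \<comment> \<open>The homogenization of the constant polynomial \<open>a\<close> is
      \<open>a\<close> multiplied by a power of \<open>s\<close>, so torsion of it is torsion of
      \<open>a\<close>.\<close>
    then have "ax a 0 \<in> ?I" using \<psi>_ker[OF ax_closed] f\<psi> by simp
    then obtain n where "\<forall>m\<ge>n. \<exists>k :: nat. s [^]\<^bsub>A\<^esub> k \<otimes>\<^bsub>A\<^esub> hgz m (ax a 0) = \<zero>\<^bsub>A\<^esub>"
      using loc_ideal_torsion by blast
    then obtain k :: nat where "s [^]\<^bsub>A\<^esub> k \<otimes>\<^bsub>A\<^esub> hgz n (ax a 0) = \<zero>\<^bsub>A\<^esub>" by blast
    then have "s [^]\<^bsub>A\<^esub> (k + n) \<otimes>\<^bsub>A\<^esub> a = \<zero>\<^bsub>A\<^esub>"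
      using a s_closed by (simp add: hgz_ax A.m_assoc[symmetric] A.nat_pow_mult)
    then show "\<exists>k :: nat. s [^]\<^bsub>A\<^esub> k \<otimes>\<^bsub>A\<^esub> a = \<zero>\<^bsub>A\<^esub>" by blast
  }
qed

end

section \<open>Descent along Zariski coverings\<close>

lemma abelian_group_diff_zero:
  assumes "abelian_group G" and x: "x \<in> carrier G" and y: "y \<in> carrier G" and "x \<ominus>\<^bsub>G\<^esub> y = \<zero>\<^bsub>G\<^esub>"
  shows "x = y"
proof -
  interpret abelian_group G by fact
  have "x \<ominus>\<^bsub>G\<^esub> y \<oplus>\<^bsub>G\<^esub> y = x" using x y by (simp add: a_minus_def a_assoc l_neg)
  then show ?thesis using assms(4) y by simp
qed

text \<open>Induction on the sum of the exponents. If some exponent is 0, the hypothesis for it is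
  the claim. Otherwise each \<open>s j \<otimes> z\<close> satisfies the hypotheses with
  \<open>k j\<close> lowered by one, hence lies in \<open>J\<close>, and \<open>z\<close> is the
  combination of these with coefficients \<open>e j\<close>. The case \<open>J = {\<zero>}\<close>
  gives separatedness; the left ideal generated by powers of the \<open>s i\<close>, with
  \<open>z\<close> the unit, gives a partition of unity by these powers.\<close>

lemma comax_pow:
  fixes k :: "nat \<Rightarrow> nat"
  assumes A: "ring A" and s: "\<And>i. i < N \<Longrightarrow> s i \<in> carrier A"
    and cen: "\<And>i a. i < N \<Longrightarrow> a \<in> carrier A \<Longrightarrow> s i \<otimes>\<^bsub>A\<^esub> a = a \<otimes>\<^bsub>A\<^esub> s i"
    and e: "\<And>i. i < N \<Longrightarrow> e i \<in> carrier A" "(\<Oplus>\<^bsub>A\<^esub>i\<in>{..<N}. e i \<otimes>\<^bsub>A\<^esub> s i) = \<one>\<^bsub>A\<^esub>"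
    and J: "\<zero>\<^bsub>A\<^esub> \<in> J" "\<And>x y. x \<in> J \<Longrightarrow> y \<in> J \<Longrightarrow> x \<oplus>\<^bsub>A\<^esub> y \<in> J"
      "\<And>a x. a \<in> carrier A \<Longrightarrow> x \<in> J \<Longrightarrow> a \<otimes>\<^bsub>A\<^esub> x \<in> J" "J \<subseteq> carrier A"
    and z: "z \<in> carrier A" "\<And>i. i < N \<Longrightarrow> s i [^]\<^bsub>A\<^esub> k i \<otimes>\<^bsub>A\<^esub> z \<in> J"
  shows "z \<in> J"
  using z
proof (induction "\<Sum>i<N. k i" arbitrary: k z rule: less_induct)
  case less
  interpret A: ring A by fact
  show ?case
  proof (cases "\<exists>i<N. k i = 0")
    case True
    then obtain i where "i < N" "k i = 0" by blast
    then show ?thesis using less.prems(2)[of i] less.prems(1) by simp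
  next
    case False
    have sz: "s j \<otimes>\<^bsub>A\<^esub> z \<in> J" if j: "j < N" for j
    proof (rule less.hyps[of "k(j := k j - 1)"])
      have "0 < k j" using False j by auto
      then show "(\<Sum>i<N. (k(j := k j - 1)) i) < (\<Sum>i<N. k i)"
        using j by (intro sum_strict_mono_ex1) auto
      show "s j \<otimes>\<^bsub>A\<^esub> z \<in> carrier A" using s[OF j] less.prems by simp
      fix i assume i: "i < N"
      show "s i [^]\<^bsub>A\<^esub> (k(j := k j - 1)) i \<otimes>\<^bsub>A\<^esub> (s j \<otimes>\<^bsub>A\<^esub> z) \<in> J"
      proof (cases "i = j")
        case True
        have "s j [^]\<^bsub>A\<^esub> (k j - 1) \<otimes>\<^bsub>A\<^esub> (s j \<otimes>\<^bsub>A\<^esub> z) = s j [^]\<^bsub>A\<^esub> Suc (k j - 1) \<otimes>\<^bsub>A\<^esub> z"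
          using s[OF j] less.prems by (simp add: A.m_assoc)
        then show ?thesis using True less.prems(2)[OF j] \<open>0 < k j\<close> by simp
      next
        case False
        have "s i [^]\<^bsub>A\<^esub> k i \<otimes>\<^bsub>A\<^esub> (s j \<otimes>\<^bsub>A\<^esub> z) = s j \<otimes>\<^bsub>A\<^esub> (s i [^]\<^bsub>A\<^esub> k i \<otimes>\<^bsub>A\<^esub> z)"
          using s[OF j] s[OF i] less.prems(1) cen[OF j, of "s i [^]\<^bsub>A\<^esub> k i"] by (simp add: A.m_assoc[symmetric])
        then show ?thesis using False J(3)[OF s[OF j] less.prems(2)[OF i]] by simp
      qed
    qed
    have "finite F \<Longrightarrow> F \<subseteq> {..<N} \<Longrightarrow> (\<Oplus>\<^bsub>A\<^esub>i\<in>F. e i \<otimes>\<^bsub>A\<^esub> (s i \<otimes>\<^bsub>A\<^esub> z)) \<in> J" for F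
    proof (induction F rule: finite_induct)
      case (insert i F)
      have "(\<Oplus>\<^bsub>A\<^esub>i\<in>insert i F. e i \<otimes>\<^bsub>A\<^esub> (s i \<otimes>\<^bsub>A\<^esub> z)) = e i \<otimes>\<^bsub>A\<^esub> (s i \<otimes>\<^bsub>A\<^esub> z) \<oplus>\<^bsub>A\<^esub> (\<Oplus>\<^bsub>A\<^esub>i\<in>F. e i \<otimes>\<^bsub>A\<^esub> (s i \<otimes>\<^bsub>A\<^esub> z))"
        using insert e s less.prems by (intro A.finsum_insert) auto
      then show ?case using insert e sz J by auto
    qed (use J in simp)
    then have "(\<Oplus>\<^bsub>A\<^esub>i\<in>{..<N}. e i \<otimes>\<^bsub>A\<^esub> (s i \<otimes>\<^bsub>A\<^esub> z)) \<in> J" by simp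
    also have "(\<Oplus>\<^bsub>A\<^esub>i\<in>{..<N}. e i \<otimes>\<^bsub>A\<^esub> (s i \<otimes>\<^bsub>A\<^esub> z)) = (\<Oplus>\<^bsub>A\<^esub>i\<in>{..<N}. e i \<otimes>\<^bsub>A\<^esub> s i \<otimes>\<^bsub>A\<^esub> z)"
      using e s less.prems by (intro A.finsum_cong') (auto simp: A.m_assoc)
    also have "\<dots> = (\<Oplus>\<^bsub>A\<^esub>i\<in>{..<N}. e i \<otimes>\<^bsub>A\<^esub> s i) \<otimes>\<^bsub>A\<^esub> z"
      using e s less.prems by (intro A.finsum_ldistr[symmetric]) auto
    also have "\<dots> = z" using e less.prems by simp
    finally show ?thesis .
  qed
qed

context
  fixes R :: "('k::field, 'n::finite) torus2 \<Rightarrow> 'k" and A :: "('k, 'n, 'u) hobj"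
    and N s C f D g h
  assumes R: "cotriangular R" and A: "halgebra R A"
    and cov: "hcover R A N s C f" and ov: "hoverlap R A N s C f D g h"
begin

interpretation A: ring A by (rule galg_ring[OF halgebra_galg[OF A]])

lemma cover_s: "i < N \<Longrightarrow> homog A 0 (s i)"
  using cov by (auto simp: hcover_def coinv_homog)

lemma cover_sc: "i < N \<Longrightarrow> s i \<in> carrier A"
  by (rule homog_closed[OF cover_s])

lemma cover_central: "i < N \<Longrightarrow> a \<in> carrier A \<Longrightarrow> s i \<otimes>\<^bsub>A\<^esub> a = a \<otimes>\<^bsub>A\<^esub> s i"
  by (rule coinv_central[OF R A cover_s])

lemma cover_C: "i < N \<Longrightarrow> halgebra R (C i)" "i < N \<Longrightarrow> is_loc R A (s i) (C i) (f i)"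
  using cov by (auto simp: hcover_def hfp_def)

lemma cover_gC: "i < N \<Longrightarrow> galg (C i)"
  by (rule halgebra_galg[OF cover_C(1)])

lemma cover_f: "i < N \<Longrightarrow> ghom A (C i) (f i)"
  by (rule is_loc_ghom[OF R A cover_s cover_gC cover_C(2)])

lemma overlap_D: "i < N \<Longrightarrow> j < N \<Longrightarrow> galg (D i j)"
  "i < N \<Longrightarrow> j < N \<Longrightarrow> is_loc R (C i) (f i (s j)) (D i j) (g i j)"
  "i < N \<Longrightarrow> j < N \<Longrightarrow> is_loc R (C j) (f j (s i)) (D i j) (h i j)"
  using ov halgebra_galg by (auto simp: hoverlap_def hfp_def)

lemma overlap_g: "i < N \<Longrightarrow> j < N \<Longrightarrow> ghom (C i) (D i j) (g i j)"
  by (rule is_loc_ghom[OF R cover_C(1) ghom_homog[OF cover_f cover_s] overlap_D(1,2)])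

lemma overlap_h: "i < N \<Longrightarrow> j < N \<Longrightarrow> ghom (C j) (D i j) (h i j)"
  by (rule is_loc_ghom[OF R cover_C(1) ghom_homog[OF cover_f cover_s] overlap_D(1,3)])

lemma overlap_eq: "i < N \<Longrightarrow> j < N \<Longrightarrow> a \<in> carrier A \<Longrightarrow> g i j (f i a) = h i j (f j a)"
proof -
  assume ij: "i < N" "j < N" and a: "a \<in> carrier A"
  have "compose (carrier A) (g i j) (f i) = compose (carrier A) (h i j) (f j)"
    using ov ij by (simp add: hoverlap_def)
  from fun_cong[OF this, of a] show ?thesis using a by (simp add: compose_def)
qed

lemma cover_e: obtains e where "\<And>i. i < N \<Longrightarrow> e i \<in> carrier A" "(\<Oplus>\<^bsub>A\<^esub>i\<in>{..<N}. e i \<otimes>\<^bsub>A\<^esub> s i) = \<one>\<^bsub>A\<^esub>"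
  using cov by (auto simp: hcover_def)

lemma cover_cancel_pow:
  assumes i: "i < N" and c: "c \<in> carrier (C i)" "c' \<in> carrier (C i)"
    and eq: "f i (s i) [^]\<^bsub>C i\<^esub> (k :: nat) \<otimes>\<^bsub>C i\<^esub> c = f i (s i) [^]\<^bsub>C i\<^esub> k \<otimes>\<^bsub>C i\<^esub> c'"
  shows "c = c'"
  using eq
proof (induction k)
  case 0
  interpret C: ring "C i" by (rule galg_ring[OF cover_gC[OF i]])
  show ?case using 0 c by simp
next
  case (Suc k)
  interpret C: ring "C i" by (rule galg_ring[OF cover_gC[OF i]])
  let ?t = "f i (s i)"
  have t: "?t \<in> carrier (C i)" by (rule ghom_closed[OF cover_f[OF i] cover_sc[OF i]])
  let ?x = "?t [^]\<^bsub>C i\<^esub> k \<otimes>\<^bsub>C i\<^esub> c" and ?y = "?t [^]\<^bsub>C i\<^esub> k \<otimes>\<^bsub>C i\<^esub> c'"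
  have xy: "?x \<in> carrier (C i)" "?y \<in> carrier (C i)" using t c by auto
  have comm: "?t [^]\<^bsub>C i\<^esub> k \<otimes>\<^bsub>C i\<^esub> ?t = ?t \<otimes>\<^bsub>C i\<^esub> ?t [^]\<^bsub>C i\<^esub> k"
    using t C.nat_pow_Suc2[OF t, of k] by simp
  have "?t \<otimes>\<^bsub>C i\<^esub> ?x = ?t \<otimes>\<^bsub>C i\<^esub> ?y"
    using Suc.prems t c by (simp add: comm C.m_assoc)
  then have "?t \<otimes>\<^bsub>C i\<^esub> (?x \<ominus>\<^bsub>C i\<^esub> ?y) = \<zero>\<^bsub>C i\<^esub>"
    using t xy by (simp add: a_minus_def C.r_distr C.r_minus C.r_neg)
  then have "?x \<ominus>\<^bsub>C i\<^esub> ?y = \<zero>\<^bsub>C i\<^esub>"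
    using is_loc_cancel[OF R A cover_s[OF i] cover_gC[OF i] cover_C(2)[OF i]] xy by simp
  then have "?x = ?y" by (rule abelian_group_diff_zero[OF C.is_abelian_group xy])
  then show ?case by (rule Suc.IH)
qed

text \<open>Vanishing in each localization means being killed by a power of each \<open>s i\<close>;
  \<open>comax_pow\<close> with the zero ideal then kills the element.\<close>

lemma cover_separated:
  assumes a: "a \<in> carrier A" and z: "\<And>i. i < N \<Longrightarrow> f i a = \<zero>\<^bsub>C i\<^esub>"
  shows "a = \<zero>\<^bsub>A\<^esub>"
proof -
  have "\<forall>i. \<exists>k :: nat. i < N \<longrightarrow> s i [^]\<^bsub>A\<^esub> k \<otimes>\<^bsub>A\<^esub> a = \<zero>\<^bsub>A\<^esub>"
    using is_loc_ker[OF R A cover_s cover_gC cover_C(2) a] z by meson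
  then obtain k :: "nat \<Rightarrow> nat" where k: "\<And>i. i < N \<Longrightarrow> s i [^]\<^bsub>A\<^esub> k i \<otimes>\<^bsub>A\<^esub> a = \<zero>\<^bsub>A\<^esub>" by metis
  obtain e where e: "\<And>i. i < N \<Longrightarrow> e i \<in> carrier A" "(\<Oplus>\<^bsub>A\<^esub>i\<in>{..<N}. e i \<otimes>\<^bsub>A\<^esub> s i) = \<one>\<^bsub>A\<^esub>"
    using cover_e by blast
  have "a \<in> {\<zero>\<^bsub>A\<^esub>}"
    by (rule comax_pow[of A N s e _ a k]) (use A.ring_axioms cover_sc cover_central e a k in auto)
  then show ?thesis by simp
qed

text \<open>The sum of all individual exponents serves every index; the excess is compensated in the
  numerator.\<close>

lemma cover_common_denominator:
  assumes c: "\<And>i. i < N \<Longrightarrow> c i \<in> carrier (C i)"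
  shows "\<exists>b. \<exists>k :: nat. \<forall>i<N. b i \<in> carrier A \<and> f i (s i) [^]\<^bsub>C i\<^esub> k \<otimes>\<^bsub>C i\<^esub> c i = f i (b i)"
proof -
  have "\<forall>i. \<exists>k :: nat. \<exists>a. i < N \<longrightarrow> a \<in> carrier A \<and> f i (s i) [^]\<^bsub>C i\<^esub> k \<otimes>\<^bsub>C i\<^esub> c i = f i a"
    using is_loc_frac[OF R A cover_s cover_gC cover_C(2)] c by meson
  then obtain k :: "nat \<Rightarrow> nat" and b where b: "\<And>i. i < N \<Longrightarrow> b i \<in> carrier A"
    "\<And>i. i < N \<Longrightarrow> f i (s i) [^]\<^bsub>C i\<^esub> k i \<otimes>\<^bsub>C i\<^esub> c i = f i (b i)" by metis
  let ?K = "\<Sum>i<N. k i"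
  have "f i (s i) [^]\<^bsub>C i\<^esub> ?K \<otimes>\<^bsub>C i\<^esub> c i = f i (s i [^]\<^bsub>A\<^esub> (?K - k i) \<otimes>\<^bsub>A\<^esub> b i)" if i: "i < N" for i
  proof -
    interpret C: ring "C i" by (rule galg_ring[OF cover_gC[OF i]])
    have t: "f i (s i) \<in> carrier (C i)" by (rule ghom_closed[OF cover_f[OF i] cover_sc[OF i]])
    have "k i \<le> ?K" using i by (intro member_le_sum) auto
    then have "f i (s i) [^]\<^bsub>C i\<^esub> ?K = f i (s i) [^]\<^bsub>C i\<^esub> (?K - k i) \<otimes>\<^bsub>C i\<^esub> f i (s i) [^]\<^bsub>C i\<^esub> k i"
      using t by (simp add: C.nat_pow_mult)
    then show ?thesis
      using t c[OF i] b[OF i] cover_sc[OF i]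
      by (simp add: C.m_assoc ghom_mult[OF cover_f[OF i]] ghom_pow[OF A.ring_axioms C.ring_axioms cover_f[OF i]])
  qed
  then show ?thesis using b cover_sc
    by (intro exI[of _ "\<lambda>i. s i [^]\<^bsub>A\<^esub> (?K - k i) \<otimes>\<^bsub>A\<^esub> b i"] exI[of _ ?K]) auto
qed

text \<open>The classical argument: write \<open>c i\<close> as a fraction with numerator
  \<open>b i\<close>, raise the common exponent until the cross relations between numerators hold in
  \<open>A\<close> itself, and glue the numerators with a partition of unity by powers of the
  \<open>s i\<close>.\<close>

lemma cover_glue:
  assumes c: "\<And>i. i < N \<Longrightarrow> c i \<in> carrier (C i)"
    and cc: "\<And>i j. i < N \<Longrightarrow> j < N \<Longrightarrow> g i j (c i) = h i j (c j)"
  shows "\<exists>a\<in>carrier A. \<forall>i<N. f i a = c i"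
proof -
  have "\<exists>b. \<exists>k :: nat. \<forall>i<N. b i \<in> carrier A \<and> f i (s i) [^]\<^bsub>C i\<^esub> k \<otimes>\<^bsub>C i\<^esub> c i = f i (b i)"
    by (rule cover_common_denominator) (rule c)
  then obtain b and k :: nat where b0: "\<forall>i<N. b i \<in> carrier A \<and> f i (s i) [^]\<^bsub>C i\<^esub> k \<otimes>\<^bsub>C i\<^esub> c i = f i (b i)"
    by (elim exE)
  have b: "i < N \<Longrightarrow> b i \<in> carrier A" "i < N \<Longrightarrow> f i (s i) [^]\<^bsub>C i\<^esub> k \<otimes>\<^bsub>C i\<^esub> c i = f i (b i)" for i
    using b0 by auto
  have sp: "s i [^]\<^bsub>A\<^esub> n \<in> carrier A" if "i < N" for i and n :: nat using cover_sc[OF that] by simp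
  have cp: "s i [^]\<^bsub>A\<^esub> n \<otimes>\<^bsub>A\<^esub> a = a \<otimes>\<^bsub>A\<^esub> s i [^]\<^bsub>A\<^esub> n" if "i < N" "a \<in> carrier A" for i a and n :: nat
    by (rule central_pow[OF A.ring_axioms cover_sc]) (use that cover_central in auto)
  \<comment> \<open>The failure of the cross relation between two numerators. It vanishes in the
    overlap because the sections agree there.\<close>
  define d where "d i j = s j [^]\<^bsub>A\<^esub> k \<otimes>\<^bsub>A\<^esub> b i \<ominus>\<^bsub>A\<^esub> s i [^]\<^bsub>A\<^esub> k \<otimes>\<^bsub>A\<^esub> b j" for i j
  \<comment> \<open>The overlap is a localization of a localization, so its kernel is found in two
    stages: a power of \<open>s j\<close> kills the defect in \<open>C i\<close>, then a power of
    \<open>s i\<close> kills the result in \<open>A\<close>.\<close>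
  have "\<exists>(l :: nat) (l' :: nat). s i [^]\<^bsub>A\<^esub> l' \<otimes>\<^bsub>A\<^esub> (s j [^]\<^bsub>A\<^esub> l \<otimes>\<^bsub>A\<^esub> d i j) = \<zero>\<^bsub>A\<^esub>" if i: "i < N" and j: "j < N" for i j
  proof -
    interpret C: ring "C i" by (rule galg_ring[OF cover_gC[OF i]])
    interpret Cj: ring "C j" by (rule galg_ring[OF cover_gC[OF j]])
    interpret D: ring "D i j" by (rule galg_ring[OF overlap_D(1)[OF i j]])
    note fi = cover_f[OF i] and fj = cover_f[OF j] and gij = overlap_g[OF i j] and hij = overlap_h[OF i j]
    let ?F = "\<lambda>a. g i j (f i a)"
    have gF: "ghom A (D i j) ?F" by (rule ghom_comp[OF fi gij])
    note Fm = ghom_mult[OF gF] and Fc = ghom_closed[OF gF]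
    have d: "d i j \<in> carrier A" using b sp i j by (simp add: d_def)
    have 1: "?F (b i) = ?F (s i [^]\<^bsub>A\<^esub> k) \<otimes>\<^bsub>D i j\<^esub> g i j (c i)"
      using b(2)[OF i, symmetric] c[OF i] cover_sc[OF i] sp[OF i] ghom_closed[OF fi]
      by (simp add: ghom_mult[OF gij] ghom_pow[OF A.ring_axioms C.ring_axioms fi])
    have "?F (b j) = h i j (f j (b j))" using overlap_eq[OF i j] b j by simp
    also have "\<dots> = h i j (f j (s j [^]\<^bsub>A\<^esub> k)) \<otimes>\<^bsub>D i j\<^esub> h i j (c j)"
      using b(2)[OF j, symmetric] c[OF j] cover_sc[OF j] sp[OF j] ghom_closed[OF fj]
      by (simp add: ghom_mult[OF hij] ghom_pow[OF A.ring_axioms Cj.ring_axioms fj])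
    also have "\<dots> = ?F (s j [^]\<^bsub>A\<^esub> k) \<otimes>\<^bsub>D i j\<^esub> g i j (c i)"
      using overlap_eq[OF i j sp[OF j]] cc[OF i j] by simp
    finally have 2: "?F (b j) = ?F (s j [^]\<^bsub>A\<^esub> k) \<otimes>\<^bsub>D i j\<^esub> g i j (c i)" .
    have gc: "g i j (c i) \<in> carrier (D i j)" using ghom_closed[OF gij c[OF i]] .
    have "?F (s j [^]\<^bsub>A\<^esub> k \<otimes>\<^bsub>A\<^esub> b i) = ?F (s j [^]\<^bsub>A\<^esub> k \<otimes>\<^bsub>A\<^esub> s i [^]\<^bsub>A\<^esub> k) \<otimes>\<^bsub>D i j\<^esub> g i j (c i)"
      using b sp i j Fc gc by (simp add: Fm 1 D.m_assoc)
    also have "s j [^]\<^bsub>A\<^esub> k \<otimes>\<^bsub>A\<^esub> s i [^]\<^bsub>A\<^esub> k = s i [^]\<^bsub>A\<^esub> k \<otimes>\<^bsub>A\<^esub> s j [^]\<^bsub>A\<^esub> k"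
      by (rule cp[OF j sp[OF i]])
    also have "?F (s i [^]\<^bsub>A\<^esub> k \<otimes>\<^bsub>A\<^esub> s j [^]\<^bsub>A\<^esub> k) \<otimes>\<^bsub>D i j\<^esub> g i j (c i) = ?F (s i [^]\<^bsub>A\<^esub> k \<otimes>\<^bsub>A\<^esub> b j)"
      using b sp i j Fc gc by (simp add: Fm 2 D.m_assoc)
    finally have eq: "?F (s j [^]\<^bsub>A\<^esub> k \<otimes>\<^bsub>A\<^esub> b i) = ?F (s i [^]\<^bsub>A\<^esub> k \<otimes>\<^bsub>A\<^esub> b j)" .
    have "?F (d i j) = ?F (s j [^]\<^bsub>A\<^esub> k \<otimes>\<^bsub>A\<^esub> b i) \<ominus>\<^bsub>D i j\<^esub> ?F (s i [^]\<^bsub>A\<^esub> k \<otimes>\<^bsub>A\<^esub> b j)"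
      unfolding d_def
      by (rule lin_map_diff[OF galg_vspace[OF halgebra_galg[OF A]] galg_vspace[OF overlap_D(1)[OF i j]] ghom_lin[OF gF]])
        (use b sp i j in auto)
    then have "g i j (f i (d i j)) = \<zero>\<^bsub>D i j\<^esub>"
      using eq Fc sp b i j by (simp add: a_minus_def D.r_neg)
    then obtain l :: nat where l: "f i (s j) [^]\<^bsub>C i\<^esub> l \<otimes>\<^bsub>C i\<^esub> f i (d i j) = \<zero>\<^bsub>C i\<^esub>"
      using is_loc_ker[OF R cover_C(1)[OF i] ghom_homog[OF fi cover_s[OF j]] overlap_D(1,2)[OF i j] ghom_closed[OF fi d]]
      by blast
    have "f i (s j [^]\<^bsub>A\<^esub> l \<otimes>\<^bsub>A\<^esub> d i j) = \<zero>\<^bsub>C i\<^esub>"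
      using l d sp[OF j] cover_sc[OF j]
      by (simp add: ghom_mult[OF fi] ghom_pow[OF A.ring_axioms C.ring_axioms fi])
    then obtain l' :: nat where "s i [^]\<^bsub>A\<^esub> l' \<otimes>\<^bsub>A\<^esub> (s j [^]\<^bsub>A\<^esub> l \<otimes>\<^bsub>A\<^esub> d i j) = \<zero>\<^bsub>A\<^esub>"
      using is_loc_ker[OF R A cover_s[OF i] cover_gC[OF i] cover_C(2)[OF i], of "s j [^]\<^bsub>A\<^esub> l \<otimes>\<^bsub>A\<^esub> d i j"] d sp[OF j]
      by auto
    then show ?thesis by blast
  qed
  then have "\<forall>i j. \<exists>(l :: nat) (l' :: nat). i < N \<longrightarrow> j < N \<longrightarrow> s i [^]\<^bsub>A\<^esub> l' \<otimes>\<^bsub>A\<^esub> (s j [^]\<^bsub>A\<^esub> l \<otimes>\<^bsub>A\<^esub> d i j) = \<zero>\<^bsub>A\<^esub>" by blast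
  then obtain l l' :: "nat \<Rightarrow> nat \<Rightarrow> nat" where
    ll: "\<And>i j. i < N \<Longrightarrow> j < N \<Longrightarrow> s i [^]\<^bsub>A\<^esub> l' i j \<otimes>\<^bsub>A\<^esub> (s j [^]\<^bsub>A\<^esub> l i j \<otimes>\<^bsub>A\<^esub> d i j) = \<zero>\<^bsub>A\<^esub>" by metis
  \<comment> \<open>An exponent that serves all pairs at once.\<close>
  define m where "m = (\<Sum>i<N. \<Sum>j<N. l i j + l' i j)"
  have dc: "d i j \<in> carrier A" if "i < N" "j < N" for i j using b sp that by (simp add: d_def)
  have kill: "s i [^]\<^bsub>A\<^esub> m \<otimes>\<^bsub>A\<^esub> (s j [^]\<^bsub>A\<^esub> m \<otimes>\<^bsub>A\<^esub> d i j) = \<zero>\<^bsub>A\<^esub>" if i: "i < N" and j: "j < N" for i j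
  proof -
    have "l i j + l' i j \<le> (\<Sum>j<N. l i j + l' i j)" using j by (intro member_le_sum) auto
    also have "\<dots> \<le> m" unfolding m_def using i by (intro member_le_sum[of i _ "\<lambda>i. \<Sum>j<N. l i j + l' i j"]) auto
    finally have le: "l i j \<le> m" "l' i j \<le> m" by auto
    have "s i [^]\<^bsub>A\<^esub> m \<otimes>\<^bsub>A\<^esub> (s j [^]\<^bsub>A\<^esub> l i j \<otimes>\<^bsub>A\<^esub> d i j) = \<zero>\<^bsub>A\<^esub>"
      by (rule pow_kill[OF A.ring_axioms _ _ ll[OF i j] le(2)]) (use cover_sc i j dc sp in auto)
    then have "s j [^]\<^bsub>A\<^esub> l i j \<otimes>\<^bsub>A\<^esub> (s i [^]\<^bsub>A\<^esub> m \<otimes>\<^bsub>A\<^esub> d i j) = \<zero>\<^bsub>A\<^esub>"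
      using cp[OF j sp[OF i], of "l i j" m] sp i j dc by (simp add: A.m_assoc[symmetric])
    then have "s j [^]\<^bsub>A\<^esub> m \<otimes>\<^bsub>A\<^esub> (s i [^]\<^bsub>A\<^esub> m \<otimes>\<^bsub>A\<^esub> d i j) = \<zero>\<^bsub>A\<^esub>"
      by (rule pow_kill[OF A.ring_axioms _ _ _ le(1), rotated 2]) (use cover_sc i j dc sp in auto)
    then show ?thesis
      using cp[OF j sp[OF i], of m m] sp i j dc by (simp add: A.m_assoc[symmetric])
  qed
  \<comment> \<open>Extending numerator and denominator by the power \<open>m\<close> makes the
    cross relations exact, with common exponent \<open>m + k\<close>.\<close>
  define b' where "b' i = s i [^]\<^bsub>A\<^esub> m \<otimes>\<^bsub>A\<^esub> b i" for i
  let ?K = "m + k"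
  have b'c: "b' i \<in> carrier A" if "i < N" for i using that b sp by (simp add: b'_def)
  have fb': "f i (s i) [^]\<^bsub>C i\<^esub> ?K \<otimes>\<^bsub>C i\<^esub> c i = f i (b' i)" if i: "i < N" for i
  proof -
    interpret C: ring "C i" by (rule galg_ring[OF cover_gC[OF i]])
    have t: "f i (s i) \<in> carrier (C i)" by (rule ghom_closed[OF cover_f[OF i] cover_sc[OF i]])
    show ?thesis
      using t c[OF i] b[OF i] cover_sc[OF i] sp[OF i]
      by (simp add: b'_def C.m_assoc C.nat_pow_mult[symmetric] ghom_mult[OF cover_f[OF i]]
          ghom_pow[OF A.ring_axioms C.ring_axioms cover_f[OF i]])
  qed
  have sb: "s i [^]\<^bsub>A\<^esub> ?K \<otimes>\<^bsub>A\<^esub> b' j = s j [^]\<^bsub>A\<^esub> ?K \<otimes>\<^bsub>A\<^esub> b' i" if i: "i < N" and j: "j < N" for i j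
  proof -
    have e: "s i [^]\<^bsub>A\<^esub> ?K \<otimes>\<^bsub>A\<^esub> b' j = s i [^]\<^bsub>A\<^esub> m \<otimes>\<^bsub>A\<^esub> s j [^]\<^bsub>A\<^esub> m \<otimes>\<^bsub>A\<^esub> (s i [^]\<^bsub>A\<^esub> k \<otimes>\<^bsub>A\<^esub> b j)"
      if i: "i < N" and j: "j < N" for i j
    proof -
      have "s i [^]\<^bsub>A\<^esub> ?K \<otimes>\<^bsub>A\<^esub> b' j = s i [^]\<^bsub>A\<^esub> m \<otimes>\<^bsub>A\<^esub> (s i [^]\<^bsub>A\<^esub> k \<otimes>\<^bsub>A\<^esub> s j [^]\<^bsub>A\<^esub> m \<otimes>\<^bsub>A\<^esub> b j)"
        using i j sp b cover_sc[OF i] by (simp add: b'_def A.nat_pow_mult[symmetric] A.m_assoc)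
      also have "s i [^]\<^bsub>A\<^esub> k \<otimes>\<^bsub>A\<^esub> s j [^]\<^bsub>A\<^esub> m = s j [^]\<^bsub>A\<^esub> m \<otimes>\<^bsub>A\<^esub> s i [^]\<^bsub>A\<^esub> k"
        by (rule cp[OF i sp[OF j]])
      finally show ?thesis using i j sp b by (simp add: A.m_assoc)
    qed
    let ?t = "s i [^]\<^bsub>A\<^esub> m \<otimes>\<^bsub>A\<^esub> s j [^]\<^bsub>A\<^esub> m"
    have t: "?t \<in> carrier A" using sp i j by simp
    have xy: "s j [^]\<^bsub>A\<^esub> k \<otimes>\<^bsub>A\<^esub> b i \<in> carrier A" "s i [^]\<^bsub>A\<^esub> k \<otimes>\<^bsub>A\<^esub> b j \<in> carrier A" using sp i j b by auto
    have "?t \<otimes>\<^bsub>A\<^esub> d i j = \<zero>\<^bsub>A\<^esub>" using kill[OF i j] sp i j dc by (simp add: A.m_assoc)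
    then have "?t \<otimes>\<^bsub>A\<^esub> (s j [^]\<^bsub>A\<^esub> k \<otimes>\<^bsub>A\<^esub> b i) \<ominus>\<^bsub>A\<^esub> ?t \<otimes>\<^bsub>A\<^esub> (s i [^]\<^bsub>A\<^esub> k \<otimes>\<^bsub>A\<^esub> b j) = \<zero>\<^bsub>A\<^esub>"
      using t xy by (simp add: d_def a_minus_def A.r_distr A.r_minus)
    then have "?t \<otimes>\<^bsub>A\<^esub> (s j [^]\<^bsub>A\<^esub> k \<otimes>\<^bsub>A\<^esub> b i) = ?t \<otimes>\<^bsub>A\<^esub> (s i [^]\<^bsub>A\<^esub> k \<otimes>\<^bsub>A\<^esub> b j)"
      by (rule abelian_group_diff_zero[OF A.is_abelian_group A.m_closed[OF t xy(1)] A.m_closed[OF t xy(2)]])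
    then show ?thesis unfolding e[OF i j] e[OF j i] using cp[OF i sp[OF j], of m m] by simp
  qed
  obtain e where e: "\<And>i. i < N \<Longrightarrow> e i \<in> carrier A" "(\<Oplus>\<^bsub>A\<^esub>i\<in>{..<N}. e i \<otimes>\<^bsub>A\<^esub> s i) = \<one>\<^bsub>A\<^esub>"
    using cover_e by blast
  \<comment> \<open>The left ideal generated by the \<open>K\<close>-th powers; that it contains the
    unit is the partition of unity with coefficients \<open>u\<close>.\<close>
  define J where "J = {\<Oplus>\<^bsub>A\<^esub>i\<in>{..<N}. u i \<otimes>\<^bsub>A\<^esub> s i [^]\<^bsub>A\<^esub> ?K | u. u \<in> {..<N} \<rightarrow> carrier A}"
  have "\<one>\<^bsub>A\<^esub> \<in> J"
  proof (rule comax_pow[of A N s e _ _ "\<lambda>_. ?K"])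
    have "(\<Oplus>\<^bsub>A\<^esub>i\<in>{..<N}. \<zero>\<^bsub>A\<^esub> \<otimes>\<^bsub>A\<^esub> s i [^]\<^bsub>A\<^esub> ?K) = \<zero>\<^bsub>A\<^esub>"
      by (rule A.add.finprod_one_eqI) (use sp in simp)
    then show "\<zero>\<^bsub>A\<^esub> \<in> J" unfolding J_def by (intro CollectI exI[of _ "\<lambda>_. \<zero>\<^bsub>A\<^esub>"] conjI) simp_all
    show "J \<subseteq> carrier A"
    proof
      fix x assume "x \<in> J"
      then obtain u where "u \<in> {..<N} \<rightarrow> carrier A" "x = (\<Oplus>\<^bsub>A\<^esub>i\<in>{..<N}. u i \<otimes>\<^bsub>A\<^esub> s i [^]\<^bsub>A\<^esub> ?K)"
        unfolding J_def by blast
      then show "x \<in> carrier A" using sp by (auto simp: Pi_iff intro!: A.finsum_closed)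
    qed
    show "x \<oplus>\<^bsub>A\<^esub> y \<in> J" if "x \<in> J" "y \<in> J" for x y
    proof -
      from that(1) obtain u where u: "u \<in> {..<N} \<rightarrow> carrier A" "x = (\<Oplus>\<^bsub>A\<^esub>i\<in>{..<N}. u i \<otimes>\<^bsub>A\<^esub> s i [^]\<^bsub>A\<^esub> ?K)"
        unfolding J_def by blast
      from that(2) obtain v where v: "v \<in> {..<N} \<rightarrow> carrier A" "y = (\<Oplus>\<^bsub>A\<^esub>i\<in>{..<N}. v i \<otimes>\<^bsub>A\<^esub> s i [^]\<^bsub>A\<^esub> ?K)"
        unfolding J_def by blast
      from u v have "(\<Oplus>\<^bsub>A\<^esub>i\<in>{..<N}. (u i \<oplus>\<^bsub>A\<^esub> v i) \<otimes>\<^bsub>A\<^esub> s i [^]\<^bsub>A\<^esub> ?K) =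
          (\<Oplus>\<^bsub>A\<^esub>i\<in>{..<N}. u i \<otimes>\<^bsub>A\<^esub> s i [^]\<^bsub>A\<^esub> ?K \<oplus>\<^bsub>A\<^esub> v i \<otimes>\<^bsub>A\<^esub> s i [^]\<^bsub>A\<^esub> ?K)"
        using sp by (intro A.finsum_cong') (auto simp: Pi_iff A.l_distr)
      also have "\<dots> = x \<oplus>\<^bsub>A\<^esub> y"
        unfolding u(2) v(2) using sp u(1) v(1) by (intro A.finsum_addf) (auto simp: Pi_iff)
      finally have "x \<oplus>\<^bsub>A\<^esub> y = (\<Oplus>\<^bsub>A\<^esub>i\<in>{..<N}. (u i \<oplus>\<^bsub>A\<^esub> v i) \<otimes>\<^bsub>A\<^esub> s i [^]\<^bsub>A\<^esub> ?K)" ..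
      moreover have "(\<lambda>i. u i \<oplus>\<^bsub>A\<^esub> v i) \<in> {..<N} \<rightarrow> carrier A" using u(1) v(1) by (auto simp: Pi_iff)
      ultimately show ?thesis unfolding J_def by (intro CollectI exI conjI)
    qed
    show "a \<otimes>\<^bsub>A\<^esub> x \<in> J" if "a \<in> carrier A" "x \<in> J" for a x
    proof -
      from that(2) obtain u where u: "u \<in> {..<N} \<rightarrow> carrier A" "x = (\<Oplus>\<^bsub>A\<^esub>i\<in>{..<N}. u i \<otimes>\<^bsub>A\<^esub> s i [^]\<^bsub>A\<^esub> ?K)"
        unfolding J_def by blast
      have "a \<otimes>\<^bsub>A\<^esub> x = (\<Oplus>\<^bsub>A\<^esub>i\<in>{..<N}. a \<otimes>\<^bsub>A\<^esub> (u i \<otimes>\<^bsub>A\<^esub> s i [^]\<^bsub>A\<^esub> ?K))"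
        unfolding u(2) using u(1) sp that by (intro A.finsum_rdistr) auto
      also have "\<dots> = (\<Oplus>\<^bsub>A\<^esub>i\<in>{..<N}. (a \<otimes>\<^bsub>A\<^esub> u i) \<otimes>\<^bsub>A\<^esub> s i [^]\<^bsub>A\<^esub> ?K)"
        using u(1) sp that by (intro A.finsum_cong') (auto simp: Pi_iff A.m_assoc)
      finally have "a \<otimes>\<^bsub>A\<^esub> x = (\<Oplus>\<^bsub>A\<^esub>i\<in>{..<N}. (a \<otimes>\<^bsub>A\<^esub> u i) \<otimes>\<^bsub>A\<^esub> s i [^]\<^bsub>A\<^esub> ?K)" .
      moreover have "(\<lambda>i. a \<otimes>\<^bsub>A\<^esub> u i) \<in> {..<N} \<rightarrow> carrier A" using u(1) that(1) by (auto simp: Pi_iff)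
      ultimately show ?thesis unfolding J_def by (intro CollectI exI conjI)
    qed
    show "s i [^]\<^bsub>A\<^esub> ?K \<otimes>\<^bsub>A\<^esub> \<one>\<^bsub>A\<^esub> \<in> J" if i: "i < N" for i
    proof -
      have "(\<Oplus>\<^bsub>A\<^esub>j\<in>{..<N}. (if j = i then \<one>\<^bsub>A\<^esub> else \<zero>\<^bsub>A\<^esub>) \<otimes>\<^bsub>A\<^esub> s j [^]\<^bsub>A\<^esub> ?K) =
        (\<Oplus>\<^bsub>A\<^esub>j\<in>{..<N}. if i = j then s j [^]\<^bsub>A\<^esub> ?K else \<zero>\<^bsub>A\<^esub>)"
        using sp by (intro A.finsum_cong') auto
      also have "\<dots> = s i [^]\<^bsub>A\<^esub> ?K"
        using sp i by (intro A.finsum_singleton) auto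
      also have "\<dots> = s i [^]\<^bsub>A\<^esub> ?K \<otimes>\<^bsub>A\<^esub> \<one>\<^bsub>A\<^esub>" using sp[OF i] by simp
      finally have "s i [^]\<^bsub>A\<^esub> ?K \<otimes>\<^bsub>A\<^esub> \<one>\<^bsub>A\<^esub> =
        (\<Oplus>\<^bsub>A\<^esub>j\<in>{..<N}. (if j = i then \<one>\<^bsub>A\<^esub> else \<zero>\<^bsub>A\<^esub>) \<otimes>\<^bsub>A\<^esub> s j [^]\<^bsub>A\<^esub> ?K)" ..
      moreover have "(\<lambda>j. if j = i then \<one>\<^bsub>A\<^esub> else \<zero>\<^bsub>A\<^esub>) \<in> {..<N} \<rightarrow> carrier A" by auto
      ultimately show ?thesis unfolding J_def by (intro CollectI exI conjI)
    qed
  qed (use A.ring_axioms cover_sc cover_central e in auto)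
  then obtain u where u: "u \<in> {..<N} \<rightarrow> carrier A" "\<one>\<^bsub>A\<^esub> = (\<Oplus>\<^bsub>A\<^esub>i\<in>{..<N}. u i \<otimes>\<^bsub>A\<^esub> s i [^]\<^bsub>A\<^esub> ?K)"
    unfolding J_def by blast
  have uc: "i < N \<Longrightarrow> u i \<in> carrier A" for i using u(1) by auto
  \<comment> \<open>By the cross relations \<open>s i\<close> to the power \<open>K\<close> times
    \<open>a\<close> is \<open>b' i\<close>, hence \<open>f i a = c i\<close> after cancelling the
    power in \<open>C i\<close>.\<close>
  define a where "a = (\<Oplus>\<^bsub>A\<^esub>j\<in>{..<N}. u j \<otimes>\<^bsub>A\<^esub> b' j)"
  have ac: "a \<in> carrier A" unfolding a_def using uc b'c by (intro A.finsum_closed) auto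
  have sa: "s i [^]\<^bsub>A\<^esub> ?K \<otimes>\<^bsub>A\<^esub> a = b' i" if i: "i < N" for i
  proof -
    have "s i [^]\<^bsub>A\<^esub> ?K \<otimes>\<^bsub>A\<^esub> a = (\<Oplus>\<^bsub>A\<^esub>j\<in>{..<N}. s i [^]\<^bsub>A\<^esub> ?K \<otimes>\<^bsub>A\<^esub> (u j \<otimes>\<^bsub>A\<^esub> b' j))"
      unfolding a_def using uc b'c sp[OF i] by (intro A.finsum_rdistr) auto
    also have "\<dots> = (\<Oplus>\<^bsub>A\<^esub>j\<in>{..<N}. u j \<otimes>\<^bsub>A\<^esub> s j [^]\<^bsub>A\<^esub> ?K \<otimes>\<^bsub>A\<^esub> b' i)"
    proof (rule A.finsum_cong')
      fix j assume "j \<in> {..<N}"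
      then have j: "j < N" by simp
      have "s i [^]\<^bsub>A\<^esub> ?K \<otimes>\<^bsub>A\<^esub> (u j \<otimes>\<^bsub>A\<^esub> b' j) = u j \<otimes>\<^bsub>A\<^esub> (s i [^]\<^bsub>A\<^esub> ?K \<otimes>\<^bsub>A\<^esub> b' j)"
        using cp[OF i uc[OF j], of ?K] uc[OF j] b'c[OF j] sp[OF i, of ?K] by (metis A.m_assoc)
      then show "s i [^]\<^bsub>A\<^esub> ?K \<otimes>\<^bsub>A\<^esub> (u j \<otimes>\<^bsub>A\<^esub> b' j) = u j \<otimes>\<^bsub>A\<^esub> s j [^]\<^bsub>A\<^esub> ?K \<otimes>\<^bsub>A\<^esub> b' i"
        using sb[OF i j] uc[OF j] b'c[OF i] sp[OF j] by (simp add: A.m_assoc)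
    qed (use uc b'c[OF i] sp in auto)
    also have "\<dots> = (\<Oplus>\<^bsub>A\<^esub>j\<in>{..<N}. u j \<otimes>\<^bsub>A\<^esub> s j [^]\<^bsub>A\<^esub> ?K) \<otimes>\<^bsub>A\<^esub> b' i"
      using uc b'c[OF i] sp by (intro A.finsum_ldistr[symmetric]) auto
    also have "\<dots> = b' i" using b'c[OF i] by (simp add: u(2)[symmetric])
    finally show ?thesis .
  qed
  have "f i a = c i" if i: "i < N" for i
  proof (rule cover_cancel_pow[OF i])
    interpret C: ring "C i" by (rule galg_ring[OF cover_gC[OF i]])
    show "f i a \<in> carrier (C i)" "c i \<in> carrier (C i)" using ghom_closed[OF cover_f[OF i] ac] c[OF i] .
    show "f i (s i) [^]\<^bsub>C i\<^esub> ?K \<otimes>\<^bsub>C i\<^esub> f i a = f i (s i) [^]\<^bsub>C i\<^esub> ?K \<otimes>\<^bsub>C i\<^esub> c i"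
      unfolding fb'[OF i] sa[OF i, symmetric] ghom_mult[OF cover_f[OF i] sp[OF i] ac]
        ghom_pow[OF A.ring_axioms C.ring_axioms cover_f[OF i] cover_sc[OF i]] ..
  qed
  then show ?thesis using ac by blast
qed

end

section \<open>The module object of a comodule\<close>

text \<open>A homogeneous tensor is a sum of pure tensors of homogeneous elements with the same
  total degree, so a degree shift may be tested on these.\<close>

lemma homog_tensor_map:
  assumes V: "gr V" and W: "gr W" and X: "gr X" and f: "lin_map (tensor V W) X f"
    and h: "\<And>m n v w. homog V m v \<Longrightarrow> homog W n w \<Longrightarrow> homog X (m + n + k) (f (tens V W v w))"
    and T: "homog (htensor V W) l T"
  shows "homog X (l + k) (f T)"
proof -
  have "T \<in> aspan (htensor V W) (tgen V W l)" by (rule homog_htensor_aspan[OF V W T])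
  then have "T \<in> carrier (tensor V W) \<and> homog X (l + k) (f T)"
  proof induction
    case (base T)
    then obtain v w m n where "T = tens V W v w" "homog V m v" "homog W n w" "m + n = l"
      unfolding tgen_def by blast
    then show ?case using h[of m v n w] tens_closed[OF gr_vspace[OF V] gr_vspace[OF W], of v w]
      by (simp add: homog_closed)
  next
    case (add S T)
    then show ?case
      using vspace_tensor[OF gr_vspace[OF V] gr_vspace[OF W]] homog_add[OF X] by (simp add: lin_map_add[OF f])
  qed
  then show ?thesis ..
qed

text \<open>The shift \<open>k\<close> on the second factor is the degree of \<open>w\<close> when
  evaluating at \<open>w\<close>, and minus the degree of a generator when including
  \<open>A\<close> as a summand of the shifted direct sum.\<close>

lemma homog_tmap:
  assumes "gr V" "gr W" "gr V'" "gr W'"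
    and f: "lin_map V V' f" "\<And>m v. homog V m v \<Longrightarrow> homog V' m (f v)"
    and g: "lin_map W W' g" "\<And>m w. homog W m w \<Longrightarrow> homog W' (m + k) (g w)"
    and T: "homog (htensor V W) l T"
  shows "homog (htensor V' W') (l + k) (tmap V' W' f g T)"
proof (rule homog_tensor_map[OF assms(1,2) gr_htensor[OF assms(3,4)] _ _ T])
  note v = assms(1-4)[THEN gr_vspace]
  show "lin_map (tensor V W) (htensor V' W') (tmap V' W' f g)"
    using lin_tmap[OF v f(1) g(1)] by simp
  show "homog (htensor V' W') (m + n + k) (tmap V' W' f g (tens V W a b))"
    if "homog V m a" "homog W n b" for m n a b
    using homog_tens[OF assms(3,4) f(2)[OF that(1)] g(2)[OF that(2)]] tmap_tens[OF v f(1) g(1)] that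
    by (simp add: homog_closed add.assoc)
qed

section \<open>Coinvariant scalars and the module structure of \<open>j(V)\<close>\<close>

lemma cring_coinv_ring:
  fixes B :: "('k::field, 'n::finite, 'u) hobj"
  assumes R: "cotriangular R" and B: "halgebra R B"
  shows "cring (coinv_ring B)"
proof -
  note g = halgebra_galg[OF B]
  interpret B: ring B by (rule galg_ring[OF g])
  note h = galg_gr[OF g]
  have c: "homog B 0 x \<Longrightarrow> x \<in> carrier B" for x by (rule homog_closed)
  have neg: "homog B 0 (\<ominus>\<^bsub>B\<^esub> x)" if "homog B 0 x" for x
    using homog_smult[OF h that, of "- 1"] vs_minus[OF gr_vspace[OF h] c[OF that]] by simp
  have ab: "abelian_group (coinv_ring B)"
  proof (rule abelian_groupI)
    fix x assume x: "x \<in> carrier (coinv_ring B)"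
    then show "\<exists>y\<in>carrier (coinv_ring B). y \<oplus>\<^bsub>coinv_ring B\<^esub> x = \<zero>\<^bsub>coinv_ring B\<^esub>"
      by (intro bexI[of _ "\<ominus>\<^bsub>B\<^esub> x"]) (auto simp: coinv_ring_def coinv_homog c neg B.l_neg)
  qed (auto simp: coinv_ring_def coinv_homog c homog_add[OF h] homog_zero[OF h] B.a_ac)
  have mult: "homog B 0 (x \<otimes>\<^bsub>B\<^esub> y)" if "homog B 0 x" "homog B 0 y" for x y
    using galg_homog_mult[OF g that] by simp
  show ?thesis
  proof (rule cringI[OF ab])
    show "comm_monoid (coinv_ring B)"
    proof (rule comm_monoidI)
      fix x y assume "x \<in> carrier (coinv_ring B)" "y \<in> carrier (coinv_ring B)"
      then show "x \<otimes>\<^bsub>coinv_ring B\<^esub> y = y \<otimes>\<^bsub>coinv_ring B\<^esub> x"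
        using coinv_central[OF R B, of x y] by (simp add: coinv_ring_def coinv_homog c)
    qed (auto simp: coinv_ring_def coinv_homog mult c galg_homog_one[OF g] B.m_assoc)
  qed (auto simp: coinv_ring_def coinv_homog c B.l_distr)
qed

context
  fixes V :: "('k::field, 'n::finite, 'v) hobj" and R :: "('k, 'n) torus2 \<Rightarrow> 'k"
  assumes R: "cotriangular R" and V: "gr V"
begin

lemma jmod_fields [simp]:
  "carrier (sect (jmod V) B) = coinv (htensor B V)" "zero (sect (jmod V) B) = \<zero>\<^bsub>tensor B V\<^esub>"
  "add (sect (jmod V) B) = add (tensor B V)"
  "smult (sect (jmod V) B) = (\<lambda>b. tlift (tensor B V) (\<lambda>b' v. tens B V (b \<otimes>\<^bsub>B\<^esub> b') v))"
  "restr (jmod V) B C f = tmap B V f id"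
  by (simp_all add: jmod_def)

context
  fixes B :: "('k, 'n, 'u) hobj"
  assumes B: "galg B"
begin

lemma bilin_jact: "b \<in> carrier B \<Longrightarrow> bilin B V (tensor B V) (\<lambda>b' v. tens B V (b \<otimes>\<^bsub>B\<^esub> b') v)"
  by (rule bilin_comp[OF bilin_tens[OF galg_vspace[OF B] gr_vspace[OF V]] bilin_r[OF bilin_mult[OF B]] lin_map_id])

lemmas lin_jact = lin_tlift[OF galg_vspace[OF B] gr_vspace[OF V] vspace_tensor[OF galg_vspace[OF B] gr_vspace[OF V]] bilin_jact]
lemmas jact_tens = tlift_tens[OF galg_vspace[OF B] gr_vspace[OF V] vspace_tensor[OF galg_vspace[OF B] gr_vspace[OF V]] bilin_jact]

lemma jact_homog:
  assumes b: "homog B 0 b" and T: "homog (htensor B V) l T"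
  shows "homog (htensor B V) l (tlift (tensor B V) (\<lambda>b' v. tens B V (b \<otimes>\<^bsub>B\<^esub> b') v) T)"
proof -
  note bc = homog_closed[OF b]
  have "homog (htensor B V) (l + 0) (tlift (tensor B V) (\<lambda>b' v. tens B V (b \<otimes>\<^bsub>B\<^esub> b') v) T)"
  proof (rule homog_tensor_map[OF galg_gr[OF B] V gr_htensor[OF galg_gr[OF B] V] _ _ T])
    show "lin_map (tensor B V) (htensor B V) (tlift (tensor B V) (\<lambda>b' v. tens B V (b \<otimes>\<^bsub>B\<^esub> b') v))"
      using lin_jact[OF bc] by simp
    show "homog (htensor B V) (m + n + 0) (tlift (tensor B V) (\<lambda>b' v. tens B V (b \<otimes>\<^bsub>B\<^esub> b') v) (tens B V b' v))"
      if "homog B m b'" "homog V n v" for m n b' v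
      using homog_tens[OF galg_gr[OF B] V galg_homog_mult[OF B b that(1)] that(2)] jact_tens[OF bc] that
      by (simp add: homog_closed)
  qed
  then show ?thesis by simp
qed

end

lemma module_jmod:
  fixes B :: "('k, 'n, 'u) hobj"
  assumes hB: "halgebra R B"
  shows "Module.module (coinv_ring B) (sect (jmod V) B)"
proof -
  note B = halgebra_galg[OF hB]
  note vB = galg_vspace[OF B] and vV = gr_vspace[OF V] and h = gr_htensor[OF galg_gr[OF B] V]
  note t = vspace_tensor[OF vB vV] and bt = bilin_tens[OF vB vV]
  interpret B: ring B by (rule galg_ring[OF B])
  interpret t: abelian_group "tensor B V" by (rule vspace_abelian_group[OF t])
  let ?M = "sect (jmod V) B"
  note act = lin_jact[OF B] jact_tens[OF B]
  have c: "homog (htensor B V) 0 T \<Longrightarrow> T \<in> carrier (tensor B V)" for T using homog_closed[of "htensor B V"] by simp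
  have cB: "homog B 0 b \<Longrightarrow> b \<in> carrier B" for b by (rule homog_closed)
  have add: "homog (htensor B V) 0 (S \<oplus>\<^bsub>tensor B V\<^esub> T)" if "homog (htensor B V) 0 S" "homog (htensor B V) 0 T" for S T
    using homog_add[OF h that] by simp
  have zero: "homog (htensor B V) 0 \<zero>\<^bsub>tensor B V\<^esub>" using homog_zero[OF h] by simp
  have neg: "homog (htensor B V) 0 (\<ominus>\<^bsub>tensor B V\<^esub> T)" if "homog (htensor B V) 0 T" for T
    using homog_smult[OF h that, of "- 1"] vs_minus[OF t c[OF that]] by simp
  have eqI: "f T = g T" if "lin_map (tensor B V) (tensor B V) f" "lin_map (tensor B V) (tensor B V) g"
    "\<And>b v. b \<in> carrier B \<Longrightarrow> v \<in> carrier V \<Longrightarrow> f (tens B V b v) = g (tens B V b v)" "homog (htensor B V) 0 T" for f g T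
    by (rule tensor_lin_eqI[OF vB vV t that(1-3) c[OF that(4)]])
  have tl: "tens B V (b \<oplus>\<^bsub>B\<^esub> b') v = tens B V b v \<oplus>\<^bsub>tensor B V\<^esub> tens B V b' v"
    if "b \<in> carrier B" "b' \<in> carrier B" "v \<in> carrier V" for b b' v
    by (rule lin_map_add[OF bilin_l[OF bt that(3)] that(1,2)])
  show ?thesis
  proof (rule moduleI)
    show "cring (coinv_ring B)" by (rule cring_coinv_ring[OF R hB])
    show "abelian_group ?M"
    proof (rule abelian_groupI)
      fix x assume x: "x \<in> carrier ?M"
      then show "\<exists>y\<in>carrier ?M. y \<oplus>\<^bsub>?M\<^esub> x = \<zero>\<^bsub>?M\<^esub>"
        by (intro bexI[of _ "\<ominus>\<^bsub>tensor B V\<^esub> x"]) (auto simp: coinv_homog c neg t.l_neg)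
    qed (auto simp: coinv_homog c add zero t.a_ac)
  next
    fix a x assume "a \<in> carrier (coinv_ring B)" "x \<in> carrier ?M"
    then have a: "homog B 0 a" and x: "homog (htensor B V) 0 x" by (auto simp: coinv_ring_def coinv_homog)
    show "a \<odot>\<^bsub>?M\<^esub> x \<in> carrier ?M" using jact_homog[OF B a x] by (simp add: coinv_homog)
  next
    fix a b x assume "a \<in> carrier (coinv_ring B)" "b \<in> carrier (coinv_ring B)" "x \<in> carrier ?M"
    then have a: "homog B 0 a" and b: "homog B 0 b" and x: "homog (htensor B V) 0 x"
      by (auto simp: coinv_ring_def coinv_homog)
    note ac = cB[OF a] and bc = cB[OF b]
    note abc = B.a_closed[OF ac bc] and mc = B.m_closed[OF ac bc]
    show "(a \<oplus>\<^bsub>coinv_ring B\<^esub> b) \<odot>\<^bsub>?M\<^esub> x = a \<odot>\<^bsub>?M\<^esub> x \<oplus>\<^bsub>?M\<^esub> b \<odot>\<^bsub>?M\<^esub> x"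
      using eqI[OF act(1)[OF abc] lin_map_sum2[OF t act(1)[OF ac] act(1)[OF bc]] _ x] ac bc abc
      by (simp add: coinv_ring_def act(2) B.l_distr tl)
    show "(a \<otimes>\<^bsub>coinv_ring B\<^esub> b) \<odot>\<^bsub>?M\<^esub> x = a \<odot>\<^bsub>?M\<^esub> (b \<odot>\<^bsub>?M\<^esub> x)"
      using eqI[OF act(1)[OF mc] lin_map_comp[OF act(1)[OF bc] act(1)[OF ac]] _ x] ac bc mc
      by (simp add: coinv_ring_def act(2) B.m_assoc)
  next
    fix a x y assume "a \<in> carrier (coinv_ring B)" "x \<in> carrier ?M" "y \<in> carrier ?M"
    then have "homog B 0 a" "homog (htensor B V) 0 x" "homog (htensor B V) 0 y"
      by (auto simp: coinv_ring_def coinv_homog)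
    then show "a \<odot>\<^bsub>?M\<^esub> (x \<oplus>\<^bsub>?M\<^esub> y) = a \<odot>\<^bsub>?M\<^esub> x \<oplus>\<^bsub>?M\<^esub> a \<odot>\<^bsub>?M\<^esub> y"
      using lin_map_add[OF act(1)] c cB by simp
  next
    fix x assume "x \<in> carrier ?M"
    then have x: "homog (htensor B V) 0 x" by (simp add: coinv_homog)
    show "\<one>\<^bsub>coinv_ring B\<^esub> \<odot>\<^bsub>?M\<^esub> x = x"
      using eqI[OF act(1)[OF B.one_closed] lin_map_id _ x] by (simp add: coinv_ring_def act(2))
  qed
qed

lemma tmap_restr:
  fixes B C :: "('k, 'n, 'u) hobj"
  assumes B: "galg B" and C: "galg C" and f: "ghom C B f"
  shows tmap_restr_lin: "lin_map (tensor C V) (tensor B V) (tmap B V f id)"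
    and tmap_restr_tens: "c \<in> carrier C \<Longrightarrow> v \<in> carrier V \<Longrightarrow> tmap B V f id (tens C V c v) = tens B V (f c) v"
    and tmap_restr_homog: "homog (htensor C V) l T \<Longrightarrow> homog (htensor B V) l (tmap B V f id T)"
proof -
  note vB = galg_vspace[OF B] and vC = galg_vspace[OF C] and vV = gr_vspace[OF V]
  have id: "lin_map V V id" by (simp add: id_def lin_map_id)
  show "lin_map (tensor C V) (tensor B V) (tmap B V f id)"
    by (rule lin_tmap[OF vC vV vB vV ghom_lin[OF f] id])
  show "c \<in> carrier C \<Longrightarrow> v \<in> carrier V \<Longrightarrow> tmap B V f id (tens C V c v) = tens B V (f c) v"
    using tmap_tens[OF vC vV vB vV ghom_lin[OF f] id] by simp
  show "homog (htensor C V) l T \<Longrightarrow> homog (htensor B V) l (tmap B V f id T)"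
    using homog_tmap[OF galg_gr[OF C] V galg_gr[OF B] V ghom_lin[OF f] ghom_homog[OF f] id, of 0] by simp
qed

section \<open>The presheaf and sheaf conditions for \<open>j(V)\<close>\<close>

lemma hpresheaf_jmod: "hpresheaf R (\<lambda>B :: ('k, 'n, 'u) hobj. carrier (sect (jmod V) B)) (restr (jmod V))"
  unfolding hpresheaf_def
proof (intro conjI allI impI ballI)
  fix B C :: "('k, 'n, 'u) hobj" and f
  assume "hfp R B" "hfp R C" "f \<in> halg_hom C B"
  then have "galg B" "galg C" "ghom C B f"
    using halg_hom_ghom by (auto simp: hfp_def dest: halgebra_galg)
  from tmap_restr_homog[OF this]
  show "restr (jmod V) B C f \<in> carrier (sect (jmod V) C) \<rightarrow> carrier (sect (jmod V) B)"
    by (auto simp: coinv_homog)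
next
  fix B :: "('k, 'n, 'u) hobj" and y
  assume "hfp R B" and y: "y \<in> carrier (sect (jmod V) B)"
  then have B: "galg B" by (auto simp: hfp_def dest: halgebra_galg)
  note vB = galg_vspace[OF B] and vV = gr_vspace[OF V]
  have i: "ghom B B (\<lambda>b\<in>carrier B. b)"
    using galg_mult_closed[OF B] galg_one_closed[OF B] vB by (auto simp: ghom_def lin_map_def homog_closed)
  have yc: "y \<in> carrier (tensor B V)" using y homog_closed[of "htensor B V" 0 y] by (simp add: coinv_homog)
  show "restr (jmod V) B B (\<lambda>b\<in>carrier B. b) y = y"
    using tensor_lin_eqI[OF vB vV vspace_tensor[OF vB vV] tmap_restr_lin[OF B B i] lin_map_id _ yc]
      tmap_restr_tens[OF B B i] by simp
next
  fix B C D :: "('k, 'n, 'u) hobj" and f g y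
  assume "hfp R B" "hfp R C" "hfp R D" and fg: "f \<in> halg_hom C B" "g \<in> halg_hom D C"
    and y: "y \<in> carrier (sect (jmod V) D)"
  then have B: "galg B" and C: "galg C" and D: "galg D" by (auto simp: hfp_def dest: halgebra_galg)
  note f = halg_hom_ghom[OF C B fg(1)] and g = halg_hom_ghom[OF D C fg(2)]
  note vB = galg_vspace[OF B] and vD = galg_vspace[OF D] and vV = gr_vspace[OF V]
  have fg: "ghom D B (compose (carrier D) f g)"
    by (rule ghom_cong[OF ghom_comp[OF g f] vD]) (auto simp: compose_def galg_one_closed[OF D] galg_mult_closed[OF D])
  have yc: "y \<in> carrier (tensor D V)" using y homog_closed[of "htensor D V" 0 y] by (simp add: coinv_homog)
  show "restr (jmod V) B D (compose (carrier D) f g) y = restr (jmod V) B C f (restr (jmod V) C D g y)"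
    using tensor_lin_eqI[OF vD vV vspace_tensor[OF vB vV] tmap_restr_lin[OF B D fg]
        lin_map_comp[OF tmap_restr_lin[OF C D g] tmap_restr_lin[OF B C f]] _ yc]
      tmap_restr_tens[OF B D fg] tmap_restr_tens[OF C D g] tmap_restr_tens[OF B C f] ghom_closed[OF g]
    by (simp add: compose_def)
qed

lemma hsheaf_jmod: "hsheaf R (\<lambda>B :: ('k, 'n, 'u) hobj. carrier (sect (jmod V) B)) (restr (jmod V))"
  unfolding hsheaf_def
proof (intro conjI allI impI ballI)
  show "hpresheaf R (\<lambda>B :: ('k, 'n, 'u) hobj. carrier (sect (jmod V) B)) (restr (jmod V))"
    by (rule hpresheaf_jmod)
  fix A :: "('k, 'n, 'u) hobj" and N s C f D g h y
  assume "hfp R A" and cov: "hcover R A N s C f" and ov: "hoverlap R A N s C f D g h"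
    and y: "y \<in> (\<Pi>\<^sub>E i\<in>{..<N}. carrier (sect (jmod V) (C i)))"
    and comp: "\<forall>i<N. \<forall>j<N. restr (jmod V) (D i j) (C i) (g i j) (y i) = restr (jmod V) (D i j) (C j) (h i j) (y j)"
  then have hA: "halgebra R A" by (simp add: hfp_def)
  note ca = R hA cov ov
  note A = halgebra_galg[OF hA] and C = cover_gC[OF ca] and D = overlap_D(1)[OF ca]
  note gf = cover_f[OF ca] and gg = overlap_g[OF ca] and gh = overlap_h[OF ca]
  note vA = galg_vspace[OF A] and vC = galg_vspace[OF C] and vD = galg_vspace[OF D] and vV = gr_vspace[OF V]
  obtain \<sigma> where d: "dbasis V (\<lambda>v. v) \<sigma>" using ex_dbasis[OF vV] by blast
  have yh: "homog (htensor (C i) V) 0 (y i)" if "i < N" for i using y that by (auto simp: coinv_homog)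
  have yc: "y i \<in> carrier (tensor (C i) V)" if "i < N" for i using homog_closed[OF yh[OF that]] by simp
  let ?c = "\<lambda>v i. rsl \<sigma> (C i) v (y i)"
  have cc: "?c v i \<in> carrier (C i)" if "i < N" for v i
    by (rule lin_map_closed[OF lin_rsl[OF vC vV d] yc]) (use that in auto)
  have "\<exists>a\<in>carrier A. \<forall>i<N. f i a = ?c v i" for v
  proof (rule cover_glue[OF ca cc])
    fix i j assume i: "i < N" and j: "j < N"
    have "g i j (?c v i) = rsl \<sigma> (D i j) v (tmap (D i j) V (g i j) id (y i))"
      by (rule rsl_tmap[OF vC vV vD d ghom_lin[OF gg] yc, symmetric]) (use i j in auto)
    also have "\<dots> = rsl \<sigma> (D i j) v (tmap (D i j) V (h i j) id (y j))" using comp i j by simp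
    also have "\<dots> = h i j (?c v j)"
      by (rule rsl_tmap[OF vC vV vD d ghom_lin[OF gh] yc]) (use i j in auto)
    finally show "g i j (?c v i) = h i j (?c v j)" .
  qed
  \<comment> \<open>The coefficients are glued separately for each index; naturality of slices
    turned the compatibility of the \<open>y i\<close> into compatibility of their
    coefficients.\<close>
  then obtain a where a: "\<And>v. a v \<in> carrier A" "\<And>v i. i < N \<Longrightarrow> f i (a v) = ?c v i" by metis
  have "\<exists>F. finite F \<and> F \<subseteq> carrier V \<and> (\<forall>v. v \<notin> F \<longrightarrow> ?c v i = \<zero>\<^bsub>C i\<^esub>) \<and>
      y i = (\<Oplus>\<^bsub>tensor (C i) V\<^esub>v\<in>F. tens (C i) V (?c v i) v)" if "i < N" for i
    using tensor_rsl[OF vC[OF that] vV d yc[OF that]] unfolding image_ident .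
  then have "\<exists>F. \<forall>i<N. finite (F i) \<and> F i \<subseteq> carrier V \<and> (\<forall>v. v \<notin> F i \<longrightarrow> ?c v i = \<zero>\<^bsub>C i\<^esub>) \<and>
      y i = (\<Oplus>\<^bsub>tensor (C i) V\<^esub>v\<in>F i. tens (C i) V (?c v i) v)"
    by (intro bchoice[of "{..<N}", simplified Ball_def lessThan_iff]) blast
  then obtain F where F0: "\<forall>i<N. finite (F i) \<and> F i \<subseteq> carrier V \<and> (\<forall>v. v \<notin> F i \<longrightarrow> ?c v i = \<zero>\<^bsub>C i\<^esub>) \<and>
      y i = (\<Oplus>\<^bsub>tensor (C i) V\<^esub>v\<in>F i. tens (C i) V (?c v i) v)" by (elim exE)
  have F: "i < N \<Longrightarrow> finite (F i)" "i < N \<Longrightarrow> F i \<subseteq> carrier V"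
    "i < N \<Longrightarrow> v \<notin> F i \<Longrightarrow> ?c v i = \<zero>\<^bsub>C i\<^esub>"
    "i < N \<Longrightarrow> y i = (\<Oplus>\<^bsub>tensor (C i) V\<^esub>v\<in>F i. tens (C i) V (?c v i) v)" for i v
    using F0[rule_format, of i] by blast+
  \<comment> \<open>Only finitely many indices occur in the expansions of the \<open>y i\<close>.
    Summing over their union keeps \<open>x\<close> a finite sum, and the terms beyond
    \<open>F i\<close> vanish over \<open>C i\<close>.\<close>
  let ?G = "\<Union>i<N. F i"
  have G: "finite ?G" "?G \<subseteq> carrier V" using F by auto
  define x where "x = (\<Oplus>\<^bsub>tensor A V\<^esub>v\<in>?G. tens A V (a v) v)"
  have tc: "(\<lambda>v. tens A V (a v) v) \<in> ?G \<rightarrow> carrier (tensor A V)"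
    using a G by (auto intro!: tens_closed[OF vA vV])
  have xc: "x \<in> carrier (tensor A V)"
    unfolding x_def by (rule vs_finsum_closed[OF vspace_tensor[OF vA vV] tc])
  have fx: "tmap (C i) V (f i) id x = y i" if i: "i < N" for i
  proof -
    interpret t: abelian_group "tensor (C i) V"
      by (rule vspace_abelian_group[OF vspace_tensor[OF vC[OF i] vV]])
    have "tmap (C i) V (f i) id x = (\<Oplus>\<^bsub>tensor (C i) V\<^esub>v\<in>?G. tmap (C i) V (f i) id (tens A V (a v) v))"
      unfolding x_def
      by (rule lin_map_finsum[OF vspace_tensor[OF vA vV] vspace_tensor[OF vC[OF i] vV] tmap_restr_lin[OF C[OF i] A gf[OF i]] tc])
    also have "\<dots> = (\<Oplus>\<^bsub>tensor (C i) V\<^esub>v\<in>?G. tens (C i) V (?c v i) v)"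
      using a(2)[OF i] a(1) G cc[OF i] by (intro t.finsum_cong')
        (auto simp: tmap_restr_tens[OF C[OF i] A gf[OF i]] intro!: tens_closed[OF vC[OF i] vV])
    also have "\<dots> = (\<Oplus>\<^bsub>tensor (C i) V\<^esub>v\<in>F i. tens (C i) V (?c v i) v)"
    proof (rule t.add.finprod_mono_neutral_cong_right)
      show "tens (C i) V (?c v i) v = \<zero>\<^bsub>tensor (C i) V\<^esub>" if "v \<in> ?G - F i" for v
        using that F(3)[OF i, of v] G tens_zero_l[OF vC[OF i] vV, of v] by auto
      show "(\<lambda>v. tens (C i) V (?c v i) v) \<in> ?G \<rightarrow> carrier (tensor (C i) V)"
        using G cc[OF i] by (auto intro!: tens_closed[OF vC[OF i] vV])
    qed (use G i in auto)
    also have "\<dots> = y i" by (rule F(4)[OF i, symmetric])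
    finally show ?thesis .
  qed
  note hA = gr_htensor[OF galg_gr[OF A] V] and hC = gr_htensor[OF galg_gr[OF C] V]
  \<comment> \<open>The glued coefficients were not chosen homogeneous, so \<open>x\<close> is
    replaced by its component of degree 0. The restrictions preserve degrees and the
    \<open>y i\<close> have degree 0, so they are unaffected.\<close>
  let ?x = "hpr (htensor A V) 0 x"
  show "\<exists>!x. x \<in> carrier (sect (jmod V) A) \<and> (\<forall>i<N. restr (jmod V) (C i) A (f i) x = y i)"
  proof (rule ex1I[of _ ?x], intro conjI allI impI)
    show "?x \<in> carrier (sect (jmod V) A)" using homog_hpr[OF hA, of x 0] xc by (simp add: coinv_homog)
    show "restr (jmod V) (C i) A (f i) ?x = y i" if i: "i < N" for i
    proof -
      have "tmap (C i) V (f i) id ?x = hpr (htensor (C i) V) (0 + 0) (tmap (C i) V (f i) id x)"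
      proof (rule hpr_map[OF hA hC[OF i]])
        show "lin_map (htensor A V) (htensor (C i) V) (tmap (C i) V (f i) id)"
          using tmap_restr_lin[OF C[OF i] A gf[OF i]] by simp
      qed (use xc tmap_restr_homog[OF C[OF i] A gf[OF i]] in \<open>auto simp: id_def\<close>)
      then show ?thesis using hpr_homog[OF hC[OF i] yh[OF i], of 0] fx[OF i] by simp
    qed
    fix x' assume x': "x' \<in> carrier (sect (jmod V) A) \<and> (\<forall>i<N. restr (jmod V) (C i) A (f i) x' = y i)"
    then have x'c: "x' \<in> carrier (tensor A V)" using homog_closed[of "htensor A V" 0 x'] by (simp add: coinv_homog)
    have x0: "homog (htensor A V) 0 x'" using x' by (simp add: coinv_homog)
    \<comment> \<open>Uniqueness holds among all tensors: each coefficient of the difference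
      vanishes in every \<open>C i\<close>, so \<open>cover_separated\<close> applies.\<close>
    have "x' = x"
    proof (rule tensor_eq_rsl[OF vA vV d x'c xc])
      fix v
      note lr = lin_rsl[OF vA vV d]
      have c: "rsl \<sigma> A v x' \<in> carrier A" "rsl \<sigma> A v x \<in> carrier A"
        using lin_map_closed[OF lr] x'c xc by auto
      interpret A: ring A by (rule galg_ring[OF A])
      have "rsl \<sigma> A v x' \<ominus>\<^bsub>A\<^esub> rsl \<sigma> A v x = \<zero>\<^bsub>A\<^esub>"
      proof (rule cover_separated[OF ca])
        fix i assume i: "i < N"
        interpret Ci: ring "C i" by (rule galg_ring[OF C[OF i]])
        have "f i (rsl \<sigma> A v x') = ?c v i" "f i (rsl \<sigma> A v x) = ?c v i"
          using rsl_tmap[OF vA vV vC[OF i] d ghom_lin[OF gf[OF i]] x'c, of v]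
            rsl_tmap[OF vA vV vC[OF i] d ghom_lin[OF gf[OF i]] xc, of v] x' fx[OF i] i by auto
        then show "f i (rsl \<sigma> A v x' \<ominus>\<^bsub>A\<^esub> rsl \<sigma> A v x) = \<zero>\<^bsub>C i\<^esub>"
          using lin_map_diff[OF vA vC[OF i] ghom_lin[OF gf[OF i]] c] cc[OF i] by (simp add: a_minus_def Ci.r_neg)
      qed (use c in simp)
      then show "rsl \<sigma> A v x' = rsl \<sigma> A v x" by (rule abelian_group_diff_zero[OF A.is_abelian_group c])
    qed
    then show "x' = ?x" using hpr_homog[OF hA x0, of 0] by simp
  qed
qed

lemma kmod_obj_jmod: "kmod_obj R (jmod V :: ('k, 'n, 'u, (('u \<times> 'v) \<Rightarrow>\<^sub>0 'k) set) kmod)"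
  unfolding kmod_obj_def
proof (intro conjI allI impI ballI)
  show "hsheaf R (\<lambda>B :: ('k, 'n, 'u) hobj. carrier (sect (jmod V) B)) (restr (jmod V))" by (rule hsheaf_jmod)
  show "Module.module (coinv_ring B) (sect (jmod V) B)" if "hfp R B" for B :: "('k, 'n, 'u) hobj"
    using that by (auto simp: hfp_def intro: module_jmod)
  fix B C :: "('k, 'n, 'u) hobj" and f
  assume "hfp R B" "hfp R C" and fh: "f \<in> halg_hom C B"
  then have B: "galg B" and C: "galg C" by (auto simp: hfp_def dest: halgebra_galg)
  note f = halg_hom_ghom[OF C B fh]
  note vB = galg_vspace[OF B] and vC = galg_vspace[OF C] and vV = gr_vspace[OF V]
  have cc: "y \<in> carrier (tensor C V)" if "y \<in> carrier (sect (jmod V) C)" for y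
    using that homog_closed[of "htensor C V" 0 y] by (simp add: coinv_homog)
  show "restr (jmod V) B C f (y \<oplus>\<^bsub>sect (jmod V) C\<^esub> y') =
      restr (jmod V) B C f y \<oplus>\<^bsub>sect (jmod V) B\<^esub> restr (jmod V) B C f y'"
    if "y \<in> carrier (sect (jmod V) C)" "y' \<in> carrier (sect (jmod V) C)" for y y'
    using lin_map_add[OF tmap_restr_lin[OF B C f]] cc[OF that(1)] cc[OF that(2)] by simp
  fix c y assume "c \<in> coinv C" and y: "y \<in> carrier (sect (jmod V) C)"
  then have c: "c \<in> carrier C" by (simp add: coinv_def)
  note fc = ghom_closed[OF f c]
  show "restr (jmod V) B C f (c \<odot>\<^bsub>sect (jmod V) C\<^esub> y) = f c \<odot>\<^bsub>sect (jmod V) B\<^esub> restr (jmod V) B C f y"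
    using tensor_lin_eqI[OF vC vV vspace_tensor[OF vB vV] lin_map_comp[OF lin_jact[OF C c] tmap_restr_lin[OF B C f]]
        lin_map_comp[OF tmap_restr_lin[OF B C f] lin_jact[OF B fc]] _ cc[OF y]]
      c fc galg_mult_closed[OF C c]
    by (simp add: jact_tens[OF C c] jact_tens[OF B fc] tmap_restr_tens[OF B C f] ghom_mult[OF f] ghom_closed[OF f])
qed

end

section \<open>Braided partial derivatives\<close>

lemma aspan_finsum:
  assumes V: "vspace V" and z: "\<zero>\<^bsub>V\<^esub> \<in> aspan V G" and f: "finite F"
    and g: "\<And>i. i \<in> F \<Longrightarrow> g i \<in> carrier V" "\<And>i. i \<in> F \<Longrightarrow> g i \<in> aspan V G"
  shows "(\<Oplus>\<^bsub>V\<^esub>i\<in>F. g i) \<in> aspan V G"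
proof -
  interpret V: abelian_group V by (rule vspace_abelian_group[OF V])
  show ?thesis using f g
  proof (induction F rule: finite_induct)
    case empty
    then show ?case using z by simp
  next
    case (insert i F)
    then have "(\<Oplus>\<^bsub>V\<^esub>i\<in>insert i F. g i) = g i \<oplus>\<^bsub>V\<^esub> (\<Oplus>\<^bsub>V\<^esub>i\<in>F. g i)"
      by (intro V.finsum_insert) auto
    then show ?case using insert by (auto intro: aspan.add)
  qed
qed

lemma homog_finsum:
  assumes V: "gr V" and f: "finite F" and g: "\<And>i. i \<in> F \<Longrightarrow> homog V m (g i)"
  shows "homog V m (\<Oplus>\<^bsub>V\<^esub>i\<in>F. g i)"
proof -
  interpret V: abelian_group V by (rule vspace_abelian_group[OF gr_vspace[OF V]])
  show ?thesis using f g
  proof (induction F rule: finite_induct)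
    case empty
    then show ?case using homog_zero[OF V] by simp
  next
    case (insert i F)
    then have "(\<Oplus>\<^bsub>V\<^esub>i\<in>insert i F. g i) = g i \<oplus>\<^bsub>V\<^esub> (\<Oplus>\<^bsub>V\<^esub>i\<in>F. g i)"
      using homog_closed[OF insert.prems] by (intro V.finsum_insert) auto
    then show ?case using insert by (auto intro: homog_add[OF V])
  qed
qed

text \<open>Sums of products of a generator with homogeneous elements on both sides already form an
  ideal. The homogeneity of the outer factors lets the braided Leibniz rule be applied to each
  summand.\<close>

lemma genideal_aspan:
  fixes A :: "('k::field, 'n::finite, 'a) hobj"
  assumes A: "galg A" and S: "S \<subseteq> carrier A" and x: "x \<in> genideal A S"
  shows "x \<in> aspan A (insert \<zero>\<^bsub>A\<^esub> {a \<otimes>\<^bsub>A\<^esub> s \<otimes>\<^bsub>A\<^esub> b | a s b m n. s \<in> S \<and> homog A m a \<and> homog A n b})"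
proof -
  interpret A: ring A by (rule galg_ring[OF A])
  note gA = galg_gr[OF A] and vA = galg_vspace[OF A]
  let ?G = "insert \<zero>\<^bsub>A\<^esub> {a \<otimes>\<^bsub>A\<^esub> s \<otimes>\<^bsub>A\<^esub> b | a s b m n. s \<in> S \<and> homog A m a \<and> homog A n b}"
  let ?K = "aspan A ?G"
  have G: "?G \<subseteq> carrier A" using S homog_closed by fastforce
  have Kc: "y \<in> carrier A" if "y \<in> ?K" for y by (rule aspan_closed[OF vA G that])
  have z: "\<zero>\<^bsub>A\<^esub> \<in> ?K" by (rule aspan.base) simp
  have gen: "a \<otimes>\<^bsub>A\<^esub> s \<otimes>\<^bsub>A\<^esub> b \<in> ?K" if "s \<in> S" "homog A m a" "homog A n b" for a s b m n
    by (rule aspan.base) (use that in blast)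
  have l: "c \<otimes>\<^bsub>A\<^esub> y \<in> ?K" if c: "homog A k c" and y: "y \<in> ?K" for c y k
    using y
  proof induction
    case (base g)
    show ?case
    proof (cases "g = \<zero>\<^bsub>A\<^esub>")
      case True then show ?thesis using z homog_closed[OF c] by simp
    next
      case False
      then obtain a s b m n where g: "g = a \<otimes>\<^bsub>A\<^esub> s \<otimes>\<^bsub>A\<^esub> b" "s \<in> S" "homog A m a" "homog A n b"
        using base by blast
      have "c \<otimes>\<^bsub>A\<^esub> g = (c \<otimes>\<^bsub>A\<^esub> a) \<otimes>\<^bsub>A\<^esub> s \<otimes>\<^bsub>A\<^esub> b"
        using g c S by (simp add: homog_closed A.m_assoc subset_iff)
      then show ?thesis using gen[OF g(2) galg_homog_mult[OF A c g(3)] g(4)] by simp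
    qed
  next
    case (add v w)
    then show ?case using Kc homog_closed[OF c] by (simp add: A.r_distr aspan.add)
  qed
  have r: "y \<otimes>\<^bsub>A\<^esub> c \<in> ?K" if c: "homog A k c" and y: "y \<in> ?K" for c y k
    using y
  proof induction
    case (base g)
    show ?case
    proof (cases "g = \<zero>\<^bsub>A\<^esub>")
      case True then show ?thesis using z homog_closed[OF c] by simp
    next
      case False
      then obtain a s b m n where g: "g = a \<otimes>\<^bsub>A\<^esub> s \<otimes>\<^bsub>A\<^esub> b" "s \<in> S" "homog A m a" "homog A n b"
        using base by blast
      have "g \<otimes>\<^bsub>A\<^esub> c = a \<otimes>\<^bsub>A\<^esub> s \<otimes>\<^bsub>A\<^esub> (b \<otimes>\<^bsub>A\<^esub> c)"
        using g c S by (simp add: homog_closed A.m_assoc subset_iff)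
      then show ?thesis using gen[OF g(2,3) galg_homog_mult[OF A g(4) c]] by simp
    qed
  next
    case (add v w)
    then show ?case using Kc homog_closed[OF c] by (simp add: A.l_distr aspan.add)
  qed
  have "ideal ?K A"
  proof (rule idealI)
    show "ring A" by (rule A.ring_axioms)
    show "subgroup ?K (add_monoid A)"
    proof (rule A.add.subgroupI)
      show "?K \<subseteq> carrier A" using Kc by blast
      show "?K \<noteq> {}" using z by blast
      show "v \<oplus>\<^bsub>A\<^esub> w \<in> ?K" if "v \<in> ?K" "w \<in> ?K" for v w using that by (rule aspan.add)
      show "\<ominus>\<^bsub>A\<^esub> v \<in> ?K" if v: "v \<in> ?K" for v
      proof -
        have "(\<ominus>\<^bsub>A\<^esub> \<one>\<^bsub>A\<^esub>) \<otimes>\<^bsub>A\<^esub> v \<in> ?K"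
          using l[OF homog_smult[OF gA galg_homog_one[OF A], of "- 1"] v] vs_minus[OF vA A.one_closed] by simp
        then show ?thesis using Kc[OF v] A.l_minus[OF A.one_closed Kc[OF v]] by simp
      qed
    qed
    fix y c assume y: "y \<in> ?K" and c: "c \<in> carrier A"
    show "c \<otimes>\<^bsub>A\<^esub> y \<in> ?K" using c
    proof (induction rule: gr_induct[OF gA, consumes 1, case_names homog add])
      case (homog k c)
      then show ?case using l y by blast
    next
      case (add v w)
      then show ?case using Kc[OF y] by (simp add: A.l_distr aspan.add)
    qed
    show "y \<otimes>\<^bsub>A\<^esub> c \<in> ?K" using c
    proof (induction rule: gr_induct[OF gA, consumes 1, case_names homog add])
      case (homog k c)
      then show ?case using r y by blast
    next
      case (add v w)
      then show ?case using Kc[OF y] by (simp add: A.r_distr aspan.add)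
    qed
  qed
  moreover have "S \<subseteq> ?K"
  proof
    fix s assume s: "s \<in> S"
    show "s \<in> ?K" using gen[OF s galg_homog_one[OF A] galg_homog_one[OF A]] s S by (simp add: subset_iff)
  qed
  ultimately have "genideal A S \<subseteq> ?K" by (rule A.genideal_minimal)
  then show ?thesis using x by blast
qed

text \<open>The braided derivative of a word, with the Leibniz rule read as a recursion on the first
  letter; \<open>bch R (ms ! i) (- (ms ! j))\<close> is the factor for moving the derivation past
  \<open>x_i\<close>.\<close>

fun wpd :: "(('k::field, 'n::finite) torus2 \<Rightarrow> 'k) \<Rightarrow> (int ^ 'n) list \<Rightarrow> nat \<Rightarrow> nat list \<Rightarrow> 'k ncpoly" where
  "wpd R ms j [] = 0"
| "wpd R ms j (i # l) = (if i = j then Poly_Mapping.single (Word l) 1 else 0) +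
     psmult (bch R (ms ! i) (- (ms ! j))) (ncgen i * wpd R ms j l)"

context
  fixes R :: "('k::field, 'n::finite) torus2 \<Rightarrow> 'k" and ms :: "(int ^ 'n) list" and j :: nat
  assumes R: "cotriangular R" and j: "j < length ms"
begin

private abbreviation (input) "NA \<equiv> ncpoly_alg ms :: ('k, 'n, 'k ncpoly) hobj"
private abbreviation (input) "FA \<equiv> hfree R ms"

definition ncpd :: "'k ncpoly \<Rightarrow> 'k ncpoly" where
  "ncpd = fsum NA (\<lambda>w. wpd R ms j (letters w))"

lemma wpd_keys: "Word l \<in> words (length ms) \<Longrightarrow> Poly_Mapping.keys (wpd R ms j l) \<subseteq> words (length ms)"
proof (induction l)
  case (Cons i l)
  then have l: "Word l \<in> words (length ms)" and i: "i < length ms" by (auto simp: words_def)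
  have "Poly_Mapping.keys (if i = j then Poly_Mapping.single (Word l) 1 else 0 :: 'k ncpoly) \<subseteq> words (length ms)"
    using l by auto
  then show ?case
    using ncpoly_keys(1)[OF _ ncpoly_keys(3)[OF ncpoly_keys(2)[OF ncgen_keys[OF i] Cons.IH[OF l]]]] by simp
qed simp

lemma ncpd_lin: "lin_map NA NA ncpd"
proof -
  have g: "(\<lambda>w. wpd R ms j (letters w)) \<in> words (length ms) \<rightarrow> carrier NA"
    using wpd_keys by auto
  show ?thesis unfolding ncpd_def
    using fsum_add[OF vspace_ncpoly g] fsum_psmult[OF vspace_ncpoly g] fsum_closed[OF vspace_ncpoly g]
    by (intro lin_mapI) auto
qed

lemma ncpd_single: "w \<in> words (length ms) \<Longrightarrow> ncpd (Poly_Mapping.single w c) = psmult c (wpd R ms j (letters w))"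
proof -
  have g: "(\<lambda>w. wpd R ms j (letters w)) \<in> words (length ms) \<rightarrow> carrier NA"
    using wpd_keys by auto
  show "w \<in> words (length ms) \<Longrightarrow> ?thesis"
    unfolding ncpd_def using fsum_single[OF vspace_ncpoly g] by simp
qed

text \<open>The factors collected from the letters of \<open>l\<close> multiply to the factor of the
  whole degree of \<open>l\<close>, by the bicharacter property.\<close>

lemma wpd_append:
  "wpd R ms j (l @ l') = wpd R ms j l * Poly_Mapping.single (Word l') 1 +
    psmult (bch R (wdeg ms (Word l)) (- (ms ! j))) (Poly_Mapping.single (Word l) 1 * wpd R ms j l')"
proof (induction l)
  case Nil
  have "Poly_Mapping.single (Word []) 1 = (1 :: 'k ncpoly)" using zero_word_def by (metis single_one)
  then show ?case by (simp add: wdeg_def bch_0_l[OF R])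
next
  case (Cons i l)
  have 1: "Poly_Mapping.single (Word l) 1 * Poly_Mapping.single (Word l') 1 = (Poly_Mapping.single (Word (l @ l')) 1 :: 'k ncpoly)"
    by (simp add: mult_single plus_word_def)
  have 2: "ncgen i * Poly_Mapping.single (Word l) 1 = (Poly_Mapping.single (Word (i # l)) 1 :: 'k ncpoly)"
    by (simp add: ncgen_def mult_single plus_word_def)
  have 3: "bch R (wdeg ms (Word (i # l))) (- (ms ! j)) = bch R (ms ! i) (- (ms ! j)) * bch R (wdeg ms (Word l)) (- (ms ! j))"
    by (simp add: wdeg_def bch_add_l[OF R])
  show ?case
    by (simp add: Cons.IH 1[symmetric] 2[symmetric] 3 distrib_left distrib_right psm.scale_right_distrib psmult_mult mult.assoc)
qed

lemma ncpd_mult_single: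
  assumes w: "w \<in> words (length ms)" and p: "Poly_Mapping.keys p \<subseteq> words (length ms)"
  shows "ncpd (Poly_Mapping.single w c * p) = ncpd (Poly_Mapping.single w c) * p +
    psmult (bch R (wdeg ms w) (- (ms ! j))) (Poly_Mapping.single w c * ncpd p)"
  using p
proof (induction rule: ncpoly_induct)
  case (single u d)
  have u: "letters (w + u) = letters w @ letters u" "Word (letters u) = u" "Word (letters w) = w" by simp_all
  have s: "Poly_Mapping.single u d = psmult d (Poly_Mapping.single u 1)"
    "Poly_Mapping.single w c = psmult c (Poly_Mapping.single w 1)" by simp_all
  have "ncpd (Poly_Mapping.single w c * Poly_Mapping.single u d) = psmult (c * d) (wpd R ms j (letters w @ letters u))"
    using w single by (simp add: mult_single ncpd_single)
  also have "\<dots> = psmult (c * d) (wpd R ms j (letters w) * Poly_Mapping.single u 1 +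
    psmult (bch R (wdeg ms w) (- (ms ! j))) (Poly_Mapping.single w 1 * wpd R ms j (letters u)))"
    unfolding wpd_append u by simp
  also have "\<dots> = psmult c (wpd R ms j (letters w)) * psmult d (Poly_Mapping.single u 1) +
    psmult (bch R (wdeg ms w) (- (ms ! j))) (psmult c (Poly_Mapping.single w 1) * psmult d (wpd R ms j (letters u)))"
    by (simp add: psmult_mult psm.scale_right_distrib mult_ac del: psmult_single)
  finally show ?case using w single by (simp add: ncpd_single)
next
  case (add p q)
  have k: "Poly_Mapping.keys (Poly_Mapping.single w c * p) \<subseteq> words (length ms)"
    "Poly_Mapping.keys (Poly_Mapping.single w c * q) \<subseteq> words (length ms)"
    using ncpoly_keys(2)[of "Poly_Mapping.single w c"] w add by auto
  have "ncpd (p + q) = ncpd p + ncpd q"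
    "ncpd (Poly_Mapping.single w c * p + Poly_Mapping.single w c * q) = ncpd (Poly_Mapping.single w c * p) + ncpd (Poly_Mapping.single w c * q)"
    using lin_map_add[OF ncpd_lin, of p q] lin_map_add[OF ncpd_lin, of "Poly_Mapping.single w c * p" "Poly_Mapping.single w c * q"] add k by simp_all
  then show ?case using add by (simp add: distrib_left psm.scale_right_distrib)
qed

lemma homog_ncpoly_aspan:
  assumes "homog NA m p"
  shows "p \<in> aspan NA (insert 0 {Poly_Mapping.single w c | w c. w \<in> words (length ms) \<and> wdeg ms w = m})"
proof -
  let ?G = "\<lambda>m. {Poly_Mapping.single w c | w c. w \<in> words (length ms) \<and> wdeg ms w = m}"
  have e: "(\<Union>m. ?G m) = {Poly_Mapping.single w c | w c. w \<in> words (length ms)}" by auto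
  have "carrier NA \<subseteq> aspan NA (\<Union>m. ?G m)" unfolding e using ncpoly_aspan by blast
  from homog_aspan[OF galg_gr[OF galg_ncpoly] this _ assms] show ?thesis
    by (auto intro: homog_single)
qed

text \<open>The scalar depends on the left factor only through its degree, so the rule extends from
  monomials to all homogeneous left factors.\<close>

lemma ncpd_mult:
  assumes u: "homog NA m u" and p: "Poly_Mapping.keys p \<subseteq> words (length ms)"
  shows "ncpd (u * p) = ncpd u * p + psmult (bch R m (- (ms ! j))) (u * ncpd p)"
proof -
  have n0: "ncpd 0 = 0" using lin_map_zero[OF vspace_ncpoly vspace_ncpoly ncpd_lin] by simp
  have "Poly_Mapping.keys u \<subseteq> words (length ms) \<and> ncpd (u * p) = ncpd u * p + psmult (bch R m (- (ms ! j))) (u * ncpd p)"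
    using homog_ncpoly_aspan[OF u]
  proof induction
    case (base g)
    then show ?case using ncpd_mult_single[OF _ p] n0 by (auto simp del: keys_single) (auto split: if_splits)
  next
    case (add v w)
    have "Poly_Mapping.keys (v * p) \<subseteq> words (length ms)" "Poly_Mapping.keys (w * p) \<subseteq> words (length ms)"
      using add ncpoly_keys(2) p by blast+
    then have "ncpd (v + w) = ncpd v + ncpd w" "ncpd (v * p + w * p) = ncpd (v * p) + ncpd (w * p)"
      using lin_map_add[OF ncpd_lin, of v w] lin_map_add[OF ncpd_lin, of "v * p" "w * p"] add by simp_all
    then show ?case using add ncpoly_keys(1)[of v "length ms" w] by (simp add: distrib_right psm.scale_right_distrib)
  qed
  then show ?thesis ..
qed

text \<open>For \<open>i = j\<close> the coefficient of \<open>x_k\<close> is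
  \<open>1 - R(m_k, m_i) R(m_k, - m_i)\<close>; for \<open>k = j\<close> that of \<open>x_i\<close>
  is \<open>R(m_i, - m_k) - R(m_k, m_i)\<close>. Both vanish by the bicharacter property and
  symmetry, also when \<open>i = k\<close>.\<close>

lemma ncpd_rel:
  assumes i: "i < length ms" and k: "k < length ms"
  shows "ncpd (ncgen i * ncgen k - psmult (R (tens HT HT (tbasis (ms ! k)) (tbasis (ms ! i)))) (ncgen k * ncgen i)) = 0"
proof -
  have g: "ncpd (ncgen i * ncgen k) = (if i = j then ncgen k else 0) + (if k = j then psmult (bch R (ms ! i) (- (ms ! j))) (ncgen i) else 0)"
    if "i < length ms" "k < length ms" for i k
  proof -
    have "ncgen i * ncgen k = (Poly_Mapping.single (Word [i, k]) 1 :: 'k ncpoly)"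
      by (simp add: ncgen_def mult_single plus_word_def)
    moreover have "Word [i, k] \<in> words (length ms)" using that by (auto simp: words_def)
    moreover have "Poly_Mapping.single (Word []) 1 = (1 :: 'k ncpoly)" using zero_word_def by (metis single_one)
    ultimately show ?thesis by (simp add: ncpd_single) (simp add: ncgen_def)
  qed
  let ?r = "bch R (ms ! k) (ms ! i)"
  have kk: "Poly_Mapping.keys (ncgen i * ncgen k :: 'k ncpoly) \<subseteq> words (length ms)"
    "Poly_Mapping.keys (ncgen k * ncgen i :: 'k ncpoly) \<subseteq> words (length ms)"
    using ncpoly_keys(2)[OF ncgen_keys ncgen_keys] i k by blast+
  have "ncpd (ncgen i * ncgen k - psmult ?r (ncgen k * ncgen i)) = ncpd (ncgen i * ncgen k + psmult (- ?r) (ncgen k * ncgen i))"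
    by simp
  also have "\<dots> = ncpd (ncgen i * ncgen k) + psmult (- ?r) (ncpd (ncgen k * ncgen i))"
    using lin_map_add[OF ncpd_lin, of "ncgen i * ncgen k" "psmult (- ?r) (ncgen k * ncgen i)"]
      lin_map_smult[OF ncpd_lin, of "ncgen k * ncgen i" "- ?r"] kk ncpoly_keys(3)[OF kk(2), of ?r] by simp
  also have "\<dots> = 0"
  proof -
    have a: "bch R (ms ! i) (- (ms ! i)) = bch R (ms ! i) (ms ! i)" for i by (rule bch_minus_r[OF R])
    have sw: "bch R (ms ! k) (ms ! i) * bch R (ms ! i) (ms ! k) = 1" "bch R (ms ! i) (ms ! k) * bch R (ms ! k) (ms ! i) = 1"
      by (rule bch_swap[OF R])+
    show ?thesis
      unfolding g[OF i k] g[OF k i] using sw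
      by (cases "i = j"; cases "k = j") (simp_all add: bch_minus_r[OF R] psm.scale_right_distrib psm.scale_left_distrib[symmetric] mult.commute)
  qed
  finally show ?thesis by (simp add: bch_def)
qed

text \<open>In the Leibniz expansion of \<open>a * s * b\<close>, the term that differentiates the
  relation \<open>s\<close> is zero by \<open>ncpd_rel\<close>, and the two others still contain
  \<open>s\<close> as a factor.\<close>

lemma ncpd_ideal:
  assumes x: "x \<in> free_ideal R ms"
  shows "ncpd x \<in> free_ideal R ms"
proof -
  interpret NA: ring NA by (rule ring_ncpoly)
  interpret I: ideal "free_ideal R ms" NA using graded_free_ideal[of R ms] unfolding graded_ideal_def by (rule conjunct1)
  let ?S = "{ncgen i * ncgen k - psmult (R (tens HT HT (tbasis (ms ! k)) (tbasis (ms ! i)))) (ncgen k * ncgen i)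
        | i k. i < length ms \<and> k < length ms}"
  have S: "?S \<subseteq> carrier NA"
  proof
    fix x assume "x \<in> ?S"
    then obtain m where "homog NA m x" using free_rel_homog by blast
    then show "x \<in> carrier NA" by (rule homog_closed)
  qed
  have SI: "?S \<subseteq> free_ideal R ms" unfolding free_ideal_def by (rule NA.genideal_self[OF S])
  have nc: "Poly_Mapping.keys p \<subseteq> words (length ms) \<Longrightarrow> Poly_Mapping.keys (ncpd p) \<subseteq> words (length ms)" for p
    using lin_map_closed[OF ncpd_lin, of p] by simp
  have n0: "ncpd 0 = 0" using lin_map_zero[OF vspace_ncpoly vspace_ncpoly ncpd_lin] by simp
  have "x \<in> aspan NA (insert \<zero>\<^bsub>NA\<^esub> {a \<otimes>\<^bsub>NA\<^esub> s \<otimes>\<^bsub>NA\<^esub> b | a s b m n. s \<in> ?S \<and> homog NA m a \<and> homog NA n b})"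
    by (rule genideal_aspan[OF galg_ncpoly S]) (use x in \<open>simp add: free_ideal_def\<close>)
  then have "x \<in> free_ideal R ms \<and> ncpd x \<in> free_ideal R ms"
  proof induction
    case (base g)
    show ?case
    proof (cases "g = 0")
      case True then show ?thesis using n0 I.zero_closed by simp
    next
      case False
      then have "g \<in> {a \<otimes>\<^bsub>NA\<^esub> s \<otimes>\<^bsub>NA\<^esub> b | a s b m n. s \<in> ?S \<and> homog NA m a \<and> homog NA n b}"
        using base by simp
      then obtain a s b m n where g': "g = a \<otimes>\<^bsub>NA\<^esub> s \<otimes>\<^bsub>NA\<^esub> b" and g2: "s \<in> ?S" and a: "homog NA m a" and b: "homog NA n b"
        by blast
      have g: "g = a * s * b" "s \<in> ?S" using g' g2 by simp_all
      obtain i k where s: "s = ncgen i * ncgen k - psmult (R (tens HT HT (tbasis (ms ! k)) (tbasis (ms ! i)))) (ncgen k * ncgen i)"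
        "i < length ms" "k < length ms" using g(2) by blast
      have sh: "homog NA (ms ! i + ms ! k) s" unfolding s(1) by (rule free_rel_homog[OF s(2,3)])
      have s0: "ncpd s = 0" unfolding s(1) by (rule ncpd_rel[OF s(2,3)])
      have k: "Poly_Mapping.keys a \<subseteq> words (length ms)" "Poly_Mapping.keys s \<subseteq> words (length ms)" "Poly_Mapping.keys b \<subseteq> words (length ms)"
        using homog_closed[OF a] homog_closed[OF b] homog_closed[OF sh] by simp_all
      have sI: "s \<in> free_ideal R ms" using g SI by blast
      have sb: "s * b \<in> free_ideal R ms" using I.I_r_closed[OF sI, of b] k by simp
      have snb: "s * ncpd b \<in> free_ideal R ms" using I.I_r_closed[OF sI, of "ncpd b"] nc[OF k(3)] by simp
      have "ncpd (a * (s * b)) = ncpd a * (s * b) +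
          psmult (bch R m (- (ms ! j))) (a * psmult (bch R (ms ! i + ms ! k) (- (ms ! j))) (s * ncpd b))"
        using ncpd_mult[OF a ncpoly_keys(2)[OF k(2,3)]] ncpd_mult[OF sh k(3)] s0 by simp
      also have "\<dots> \<in> free_ideal R ms"
      proof -
        have 1: "ncpd a * (s * b) \<in> free_ideal R ms" using I.I_l_closed[OF sb, of "ncpd a"] nc[OF k(1)] by simp
        have "psmult c (s * ncpd b) \<in> free_ideal R ms" for c
          using ideal_smult[OF galg_ncpoly graded_free_ideal snb] by simp
        then have "a * psmult c (s * ncpd b) \<in> free_ideal R ms" for c
          using I.I_l_closed[of "psmult c (s * ncpd b)" a] k by simp
        then have "psmult c' (a * psmult c (s * ncpd b)) \<in> free_ideal R ms" for c c'
          using ideal_smult[OF galg_ncpoly graded_free_ideal[of R ms]] by simp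
        then show ?thesis using I.a_closed[OF 1] by simp
      qed
      finally have "ncpd g \<in> free_ideal R ms" by (simp add: g mult.assoc)
      moreover have "g \<in> free_ideal R ms" using I.I_l_closed[OF sb, of a] k by (simp add: g mult.assoc)
      ultimately show ?thesis by simp
    qed
  next
    case (add v w)
    then have "v \<in> carrier NA" "w \<in> carrier NA" using I.Icarr by blast+
    then show ?case using add I.a_closed lin_map_add[OF ncpd_lin, of v w] by simp
  qed
  then show ?thesis ..
qed

section \<open>Existence of the partial derivatives on the free algebra\<close>

definition fpd :: "'k ncpoly set \<Rightarrow> 'k ncpoly set" where
  "fpd = (\<lambda>X\<in>carrier FA. fpr R ms (ncpd (SOME p. Poly_Mapping.keys p \<subseteq> words (length ms) \<and> X = fpr R ms p)))"

text \<open>Independence of the chosen polynomial: two choices differ by an element of the ideal of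
  commutation relations, which \<open>ncpd\<close> preserves.\<close>

lemma fpd_fpr:
  assumes p: "Poly_Mapping.keys p \<subseteq> words (length ms)"
  shows "fpd (fpr R ms p) = fpr R ms (ncpd p)"
proof -
  let ?P = "\<lambda>q. Poly_Mapping.keys q \<subseteq> words (length ms) \<and> fpr R ms p = fpr R ms q"
  have q: "?P (SOME q. ?P q)" by (rule someI[of ?P p]) (use p in simp)
  let ?q = "SOME q. ?P q"
  have d: "?q - p \<in> free_ideal R ms" using q p fpr_eq_iff[of ?q ms p R] by metis
  have nc: "Poly_Mapping.keys q \<subseteq> words (length ms) \<Longrightarrow> Poly_Mapping.keys (ncpd q) \<subseteq> words (length ms)" for q
    using lin_map_closed[OF ncpd_lin, of q] by simp
  have "ncpd (?q - p) = ncpd (?q + psmult (- 1) p)" by simp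
  also have "\<dots> = ncpd ?q + psmult (- 1) (ncpd p)"
    using lin_map_add[OF ncpd_lin, of ?q "psmult (- 1) p"] lin_map_smult[OF ncpd_lin, of p "- 1"] p q ncpoly_keys(3)[of p "length ms" "- 1"] by simp
  finally have "ncpd ?q - ncpd p \<in> free_ideal R ms" using ncpd_ideal[OF d] by simp
  then have "fpr R ms (ncpd ?q) = fpr R ms (ncpd p)" using fpr_eq_iff[of "ncpd ?q" ms "ncpd p" R] nc p q by simp
  then show ?thesis using fpr_closed[OF p] by (simp add: fpd_def)
qed

lemma fpd_lin: "lin_map FA FA fpd"
proof (rule lin_mapI)
  have nc: "Poly_Mapping.keys q \<subseteq> words (length ms) \<Longrightarrow> Poly_Mapping.keys (ncpd q) \<subseteq> words (length ms)" for q
    using lin_map_closed[OF ncpd_lin, of q] by simp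
  fix X c assume "X \<in> carrier FA"
  then obtain p where p: "X = fpr R ms p" "Poly_Mapping.keys p \<subseteq> words (length ms)" unfolding carrier_hfree by auto
  show "fpd X \<in> carrier FA" using p nc by (simp add: fpd_fpr fpr_closed)
  show "fpd (c \<odot>\<^bsub>FA\<^esub> X) = c \<odot>\<^bsub>FA\<^esub> fpd X"
    using p nc ncpoly_keys(3)[OF p(2), of c] lin_map_smult[OF ncpd_lin, of p c] by (simp add: fpr_smult[symmetric] fpd_fpr)
  fix Y assume "Y \<in> carrier FA"
  then obtain q where q: "Y = fpr R ms q" "Poly_Mapping.keys q \<subseteq> words (length ms)" unfolding carrier_hfree by auto
  show "fpd (X \<oplus>\<^bsub>FA\<^esub> Y) = fpd X \<oplus>\<^bsub>FA\<^esub> fpd Y"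
    using p q nc ncpoly_keys(1)[OF p(2) q(2)] lin_map_add[OF ncpd_lin, of p q] by (simp add: fpr_add[symmetric] fpd_fpr)
qed

lemma bilin_leibniz:
  assumes d: "lin_map FA FA d" and a': "a' \<in> carrier FA"
  shows "bilin HT FA FA (\<lambda>h a0. R (tens HT HT h (tbasis (- (ms ! j)))) \<odot>\<^bsub>FA\<^esub> (a0 \<otimes>\<^bsub>FA\<^esub> d a'))"
proof -
  note F = galg_hfree[of R ms]
  have d': "d a' \<in> carrier FA" by (rule lin_map_closed[OF d a'])
  show ?thesis
    using d' galg_mult_closed[OF F]
    by (intro bilinI lin_map_scale_l lin_map_scale galg_vspace[OF F] lin_R_l[OF R] bilin_l[OF bilin_mult[OF F]]) auto
qed

lemma is_partial_fpd: "is_partial R ms j fpd"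
  unfolding is_partial_def
proof (intro conjI allI impI ballI)
  note F = galg_hfree[of R ms]
  interpret F: ring FA by (rule galg_ring[OF F])
  show "fpd \<in> extensional (carrier FA)" by (simp add: fpd_def)
  show "lin_map FA FA fpd" by (rule fpd_lin)
  show "fpd (fgen R ms i) = (if i = j then \<one>\<^bsub>FA\<^esub> else \<zero>\<^bsub>FA\<^esub>)" if i: "i < length ms" for i
  proof -
    have w: "Word [i] \<in> words (length ms)" using i by (auto simp: words_def)
    have 1: "Poly_Mapping.single (Word []) 1 = (1 :: 'k ncpoly)" using zero_word_def by (metis single_one)
    have "ncpd (ncgen i) = (if i = j then 1 else 0)"
      unfolding ncgen_def using ncpd_single[OF w, of 1] by (simp add: 1)
    then show ?thesis using fpd_fpr[OF ncgen_keys[OF i]] by (simp add: fgen_fpr fpr_one fpr_zero)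
  qed
  fix a a' assume a: "a \<in> carrier FA" and a': "a' \<in> carrier FA"
  let ?t = "\<lambda>a. tlift FA (\<lambda>h a0. R (tens HT HT h (tbasis (- (ms ! j)))) \<odot>\<^bsub>FA\<^esub> (a0 \<otimes>\<^bsub>FA\<^esub> fpd a')) (coact FA a)"
  note bl = bilin_leibniz[OF fpd_lin a']
  have lt: "lin_map FA FA ?t"
    by (rule lin_map_comp[OF gr_coact[OF galg_gr[OF F]] lin_tlift[OF vspace_HT galg_vspace[OF F] galg_vspace[OF F] bl]])
  have nc: "Poly_Mapping.keys q \<subseteq> words (length ms) \<Longrightarrow> Poly_Mapping.keys (ncpd q) \<subseteq> words (length ms)" for q
    using lin_map_closed[OF ncpd_lin, of q] by simp
  show "fpd (a \<otimes>\<^bsub>FA\<^esub> a') = fpd a \<otimes>\<^bsub>FA\<^esub> a' \<oplus>\<^bsub>FA\<^esub> ?t a"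
    using a
  proof (induction rule: hfree_induct)
    case (single w c)
    obtain q where q: "a' = fpr R ms q" "Poly_Mapping.keys q \<subseteq> words (length ms)" using a' unfolding carrier_hfree by auto
    let ?p = "Poly_Mapping.single w c"
    have p: "Poly_Mapping.keys ?p \<subseteq> words (length ms)" using single by auto
    have "?t (fpr R ms ?p) = bch R (wdeg ms w) (- (ms ! j)) \<odot>\<^bsub>FA\<^esub> (fpr R ms ?p \<otimes>\<^bsub>FA\<^esub> fpd a')"
      using tlift_homog[OF galg_vspace[OF F] galg_vspace[OF F] bl fpr_single_homog[OF single]] by (simp add: bch_def)
    also have "\<dots> = fpr R ms (psmult (bch R (wdeg ms w) (- (ms ! j))) (?p * ncpd q))"
      using p q nc ncpoly_keys(2)[OF p nc[OF q(2)]] by (simp add: fpd_fpr fpr_mult fpr_smult del: keys_single)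
    finally have t: "?t (fpr R ms ?p) = fpr R ms (psmult (bch R (wdeg ms w) (- (ms ! j))) (?p * ncpd q))" .
    have "fpd (fpr R ms ?p \<otimes>\<^bsub>FA\<^esub> a') = fpr R ms (ncpd (?p * q))"
      using p q ncpoly_keys(2)[OF p q(2)] by (simp add: fpr_mult[symmetric] fpd_fpr del: keys_single)
    also have "\<dots> = fpr R ms (ncpd ?p * q) \<oplus>\<^bsub>FA\<^esub> fpr R ms (psmult (bch R (wdeg ms w) (- (ms ! j))) (?p * ncpd q))"
      unfolding ncpd_mult_single[OF single q(2)]
      by (rule fpr_add) (use ncpoly_keys(2)[OF nc[OF p] q(2)] ncpoly_keys(3)[OF ncpoly_keys(2)[OF p nc[OF q(2)]]] in auto)
    also have "fpr R ms (ncpd ?p * q) = fpd (fpr R ms ?p) \<otimes>\<^bsub>FA\<^esub> a'"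
      using p q nc[OF p] by (simp add: fpr_mult fpd_fpr del: keys_single)
    finally show ?case unfolding t .
  next
    case (add X Y)
    note c = lin_map_closed[OF fpd_lin] lin_map_closed[OF lt]
    show ?case
      using add a' c
      by (simp add: F.l_distr lin_map_add[OF fpd_lin] lin_map_add[OF lt] F.a_ac)
  qed
qed

section \<open>Uniqueness, Leibniz rule and degree of the partial derivatives\<close>

lemma
  assumes d: "is_partial R ms j d"
  shows is_partial_lin: "lin_map FA FA d"
    and is_partial_gen: "i < length ms \<Longrightarrow> d (fgen R ms i) = (if i = j then \<one>\<^bsub>FA\<^esub> else \<zero>\<^bsub>FA\<^esub>)"
    and is_partial_leibniz: "homog FA m a \<Longrightarrow> a' \<in> carrier FA \<Longrightarrow>
      d (a \<otimes>\<^bsub>FA\<^esub> a') = d a \<otimes>\<^bsub>FA\<^esub> a' \<oplus>\<^bsub>FA\<^esub> bch R m (- (ms ! j)) \<odot>\<^bsub>FA\<^esub> (a \<otimes>\<^bsub>FA\<^esub> d a')"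
    and is_partial_one: "d \<one>\<^bsub>FA\<^esub> = \<zero>\<^bsub>FA\<^esub>"
proof -
  note F = galg_hfree[of R ms]
  interpret F: ring FA by (rule galg_ring[OF F])
  show l: "lin_map FA FA d" using d by (simp add: is_partial_def)
  show "i < length ms \<Longrightarrow> d (fgen R ms i) = (if i = j then \<one>\<^bsub>FA\<^esub> else \<zero>\<^bsub>FA\<^esub>)"
    using d by (simp add: is_partial_def)
  show L: "d (a \<otimes>\<^bsub>FA\<^esub> a') = d a \<otimes>\<^bsub>FA\<^esub> a' \<oplus>\<^bsub>FA\<^esub> bch R m (- (ms ! j)) \<odot>\<^bsub>FA\<^esub> (a \<otimes>\<^bsub>FA\<^esub> d a')"
    if a: "homog FA m a" and a': "a' \<in> carrier FA" for a a' m
    using d homog_closed[OF a] a' tlift_homog[OF galg_vspace[OF F] galg_vspace[OF F] bilin_leibniz[OF l a'] a]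
    by (simp add: is_partial_def bch_def)
  have c: "d \<one>\<^bsub>FA\<^esub> \<in> carrier FA" by (rule lin_map_closed[OF l]) simp
  \<comment> \<open>The Leibniz rule at the product of the unit with itself carries the factor 1,
    since the unit has degree 0.\<close>
  have "d \<one>\<^bsub>FA\<^esub> = d \<one>\<^bsub>FA\<^esub> \<oplus>\<^bsub>FA\<^esub> d \<one>\<^bsub>FA\<^esub>"
    using L[OF galg_homog_one[OF F] F.one_closed] c galg_vspace[OF F] by (simp add: bch_0_l[OF R])
  then show "d \<one>\<^bsub>FA\<^esub> = \<zero>\<^bsub>FA\<^esub>" using c by (metis F.add.l_cancel_one')
qed

text \<open>\<open>partial\<close> is a definite description, so uniqueness is needed besides
  existence. The Leibniz rule with a generator as left factor determines the derivative on all words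
  from its values on generators.\<close>

lemma is_partial_partial: "is_partial R ms j (partial R ms j)"
  unfolding partial_def
proof (rule theI[of "is_partial R ms j" fpd])
  show "is_partial R ms j fpd" by (rule is_partial_fpd)
  fix d assume d: "is_partial R ms j d"
  note e = is_partial_fpd
  note F = galg_hfree[of R ms]
  have "d X = fpd X" if "X \<in> carrier FA" for X
    using that
  proof (induction rule: hfree_gen_induct)
    case one
    then show ?case by (simp add: is_partial_one[OF d] is_partial_one[OF e])
  next
    case (gen i X)
    then show ?case
      by (simp add: is_partial_leibniz[OF d fgen_homog] is_partial_leibniz[OF e fgen_homog]
          is_partial_gen[OF d] is_partial_gen[OF e])
  next
    case (smult c X)
    then show ?case by (simp add: lin_map_smult[OF is_partial_lin[OF d]] lin_map_smult[OF is_partial_lin[OF e]])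
  next
    case (add X Y)
    then show ?case by (simp add: lin_map_add[OF is_partial_lin[OF d]] lin_map_add[OF is_partial_lin[OF e]])
  qed
  then show "d = fpd"
    using d e by (intro extensionalityI[of d "carrier FA" fpd]) (auto simp: is_partial_def)
qed

lemmas partial_lin = is_partial_lin[OF is_partial_partial]
lemmas partial_gen = is_partial_gen[OF is_partial_partial]
lemmas partial_leibniz = is_partial_leibniz[OF is_partial_partial]
lemmas partial_one = is_partial_one[OF is_partial_partial]

text \<open>Along a word, the Leibniz rule either removes the letter \<open>x_j\<close> or keeps a
  letter and differentiates the remainder; in both cases the degree drops by \<open>ms ! j\<close>.
  Homogeneous elements are sums of scaled words of their degree.\<close>

lemma partial_homog:
  assumes a: "homog FA m a"
  shows "homog FA (m - ms ! j) (partial R ms j a)"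
proof -
  note F = galg_hfree[of R ms]
  note gF = galg_gr[OF F] and vF = galg_vspace[OF F]
  let ?d = "partial R ms j"
  have w: "homog FA (wdeg ms (Word l) - ms ! j) (?d (fpr R ms (Poly_Mapping.single (Word l) 1)))"
    if "Word l \<in> words (length ms)" for l
    using that
  proof (induction l)
    case Nil
    have "Poly_Mapping.single (Word []) 1 = (1 :: 'k ncpoly)" using zero_word_def by (metis single_one)
    then show ?case using homog_zero[OF gF] by (simp add: fpr_one partial_one)
  next
    case (Cons i l)
    then have l: "Word l \<in> words (length ms)" and i: "i < length ms" by (auto simp: words_def)
    let ?X = "fpr R ms (Poly_Mapping.single (Word l) 1)"
    have "Word (i # l) = Word [i] + Word l" by (simp add: plus_word_def)
    then have "Poly_Mapping.single (Word (i # l)) 1 = ncgen i * (Poly_Mapping.single (Word l) 1 :: 'k ncpoly)"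
      by (simp add: ncgen_def mult_single)
    then have e: "fpr R ms (Poly_Mapping.single (Word (i # l)) 1) = fgen R ms i \<otimes>\<^bsub>FA\<^esub> ?X"
      using fpr_mult[OF ncgen_keys[OF i], of "Poly_Mapping.single (Word l) 1"] l by (simp add: fgen_fpr)
    have wd: "wdeg ms (Word (i # l)) - ms ! j = ms ! i + (wdeg ms (Word l) - ms ! j)" by (simp add: wdeg_def)
    have Xh: "homog FA (wdeg ms (Word l)) ?X" by (rule fpr_single_homog[OF l])
    interpret F: ring FA by (rule galg_ring[OF F])
    have "homog FA (ms ! i + (wdeg ms (Word l) - ms ! j)) ((if i = j then \<one>\<^bsub>FA\<^esub> else \<zero>\<^bsub>FA\<^esub>) \<otimes>\<^bsub>FA\<^esub> ?X)"
      using Xh homog_zero[OF gF] homog_closed[OF Xh] by auto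
    moreover have "homog FA (ms ! i + (wdeg ms (Word l) - ms ! j)) (bch R (ms ! i) (- (ms ! j)) \<odot>\<^bsub>FA\<^esub> (fgen R ms i \<otimes>\<^bsub>FA\<^esub> ?d ?X))"
      by (intro homog_smult[OF gF] galg_homog_mult[OF F] fgen_homog[OF i] Cons.IH[OF l])
    ultimately show ?case
      unfolding e wd partial_leibniz[OF fgen_homog[OF i] homog_closed[OF Xh]] partial_gen[OF i]
      by (rule homog_add[OF gF])
  qed
  let ?G = "\<lambda>m. {fpr R ms (Poly_Mapping.single w c) | w c. w \<in> words (length ms) \<and> wdeg ms w = m}"
  have span: "carrier FA \<subseteq> aspan FA (\<Union>m. ?G m)"
  proof
    fix X assume "X \<in> carrier FA"
    then show "X \<in> aspan FA (\<Union>m. ?G m)"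
    proof (induction rule: hfree_induct)
      case (single w c)
      then show ?case by (intro aspan.base) auto
    next
      case (add X Y)
      then show ?case by (intro aspan.add)
    qed
  qed
  have "a \<in> aspan FA (insert \<zero>\<^bsub>FA\<^esub> (?G m))"
    by (rule homog_aspan[OF gF span _ a]) (auto intro: fpr_single_homog)
  then have "a \<in> carrier FA \<and> homog FA (m - ms ! j) (?d a)"
  proof induction
    case (base g)
    show ?case
    proof (cases "g = \<zero>\<^bsub>FA\<^esub>")
      case True
      then show ?thesis using homog_zero[OF gF] vF lin_map_zero[OF vF vF partial_lin] by simp
    next
      case False
      then obtain w c where g: "g = fpr R ms (Poly_Mapping.single w c)" "w \<in> words (length ms)" "wdeg ms w = m"
        using base by blast
      have wc: "Word (letters w) = w" by simp
      have "g = c \<odot>\<^bsub>FA\<^esub> fpr R ms (Poly_Mapping.single w 1)"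
        using g fpr_smult[of "Poly_Mapping.single w 1" ms R c] by simp
      then have "?d g = c \<odot>\<^bsub>FA\<^esub> ?d (fpr R ms (Poly_Mapping.single w 1))"
        using lin_map_smult[OF partial_lin fpr_single_closed[OF g(2)]] by simp
      moreover have "g \<in> carrier FA" unfolding g(1) by (rule fpr_single_closed[OF g(2)])
      ultimately show ?thesis
        using w[of "letters w"] g(2,3) homog_smult[OF gF] by (simp add: wc)
    qed
  next
    case (add v w)
    then show ?case using vF homog_add[OF gF] by (simp add: lin_map_add[OF partial_lin])
  qed
  then show ?thesis ..
qed

end

section \<open>Shifts, direct sums and subobjects\<close>

context
  fixes A :: "('k::field, 'n::finite, 'a) hobj" and m :: "int ^ 'n"
begin

lemma hshift_simps [simp]:
  "carrier (hshift A m) = carrier A" "zero (hshift A m) = zero A" "add (hshift A m) = add A"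
  "smult (hshift A m) = smult A" "vspace (hshift A m) \<longleftrightarrow> vspace A"
  "tensor U (hshift A m) = tensor U A" "tens U (hshift A m) = tens U A"
  "lin_map (hshift A m) X f \<longleftrightarrow> lin_map A X f" "lin_map Y (hshift A m) g \<longleftrightarrow> lin_map Y A g"
proof -
  show 1: "carrier (hshift A m) = carrier A" "zero (hshift A m) = zero A" "add (hshift A m) = add A"
    "smult (hshift A m) = smult A" by (simp_all add: hshift_def)
  show "vspace (hshift A m) \<longleftrightarrow> vspace A" by (rule vspace_cong[OF 1])
  show "tensor U (hshift A m) = tensor U A" "tens U (hshift A m) = tens U A"
    using tensor_cong_r[OF 1(1,3,4)] by auto
  show "lin_map (hshift A m) X f \<longleftrightarrow> lin_map A X f" "lin_map Y (hshift A m) g \<longleftrightarrow> lin_map Y A g"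
    by (simp_all add: lin_map_def 1)
qed

lemma coact_hshift: "coact (hshift A m) v = tlift (tensor HT A) (\<lambda>h v0. tens HT A (h * tbasis m) v0) (coact A v)"
  by (simp add: hshift_def)

context
  assumes A: "gr A"
begin

lemma homog_hshiftI: "homog A l a \<Longrightarrow> homog (hshift A m) (l + m) a"
proof -
  assume a: "homog A l a"
  note vA = gr_vspace[OF A]
  have "bilin HT A (tensor HT A) (\<lambda>h v0. tens HT A (h * tbasis m) v0)"
    by (rule bilin_comp[OF bilin_tens[OF vspace_HT vA] lin_times_HT(2) lin_map_id])
  then have "coact (hshift A m) a = tens HT A (tbasis l * tbasis m) a"
    unfolding coact_hshift using tlift_homog[OF vA vspace_tensor[OF vspace_HT vA] _ a] by blast
  then show ?thesis using a by (simp add: homog_def tbasis_mult)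
qed

lemma gr_hshift: "gr (hshift A m)"
proof (rule grI[of _ "\<lambda>l. {a. homog A (l - m) a}"])
  note vA = gr_vspace[OF A]
  show "vspace (hshift A m)" using vA by simp
  have "bilin HT A (tensor HT A) (\<lambda>h v0. tens HT A (h * tbasis m) v0)"
    by (rule bilin_comp[OF bilin_tens[OF vspace_HT vA] lin_times_HT(2) lin_map_id])
  from lin_map_comp[OF gr_coact[OF A] lin_tlift[OF vspace_HT vA vspace_tensor[OF vspace_HT vA] this]]
  show "lin_map (hshift A m) (tensor HT (hshift A m)) (coact (hshift A m))"
    by (simp add: coact_hshift[abs_def])
  show "homog (hshift A m) l g" if "g \<in> {a. homog A (l - m) a}" for l g
    using homog_hshiftI[of "l - m" g] that by simp
  show "carrier (hshift A m) \<subseteq> aspan (hshift A m) (\<Union>l. {a. homog A (l - m) a})"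
  proof
    fix a assume "a \<in> carrier (hshift A m)"
    then have "a \<in> carrier A" by simp
    then show "a \<in> aspan (hshift A m) (\<Union>l. {a. homog A (l - m) a})"
    proof (induction rule: gr_induct[OF A, consumes 1, case_names homog add])
      case (homog l a)
      then have "homog A ((l + m) - m) a" by simp
      then show ?case by (intro aspan.base) blast
    next
      case (add v w)
      then show ?case using aspan.add[of v "hshift A m"] by simp
    qed
  qed
qed

text \<open>For the direction from the shift back to \<open>A\<close>, the identity map is compared
  with the degree projections: the projection of \<open>A\<close> to \<open>l - m\<close> is the
  projection of the shifted object to \<open>l\<close>.\<close>

lemma homog_hshift: "homog (hshift A m) l a \<longleftrightarrow> homog A (l - m) a"
proof
  assume "homog A (l - m) a"
  then show "homog (hshift A m) l a" using homog_hshiftI[of "l - m" a] by simp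
next
  assume a: "homog (hshift A m) l a"
  have aA: "a \<in> carrier A" using homog_closed[OF a] by simp
  have "hpr A (l - m) a = hpr (hshift A m) (l - m + m) a"
    by (rule hpr_map[OF A gr_hshift, of "\<lambda>a. a"]) (use homog_hshiftI aA lin_map_id in auto)
  also have "\<dots> = a" using hpr_homog[OF gr_hshift a, of l] by simp
  finally show "homog A (l - m) a" using homog_iff_hpr[OF A, of "l - m" a] aA by simp
qed

end
end

context
  fixes N :: nat and V :: "nat \<Rightarrow> ('k::field, 'n::finite, 'v) hobj"
  assumes V: "\<And>i. gr (V i)"
begin

lemma dsum_fields [simp]:
  "carrier (dsum_space N V) = (\<Pi>\<^sub>E j\<in>{..<N}. carrier (V j))"
  "zero (dsum_space N V) = (\<lambda>j\<in>{..<N}. \<zero>\<^bsub>V j\<^esub>)"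
  "add (dsum_space N V) = (\<lambda>x y. \<lambda>j\<in>{..<N}. x j \<oplus>\<^bsub>V j\<^esub> y j)"
  "smult (dsum_space N V) = (\<lambda>c x. \<lambda>j\<in>{..<N}. c \<odot>\<^bsub>V j\<^esub> x j)"
  by (simp_all add: dsum_space_def)

lemma vspace_dsum: "vspace (dsum_space N V)"
proof -
  note v = gr_vspace[OF V]
  have c: "x \<in> (\<Pi>\<^sub>E j\<in>{..<N}. carrier (V j)) \<Longrightarrow> i < N \<Longrightarrow> x i \<in> carrier (V i)" for x i by auto
  have e: "x = y" if "x \<in> (\<Pi>\<^sub>E j\<in>{..<N}. carrier (V j))" "y \<in> (\<Pi>\<^sub>E j\<in>{..<N}. carrier (V j))" "\<And>i. i < N \<Longrightarrow> x i = y i" for x y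
    using that by (intro PiE_ext[of x "{..<N}" _ y]) auto
  show ?thesis
  proof (rule vspaceI)
    show "abelian_group (dsum_space N V)"
    proof (rule abelian_groupI)
      fix x assume x: "x \<in> carrier (dsum_space N V)"
      show "\<exists>y\<in>carrier (dsum_space N V). y \<oplus>\<^bsub>dsum_space N V\<^esub> x = \<zero>\<^bsub>dsum_space N V\<^esub>"
      proof (rule bexI[of _ "\<lambda>j\<in>{..<N}. \<ominus>\<^bsub>V j\<^esub> x j"])
        have "i < N \<Longrightarrow> \<ominus>\<^bsub>V i\<^esub> x i \<oplus>\<^bsub>V i\<^esub> x i = \<zero>\<^bsub>V i\<^esub>" for i
          using c[of x i] x abelian_group.l_neg[OF vspace_abelian_group[OF v]] by simp
        then show "(\<lambda>j\<in>{..<N}. \<ominus>\<^bsub>V j\<^esub> x j) \<oplus>\<^bsub>dsum_space N V\<^esub> x = \<zero>\<^bsub>dsum_space N V\<^esub>" by auto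
        show "(\<lambda>j\<in>{..<N}. \<ominus>\<^bsub>V j\<^esub> x j) \<in> carrier (dsum_space N V)"
          using x by (auto intro!: abelian_group.a_inv_closed[OF vspace_abelian_group[OF v]])
      qed
    next
      fix x y assume "x \<in> carrier (dsum_space N V)" "y \<in> carrier (dsum_space N V)"
      then show "x \<oplus>\<^bsub>dsum_space N V\<^esub> y = y \<oplus>\<^bsub>dsum_space N V\<^esub> x"
        by (auto intro!: restrict_ext vs_add_comm[OF v])
    next
      fix x y z assume "x \<in> carrier (dsum_space N V)" "y \<in> carrier (dsum_space N V)" "z \<in> carrier (dsum_space N V)"
      then show "x \<oplus>\<^bsub>dsum_space N V\<^esub> y \<oplus>\<^bsub>dsum_space N V\<^esub> z = x \<oplus>\<^bsub>dsum_space N V\<^esub> (y \<oplus>\<^bsub>dsum_space N V\<^esub> z)"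
        using abelian_monoid.a_assoc[OF abelian_group.axioms(1)[OF vspace_abelian_group[OF v]]] by (auto simp: c)
    qed (use v in \<open>auto intro!: e simp: c\<close>)
  qed (use v in \<open>auto intro!: e simp: c vs_smult_add_l vs_smult_add_r\<close>)
qed

lemma lin_dsum_incl: "i < N \<Longrightarrow> lin_map (V i) (dsum_space N V) (dsum_incl N V i)"
  using gr_vspace[OF V] by (auto simp: lin_map_def dsum_incl_def)

lemma lin_dsum_proj: "i < N \<Longrightarrow> lin_map (dsum_space N V) (V i) (\<lambda>x. x i)"
  by (auto simp: lin_map_def)

lemma dsum_incl_closed: "i < N \<Longrightarrow> v \<in> carrier (V i) \<Longrightarrow> dsum_incl N V i v \<in> (\<Pi>\<^sub>E j\<in>{..<N}. carrier (V j))"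
  using lin_map_closed[OF lin_dsum_incl, of i v] by simp

lemma hdsum_fields [simp]:
  "carrier (hdsum N V) = (\<Pi>\<^sub>E j\<in>{..<N}. carrier (V j))"
  "zero (hdsum N V) = zero (dsum_space N V)" "add (hdsum N V) = add (dsum_space N V)"
  "smult (hdsum N V) = smult (dsum_space N V)" "vspace (hdsum N V) \<longleftrightarrow> vspace (dsum_space N V)"
  "tensor U (hdsum N V) = tensor U (dsum_space N V)" "tens U (hdsum N V) = tens U (dsum_space N V)"
  "lin_map (hdsum N V) X f \<longleftrightarrow> lin_map (dsum_space N V) X f" "lin_map Y (hdsum N V) g \<longleftrightarrow> lin_map Y (dsum_space N V) g"
  by (simp_all add: hdsum_def)

lemma lin_coact_hdsum: "lin_map (dsum_space N V) (tensor HT (dsum_space N V)) (coact (hdsum N V))"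
proof -
  have id: "lin_map HT HT id" by (simp add: id_def lin_map_id)
  have "lin_map (dsum_space N V) (tensor HT (dsum_space N V))
      (\<lambda>x. \<Oplus>\<^bsub>tensor HT (dsum_space N V)\<^esub>i\<in>{..<N}. tmap HT (dsum_space N V) id (dsum_incl N V i) (coact (V i) (x i)))"
  proof (rule lin_map_fin[OF vspace_tensor[OF vspace_HT vspace_dsum]])
    fix i assume "i \<in> {..<N}"
    then have i: "i < N" by simp
    show "lin_map (dsum_space N V) (tensor HT (dsum_space N V))
       (\<lambda>x. tmap HT (dsum_space N V) id (dsum_incl N V i) (coact (V i) (x i)))"
      by (rule lin_map_comp[OF lin_map_comp[OF lin_dsum_proj[OF i] gr_coact[OF V]]
            lin_tmap[OF vspace_HT gr_vspace[OF V] vspace_HT vspace_dsum id lin_dsum_incl[OF i]]])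
  qed
  then show ?thesis by (simp add: hdsum_def)
qed

lemma homog_dsum_incl:
  assumes i: "i < N" and v: "homog (V i) l v"
  shows "homog (hdsum N V) l (dsum_incl N V i v)"
proof -
  let ?D = "dsum_space N V"
  have id: "lin_map HT HT id" by (simp add: id_def lin_map_id)
  note t = vspace_tensor[OF vspace_HT vspace_dsum]
  interpret t: abelian_group "tensor HT ?D" by (rule vspace_abelian_group[OF t])
  have z: "coact (V k) \<zero>\<^bsub>V k\<^esub> = \<zero>\<^bsub>tensor HT (V k)\<^esub>" for k
    by (rule lin_map_zero[OF gr_vspace[OF V] vspace_tensor[OF vspace_HT gr_vspace[OF V]] gr_coact[OF V]])
  have lt: "lin_map (tensor HT (V k)) (tensor HT ?D) (tmap HT ?D id (dsum_incl N V k))" if "k < N" for k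
    by (rule lin_tmap[OF vspace_HT gr_vspace[OF V] vspace_HT vspace_dsum id lin_dsum_incl[OF that]])
  have tz: "tmap HT ?D id (dsum_incl N V k) \<zero>\<^bsub>tensor HT (V k)\<^esub> = \<zero>\<^bsub>tensor HT ?D\<^esub>" if "k < N" for k
    by (rule lin_map_zero[OF vspace_tensor[OF vspace_HT gr_vspace[OF V]] t lt[OF that]])
  have c: "dsum_incl N V i v \<in> carrier ?D" using dsum_incl_closed[OF i homog_closed[OF v]] by simp
  have tv: "tmap HT ?D id (dsum_incl N V i) (coact (V i) v) = tens HT ?D (tbasis l) (dsum_incl N V i v)"
    using v tmap_tens[OF vspace_HT gr_vspace[OF V] vspace_HT vspace_dsum id lin_dsum_incl[OF i], of "tbasis l" v]
    by (simp add: homog_def)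
  have "coact (hdsum N V) (dsum_incl N V i v) =
      (\<Oplus>\<^bsub>tensor HT ?D\<^esub>k\<in>{..<N}. tmap HT ?D id (dsum_incl N V k) (coact (V k) (dsum_incl N V i v k)))"
    by (simp add: hdsum_def)
  also have "\<dots> = (\<Oplus>\<^bsub>tensor HT ?D\<^esub>k\<in>{..<N}. if i = k then tens HT ?D (tbasis l) (dsum_incl N V i v) else \<zero>\<^bsub>tensor HT ?D\<^esub>)"
  proof (rule t.finsum_cong')
    show "(\<lambda>k. if i = k then tens HT ?D (tbasis l) (dsum_incl N V i v) else \<zero>\<^bsub>tensor HT ?D\<^esub>) \<in> {..<N} \<rightarrow> carrier (tensor HT ?D)"
    proof (rule Pi_I)
      fix k
      show "(if i = k then tens HT ?D (tbasis l) (dsum_incl N V i v) else \<zero>\<^bsub>tensor HT ?D\<^esub>) \<in> carrier (tensor HT ?D)"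
        by (cases "i = k") (use c tens_closed[OF vspace_HT vspace_dsum, of "tbasis l"] in simp_all)
    qed
    fix k assume "k \<in> {..<N}"
    then have k: "k < N" by simp
    show "tmap HT ?D id (dsum_incl N V k) (coact (V k) (dsum_incl N V i v k)) =
        (if i = k then tens HT ?D (tbasis l) (dsum_incl N V i v) else \<zero>\<^bsub>tensor HT ?D\<^esub>)"
    proof (cases "i = k")
      case True
      then have "dsum_incl N V i v k = v" using i by (simp add: dsum_incl_def)
      then show ?thesis using True tv by simp
    next
      case False
      then have "dsum_incl N V i v k = \<zero>\<^bsub>V k\<^esub>" using k by (simp add: dsum_incl_def)
      then show ?thesis using False z tz[OF k] by simp
    qed
  qed simp
  also have "\<dots> = tens HT ?D (tbasis l) (dsum_incl N V i v)"
    by (rule t.finsum_singleton) (use i c tens_closed[OF vspace_HT vspace_dsum, of "tbasis l"] in simp_all)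
  finally show ?thesis using c by (simp add: homog_def)
qed

private abbreviation (input) "dgen l \<equiv> insert (zero (dsum_space N V)) {dsum_incl N V i v | i v. i < N \<and> homog (V i) l v}"

text \<open>The zero vector is listed among the generators because \<open>aspan\<close> contains no
  empty sum; it starts the induction below and covers the case without summands.\<close>

lemma dsum_aspan: "carrier (hdsum N V) \<subseteq> aspan (hdsum N V) (\<Union>l. dgen l)"
proof
  fix x assume "x \<in> carrier (hdsum N V)"
  then have xP: "x \<in> (\<Pi>\<^sub>E j\<in>{..<N}. carrier (V j))" by simp
  then have x: "i < N \<Longrightarrow> x i \<in> carrier (V i)" "x \<in> extensional {..<N}" for i
    by (simp_all add: PiE_iff)
  have 1: "dsum_incl N V i v \<in> aspan (hdsum N V) (\<Union>l. dgen l)" if i: "i < N" and v: "v \<in> carrier (V i)" for i v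
    using v
  proof (induction rule: gr_induct[OF V, consumes 1, case_names homog add])
    case (homog l v)
    then show ?case using i by (intro aspan.base) blast
  next
    case (add v w)
    show ?case
      unfolding lin_map_add[OF lin_dsum_incl[OF i] add(1,2)] hdsum_fields(3)[symmetric]
      by (rule aspan.add[OF add(3,4)])
  qed
  \<comment> \<open>Induction on the number of coordinates that are kept; each step adds one
    included component.\<close>
  have "n \<le> N \<Longrightarrow> (\<lambda>j\<in>{..<N}. if j < n then x j else \<zero>\<^bsub>V j\<^esub>) \<in> aspan (hdsum N V) (\<Union>l. dgen l)" for n
  proof (induction n)
    case 0
    then show ?case by (auto intro!: aspan.base)
  next
    case (Suc n)
    have n: "n < N" using Suc by simp
    have "(\<lambda>j\<in>{..<N}. if j < Suc n then x j else \<zero>\<^bsub>V j\<^esub>) =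
        (\<lambda>j\<in>{..<N}. if j < n then x j else \<zero>\<^bsub>V j\<^esub>) \<oplus>\<^bsub>hdsum N V\<^esub> dsum_incl N V n (x n)"
      using x(1) gr_vspace[OF V] by (auto simp: dsum_incl_def less_Suc_eq)
    moreover have "(\<lambda>j\<in>{..<N}. if j < n then x j else \<zero>\<^bsub>V j\<^esub>) \<oplus>\<^bsub>hdsum N V\<^esub> dsum_incl N V n (x n) \<in> aspan (hdsum N V) (\<Union>l. dgen l)"
      by (rule aspan.add[OF Suc.IH 1[OF n x(1)[OF n]]]) (use n in simp)
    ultimately show ?case by (simp only:)
  qed
  from this[of N] have "(\<lambda>j\<in>{..<N}. if j < N then x j else \<zero>\<^bsub>V j\<^esub>) \<in> aspan (hdsum N V) (\<Union>l. dgen l)" by simp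
  also have "(\<lambda>j\<in>{..<N}. if j < N then x j else \<zero>\<^bsub>V j\<^esub>) = x"
    using x(2) by (auto simp: extensional_def)
  finally show "x \<in> aspan (hdsum N V) (\<Union>l. dgen l)" .
qed

lemma homog_dgen: "g \<in> dgen l \<Longrightarrow> homog (hdsum N V) l g"
proof -
  have "homog (hdsum N V) l (zero (dsum_space N V))"
    using lin_map_zero[OF vspace_dsum vspace_tensor[OF vspace_HT vspace_dsum] lin_coact_hdsum]
      vs_zero_closed[OF vspace_dsum]
    by (simp add: homog_def tens_zero_r[OF vspace_HT vspace_dsum, simplified])
  then show "g \<in> dgen l \<Longrightarrow> ?thesis" using homog_dsum_incl by blast
qed

lemma gr_hdsum: "gr (hdsum N V)"
  by (rule grI[OF _ _ dsum_aspan homog_dgen]) (use vspace_dsum lin_coact_hdsum in auto)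

lemma homog_dsum_proj:
  assumes x: "homog (hdsum N V) l x" and i: "i < N"
  shows "homog (V i) l (x i)"
proof -
  have "x \<in> aspan (hdsum N V) (insert \<zero>\<^bsub>hdsum N V\<^esub> (dgen l))"
    by (rule homog_aspan[OF gr_hdsum dsum_aspan homog_dgen x])
  then have "x \<in> carrier (hdsum N V) \<and> homog (V i) l (x i)"
  proof induction
    case (base g)
    then have "g \<in> dgen l" by auto
    then have "g \<in> carrier (hdsum N V)" by (rule homog_closed[OF homog_dgen])
    moreover have "homog (V i) l (g i)"
      using \<open>g \<in> dgen l\<close> i homog_zero[OF V] by (auto simp: dsum_incl_def)
    ultimately show ?case by simp
  next
    case (add v w)
    have "v \<oplus>\<^bsub>hdsum N V\<^esub> w \<in> carrier (hdsum N V)"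
      by (rule vs_add_closed[OF gr_vspace[OF gr_hdsum]]) (use add in blast)+
    moreover have "(v \<oplus>\<^bsub>hdsum N V\<^esub> w) i = v i \<oplus>\<^bsub>V i\<^esub> w i" using i by simp
    ultimately show ?case using add homog_add[OF V] by (metis (no_types, lifting))
  qed
  then show ?thesis ..
qed

end

context
  fixes V :: "('k::field, 'n::finite, 'v) hobj" and S :: "'v set"
  assumes V: "gr V" and S: "lsubspace S V" and Sh: "\<And>v m. v \<in> S \<Longrightarrow> hpr V m v \<in> S"
begin

private abbreviation (input) "VS \<equiv> V\<lparr>carrier := S\<rparr>"

lemma hsub_simps [simp]:
  "carrier (hsub V S) = S" "zero (hsub V S) = zero V" "add (hsub V S) = add V" "smult (hsub V S) = smult V"
  "vspace (hsub V S) \<longleftrightarrow> vspace VS" "tensor U (hsub V S) = tensor U VS" "tens U (hsub V S) = tens U VS"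
  "lin_map (hsub V S) X f \<longleftrightarrow> lin_map VS X f" "lin_map Y (hsub V S) g \<longleftrightarrow> lin_map Y VS g"
proof -
  show 1: "carrier (hsub V S) = S" "zero (hsub V S) = zero V" "add (hsub V S) = add V" "smult (hsub V S) = smult V"
    by (simp_all add: hsub_def)
  show "vspace (hsub V S) \<longleftrightarrow> vspace VS" by (rule vspace_cong) (simp_all add: 1)
  show "tensor U (hsub V S) = tensor U VS" "tens U (hsub V S) = tens U VS"
    by (rule tensor_cong_r; simp add: 1)+
  show "lin_map (hsub V S) X f \<longleftrightarrow> lin_map VS X f" "lin_map Y (hsub V S) g \<longleftrightarrow> lin_map Y VS g"
    by (simp_all add: lin_map_def 1)
qed

lemma sub_closed: "v \<in> S \<Longrightarrow> v \<in> carrier V"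
  using S by (auto simp: lsubspace_def)

lemma vspace_VS: "vspace VS"
  by (rule vspace_sub[OF gr_vspace[OF V] S])

text \<open>The slice of the coaction at \<open>t_m\<close> is the component of degree
  \<open>m\<close>, which stays in \<open>S\<close>; so a lift to \<open>H \<otimes> S\<close>
  exists by \<open>tensor_sub_surj\<close>. It is unique by \<open>tensor_sub_inj\<close>, which
  justifies the definite description.\<close>

lemma coact_hsub:
  assumes v: "v \<in> S"
  shows "coact (hsub V S) v \<in> carrier (tensor HT VS)" "tmap HT V id id (coact (hsub V S) v) = coact V v"
proof -
  note vV = gr_vspace[OF V]
  have cv: "coact V v \<in> carrier (tensor HT V)" by (rule lin_map_closed[OF gr_coact[OF V] sub_closed[OF v]])
  have "\<exists>\<tau>\<in>carrier (tensor HT VS). tmap HT V id id \<tau> = coact V v"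
    by (rule tensor_sub_surj[OF vspace_HT vV S dbasis_HT cv]) (use Sh[OF v] in \<open>simp add: hpr_def\<close>)
  then have ex: "\<exists>!\<tau>. \<tau> \<in> carrier (tensor HT VS) \<and> tmap HT V id id \<tau> = coact V v"
    using tensor_sub_inj[OF vspace_HT vV S] by (metis (no_types, lifting))
  have e: "coact (hsub V S) v = (THE \<tau>. \<tau> \<in> carrier (tensor HT VS) \<and> tmap HT V id id \<tau> = coact V v)"
    by (simp add: hsub_def)
  show "coact (hsub V S) v \<in> carrier (tensor HT VS)" "tmap HT V id id (coact (hsub V S) v) = coact V v"
    unfolding e using theI'[OF ex] by auto
qed

lemma coact_hsub_eqI:
  assumes v: "v \<in> S" and t: "\<tau> \<in> carrier (tensor HT VS)" "tmap HT V id id \<tau> = coact V v"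
  shows "coact (hsub V S) v = \<tau>"
  by (rule tensor_sub_inj[OF vspace_HT gr_vspace[OF V] S]) (use coact_hsub[OF v] t in auto)

lemma lin_tincl: "lin_map (tensor HT VS) (tensor HT V) (tmap HT V id id)"
  by (rule lin_tmap[OF vspace_HT vspace_VS vspace_HT gr_vspace[OF V] _ lin_incl[OF S]]) (simp add: id_def lin_map_id)

lemma homog_hsub: "homog (hsub V S) m v \<longleftrightarrow> v \<in> S \<and> homog V m v"
proof -
  have id: "lin_map HT HT id" by (simp add: id_def lin_map_id)
  have t: "tmap HT V id id (tens HT VS (tbasis m) v) = tens HT V (tbasis m) v" if "v \<in> S"
    using tmap_tens[OF vspace_HT vspace_VS vspace_HT gr_vspace[OF V] id lin_incl[OF S], of "tbasis m" v] that by simp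
  show ?thesis
  proof
    assume h: "homog (hsub V S) m v"
    then have "v \<in> S" "coact (hsub V S) v = tens HT VS (tbasis m) v" by (simp_all add: homog_def)
    then show "v \<in> S \<and> homog V m v" using coact_hsub(2)[of v] t sub_closed by (simp add: homog_def)
  next
    assume h: "v \<in> S \<and> homog V m v"
    then have "coact (hsub V S) v = tens HT VS (tbasis m) v"
      by (intro coact_hsub_eqI tens_closed[OF vspace_HT vspace_VS]) (use t in \<open>auto simp: homog_def\<close>)
    then show "homog (hsub V S) m v" using h by (simp add: homog_def)
  qed
qed

lemma gr_hsub: "gr (hsub V S)"
proof (rule grI[of _ "\<lambda>m. {v \<in> S. homog V m v}"])
  note vV = gr_vspace[OF V]
  show "vspace (hsub V S)" using vspace_VS by simp
  show "homog (hsub V S) m g" if "g \<in> {v \<in> S. homog V m v}" for m g using that by (simp add: homog_hsub)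
  have tS: "vspace (tensor (HT :: ('k, ('k, 'n) torus) module) VS)" by (rule vspace_tensor[OF vspace_HT vspace_VS])
  show "lin_map (hsub V S) (tensor HT (hsub V S)) (coact (hsub V S))"
  proof (rule lin_mapI)
    fix v c assume "v \<in> carrier (hsub V S)"
    then have v: "v \<in> S" by simp
    note cv = coact_hsub[OF v]
    show "coact (hsub V S) v \<in> carrier (tensor HT (hsub V S))" using cv by simp
    have "c \<odot>\<^bsub>V\<^esub> v \<in> S" using S v by (auto simp: lsubspace_def)
    then show "coact (hsub V S) (c \<odot>\<^bsub>hsub V S\<^esub> v) = c \<odot>\<^bsub>tensor HT (hsub V S)\<^esub> coact (hsub V S) v"
      using cv tS lin_map_smult[OF lin_tincl cv(1)] lin_map_smult[OF gr_coact[OF V] sub_closed[OF v]]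
      unfolding hsub_simps by (intro coact_hsub_eqI) simp_all
    fix w assume "w \<in> carrier (hsub V S)"
    then have w: "w \<in> S" by simp
    note cw = coact_hsub[OF w]
    have "v \<oplus>\<^bsub>V\<^esub> w \<in> S" using S v w by (auto simp: lsubspace_def)
    then show "coact (hsub V S) (v \<oplus>\<^bsub>hsub V S\<^esub> w) = coact (hsub V S) v \<oplus>\<^bsub>tensor HT (hsub V S)\<^esub> coact (hsub V S) w"
      using cv cw tS lin_map_add[OF lin_tincl cv(1) cw(1)] lin_map_add[OF gr_coact[OF V] sub_closed[OF v] sub_closed[OF w]]
      unfolding hsub_simps by (intro coact_hsub_eqI) simp_all
  qed
  show "carrier (hsub V S) \<subseteq> aspan (hsub V S) (\<Union>m. {v \<in> S. homog V m v})"
  proof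
    fix v assume "v \<in> carrier (hsub V S)"
    then have v: "v \<in> S" by simp
    obtain F where F: "finite F" "v = (\<Oplus>\<^bsub>V\<^esub>m\<in>F. hpr V m v)"
      using hpr_expand[OF V sub_closed[OF v]] by (elim exE conjE)
    have "lin_map VS V (\<lambda>v. v)" using lin_incl[OF S] by (simp add: id_def)
    from lin_map_finsum[OF vspace_VS vV this, of "\<lambda>m. hpr V m v" F]
    have "(\<Oplus>\<^bsub>V\<^esub>m\<in>F. hpr V m v) = (\<Oplus>\<^bsub>VS\<^esub>m\<in>F. hpr V m v)" using Sh[OF v] by simp
    also have "\<dots> \<in> aspan VS (\<Union>m. {v \<in> S. homog V m v})"
    proof (rule aspan_finsum[OF vspace_VS _ F(1)])
      show "\<zero>\<^bsub>VS\<^esub> \<in> aspan VS (\<Union>m. {v \<in> S. homog V m v})"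
        using homog_zero[OF V] S by (auto intro!: aspan.base simp: lsubspace_def)
      show "hpr V m v \<in> aspan VS (\<Union>m. {v \<in> S. homog V m v})" for m
        using Sh[OF v] homog_hpr[OF V sub_closed[OF v]] by (auto intro!: aspan.base)
    qed (use Sh[OF v] in simp)
    finally have "v \<in> aspan VS (\<Union>m. {v \<in> S. homog V m v})" using F(2) by simp
    then show "v \<in> aspan (hsub V S) (\<Union>m. {v \<in> S. homog V m v})"
    proof induction
      case (add a b)
      then show ?case using aspan.add[of a "hsub V S"] by simp
    qed (rule aspan.base)
  qed
qed

end

section \<open>Evaluation of braided derivations\<close>

context
  fixes R :: "('k::field, 'n::finite) torus2 \<Rightarrow> 'k" and A :: "('k, 'n, 'a) hobj"
    and ms :: "(int ^ 'n) list" and fs :: "'k ncpoly set list" and \<phi> :: "'k ncpoly set set \<Rightarrow> 'a"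
  assumes R: "cotriangular R" and hA: "halgebra R A" and pres: "hpresents R A ms fs \<phi>"
begin

private abbreviation (input) "FR \<equiv> hfree R ms"
private abbreviation (input) "\<pi> \<equiv> pres_proj R ms fs \<phi>"
private abbreviation (input) "MA \<equiv> hdsum (length ms) (\<lambda>j. hshift A (- (ms ! j)))"

lemmas pA = halgebra_galg[OF hA]
lemmas pgA = galg_gr[OF pA]
lemmas pvA = galg_vspace[OF pA]
lemmas pF = galg_hfree[of R ms]
lemmas pgF = galg_gr[OF pF]
lemmas pvF = galg_vspace[OF pF]
lemmas p\<pi> = pres_ghom[OF pA pres]
lemmas pgV = gr_hshift[OF pgA]

lemma pgM: "gr MA"
  by (rule gr_hdsum[OF pgV])

lemmas pvM = gr_vspace[OF pgM]

interpretation A: ring A by (rule galg_ring[OF pA])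
interpretation FR: ring FR by (rule galg_ring[OF pF])

lemma pM_carrier: "L \<in> carrier MA \<longleftrightarrow> L \<in> (\<Pi>\<^sub>E j\<in>{..<length ms}. carrier A)"
  using hdsum_fields(1)[where V="\<lambda>j. hshift A (- (ms ! j))" and N="length ms", OF pgV] by simp

lemma pM_comp: "L \<in> carrier MA \<Longrightarrow> j < length ms \<Longrightarrow> L j \<in> carrier A"
  unfolding pM_carrier by auto

lemma lin_pM_proj: "j < length ms \<Longrightarrow> lin_map MA A (\<lambda>L. L j)"
  using lin_dsum_proj[where V="\<lambda>j. hshift A (- (ms ! j))" and N="length ms", OF pgV]
  by (simp add: hdsum_fields[OF pgV])

lemma homog_pM_proj: "homog MA l L \<Longrightarrow> j < length ms \<Longrightarrow> homog A (l + ms ! j) (L j)"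
  using homog_dsum_proj[where V="\<lambda>j. hshift A (- (ms ! j))" and N="length ms", OF pgV, of l L j]
  by (simp add: homog_hshift[OF pgA])

lemma pi_surj: "a \<in> carrier A \<Longrightarrow> \<exists>w\<in>carrier FR. \<pi> w = a"
  unfolding pres_surj[OF pA pres, symmetric] by auto

text \<open>The projection to \<open>A\<close> preserves degrees, so any preimage can be replaced by
  its component of degree \<open>p\<close>.\<close>

lemma pi_surj_homog: assumes a: "homog A p a" shows "\<exists>w. homog FR p w \<and> \<pi> w = a"
proof -
  obtain w where w: "w \<in> carrier FR" "\<pi> w = a" using pi_surj[OF homog_closed[OF a]] by blast
  have "\<pi> (hpr FR p w) = hpr A (p + 0) (\<pi> w)"
    by (rule hpr_map[OF pgF pgA ghom_lin[OF p\<pi>] _ w(1)]) (use ghom_homog[OF p\<pi>] in simp)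
  then have "\<pi> (hpr FR p w) = a" using w hpr_homog[OF pgA a, of p] by simp
  then show ?thesis using homog_hpr[OF pgF w(1)] by blast
qed

text \<open>\<open>evl w L\<close> is \<open>ev (L \<otimes> \<pi> w)\<close>, for an arbitrary vector \<open>L\<close> of coefficients.\<close>

definition evl :: "'k ncpoly set \<Rightarrow> (nat \<Rightarrow> 'a) \<Rightarrow> 'a" where
  "evl w L = (\<Oplus>\<^bsub>A\<^esub>j\<in>{..<length ms}. L j \<otimes>\<^bsub>A\<^esub> \<pi> (partial R ms j w))"

lemma pi_partial: "j < length ms \<Longrightarrow> w \<in> carrier FR \<Longrightarrow> \<pi> (partial R ms j w) \<in> carrier A"
  by (rule ghom_closed[OF p\<pi> lin_map_closed[OF partial_lin[OF R]]])

lemma bilin_evl: "bilin FR MA A evl"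
proof (rule bilinI)
  show "lin_map MA A (evl w)" if w: "w \<in> carrier FR" for w
    unfolding evl_def[abs_def]
  proof (rule lin_map_fin[OF pvA])
    fix j assume "j \<in> {..<length ms}"
    then have j: "j < length ms" by simp
    show "lin_map MA A (\<lambda>L. L j \<otimes>\<^bsub>A\<^esub> \<pi> (partial R ms j w))"
      by (rule lin_bilin_l[OF bilin_mult[OF pA] lin_pM_proj[OF j] pi_partial[OF j w]])
  qed
  show "lin_map FR A (\<lambda>w. evl w L)" if L: "L \<in> carrier MA" for L
    unfolding evl_def
  proof (rule lin_map_fin[OF pvA])
    fix j assume "j \<in> {..<length ms}"
    then have j: "j < length ms" by simp
    show "lin_map FR A (\<lambda>w. L j \<otimes>\<^bsub>A\<^esub> \<pi> (partial R ms j w))"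
      by (rule lin_bilin_r[OF bilin_mult[OF pA] lin_map_comp[OF partial_lin[OF R j] ghom_lin[OF p\<pi>]] pM_comp[OF L j]])
  qed
qed

text \<open>The coefficient \<open>L j\<close> has degree \<open>l + ms ! j\<close> in
  \<open>A\<close>, since its summand is shifted, while the derivative lowers the degree of
  \<open>w\<close> by the same \<open>ms ! j\<close>.\<close>

lemma homog_evl:
  assumes w: "homog FR p w" and L: "homog MA l L"
  shows "homog A (l + p) (evl w L)"
  unfolding evl_def
proof (rule homog_finsum[OF pgA])
  fix j assume "j \<in> {..<length ms}"
  then have j: "j < length ms" by simp
  have "homog A (l + ms ! j + (p - ms ! j)) (L j \<otimes>\<^bsub>A\<^esub> \<pi> (partial R ms j w))"
    by (rule galg_homog_mult[OF pA homog_pM_proj[OF L j] ghom_homog[OF p\<pi> partial_homog[OF R j w]]])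
  then show "homog A (l + p) (L j \<otimes>\<^bsub>A\<^esub> \<pi> (partial R ms j w))" by (simp add: algebra_simps)
qed simp

text \<open>
  The braiding factor of \<open>\<partial>\<^sub>j\<close> and the degree shift of the \<open>j\<close>-th summand combine to the braiding of \<open>L\<close>
  itself.
\<close>

lemma evl_leibniz:
  assumes u: "homog FR p u" and w: "w \<in> carrier FR" and L: "homog MA l L"
  shows "evl (u \<otimes>\<^bsub>FR\<^esub> w) L = evl u L \<otimes>\<^bsub>A\<^esub> \<pi> w \<oplus>\<^bsub>A\<^esub> bch R p l \<odot>\<^bsub>A\<^esub> (\<pi> u \<otimes>\<^bsub>A\<^esub> evl w L)"
proof -
  let ?I = "{..<length ms}"
  note uc = homog_closed[OF u] and Lc = homog_closed[OF L]
  have c: "L j \<in> carrier A" "\<pi> (partial R ms j u) \<in> carrier A" "\<pi> (partial R ms j w) \<in> carrier A"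
      if "j \<in> ?I" for j using that pM_comp[OF Lc] pi_partial uc w by auto
  have \<pi>c: "\<pi> u \<in> carrier A" "\<pi> w \<in> carrier A" using ghom_closed[OF p\<pi>] uc w by auto
  have summand: "L j \<otimes>\<^bsub>A\<^esub> \<pi> (partial R ms j (u \<otimes>\<^bsub>FR\<^esub> w)) =
     L j \<otimes>\<^bsub>A\<^esub> \<pi> (partial R ms j u) \<otimes>\<^bsub>A\<^esub> \<pi> w \<oplus>\<^bsub>A\<^esub> bch R p l \<odot>\<^bsub>A\<^esub> (\<pi> u \<otimes>\<^bsub>A\<^esub> (L j \<otimes>\<^bsub>A\<^esub> \<pi> (partial R ms j w)))"
    if jI: "j \<in> ?I" for j
  proof -
    have j: "j < length ms" using jI by simp
    let ?\<chi> = "bch R p (- (ms ! j))"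
    have dc: "partial R ms j u \<in> carrier FR" "partial R ms j w \<in> carrier FR"
      using lin_map_closed[OF partial_lin[OF R j]] uc w by auto
    have "\<pi> (partial R ms j (u \<otimes>\<^bsub>FR\<^esub> w)) = \<pi> (partial R ms j u) \<otimes>\<^bsub>A\<^esub> \<pi> w \<oplus>\<^bsub>A\<^esub> ?\<chi> \<odot>\<^bsub>A\<^esub> (\<pi> u \<otimes>\<^bsub>A\<^esub> \<pi> (partial R ms j w))"
      using dc uc w pvF
      by (simp add: partial_leibniz[OF R j u w] lin_map_add[OF ghom_lin[OF p\<pi>]] lin_map_smult[OF ghom_lin[OF p\<pi>]] ghom_mult[OF p\<pi>])
    then have "L j \<otimes>\<^bsub>A\<^esub> \<pi> (partial R ms j (u \<otimes>\<^bsub>FR\<^esub> w)) =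
        L j \<otimes>\<^bsub>A\<^esub> \<pi> (partial R ms j u) \<otimes>\<^bsub>A\<^esub> \<pi> w \<oplus>\<^bsub>A\<^esub> ?\<chi> \<odot>\<^bsub>A\<^esub> (L j \<otimes>\<^bsub>A\<^esub> \<pi> u \<otimes>\<^bsub>A\<^esub> \<pi> (partial R ms j w))"
      using c[OF jI] \<pi>c pvA by (simp add: A.r_distr galg_smult_r[OF pA] A.m_assoc)
    also have "L j \<otimes>\<^bsub>A\<^esub> \<pi> u = bch R p (l + ms ! j) \<odot>\<^bsub>A\<^esub> (\<pi> u \<otimes>\<^bsub>A\<^esub> L j)"
      by (rule halgebra_braid[OF R hA homog_pM_proj[OF L j] ghom_homog[OF p\<pi> u]])
    also have "?\<chi> \<odot>\<^bsub>A\<^esub> (bch R p (l + ms ! j) \<odot>\<^bsub>A\<^esub> (\<pi> u \<otimes>\<^bsub>A\<^esub> L j) \<otimes>\<^bsub>A\<^esub> \<pi> (partial R ms j w)) =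
        (?\<chi> * bch R p (l + ms ! j)) \<odot>\<^bsub>A\<^esub> (\<pi> u \<otimes>\<^bsub>A\<^esub> (L j \<otimes>\<^bsub>A\<^esub> \<pi> (partial R ms j w)))"
      using c[OF jI] \<pi>c pvA by (simp add: galg_smult_l[OF pA] A.m_assoc)
    also have "?\<chi> * bch R p (l + ms ! j) = bch R p l"
      using bch_add_r[OF R, of p "- (ms ! j)" "l + ms ! j"] by simp
    finally show ?thesis .
  qed
  have lin: "lin_map A A (\<lambda>x. bch R p l \<odot>\<^bsub>A\<^esub> (\<pi> u \<otimes>\<^bsub>A\<^esub> x))"
    by (rule lin_map_scale[OF pvA bilin_r[OF bilin_mult[OF pA] \<pi>c(1)]])
  have "evl (u \<otimes>\<^bsub>FR\<^esub> w) L = (\<Oplus>\<^bsub>A\<^esub>j\<in>?I. L j \<otimes>\<^bsub>A\<^esub> \<pi> (partial R ms j u) \<otimes>\<^bsub>A\<^esub> \<pi> w \<oplus>\<^bsub>A\<^esub>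
      bch R p l \<odot>\<^bsub>A\<^esub> (\<pi> u \<otimes>\<^bsub>A\<^esub> (L j \<otimes>\<^bsub>A\<^esub> \<pi> (partial R ms j w))))"
    unfolding evl_def using c \<pi>c pvA by (intro A.finsum_cong' summand) auto
  also have "\<dots> = (\<Oplus>\<^bsub>A\<^esub>j\<in>?I. L j \<otimes>\<^bsub>A\<^esub> \<pi> (partial R ms j u) \<otimes>\<^bsub>A\<^esub> \<pi> w) \<oplus>\<^bsub>A\<^esub>
      (\<Oplus>\<^bsub>A\<^esub>j\<in>?I. bch R p l \<odot>\<^bsub>A\<^esub> (\<pi> u \<otimes>\<^bsub>A\<^esub> (L j \<otimes>\<^bsub>A\<^esub> \<pi> (partial R ms j w))))"
    using c \<pi>c pvA by (intro A.finsum_addf) auto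
  also have "(\<Oplus>\<^bsub>A\<^esub>j\<in>?I. L j \<otimes>\<^bsub>A\<^esub> \<pi> (partial R ms j u) \<otimes>\<^bsub>A\<^esub> \<pi> w) = evl u L \<otimes>\<^bsub>A\<^esub> \<pi> w"
    unfolding evl_def using c \<pi>c by (intro A.finsum_ldistr[symmetric]) auto
  also have "(\<Oplus>\<^bsub>A\<^esub>j\<in>?I. bch R p l \<odot>\<^bsub>A\<^esub> (\<pi> u \<otimes>\<^bsub>A\<^esub> (L j \<otimes>\<^bsub>A\<^esub> \<pi> (partial R ms j w)))) = bch R p l \<odot>\<^bsub>A\<^esub> (\<pi> u \<otimes>\<^bsub>A\<^esub> evl w L)"
    unfolding evl_def by (rule lin_map_finsum[OF pvA pvA lin, symmetric]) (use c in auto)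
  finally show ?thesis .
qed

lemma evl_closed: "w \<in> carrier FR \<Longrightarrow> L \<in> carrier MA \<Longrightarrow> evl w L \<in> carrier A"
  by (rule bilin_closed[OF bilin_evl])

lemma evl_gen:
  assumes i: "i < length ms" and L: "L \<in> carrier MA"
  shows "evl (fgen R ms i) L = L i"
proof -
  have c: "L j \<in> carrier A" if "j < length ms" for j using pM_comp[OF L that] .
  have \<pi>0: "\<pi> \<zero>\<^bsub>FR\<^esub> = \<zero>\<^bsub>A\<^esub>" by (rule lin_map_zero[OF pvF pvA ghom_lin[OF p\<pi>]])
  have "evl (fgen R ms i) L = (\<Oplus>\<^bsub>A\<^esub>j\<in>{..<length ms}. if i = j then L j else \<zero>\<^bsub>A\<^esub>)"
    unfolding evl_def using c i by (intro A.finsum_cong') (auto simp: partial_gen[OF R] ghom_one[OF p\<pi>] \<pi>0)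
  also have "\<dots> = L i" using c i by (intro A.finsum_singleton) auto
  finally show ?thesis .
qed

section \<open>The object \<open>der(A)\<close> and well-definedness of evaluation\<close>

definition dersub :: "(nat \<Rightarrow> 'a) set" where
  "dersub = {L \<in> carrier MA. \<forall>f\<in>set fs. evl f L = \<zero>\<^bsub>A\<^esub>}"

lemma hder_eq: "hder R A ms fs \<phi> = hsub MA dersub"
  by (simp add: hder_def dersub_def evl_def)

lemma rel_closed: "f \<in> set fs \<Longrightarrow> f \<in> carrier FR" and rel_homog: "f \<in> set fs \<Longrightarrow> \<exists>m. homog FR m f"
  using pres by (auto simp: hpresents_def homog_def)

lemma lsubspace_dersub: "lsubspace dersub MA"
proof -
  have l: "lin_map MA A (evl f)" if "f \<in> set fs" for f by (rule bilin_r[OF bilin_evl rel_closed[OF that]])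
  show ?thesis
    unfolding lsubspace_def dersub_def
    using pvM pvA lin_map_zero[OF pvM pvA l] lin_map_add[OF l] lin_map_smult[OF l] by auto
qed

text \<open>The relations are homogeneous, so evaluation at a relation shifts degrees by a constant
  and its kernel is stable under the projections.\<close>

lemma hpr_dersub: "L \<in> dersub \<Longrightarrow> hpr MA m L \<in> dersub"
proof -
  assume L: "L \<in> dersub"
  then have Lc: "L \<in> carrier MA" by (simp add: dersub_def)
  have "evl f (hpr MA m L) = \<zero>\<^bsub>A\<^esub>" if f: "f \<in> set fs" for f
  proof -
    obtain n where n: "homog FR n f" using rel_homog[OF f] by blast
    have "evl f (hpr MA m L) = hpr A (m + n) (evl f L)"
      by (rule hpr_map[OF pgM pgA bilin_r[OF bilin_evl rel_closed[OF f]] homog_evl[OF n] Lc])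
    then show ?thesis using L f lin_map_zero[OF pvA pvA lin_hpr[OF pgA]] by (simp add: dersub_def)
  qed
  then show ?thesis using hpr_closed[OF pgM Lc] by (simp add: dersub_def)
qed

lemma gr_hder: "gr (hder R A ms fs \<phi>)"
  unfolding hder_eq by (rule gr_hsub[OF pgM lsubspace_dersub]) (rule hpr_dersub)

lemma homog_hder: "homog (hder R A ms fs \<phi>) m L \<longleftrightarrow> L \<in> dersub \<and> homog MA m L"
  unfolding hder_eq by (rule homog_hsub[OF pgM lsubspace_dersub]) (rule hpr_dersub)

lemma hder_simps:
  "carrier (hder R A ms fs \<phi>) = dersub" "zero (hder R A ms fs \<phi>) = zero MA" "add (hder R A ms fs \<phi>) = add MA"
  "smult (hder R A ms fs \<phi>) = smult MA" "tensor U (hder R A ms fs \<phi>) = tensor U (MA\<lparr>carrier := dersub\<rparr>)"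
  "tens U (hder R A ms fs \<phi>) = tens U (MA\<lparr>carrier := dersub\<rparr>)"
  "lin_map (hder R A ms fs \<phi>) X f \<longleftrightarrow> lin_map (MA\<lparr>carrier := dersub\<rparr>) X f"
  "lin_map Y (hder R A ms fs \<phi>) g \<longleftrightarrow> lin_map Y (MA\<lparr>carrier := dersub\<rparr>) g"
  unfolding hder_eq by (simp_all add: hsub_simps[OF pgM lsubspace_dersub] hpr_dersub)

lemma dersub_closed: "L \<in> dersub \<Longrightarrow> L \<in> carrier MA"
  by (simp add: dersub_def)

text \<open>The conditions defining \<open>der(A)\<close> concern the finitely many relations only.
  For a product \<open>a * s * b\<close> with \<open>s\<close> a relation, every term of the Leibniz
  expansion contains the evaluation at \<open>s\<close> or the image of \<open>s\<close> in
  \<open>A\<close>, and both are zero.\<close>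

lemma evl_rel:
  assumes w: "w \<in> rel_ideal R ms fs" and L: "L \<in> dersub"
  shows "evl w L = \<zero>\<^bsub>A\<^esub>"
proof -
  have fsF: "set fs \<subseteq> carrier FR" using rel_closed by blast
  have "w \<in> aspan FR (insert \<zero>\<^bsub>FR\<^esub> {a \<otimes>\<^bsub>FR\<^esub> s \<otimes>\<^bsub>FR\<^esub> b | a s b m n. s \<in> set fs \<and> homog FR m a \<and> homog FR n b})"
    by (rule genideal_aspan[OF pF fsF]) (use w in \<open>simp add: rel_ideal_def\<close>)
  then have *: "w \<in> carrier FR \<and> (\<forall>l L. L \<in> dersub \<longrightarrow> homog MA l L \<longrightarrow> evl w L = \<zero>\<^bsub>A\<^esub>)"
  proof induction
    case (base g)
    show ?case
    proof (cases "g = \<zero>\<^bsub>FR\<^esub>")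
      case True
      then show ?thesis using lin_map_zero[OF pvF pvA bilin_l[OF bilin_evl dersub_closed]] by simp
    next
      case False
      then obtain a s b m n where g: "g = a \<otimes>\<^bsub>FR\<^esub> s \<otimes>\<^bsub>FR\<^esub> b" and s: "s \<in> set fs" and a: "homog FR m a" and b: "homog FR n b"
        using base by blast
      obtain k where sh: "homog FR k s" using rel_homog[OF s] by blast
      note c = homog_closed[OF a] homog_closed[OF b] rel_closed[OF s]
      note \<pi>c = c[THEN ghom_closed[OF p\<pi>]]
      interpret I: ideal "rel_ideal R ms fs" FR using graded_rel_ideal[OF pres] by (simp add: graded_ideal_def)
      have "s \<in> rel_ideal R ms fs" unfolding rel_ideal_def using FR.genideal_self[OF fsF] s by blast
      then have \<pi>s: "\<pi> s = \<zero>\<^bsub>A\<^esub>" using pres_ker[OF pA pres c(3)] by simp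
      have "evl g L = \<zero>\<^bsub>A\<^esub>" if L: "L \<in> dersub" and Lh: "homog MA l L" for l L
      proof -
        note Lc = dersub_closed[OF L]
        have "evl s L = \<zero>\<^bsub>A\<^esub>" using L s by (simp add: dersub_def)
        then have "evl (s \<otimes>\<^bsub>FR\<^esub> b) L = \<zero>\<^bsub>A\<^esub>"
          using evl_leibniz[OF sh c(2) Lh] \<pi>c \<pi>s evl_closed[OF c(2) Lc] pvA by simp
        then have "evl (a \<otimes>\<^bsub>FR\<^esub> (s \<otimes>\<^bsub>FR\<^esub> b)) L = \<zero>\<^bsub>A\<^esub>"
          using evl_leibniz[OF a FR.m_closed[OF c(3,2)] Lh] \<pi>c \<pi>s evl_closed[OF c(1) Lc] c pvA
          by (simp add: ghom_mult[OF p\<pi>])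
        then show ?thesis using c by (simp add: g FR.m_assoc)
      qed
      then show ?thesis using c g by simp
    qed
  next
    case (add v w)
    then show ?case using lin_map_add[OF bilin_l[OF bilin_evl dersub_closed]] by simp
  qed
  then have wF: "w \<in> carrier FR" by blast
  note lw = bilin_r[OF bilin_evl wF]
  \<comment> \<open>The Leibniz rule requires a homogeneous \<open>L\<close>. The decomposition is
    taken in the graded object \<open>der(A)\<close>, so that the homogeneous summands satisfy the
    relations too.\<close>
  have "L \<in> carrier (hder R A ms fs \<phi>)" using L by (simp add: hder_simps)
  then have "L \<in> dersub \<and> evl w L = \<zero>\<^bsub>A\<^esub>"
  proof (induction rule: gr_induct[OF gr_hder, consumes 1, case_names homog add])
    case (homog l L)
    then show ?case using * by (auto simp: homog_hder)
  next
    case (add v w)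
    then show ?case using lin_map_add[OF lw] dersub_closed lsubspace_dersub
      by (simp add: hder_simps lsubspace_def)
  qed
  then show ?thesis ..
qed

text \<open>\<open>der_ev\<close> picks some preimage of its argument. Any two differ by an element
  of the ideal of relations, on which \<open>evl_rel\<close> applies.\<close>

lemma der_ev_pi:
  assumes w: "w \<in> carrier FR" and L: "L \<in> dersub"
  shows "der_ev R A ms fs \<phi> L (\<pi> w) = evl w L"
proof -
  let ?P = "\<lambda>w'. w' \<in> carrier FR \<and> \<pi> w' = \<pi> w"
  let ?w = "SOME w'. ?P w'"
  have P: "?P ?w" by (rule someI[of ?P w]) (use w in simp)
  have d: "?w \<ominus>\<^bsub>FR\<^esub> w \<in> carrier FR" using P w by simp
  have "\<pi> (?w \<ominus>\<^bsub>FR\<^esub> w) = \<zero>\<^bsub>A\<^esub>"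
    using lin_map_diff[OF pvF pvA ghom_lin[OF p\<pi>], of ?w w] P w ghom_closed[OF p\<pi> w] by (simp add: a_minus_def A.r_neg)
  then have "?w \<ominus>\<^bsub>FR\<^esub> w \<in> rel_ideal R ms fs" using pres_ker[OF pA pres d] by simp
  then have "evl (?w \<ominus>\<^bsub>FR\<^esub> w) L = \<zero>\<^bsub>A\<^esub>" using L by (rule evl_rel)
  then have "evl ?w L \<ominus>\<^bsub>A\<^esub> evl w L = \<zero>\<^bsub>A\<^esub>"
    using lin_map_diff[OF pvF pvA bilin_l[OF bilin_evl dersub_closed[OF L]], of ?w w] P w by simp
  then have "evl ?w L = evl w L"
    using abelian_group_diff_zero[OF A.is_abelian_group evl_closed evl_closed] P w dersub_closed[OF L] by blast
  then show ?thesis by (simp add: der_ev_def evl_def)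
qed

section \<open>The comparison map\<close>

context
  fixes B :: "('k, 'n, 'u) hobj"
  assumes B: "galg B"
begin

private abbreviation (input) "PB \<equiv> hcoprod R B A"
private abbreviation (input) "TB \<equiv> tensor B A"
private abbreviation (input) "HD \<equiv> hder R A ms fs \<phi>"
private abbreviation (input) "SM \<equiv> MA\<lparr>carrier := dersub\<rparr>"

lemmas xgB = galg_gr[OF B]
lemmas xvB = galg_vspace[OF B]
lemmas xvT = vspace_tensor[OF xvB pvA]
lemmas xP = galg_hcoprod[OF R B pA]
lemmas xvS = vspace_sub[OF pvM lsubspace_dersub]

interpretation T: abelian_group TB by (rule vspace_abelian_group[OF xvT])
interpretation P: ring PB by (rule galg_ring[OF xP])

lemma lin_id_B: "lin_map B B id"
  by (simp add: id_def lin_map_id)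

text \<open>Evaluation at \<open>w\<close> with coefficients in \<open>B\<close>. It is defined on
  the tensor product with the full direct sum, where arbitrary values on the generators can be
  prescribed before any relation is imposed.\<close>

definition xev :: "'k ncpoly set \<Rightarrow> (('u \<times> (nat \<Rightarrow> 'a)) \<Rightarrow>\<^sub>0 'k) set \<Rightarrow> (('u \<times> 'a) \<Rightarrow>\<^sub>0 'k) set" where
  "xev w = tmap B A id (evl w)"

lemma xi_ext:
  assumes w: "w \<in> carrier FR"
  shows lin_ext_ev: "lin_map (tensor B MA) TB (xev w)"
    and ext_ev_tens: "b \<in> carrier B \<Longrightarrow> L \<in> carrier MA \<Longrightarrow> xev w (tens B MA b L) = tens B A b (evl w L)"
  using lin_tmap[OF xvB pvM xvB pvA lin_id_B bilin_r[OF bilin_evl w]]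
    tmap_tens[OF xvB pvM xvB pvA lin_id_B bilin_r[OF bilin_evl w]] by (auto simp: xev_def)

lemma lin_ext_ev_w:
  assumes T: "T \<in> carrier (tensor B MA)"
  shows "lin_map FR TB (\<lambda>w. xev w T)"
  unfolding xev_def tmap_def
proof (rule lin_tlift_param[OF xvB pvM xvT T _ _ pvF])
  show "bilin B MA TB (\<lambda>v L. tens B A (id v) (evl w L))" if "w \<in> carrier FR" for w
    by (rule bilin_comp[OF bilin_tens[OF xvB pvA] lin_id_B bilin_r[OF bilin_evl that]])
  show "lin_map FR TB (\<lambda>w. tens B A (id v) (evl w L))" if "v \<in> carrier B" "L \<in> carrier MA" for v L
    using lin_bilin_r[OF bilin_tens[OF xvB pvA] bilin_l[OF bilin_evl that(2)], of "id v"] that by simp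
qed

lemma homog_ext_ev:
  assumes "homog FR p w" "homog (htensor B MA) l T"
  shows "homog (htensor B A) (l + p) (xev w T)"
  unfolding xev_def
  by (rule homog_tmap[OF xgB pgM xgB pgA lin_id_B _ bilin_r[OF bilin_evl homog_closed[OF assms(1)]] homog_evl[OF assms(1)] assms(2)])
    simp

text \<open>Coinvariance of \<open>T\<close> means that it is a sum of tensors
  \<open>b \<otimes> L\<close> of opposite degrees. For these, the factor from moving
  \<open>b\<close> past the image of \<open>u\<close> in the product of
  \<open>B \<squnion> A\<close> is the factor in \<open>evl_leibniz\<close>, so the resulting rule
  is that of an unbraided derivation.\<close>

lemma ext_ev_leibniz:
  assumes T: "homog (htensor B MA) 0 T" and u: "u \<in> carrier FR" and w: "w \<in> carrier FR"
  shows "xev (u \<otimes>\<^bsub>FR\<^esub> w) T =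
    xev u T \<otimes>\<^bsub>PB\<^esub> tens B A \<one>\<^bsub>B\<^esub> (\<pi> w) \<oplus>\<^bsub>TB\<^esub> tens B A \<one>\<^bsub>B\<^esub> (\<pi> u) \<otimes>\<^bsub>PB\<^esub> xev w T"
proof -
  note bm = bilin_hcoprod[OF R B pA]
  note tc = tens_closed[OF xvB pvA]
  interpret B: ring B by (rule galg_ring[OF B])
  have one: "tens B A \<one>\<^bsub>B\<^esub> (\<pi> x) \<in> carrier TB" if "x \<in> carrier FR" for x
    by (rule tc) (use that ghom_closed[OF p\<pi>] in auto)
  have ec: "xev x S \<in> carrier TB" if "x \<in> carrier FR" "S \<in> carrier (tensor B MA)" for x S
    by (rule lin_map_closed[OF lin_ext_ev[OF that(1)] that(2)])
  have gen: "xev (u \<otimes>\<^bsub>FR\<^esub> w) (tens B MA b L) =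
      xev u (tens B MA b L) \<otimes>\<^bsub>PB\<^esub> tens B A \<one>\<^bsub>B\<^esub> (\<pi> w) \<oplus>\<^bsub>TB\<^esub>
      tens B A \<one>\<^bsub>B\<^esub> (\<pi> u) \<otimes>\<^bsub>PB\<^esub> xev w (tens B MA b L)"
    if b: "homog B k b" and L: "homog MA l L" and kl: "k + l = 0" and u: "homog FR p u" for b L k l p u
  proof -
    note bc = homog_closed[OF b] and Lc = homog_closed[OF L] and uc = homog_closed[OF u]
    \<comment> \<open>From \<open>k = - l\<close> and \<open>bch_minus_l\<close>; the only place
      where total degree 0 is used.\<close>
    have bl: "bch R k p = bch R p l"
      using bch_minus_l[OF R, of l p] kl by (simp add: eq_neg_iff_add_eq_0[symmetric])
    have 1: "tens B A b (evl u L) \<otimes>\<^bsub>PB\<^esub> tens B A \<one>\<^bsub>B\<^esub> (\<pi> w) = tens B A b (evl u L \<otimes>\<^bsub>A\<^esub> \<pi> w)"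
      using hcoprod_tens[OF R B pA bc homog_evl[OF u L] galg_homog_one[OF B] ghom_closed[OF p\<pi> w]]
        bc xvT tc A.m_closed[OF evl_closed[OF uc Lc] ghom_closed[OF p\<pi> w]] by (simp add: bch_0_l[OF R])
    have 2: "tens B A \<one>\<^bsub>B\<^esub> (\<pi> u) \<otimes>\<^bsub>PB\<^esub> tens B A b (evl w L) = bch R k p \<odot>\<^bsub>TB\<^esub> tens B A b (\<pi> u \<otimes>\<^bsub>A\<^esub> evl w L)"
      using hcoprod_tens[OF R B pA B.one_closed ghom_homog[OF p\<pi> u] b evl_closed[OF w Lc]] bc by simp
    have c2: "\<pi> u \<otimes>\<^bsub>A\<^esub> evl w L \<in> carrier A" and c1: "evl u L \<otimes>\<^bsub>A\<^esub> \<pi> w \<in> carrier A"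
      using evl_closed[OF w Lc] evl_closed[OF uc Lc] ghom_closed[OF p\<pi> uc] ghom_closed[OF p\<pi> w] by auto
    show ?thesis
      unfolding ext_ev_tens[OF FR.m_closed[OF uc w] bc Lc] ext_ev_tens[OF uc bc Lc] ext_ev_tens[OF w bc Lc] 1 2
        evl_leibniz[OF u w L] bl
      using lin_map_add[OF bilin_r[OF bilin_tens[OF xvB pvA] bc]] lin_map_smult[OF bilin_r[OF bilin_tens[OF xvB pvA] bc]] c1 c2 pvA
      by simp
  qed
  have hom: "T \<in> carrier (tensor B MA) \<and> xev (u \<otimes>\<^bsub>FR\<^esub> w) T =
      xev u T \<otimes>\<^bsub>PB\<^esub> tens B A \<one>\<^bsub>B\<^esub> (\<pi> w) \<oplus>\<^bsub>TB\<^esub> tens B A \<one>\<^bsub>B\<^esub> (\<pi> u) \<otimes>\<^bsub>PB\<^esub> xev w T"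
    if u: "homog FR p u" for p u
    using homog_htensor_aspan[OF xgB pgM T]
  proof induction
    case (base S)
    then obtain b L k l where S: "S = tens B MA b L" "homog B k b" "homog MA l L" "k + l = 0"
      unfolding tgen_def by blast
    then show ?case using gen[OF S(2-4) u] tens_closed[OF xvB pvM] by (simp add: homog_closed)
  next
    case (add S T)
    note uc = homog_closed[OF u]
    note uw = FR.m_closed[OF uc w]
    have c: "S \<in> carrier (tensor B MA)" "T \<in> carrier (tensor B MA)" using add by auto
    show ?case
      using add one[OF w] one[OF uc] ec[OF uc] ec[OF w] vspace_tensor[OF xvB pvM]
        bilin_closed[OF bm ec[OF uc] one[OF w]] bilin_closed[OF bm one[OF uc] ec[OF w]]
      by (simp add: lin_map_add[OF lin_ext_ev[OF uw]] lin_map_add[OF lin_ext_ev[OF uc]] lin_map_add[OF lin_ext_ev[OF w]]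
          lin_map_add[OF bilin_l[OF bm one[OF w]]] lin_map_add[OF bilin_r[OF bm one[OF uc]]] T.a_ac)
  qed
  have Tc: "T \<in> carrier (tensor B MA)" using homog_closed[OF T] by simp
  note lw = lin_ext_ev_w[OF Tc]
  show ?thesis using u
  proof (induction rule: gr_induct[OF pgF, consumes 1, case_names homog add])
    case (homog p u)
    then show ?case using hom by blast
  next
    case (add u v)
    have d: "tens B A \<one>\<^bsub>B\<^esub> (\<pi> (u \<oplus>\<^bsub>FR\<^esub> v)) = tens B A \<one>\<^bsub>B\<^esub> (\<pi> u) \<oplus>\<^bsub>TB\<^esub> tens B A \<one>\<^bsub>B\<^esub> (\<pi> v)"
      using add lin_map_add[OF ghom_lin[OF p\<pi>]] lin_map_add[OF bilin_r[OF bilin_tens[OF xvB pvA] B.one_closed]] ghom_closed[OF p\<pi>] by simp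
    show ?case
      using add w one ec Tc bilin_closed[OF bm]
      by (simp add: FR.l_distr lin_map_add[OF lw] d lin_map_add[OF bilin_l[OF bm]] T.a_ac)
  qed
qed

text \<open>The map from \<open>B \<otimes> der(A)\<close> to \<open>B\<close> tensored with the
  full direct sum. It is not a set inclusion, as the cosets differ, but it is injective by
  exactness.\<close>

definition iot :: "(('u \<times> (nat \<Rightarrow> 'a)) \<Rightarrow>\<^sub>0 'k) set \<Rightarrow> (('u \<times> (nat \<Rightarrow> 'a)) \<Rightarrow>\<^sub>0 'k) set" where
  "iot = tmap B MA id id"

lemma lin_iot: "lin_map (tensor B SM) (tensor B MA) iot"
  and iot_tens: "b \<in> carrier B \<Longrightarrow> L \<in> dersub \<Longrightarrow> iot (tens B SM b L) = tens B MA b L"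
  using lin_tmap[OF xvB xvS xvB pvM lin_id_B lin_incl[OF lsubspace_dersub]]
    tmap_tens[OF xvB xvS xvB pvM lin_id_B lin_incl[OF lsubspace_dersub]]
  by (auto simp: iot_def)

lemma iot_inj: "T \<in> carrier (tensor B SM) \<Longrightarrow> T' \<in> carrier (tensor B SM) \<Longrightarrow> iot T = iot T' \<Longrightarrow> T = T'"
  unfolding iot_def by (rule tensor_sub_inj[OF xvB pvM lsubspace_dersub])

lemma homog_iot: "homog (htensor B HD) l T \<Longrightarrow> homog (htensor B MA) l (iot T)"
proof -
  assume T: "homog (htensor B HD) l T"
  have "homog (htensor B MA) (l + 0) (tmap B MA id id T)"
  proof (rule homog_tmap[OF xgB gr_hder xgB pgM lin_id_B _ _ _ T])
    show "lin_map HD MA id" using lin_incl[OF lsubspace_dersub] by (simp add: hder_simps)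
    show "homog MA (m + 0) (id w)" if "homog HD m w" for m w using that by (simp add: homog_hder)
  qed simp
  then show ?thesis by (simp add: iot_def)
qed

lemma bilin_der_ev:
  assumes w: "w \<in> carrier FR"
  shows "bilin B SM TB (\<lambda>b L. tens B A b (der_ev R A ms fs \<phi> L (\<pi> w)))"
proof -
  have "lin_map SM A (\<lambda>L. der_ev R A ms fs \<phi> L (\<pi> w))"
    by (rule lin_map_cong[OF _ xvS lin_map_comp[OF lin_incl[OF lsubspace_dersub] bilin_r[OF bilin_evl w]]])
      (simp add: der_ev_pi[OF w])
  then show ?thesis
    using bilin_comp[OF bilin_tens[OF xvB pvA] lin_map_id] by blast
qed

text \<open>Replaces \<open>xi\<close>, which involves a choice of preimages in \<open>A\<close>, by
  the evaluation \<open>xev\<close>, which is linear in both arguments. Properties of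
  \<open>xi\<close> are then checked on the free algebra.\<close>

lemma xi_pi:
  assumes w: "w \<in> carrier FR" and T: "T \<in> carrier (tensor B SM)"
  shows "xi R A ms fs \<phi> B T (\<pi> w) = xev w (iot T)"
proof -
  have "tlift TB (\<lambda>b L. tens B A b (der_ev R A ms fs \<phi> L (\<pi> w))) T = xev w (iot T)"
  proof (rule tensor_lin_eqI[OF xvB xvS xvT lin_tlift[OF xvB xvS xvT bilin_der_ev[OF w]] lin_map_comp[OF lin_iot lin_ext_ev[OF w]] _ T])
    fix b L assume b: "b \<in> carrier B" and "L \<in> carrier SM"
    then have L: "L \<in> dersub" by simp
    show "tlift TB (\<lambda>b L. tens B A b (der_ev R A ms fs \<phi> L (\<pi> w))) (tens B SM b L) = xev w (iot (tens B SM b L))"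
      using tlift_tens[OF xvB xvS xvT bilin_der_ev[OF w] b, of L] L b
      by (simp add: iot_tens ext_ev_tens[OF w] dersub_closed der_ev_pi[OF w])
  qed
  then show ?thesis using ghom_closed[OF p\<pi> w] by (simp add: xi_def)
qed

lemma carrier_hder_tensor: "homog (htensor B HD) l T \<Longrightarrow> T \<in> carrier (tensor B SM)"
  using homog_closed[of "htensor B HD" l T] by (simp add: hder_simps)

lemma iot_closed: "T \<in> carrier (tensor B SM) \<Longrightarrow> iot T \<in> carrier (tensor B MA)"
  by (rule lin_map_closed[OF lin_iot])

lemma xi_lin:
  assumes T: "T \<in> carrier (tensor B SM)"
  shows "lin_map A TB (xi R A ms fs \<phi> B T)"
proof -
  note l = lin_ext_ev_w[OF iot_closed[OF T]]
  have [simp]: "xi R A ms fs \<phi> B T (\<pi> w) = xev w (iot T)" if "w \<in> carrier FR" for w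
    by (rule xi_pi[OF that T])
  show ?thesis
  proof (rule lin_mapI)
    fix a a' assume "a \<in> carrier A" "a' \<in> carrier A"
    then obtain u w where uw: "u \<in> carrier FR" "\<pi> u = a" "w \<in> carrier FR" "\<pi> w = a'" using pi_surj by metis
    then show "xi R A ms fs \<phi> B T (a \<oplus>\<^bsub>A\<^esub> a') = xi R A ms fs \<phi> B T a \<oplus>\<^bsub>TB\<^esub> xi R A ms fs \<phi> B T a'"
      by (auto simp: lin_map_add[OF ghom_lin[OF p\<pi>], symmetric] lin_map_add[OF l])
  next
    fix c a assume "a \<in> carrier A"
    then obtain u where u: "u \<in> carrier FR" "\<pi> u = a" using pi_surj by metis
    then show "xi R A ms fs \<phi> B T (c \<odot>\<^bsub>A\<^esub> a) = c \<odot>\<^bsub>TB\<^esub> xi R A ms fs \<phi> B T a"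
      using pvF by (auto simp: lin_map_smult[OF ghom_lin[OF p\<pi>], symmetric] lin_map_smult[OF l])
  next
    fix a assume "a \<in> carrier A"
    then obtain u where u: "u \<in> carrier FR" "\<pi> u = a" using pi_surj by metis
    then show "xi R A ms fs \<phi> B T a \<in> carrier TB"
      using lin_map_closed[OF l] by auto
  qed
qed

lemma xi_mem:
  assumes T: "homog (htensor B HD) 0 T"
  shows "xi R A ms fs \<phi> B T \<in> hDer R A B"
proof -
  note Tc = carrier_hder_tensor[OF T]
  note x = xi_pi[OF _ Tc]
  have "xi R A ms fs \<phi> B T \<in> comod_hom A PB"
  proof (rule comod_homI[OF pgA galg_gr[OF xP]])
    show "lin_map A PB (xi R A ms fs \<phi> B T)" using xi_lin[OF Tc] by simp
    show "xi R A ms fs \<phi> B T \<in> extensional (carrier A)" by (simp add: xi_def)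
    fix m a assume "homog A m a"
    then obtain w where w: "homog FR m w" "\<pi> w = a" using pi_surj_homog by blast
    then show "homog PB m (xi R A ms fs \<phi> B T a)"
      using homog_ext_ev[OF w(1) homog_iot[OF T]] x[OF homog_closed[OF w(1)]] by simp
  qed
  moreover have "xi R A ms fs \<phi> B T (a \<otimes>\<^bsub>A\<^esub> a') =
       xi R A ms fs \<phi> B T a \<otimes>\<^bsub>PB\<^esub> tens B A \<one>\<^bsub>B\<^esub> a' \<oplus>\<^bsub>PB\<^esub> tens B A \<one>\<^bsub>B\<^esub> a \<otimes>\<^bsub>PB\<^esub> xi R A ms fs \<phi> B T a'"
    if a: "a \<in> carrier A" "a' \<in> carrier A" for a a'
  proof -
    obtain u w where uw: "u \<in> carrier FR" "\<pi> u = a" "w \<in> carrier FR" "\<pi> w = a'" using pi_surj a by metis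
    have "xi R A ms fs \<phi> B T (\<pi> (u \<otimes>\<^bsub>FR\<^esub> w)) = xev (u \<otimes>\<^bsub>FR\<^esub> w) (iot T)"
      by (rule x) (use uw in simp)
    then show ?thesis
      using x[OF uw(1)] x[OF uw(3)] ext_ev_leibniz[OF homog_iot[OF T] uw(1,3)] uw
      by (simp add: ghom_mult[OF p\<pi>])
  qed
  ultimately show ?thesis by (simp add: hDer_def)
qed

section \<open>Injectivity and surjectivity of the comparison map\<close>

lemma lsl_xev:
  assumes d: "dbasis B u \<sigma>" and w: "w \<in> carrier FR" and S: "S \<in> carrier (tensor B MA)"
  shows "lsl \<sigma> A i (xev w S) = evl w (lsl \<sigma> MA i S)"
  unfolding xev_def by (rule lsl_tmap[OF xvB pvM pvA d bilin_r[OF bilin_evl w] S])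

text \<open>Evaluation at the generator \<open>x_j\<close> reads off the coordinate of index
  \<open>j\<close>. Slicing over \<open>B\<close> reduces the claim to this fact for vectors of
  coefficients in \<open>A\<close>.\<close>

lemma xev_inj:
  assumes S: "S \<in> carrier (tensor B MA)" "S' \<in> carrier (tensor B MA)"
    and eq: "\<And>i. i < length ms \<Longrightarrow> xev (fgen R ms i) S = xev (fgen R ms i) S'"
  shows "S = S'"
proof -
  obtain \<sigma> where d: "dbasis B (\<lambda>v. v) \<sigma>" using ex_dbasis[OF xvB] by blast
  show ?thesis
  proof (rule tensor_eq_lsl[OF xvB pvM d S])
    fix i
    have c: "lsl \<sigma> MA i S \<in> carrier MA" "lsl \<sigma> MA i S' \<in> carrier MA"
      using lin_map_closed[OF lin_lsl[OF xvB pvM d]] S by blast+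
    have "lsl \<sigma> MA i S j = lsl \<sigma> MA i S' j" if j: "j \<in> {..<length ms}" for j
    proof -
      have j: "j < length ms" using j by simp
      have "lsl \<sigma> A i (xev (fgen R ms j) S) = lsl \<sigma> A i (xev (fgen R ms j) S')" by (simp only: eq[OF j])
      then show ?thesis
        unfolding lsl_xev[OF d fgen_closed[OF j] S(1)] lsl_xev[OF d fgen_closed[OF j] S(2)]
          evl_gen[OF j c(1)] evl_gen[OF j c(2)] .
    qed
    with c[unfolded pM_carrier] show "lsl \<sigma> MA i S = lsl \<sigma> MA i S'" by (rule PiE_ext)
  qed
qed

lemma xi_inj:
  assumes T: "T \<in> carrier (tensor B SM)" "T' \<in> carrier (tensor B SM)"
    and eq: "xi R A ms fs \<phi> B T = xi R A ms fs \<phi> B T'"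
  shows "T = T'"
proof (rule iot_inj[OF T xev_inj[OF iot_closed[OF T(1)] iot_closed[OF T(2)]]])
  fix i assume "i < length ms"
  then show "xev (fgen R ms i) (iot T) = xev (fgen R ms i) (iot T')"
    using xi_pi[OF fgen_closed T(1)] xi_pi[OF fgen_closed T(2)] eq by metis
qed

text \<open>
  A derivation is determined by its values on the generators, and any choice of values on the generators
  is attained by the evaluation of an element of \<open>B \<otimes> \<Oplus>\<^sub>j A[- m\<^sub>j]\<close>.
\<close>

lemma xi_surj:
  assumes v: "v \<in> hDer R A B"
  shows "\<exists>T. homog (htensor B HD) 0 T \<and> xi R A ms fs \<phi> B T = v"
proof -
  let ?N = "length ms"
  let ?V = "\<lambda>j. hshift A (- (ms ! j))"
  define inc where "inc = (\<lambda>j. tmap B MA id (dsum_incl ?N ?V j))"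
  \<comment> \<open>The value of \<open>v\<close> at \<open>x_j\<close> is placed in the summand of
    index \<open>j\<close>. The shift of that summand cancels the degree of \<open>x_j\<close>, so
    the total degree is 0.\<close>
  define S where "S = (\<Oplus>\<^bsub>tensor B MA\<^esub>j\<in>{..<?N}. inc j (v (\<pi> (fgen R ms j))))"
  interpret B: ring B by (rule galg_ring[OF B])
  have vc: "v \<in> comod_hom A PB" using v by (simp add: hDer_def)
  then have vl: "lin_map A TB v" and ve: "v \<in> extensional (carrier A)" by (simp_all add: comod_hom_def)
  have vh: "homog (htensor B A) m (v a)" if "homog A m a" for m a
    using comod_hom_homog[OF pvA galg_vspace[OF xP] vc that] by simp
  have vL: "v (a \<otimes>\<^bsub>A\<^esub> a') = v a \<otimes>\<^bsub>PB\<^esub> tens B A \<one>\<^bsub>B\<^esub> a' \<oplus>\<^bsub>TB\<^esub> tens B A \<one>\<^bsub>B\<^esub> a \<otimes>\<^bsub>PB\<^esub> v a'"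
    if "a \<in> carrier A" "a' \<in> carrier A" for a a' using v that by (simp add: hDer_def)
  have li: "lin_map A MA (dsum_incl ?N ?V j)" if "j < ?N" for j
    using lin_dsum_incl[where V="?V" and N="?N", OF pgV that] by (simp add: hdsum_fields[OF pgV])
  have linc: "lin_map TB (tensor B MA) (inc j)" if "j < ?N" for j
    unfolding inc_def by (rule lin_tmap[OF xvB pvA xvB pvM lin_id_B li[OF that]])
  have vg: "v (\<pi> (fgen R ms j)) \<in> carrier TB" if "j < ?N" for j
    using lin_map_closed[OF vl ghom_closed[OF p\<pi> fgen_closed[OF that]]] .
  have "homog (htensor B MA) 0 (\<Oplus>\<^bsub>htensor B MA\<^esub>j\<in>{..<?N}. inc j (v (\<pi> (fgen R ms j))))"
  proof (rule homog_finsum[OF gr_htensor[OF xgB pgM]])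
    fix j assume "j \<in> {..<?N}"
    then have j: "j < ?N" by simp
    have "homog (htensor B MA) (ms ! j + (- (ms ! j))) (inc j (v (\<pi> (fgen R ms j))))"
      unfolding inc_def
    proof (rule homog_tmap[OF xgB pgA xgB pgM lin_id_B _ li[OF j] _ vh[OF ghom_homog[OF p\<pi> fgen_homog[OF j]]]])
      show "homog MA (m + - (ms ! j)) (dsum_incl ?N ?V j w)" if "homog A m w" for m w
        by (rule homog_dsum_incl[OF pgV j]) (simp add: homog_hshift[OF pgA] that)
    qed simp
    then show "homog (htensor B MA) 0 (inc j (v (\<pi> (fgen R ms j))))" by simp
  qed simp
  then have Sh: "homog (htensor B MA) 0 S"
    unfolding S_def finsum_cong_spaces[of "htensor B MA" "tensor B MA", OF htensor_simps(1,3,2)] .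
  then have Sc: "S \<in> carrier (tensor B MA)" using homog_closed by fastforce
  have xgen: "xev (fgen R ms i) S = v (\<pi> (fgen R ms i))" if i: "i < ?N" for i
  proof -
    have d: "xev (fgen R ms i) (inc j Y) = (if i = j then Y else \<zero>\<^bsub>TB\<^esub>)"
      if j: "j < ?N" and Y: "Y \<in> carrier TB" for j Y
    proof (rule tensor_lin_eqI[OF xvB pvA xvT lin_map_comp[OF linc[OF j] lin_ext_ev[OF fgen_closed[OF i]]] _ _ Y])
      show "lin_map TB TB (\<lambda>Y. if i = j then Y else \<zero>\<^bsub>TB\<^esub>)"
        using lin_map_id lin_map_const_zero[OF xvT] by (cases "i = j") auto
      fix b a assume b: "b \<in> carrier B" and a: "a \<in> carrier A"
      have "inc j (tens B A b a) = tens B MA b (dsum_incl ?N ?V j a)"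
        using tmap_tens[OF xvB pvA xvB pvM lin_id_B li[OF j] b a] by (simp add: inc_def)
      then show "xev (fgen R ms i) (inc j (tens B A b a)) = (if i = j then tens B A b a else \<zero>\<^bsub>TB\<^esub>)"
        using ext_ev_tens[OF fgen_closed[OF i] b lin_map_closed[OF li[OF j] a]] evl_gen[OF i lin_map_closed[OF li[OF j] a]]
          i tens_zero_r[OF xvB pvA b] by (simp add: dsum_incl_def)
    qed
    have "xev (fgen R ms i) S = (\<Oplus>\<^bsub>TB\<^esub>j\<in>{..<?N}. xev (fgen R ms i) (inc j (v (\<pi> (fgen R ms j)))))"
      unfolding S_def by (rule lin_map_finsum[OF vspace_tensor[OF xvB pvM] xvT lin_ext_ev[OF fgen_closed[OF i]]])
        (use lin_map_closed[OF linc] vg in auto)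
    also have "\<dots> = (\<Oplus>\<^bsub>TB\<^esub>j\<in>{..<?N}. if i = j then v (\<pi> (fgen R ms j)) else \<zero>\<^bsub>TB\<^esub>)"
      by (rule T.finsum_cong') (use d vg in auto)
    also have "\<dots> = v (\<pi> (fgen R ms i))" using i vg by (intro T.finsum_singleton) auto
    finally show ?thesis .
  qed
  \<comment> \<open>The Leibniz rule at the product of units gives \<open>x = x + x\<close>; both
    evaluation and \<open>v\<close> therefore vanish on the unit.\<close>
  have one0: "x = \<zero>\<^bsub>TB\<^esub>" if "x \<in> carrier TB" "x = x \<otimes>\<^bsub>PB\<^esub> \<one>\<^bsub>PB\<^esub> \<oplus>\<^bsub>TB\<^esub> \<one>\<^bsub>PB\<^esub> \<otimes>\<^bsub>PB\<^esub> x" for x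
  proof -
    have "x \<in> carrier PB" using that(1) by simp
    then have "x \<oplus>\<^bsub>TB\<^esub> x = x" using that(2) P.r_one[of x] P.l_one[of x] by simp
    then show ?thesis using T.add.l_cancel_one[of x x] that(1) by simp
  qed
  \<comment> \<open>Evaluation of \<open>S\<close> and \<open>v\<close> composed with the projection
    satisfy the same Leibniz rule on the free algebra and agree on generators.\<close>
  have ev: "xev w S = v (\<pi> w)" if "w \<in> carrier FR" for w
    using that
  proof (induction rule: hfree_gen_induct)
    case one
    have "xev \<one>\<^bsub>FR\<^esub> S = \<zero>\<^bsub>TB\<^esub>"
      by (rule one0) (use ext_ev_leibniz[OF Sh FR.one_closed FR.one_closed] lin_map_closed[OF lin_ext_ev[OF FR.one_closed] Sc]
        in \<open>simp_all add: ghom_one[OF p\<pi>]\<close>)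
    moreover have "v \<one>\<^bsub>A\<^esub> = \<zero>\<^bsub>TB\<^esub>"
      by (rule one0) (use vL[OF A.one_closed A.one_closed] lin_map_closed[OF vl A.one_closed] in simp_all)
    ultimately show ?case by (simp add: ghom_one[OF p\<pi>])
  next
    case (gen i X)
    then show ?case
      using ext_ev_leibniz[OF Sh fgen_closed[OF gen(1)] gen(2)] xgen[OF gen(1)]
        vL[OF ghom_closed[OF p\<pi> fgen_closed[OF gen(1)]] ghom_closed[OF p\<pi> gen(2)]]
      by (simp add: ghom_mult[OF p\<pi> fgen_closed[OF gen(1)] gen(2)])
  next
    case (smult c X)
    then show ?case
      using lin_map_smult[OF lin_ext_ev_w[OF Sc] smult(1)] lin_map_smult[OF vl ghom_closed[OF p\<pi> smult(1)]]
      by (simp add: lin_map_smult[OF ghom_lin[OF p\<pi>]])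
  next
    case (add X Y)
    then show ?case
      using lin_map_add[OF lin_ext_ev_w[OF Sc] add(1,2)] lin_map_add[OF vl ghom_closed[OF p\<pi> add(1)] ghom_closed[OF p\<pi> add(2)]]
      by (simp add: lin_map_add[OF ghom_lin[OF p\<pi>]])
  qed
  obtain \<sigma> where d: "dbasis B (\<lambda>v. v) \<sigma>" using ex_dbasis[OF xvB] by blast
  \<comment> \<open>A relation is zero in \<open>A\<close>, so \<open>v\<close> vanishes on it and
    hence so does evaluation of \<open>S\<close>. Taking slices over \<open>B\<close> turns this
    into the defining equations of \<open>der(A)\<close> for each coefficient.\<close>
  have "lsl \<sigma> MA i S \<in> dersub" for i
  proof -
    have "evl f (lsl \<sigma> MA i S) = \<zero>\<^bsub>A\<^esub>" if f: "f \<in> set fs" for f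
    proof -
      note fF = rel_closed[OF f]
      have "f \<in> rel_ideal R ms fs" unfolding rel_ideal_def using FR.genideal_self[of "set fs"] rel_closed f by blast
      then have "\<pi> f = \<zero>\<^bsub>A\<^esub>" using pres_ker[OF pA pres fF] by simp
      then have "xev f S = \<zero>\<^bsub>TB\<^esub>" using ev[OF fF] lin_map_zero[OF pvA xvT vl] by simp
      then show ?thesis
        using lsl_xev[OF d fF Sc, of i] lin_map_zero[OF xvT pvA lin_lsl[OF xvB pvA d]] by simp
    qed
    then show ?thesis using lin_map_closed[OF lin_lsl[OF xvB pvM d] Sc] by (simp add: dersub_def)
  qed
  then obtain T where T: "T \<in> carrier (tensor B SM)" "tmap B MA id id T = S"
    using tensor_sub_surj[OF xvB pvM lsubspace_dersub d Sc] by blast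
  have iT: "iot T = S" using T(2) by (simp add: iot_def)
  have gB: "gr (htensor B HD)" by (rule gr_htensor[OF xgB gr_hder])
  have Tc: "T \<in> carrier (htensor B HD)" using T(1) by (simp add: hder_simps)
  \<comment> \<open>The lift to \<open>B \<otimes> der(A)\<close> was obtained without control of
    its degree. Its component of degree 0 still maps to \<open>S\<close>, because \<open>iot\<close>
    preserves degrees and \<open>S\<close> has degree 0.\<close>
  have "iot (hpr (htensor B HD) 0 T) = hpr (htensor B MA) (0 + 0) (iot T)"
    by (rule hpr_map[OF gB gr_htensor[OF xgB pgM] _ _ Tc]) (use lin_iot homog_iot in \<open>simp_all add: hder_simps\<close>)
  then have ih: "iot (hpr (htensor B HD) 0 T) = S"
    using hpr_homog[OF gr_htensor[OF xgB pgM] Sh, of 0] iT by simp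
  have hh: "homog (htensor B HD) 0 (hpr (htensor B HD) 0 T)" by (rule homog_hpr[OF gB Tc])
  have "xi R A ms fs \<phi> B (hpr (htensor B HD) 0 T) = v"
  proof (rule extensionalityI[of _ "carrier A"])
    fix a assume "a \<in> carrier A"
    then obtain w where w: "w \<in> carrier FR" "\<pi> w = a" using pi_surj by blast
    then show "xi R A ms fs \<phi> B (hpr (htensor B HD) 0 T) a = v a"
      using xi_pi[OF w(1) carrier_hder_tensor[OF hh]] ev[OF w(1)] ih by simp
  qed (use ve in \<open>simp_all add: xi_def\<close>)
  then show ?thesis using hh by blast
qed

section \<open>Linearity and naturality of the comparison map\<close>

lemma xi_zero: "xi R A ms fs \<phi> B \<zero>\<^bsub>tensor B SM\<^esub> = (\<lambda>a\<in>carrier A. \<zero>\<^bsub>PB\<^esub>)"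
proof (rule extensionalityI[of _ "carrier A"])
  fix a assume "a \<in> carrier A"
  then obtain w where w: "w \<in> carrier FR" "\<pi> w = a" using pi_surj by blast
  have vS: "vspace (tensor B SM)" by (rule vspace_tensor[OF xvB xvS])
  have "xev w (iot \<zero>\<^bsub>tensor B SM\<^esub>) = \<zero>\<^bsub>TB\<^esub>"
    by (rule lin_map_zero[OF vS xvT lin_map_comp[OF lin_iot lin_ext_ev[OF w(1)]]])
  then show "xi R A ms fs \<phi> B \<zero>\<^bsub>tensor B SM\<^esub> a = (\<lambda>a\<in>carrier A. \<zero>\<^bsub>PB\<^esub>) a"
    using xi_pi[OF w(1) vs_zero_closed[OF vS]] w ghom_closed[OF p\<pi> w(1)] by simp
qed (simp_all add: xi_def)

lemma xi_add:
  assumes T: "T \<in> carrier (tensor B SM)" "T' \<in> carrier (tensor B SM)"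
  shows "xi R A ms fs \<phi> B (T \<oplus>\<^bsub>tensor B SM\<^esub> T') =
    (\<lambda>a\<in>carrier A. xi R A ms fs \<phi> B T a \<oplus>\<^bsub>PB\<^esub> xi R A ms fs \<phi> B T' a)"
proof (rule extensionalityI[of _ "carrier A"])
  fix a assume "a \<in> carrier A"
  then obtain w where w: "w \<in> carrier FR" "\<pi> w = a" using pi_surj by blast
  have vS: "vspace (tensor B SM)" by (rule vspace_tensor[OF xvB xvS])
  have "xev w (iot (T \<oplus>\<^bsub>tensor B SM\<^esub> T')) = xev w (iot T) \<oplus>\<^bsub>TB\<^esub> xev w (iot T')"
    by (rule lin_map_add[OF lin_map_comp[OF lin_iot lin_ext_ev[OF w(1)]] T])
  then show "xi R A ms fs \<phi> B (T \<oplus>\<^bsub>tensor B SM\<^esub> T') a =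
      (\<lambda>a\<in>carrier A. xi R A ms fs \<phi> B T a \<oplus>\<^bsub>PB\<^esub> xi R A ms fs \<phi> B T' a) a"
    using xi_pi[OF w(1) vs_add_closed[OF vS T]] xi_pi[OF w(1) T(1)] xi_pi[OF w(1) T(2)] w ghom_closed[OF p\<pi> w(1)] by simp
qed (simp_all add: xi_def)

lemma xi_smult:
  assumes b: "b \<in> carrier B" and T: "T \<in> carrier (tensor B SM)"
  shows "xi R A ms fs \<phi> B (tlift (tensor B SM) (\<lambda>b' L. tens B SM (b \<otimes>\<^bsub>B\<^esub> b') L) T) =
    (\<lambda>a\<in>carrier A. tens B A b \<one>\<^bsub>A\<^esub> \<otimes>\<^bsub>PB\<^esub> xi R A ms fs \<phi> B T a)"
proof (rule extensionalityI[of _ "carrier A"])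
  fix a assume "a \<in> carrier A"
  then obtain w where w: "w \<in> carrier FR" "\<pi> w = a" using pi_surj by blast
  interpret B: ring B by (rule galg_ring[OF B])
  note vS = vspace_tensor[OF xvB xvS]
  let ?act = "tlift (tensor B SM) (\<lambda>b' L. tens B SM (b \<otimes>\<^bsub>B\<^esub> b') L)"
  have bl: "bilin B SM (tensor B SM) (\<lambda>b' L. tens B SM (b \<otimes>\<^bsub>B\<^esub> b') L)"
    by (rule bilin_comp[OF bilin_tens[OF xvB xvS] bilin_r[OF bilin_mult[OF B] b] lin_map_id])
  note la = lin_tlift[OF xvB xvS vS bl]
  have c1: "tens B A b \<one>\<^bsub>A\<^esub> \<in> carrier TB" by (rule tens_closed[OF xvB pvA b A.one_closed])
  note lm = bilin_r[OF bilin_hcoprod[OF R B pA] c1]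
  \<comment> \<open>The unit of \<open>A\<close> has degree 0, so the product in
    \<open>B \<squnion> A\<close> multiplies the left factors without a braiding factor.\<close>
  have m: "tens B A b \<one>\<^bsub>A\<^esub> \<otimes>\<^bsub>PB\<^esub> tens B A b' x = tens B A (b \<otimes>\<^bsub>B\<^esub> b') x"
    if "b' \<in> carrier B" "x \<in> carrier A" for b' x
    using that(1)
  proof (induction rule: gr_induct[OF xgB, consumes 1, case_names homog add])
    case (homog k b')
    then show ?case
      using hcoprod_tens[OF R B pA b galg_homog_one[OF pA] homog that(2)] that b
        vs_smult_1[OF xvT tens_closed[OF xvB pvA B.m_closed[OF b homog_closed[OF homog]] that(2)]]
      by (simp add: bch_0_r[OF R] bch_0_l[OF R])
  next
    case (add u v)
    note lt = bilin_l[OF bilin_tens[OF xvB pvA] that(2)]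
    show ?case
      using add b tens_closed[OF xvB pvA _ that(2)] by (simp add: lin_map_add[OF lt] lin_map_add[OF lm] B.r_distr)
  qed
  have "xev w (iot (?act T)) = tens B A b \<one>\<^bsub>A\<^esub> \<otimes>\<^bsub>PB\<^esub> xev w (iot T)"
  proof (rule tensor_lin_eqI[OF xvB xvS xvT lin_map_comp[OF la lin_map_comp[OF lin_iot lin_ext_ev[OF w(1)]]]
        lin_map_comp[OF lin_map_comp[OF lin_iot lin_ext_ev[OF w(1)]] lm] _ T])
    fix b' L assume b': "b' \<in> carrier B" and "L \<in> carrier SM"
    then have L: "L \<in> carrier SM" "L \<in> dersub" by simp_all
    have "?act (tens B SM b' L) = tens B SM (b \<otimes>\<^bsub>B\<^esub> b') L" by (rule tlift_tens[OF xvB xvS vS bl b' L(1)])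
    then show "xev w (iot (?act (tens B SM b' L))) = tens B A b \<one>\<^bsub>A\<^esub> \<otimes>\<^bsub>PB\<^esub> xev w (iot (tens B SM b' L))"
      using b b' L w dersub_closed[OF L(2)] evl_closed[OF w(1) dersub_closed[OF L(2)]]
      by (simp add: iot_tens ext_ev_tens m)
  qed
  then show "xi R A ms fs \<phi> B (?act T) a = (\<lambda>a\<in>carrier A. tens B A b \<one>\<^bsub>A\<^esub> \<otimes>\<^bsub>PB\<^esub> xi R A ms fs \<phi> B T a) a"
    using xi_pi[OF w(1) lin_map_closed[OF la T]] xi_pi[OF w(1) T] w ghom_closed[OF p\<pi> w(1)] by simp
qed (simp_all add: xi_def)

end

lemma xi_natural:
  fixes B C :: "('k, 'n, 'u) hobj"
  assumes B: "galg B" and C: "galg C" and f: "ghom C B f"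
    and T: "T \<in> carrier (tensor C (MA\<lparr>carrier := dersub\<rparr>))"
  shows "xi R A ms fs \<phi> B (tmap B (MA\<lparr>carrier := dersub\<rparr>) f id T) =
    compose (carrier A) (tmap B A f id) (xi R A ms fs \<phi> C T)"
proof (rule extensionalityI[of _ "carrier A"])
  let ?S = "MA\<lparr>carrier := dersub\<rparr>"
  note vB = galg_vspace[OF B] and vC = galg_vspace[OF C] and vS = vspace_sub[OF pvM lsubspace_dersub]
  fix a assume "a \<in> carrier A"
  then obtain w where w: "w \<in> carrier FR" "\<pi> w = a" using pi_surj by blast
  have idS: "lin_map ?S ?S id" and idA: "lin_map A A id" by (simp_all add: id_def lin_map_id)
  note lS = lin_tmap[OF vC vS vB vS ghom_lin[OF f] idS] and tS = tmap_tens[OF vC vS vB vS ghom_lin[OF f] idS]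
  note lA = lin_tmap[OF vC pvA vB pvA ghom_lin[OF f] idA] and tA = tmap_tens[OF vC pvA vB pvA ghom_lin[OF f] idA]
  have "xev B w (iot B (tmap B ?S f id T)) = tmap B A f id (xev C w (iot C T))"
  proof (rule tensor_lin_eqI[OF vC vS vspace_tensor[OF vB pvA]
        lin_map_comp[OF lS lin_map_comp[OF lin_iot[OF B] lin_ext_ev[OF B w(1)]]]
        lin_map_comp[OF lin_map_comp[OF lin_iot[OF C] lin_ext_ev[OF C w(1)]] lA] _ T])
    fix c L assume c: "c \<in> carrier C" and "L \<in> carrier ?S"
    then have L: "L \<in> carrier ?S" "L \<in> dersub" by simp_all
    then show "xev B w (iot B (tmap B ?S f id (tens C ?S c L))) = tmap B A f id (xev C w (iot C (tens C ?S c L)))"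
      using tS[OF c L(1)] tA[OF c evl_closed[OF w(1) dersub_closed[OF L(2)]]] c dersub_closed[OF L(2)] ghom_closed[OF f c] w
      by (simp add: iot_tens[OF B] iot_tens[OF C] ext_ev_tens[OF B] ext_ev_tens[OF C])
  qed
  then show "xi R A ms fs \<phi> B (tmap B ?S f id T) a = compose (carrier A) (tmap B A f id) (xi R A ms fs \<phi> C T) a"
    using xi_pi[OF B w(1) lin_map_closed[OF lS T]] xi_pi[OF C w(1) T] w ghom_closed[OF p\<pi> w(1)] by (simp add: compose_def)
qed (simp_all add: xi_def)

end

section \<open>Transport of module objects\<close>

lemma hfp_galg: "hfp R B \<Longrightarrow> galg B"
  by (auto simp: hfp_def dest: halgebra_galg)

lemma halg_homI: "galg A \<Longrightarrow> galg B \<Longrightarrow> ghom A B f \<Longrightarrow> f \<in> extensional (carrier A) \<Longrightarrow> f \<in> halg_hom A B"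
  using comod_homI[OF galg_gr[of A] galg_gr[of B] ghom_lin[of A B f]] ghom_homog[of A B f]
  by (simp add: halg_hom_def ghom_mult[of A B f] ghom_one[of A B f])

lemma halg_hom_id: "galg B \<Longrightarrow> (\<lambda>b\<in>carrier B. b) \<in> halg_hom B B"
  by (rule halg_homI, assumption+, rule ghom_cong[where g = "\<lambda>b. b"])
    (auto simp: ghom_def lin_map_id galg_vspace galg_one_closed galg_mult_closed)

lemma halg_hom_compose:
  assumes "galg A" "galg B" "galg C" "f \<in> halg_hom A B" "g \<in> halg_hom B C"
  shows "compose (carrier A) g f \<in> halg_hom A C"
  by (rule halg_homI[OF assms(1,3) ghom_cong[OF ghom_comp[OF halg_hom_ghom[OF assms(1,2,4)] halg_hom_ghom[OF assms(2,3,5)]]]])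
    (use assms in \<open>auto simp: compose_def galg_vspace galg_one_closed galg_mult_closed\<close>)

text \<open>Naturality is available along morphisms only, while the maps of a covering are specified
  as localizations. Their extensionality comes from \<open>compose\<close>.\<close>

lemma is_loc_halg_hom:
  assumes "cotriangular R" "halgebra R A" "homog A 0 s" "galg C" "is_loc R A s C f"
  shows "f \<in> halg_hom A C"
  by (rule halg_homI[OF halgebra_galg[OF assms(2)] assms(4) is_loc_ghom[OF assms]])
    (use assms(5) in \<open>auto simp: is_loc_def\<close>)

lemma module_transport:
  assumes M: "Module.module K M" and bij: "bij_betw h (carrier M) (carrier N)"
    and zero: "h \<zero>\<^bsub>M\<^esub> = \<zero>\<^bsub>N\<^esub>"
    and add: "\<And>x y. x \<in> carrier M \<Longrightarrow> y \<in> carrier M \<Longrightarrow> h (x \<oplus>\<^bsub>M\<^esub> y) = h x \<oplus>\<^bsub>N\<^esub> h y"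
    and smult: "\<And>a x. a \<in> carrier K \<Longrightarrow> x \<in> carrier M \<Longrightarrow> h (a \<odot>\<^bsub>M\<^esub> x) = a \<odot>\<^bsub>N\<^esub> h x"
  shows "Module.module K N"
proof -
  interpret M: Module.module K M by (rule M)
  have N: "carrier N = h ` carrier M" using bij by (simp add: bij_betw_def)
  show ?thesis
  proof (rule moduleI)
    show "cring K" by (rule M.R.is_cring)
    show "abelian_group N"
    proof (rule abelian_groupI)
      fix x assume "x \<in> carrier N"
      then obtain m where m: "m \<in> carrier M" "x = h m" unfolding N by blast
      then have "h (\<ominus>\<^bsub>M\<^esub> m) \<in> carrier N" "h (\<ominus>\<^bsub>M\<^esub> m) \<oplus>\<^bsub>N\<^esub> x = \<zero>\<^bsub>N\<^esub>"
        using add[of "\<ominus>\<^bsub>M\<^esub> m" m, symmetric] M.l_neg[of m] zero by (auto simp: N)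
      then show "\<exists>y\<in>carrier N. y \<oplus>\<^bsub>N\<^esub> x = \<zero>\<^bsub>N\<^esub>" by blast
      show "\<zero>\<^bsub>N\<^esub> \<oplus>\<^bsub>N\<^esub> x = x" using m add[of "\<zero>\<^bsub>M\<^esub>" m] by (simp add: zero)
    qed (auto simp: N add[symmetric] zero[symmetric] M.a_ac)
  qed (auto simp: N add[symmetric] smult[symmetric] M.smult_l_distr M.smult_r_distr M.smult_assoc1)
qed

context
  fixes R :: "('k::field, 'n::finite) torus2 \<Rightarrow> 'k" and Y :: "('k, 'n, 'u, 'y) kmod" and Z :: "('k, 'n, 'u, 'z) kmod"
    and \<eta> :: "('k, 'n, 'u) hobj \<Rightarrow> 'y \<Rightarrow> 'z"
  assumes R: "cotriangular R" and Y: "kmod_obj R Y"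
    and bij: "\<And>B. hfp R B \<Longrightarrow> bij_betw (\<eta> B) (carrier (sect Y B)) (carrier (sect Z B))"
    and zero: "\<And>B. hfp R B \<Longrightarrow> \<eta> B \<zero>\<^bsub>sect Y B\<^esub> = \<zero>\<^bsub>sect Z B\<^esub>"
    and add: "\<And>B y y'. hfp R B \<Longrightarrow> y \<in> carrier (sect Y B) \<Longrightarrow> y' \<in> carrier (sect Y B) \<Longrightarrow>
      \<eta> B (y \<oplus>\<^bsub>sect Y B\<^esub> y') = \<eta> B y \<oplus>\<^bsub>sect Z B\<^esub> \<eta> B y'"
    and smult: "\<And>B b y. hfp R B \<Longrightarrow> b \<in> coinv B \<Longrightarrow> y \<in> carrier (sect Y B) \<Longrightarrow> \<eta> B (b \<odot>\<^bsub>sect Y B\<^esub> y) = b \<odot>\<^bsub>sect Z B\<^esub> \<eta> B y"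
    and nat: "\<And>B C f y. hfp R B \<Longrightarrow> hfp R C \<Longrightarrow> f \<in> halg_hom C B \<Longrightarrow> y \<in> carrier (sect Y C) \<Longrightarrow>
      \<eta> B (restr Y B C f y) = restr Z B C f (\<eta> C y)"
begin

private abbreviation (input) "Yc B \<equiv> carrier (sect Y B)"
private abbreviation (input) "Zc B \<equiv> carrier (sect Z B)"
private abbreviation (input) "\<theta> B \<equiv> inv_into (carrier (sect Y B)) (\<eta> B)"

lemma transport_inv:
  assumes B: "hfp R B"
  shows transport_l: "y \<in> Yc B \<Longrightarrow> \<theta> B (\<eta> B y) = y" and transport_r: "z \<in> Zc B \<Longrightarrow> \<eta> B (\<theta> B z) = z"
    and transport_closed: "y \<in> Yc B \<Longrightarrow> \<eta> B y \<in> Zc B" and transport_inv_closed: "z \<in> Zc B \<Longrightarrow> \<theta> B z \<in> Yc B"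
    and transport_inj: "y \<in> Yc B \<Longrightarrow> y' \<in> Yc B \<Longrightarrow> \<eta> B y = \<eta> B y' \<Longrightarrow> y = y'"
  using bij[OF B] by (auto simp: bij_betw_def f_inv_into_f inv_into_into inj_on_def)

lemma hsheaf_Y: "hsheaf R Yc (restr Y)"
  using Y by (simp add: kmod_obj_def)

lemma restr_closed: "hfp R B \<Longrightarrow> hfp R C \<Longrightarrow> f \<in> halg_hom C B \<Longrightarrow> y \<in> Yc C \<Longrightarrow> restr Y B C f y \<in> Yc B"
  using hsheaf_Y by (auto simp: hsheaf_def hpresheaf_def)

text \<open>Restriction on \<open>Z\<close> is restriction on \<open>Y\<close> conjugated by
  \<open>\<eta>\<close>, so the laws of a presheaf carry over.\<close>

lemma hpresheaf_transport: "hpresheaf R Zc (restr Z)"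
proof -
  have Yp: "hpresheaf R Yc (restr Y)" using hsheaf_Y by (simp add: hsheaf_def)
  have r: "restr Z B C f z = \<eta> B (restr Y B C f (\<theta> C z))"
    if "hfp R B" "hfp R C" "f \<in> halg_hom C B" "z \<in> Zc C" for B C :: "('k, 'n, 'u) hobj" and f z
    using nat[OF that(1-3) transport_inv_closed[OF that(2,4)]] transport_r[OF that(2,4)] by simp
  show ?thesis
    unfolding hpresheaf_def
  proof (intro conjI allI impI ballI funcsetI)
    show "restr Z B C f z \<in> Zc B" if "hfp R B" "hfp R C" "f \<in> halg_hom C B" "z \<in> Zc C" for B C :: "('k, 'n, 'u) hobj" and f z
      using r[OF that] transport_closed[OF that(1) restr_closed[OF that(1-3) transport_inv_closed[OF that(2,4)]]] by simp
    show "restr Z B B (\<lambda>b\<in>carrier B. b) z = z" if B: "hfp R B" and z: "z \<in> Zc B" for B :: "('k, 'n, 'u) hobj" and z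
      using r[OF B B halg_hom_id[OF hfp_galg[OF B]] z] transport_inv_closed[OF B z] transport_r[OF B z] Yp B
      by (simp add: hpresheaf_def)
    fix B C D :: "('k, 'n, 'u) hobj" and f g z
    assume h: "hfp R B" "hfp R C" "hfp R D" and f: "f \<in> halg_hom C B" and g: "g \<in> halg_hom D C" and z: "z \<in> Zc D"
    note zc = transport_inv_closed[OF h(3) z]
    have c: "compose (carrier D) f g \<in> halg_hom D B"
      by (rule halg_hom_compose[OF _ _ _ g f]) (use h hfp_galg in auto)
    have "restr Z B D (compose (carrier D) f g) z = \<eta> B (restr Y B C f (restr Y C D g (\<theta> D z)))"
      using r[OF h(1,3) c z] Yp h f g zc by (simp add: hpresheaf_def)
    also have "\<dots> = restr Z B C f (\<eta> C (restr Y C D g (\<theta> D z)))"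
      by (rule nat[OF h(1,2) f restr_closed[OF h(2,3) g zc]])
    also have "\<eta> C (restr Y C D g (\<theta> D z)) = restr Z C D g z" using r[OF h(2,3) g z] by simp
    finally show "restr Z B D (compose (carrier D) f g) z = restr Z B C f (restr Z C D g z)" .
  qed
qed

text \<open>A matching family for \<open>Z\<close> is pulled back componentwise. It matches for
  \<open>Y\<close> because \<open>\<eta>\<close> is injective over the overlaps, and a glued section
  of \<open>Y\<close> is mapped back by \<open>\<eta>\<close>.\<close>

lemma hsheaf_transport: "hsheaf R Zc (restr Z)"
  unfolding hsheaf_def
proof (intro conjI allI impI ballI)
  fix A :: "('k, 'n, 'u) hobj" and N :: nat and s C f D g h z
  assume hfpA: "hfp R A" and cov: "hcover R A N s C f" and ov: "hoverlap R A N s C f D g h"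
    and z: "z \<in> (\<Pi>\<^sub>E i\<in>{..<N}. Zc (C i))"
    and comp: "\<forall>i<N. \<forall>j<N. restr Z (D i j) (C i) (g i j) (z i) = restr Z (D i j) (C j) (h i j) (z j)"
  have hA: "halgebra R A" using hfpA by (simp add: hfp_def)
  have sh: "homog A 0 (s i)" and hC: "hfp R (C i)" and lf: "is_loc R A (s i) (C i) (f i)" if "i < N" for i
    using cov that by (auto simp: hcover_def coinv_homog)
  have gC: "galg (C i)" and aC: "halgebra R (C i)" if "i < N" for i using hC[OF that] hfp_galg[OF hC[OF that]] by (auto simp: hfp_def)
  have f: "f i \<in> halg_hom A (C i)" if "i < N" for i
    by (rule is_loc_halg_hom[OF R hA sh[OF that] gC[OF that] lf[OF that]])
  have fs: "homog (C i) 0 (f i (s j))" if "i < N" "j < N" for i j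
    using ghom_homog[OF halg_hom_ghom[OF halgebra_galg[OF hA] gC f]] sh that by blast
  have hD: "hfp R (D i j)" and gD: "galg (D i j)" if "i < N" "j < N" for i j
    using ov that hfp_galg by (auto simp: hoverlap_def)
  have g: "g i j \<in> halg_hom (C i) (D i j)" if "i < N" "j < N" for i j
    by (rule is_loc_halg_hom[OF R aC[OF that(1)] fs[OF that] gD[OF that]]) (use ov that in \<open>simp add: hoverlap_def\<close>)
  have h: "h i j \<in> halg_hom (C j) (D i j)" if "i < N" "j < N" for i j
    by (rule is_loc_halg_hom[OF R aC[OF that(2)] fs[OF that(2,1)] gD[OF that]]) (use ov that in \<open>simp add: hoverlap_def\<close>)
  have zc: "z i \<in> Zc (C i)" if "i < N" for i using z that by auto
  define y where "y = (\<lambda>i\<in>{..<N}. \<theta> (C i) (z i))"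
  have yi: "y i \<in> Yc (C i)" "\<eta> (C i) (y i) = z i" if "i < N" for i
    using transport_inv_closed[OF hC[OF that] zc[OF that]] transport_r[OF hC[OF that] zc[OF that]] that
    by (simp_all add: y_def)
  have yc: "y \<in> (\<Pi>\<^sub>E i\<in>{..<N}. Yc (C i))" using yi by (auto simp: y_def)
  have ycomp: "restr Y (D i j) (C i) (g i j) (y i) = restr Y (D i j) (C j) (h i j) (y j)" if ij: "i < N" "j < N" for i j
  proof (rule transport_inj[OF hD[OF ij] restr_closed[OF hD[OF ij] hC[OF ij(1)] g[OF ij] yi(1)[OF ij(1)]]
      restr_closed[OF hD[OF ij] hC[OF ij(2)] h[OF ij] yi(1)[OF ij(2)]]])
    show "\<eta> (D i j) (restr Y (D i j) (C i) (g i j) (y i)) = \<eta> (D i j) (restr Y (D i j) (C j) (h i j) (y j))"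
      unfolding nat[OF hD[OF ij] hC[OF ij(1)] g[OF ij] yi(1)[OF ij(1)]] nat[OF hD[OF ij] hC[OF ij(2)] h[OF ij] yi(1)[OF ij(2)]]
      using comp ij yi by simp
  qed
  have ex1: "\<exists>!x. x \<in> Yc A \<and> (\<forall>i<N. restr Y (C i) A (f i) x = y i)"
    using hsheaf_Y hfpA cov ov yc ycomp unfolding hsheaf_def by blast
  have glue: "(\<forall>i<N. restr Z (C i) A (f i) (\<eta> A x) = z i) \<longleftrightarrow> (\<forall>i<N. restr Y (C i) A (f i) x = y i)" if x: "x \<in> Yc A" for x
  proof -
    have "restr Z (C i) A (f i) (\<eta> A x) = z i \<longleftrightarrow> restr Y (C i) A (f i) x = y i" if i: "i < N" for i
      unfolding nat[OF hC[OF i] hfpA f[OF i] x, symmetric] yi(2)[OF i, symmetric]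
      by (rule iffI[OF transport_inj[OF hC[OF i] restr_closed[OF hC[OF i] hfpA f[OF i] x] yi(1)[OF i]] arg_cong])
    then show ?thesis by blast
  qed
  show "\<exists>!x. x \<in> Zc A \<and> (\<forall>i<N. restr Z (C i) A (f i) x = z i)"
  proof -
    obtain x where x: "x \<in> Yc A" "\<forall>i<N. restr Y (C i) A (f i) x = y i"
      and u: "\<And>x'. x' \<in> Yc A \<Longrightarrow> \<forall>i<N. restr Y (C i) A (f i) x' = y i \<Longrightarrow> x' = x"
      using ex1 by blast
    show ?thesis
    proof (rule ex1I[of _ "\<eta> A x"])
      show "\<eta> A x \<in> Zc A \<and> (\<forall>i<N. restr Z (C i) A (f i) (\<eta> A x) = z i)"
        using transport_closed[OF hfpA x(1)] glue[OF x(1)] x(2) by blast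
      fix x' assume x': "x' \<in> Zc A \<and> (\<forall>i<N. restr Z (C i) A (f i) x' = z i)"
      then have "\<theta> A x' = x"
        using u[OF transport_inv_closed[OF hfpA]] glue[OF transport_inv_closed[OF hfpA]] transport_r[OF hfpA] by metis
      then show "x' = \<eta> A x" using transport_r[OF hfpA] x' by metis
    qed
  qed
qed (rule hpresheaf_transport)

lemma kmod_obj_transport: "kmod_obj R Z"
  unfolding kmod_obj_def
proof (intro conjI allI impI ballI)
  show "hsheaf R Zc (restr Z)" by (rule hsheaf_transport)
  show "Module.module (coinv_ring B) (sect Z B)" if B: "hfp R B" for B :: "('k, 'n, 'u) hobj"
  proof (rule module_transport[of _ "sect Y B" "\<eta> B"])
    show "Module.module (coinv_ring B) (sect Y B)" using Y B by (simp add: kmod_obj_def)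
  qed (use bij zero add smult B in \<open>auto simp: coinv_ring_def\<close>)
next
  fix B C :: "('k, 'n, 'u) hobj" and f
  assume B: "hfp R B" and C: "hfp R C" and f: "f \<in> halg_hom C B"
  have Yr: "restr Y B C f (y \<oplus>\<^bsub>sect Y C\<^esub> y') = restr Y B C f y \<oplus>\<^bsub>sect Y B\<^esub> restr Y B C f y'"
      "c \<in> coinv C \<Longrightarrow> restr Y B C f (c \<odot>\<^bsub>sect Y C\<^esub> y) = f c \<odot>\<^bsub>sect Y B\<^esub> restr Y B C f y"
    if "y \<in> Yc C" "y' \<in> Yc C" for y y' c using Y B C f that by (auto simp: kmod_obj_def)
  have mC: "Module.module (coinv_ring C) (sect Y C)" using Y C by (simp add: kmod_obj_def)
  note rc = restr_closed[OF B C f] and n = nat[OF B C f]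
  show "restr Z B C f (z \<oplus>\<^bsub>sect Z C\<^esub> z') = restr Z B C f z \<oplus>\<^bsub>sect Z B\<^esub> restr Z B C f z'"
    if z: "z \<in> Zc C" "z' \<in> Zc C" for z z'
  proof -
    obtain y y' where y: "y \<in> Yc C" "y' \<in> Yc C" "z = \<eta> C y" "z' = \<eta> C y'"
      using z transport_r[OF C] transport_inv_closed[OF C] by metis
    interpret M: Module.module "coinv_ring C" "sect Y C" by (rule mC)
    show ?thesis
      using y M.a_closed[OF y(1,2)] rc[OF y(1)] rc[OF y(2)]
      by (simp add: add[OF C, symmetric] n[symmetric] Yr add[OF B])
  qed
  show "restr Z B C f (c \<odot>\<^bsub>sect Z C\<^esub> z) = f c \<odot>\<^bsub>sect Z B\<^esub> restr Z B C f z"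
    if c: "c \<in> coinv C" and z: "z \<in> Zc C" for c z
  proof -
    obtain y where y: "y \<in> Yc C" "z = \<eta> C y"
      using z transport_r[OF C] transport_inv_closed[OF C] by metis
    interpret M: Module.module "coinv_ring C" "sect Y C" by (rule mC)
    have fc: "f c \<in> coinv B"
      using ghom_homog[OF halg_hom_ghom[OF hfp_galg[OF C] hfp_galg[OF B] f]] c by (simp add: coinv_homog)
    have "c \<odot>\<^bsub>sect Y C\<^esub> y \<in> Yc C" by (rule M.smult_closed) (use c y in \<open>simp_all add: coinv_ring_def\<close>)
    then show ?thesis
      using y c rc[OF y(1)] fc
      by (simp add: smult[OF C, symmetric] n[symmetric] Yr(2)[OF y(1) y(1)] smult[OF B])
  qed
qed

text \<open>The componentwise inverses are again linear and natural: each equation follows by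
  applying the inverse to the corresponding equation for \<open>\<eta>\<close>.\<close>

lemma kmod_iso_transport: "kmod_iso R Y Z \<eta>"
  unfolding kmod_iso_def
proof (intro conjI exI[of _ "\<lambda>B. \<theta> B"] allI impI ballI)
  show "kmod_hom R Y Z \<eta>"
    unfolding kmod_hom_def using Y kmod_obj_transport transport_closed add smult nat by blast
  show "kmod_hom R Z Y (\<lambda>B. \<theta> B)"
    unfolding kmod_hom_def
  proof (intro conjI allI impI ballI funcsetI kmod_obj_transport Y)
    fix B :: "('k, 'n, 'u) hobj" assume B: "hfp R B"
    interpret M: Module.module "coinv_ring B" "sect Y B" using Y B by (simp add: kmod_obj_def)
    note c = transport_inv_closed[OF B] and r = transport_r[OF B] and l = transport_l[OF B]
    show "\<theta> B z \<in> Yc B" if "z \<in> Zc B" for z by (rule c[OF that])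
    show "\<theta> B (z \<oplus>\<^bsub>sect Z B\<^esub> z') = \<theta> B z \<oplus>\<^bsub>sect Y B\<^esub> \<theta> B z'" if "z \<in> Zc B" "z' \<in> Zc B" for z z'
      using add[OF B c[OF that(1)] c[OF that(2)]] l[OF M.a_closed[OF c[OF that(1)] c[OF that(2)]]] r that by simp
    show "\<theta> B (b \<odot>\<^bsub>sect Z B\<^esub> z) = b \<odot>\<^bsub>sect Y B\<^esub> \<theta> B z" if b: "b \<in> coinv B" and z: "z \<in> Zc B" for b z
    proof -
      have "b \<odot>\<^bsub>sect Y B\<^esub> \<theta> B z \<in> Yc B" by (rule M.smult_closed) (use b c[OF z] in \<open>simp_all add: coinv_ring_def\<close>)
      then show ?thesis using smult[OF B b c[OF z]] l r[OF z] by metis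
    qed
  next
    fix B C :: "('k, 'n, 'u) hobj" and f z assume h: "hfp R B" "hfp R C" "f \<in> halg_hom C B" and z: "z \<in> Zc C"
    note zc = transport_inv_closed[OF h(2) z]
    show "\<theta> B (restr Z B C f z) = restr Y B C f (\<theta> C z)"
      using nat[OF h zc] transport_l[OF h(1) restr_closed[OF h zc]] transport_r[OF h(2) z] by simp
  qed
qed (use transport_l transport_r in auto)

end

section \<open>The isomorphism\<close>

theorem theorem8p2:
  fixes R :: "('k::field, 'n::finite) torus2 \<Rightarrow> 'k"
    and A :: "('k, 'n, 'a) hobj"
    and ms :: "(int ^ 'n) list"
    and fs :: "'k ncpoly set list"
    and \<phi> :: "'k ncpoly set set \<Rightarrow> 'a"
  assumes "cotriangular R"
    and "halgebra R A"
    and "hpresents R A ms fs \<phi>"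
  shows "kmod_iso R
           (jmod (hder R A ms fs \<phi>) :: ('k, 'n, 'u, (('u \<times> (nat \<Rightarrow> 'a)) \<Rightarrow>\<^sub>0 'k) set) kmod)
           (Dermod R A :: ('k, 'n, 'u, 'a \<Rightarrow> (('u \<times> 'a) \<Rightarrow>\<^sub>0 'k) set) kmod)
           (xi R A ms fs \<phi>)"
proof (rule kmod_iso_transport[OF assms(1) kmod_obj_jmod[OF assms(1) gr_hder[OF assms]]])
  let ?D = "hder R A ms fs \<phi>"
  \<comment> \<open>The tensor products with \<open>der(A)\<close> and with its underlying subspace
    are equal, so the facts about \<open>xi\<close> can be restated for the sections of
    \<open>jmod\<close>.\<close>
  note s = hder_simps(5,6)[OF assms, symmetric]
  note xiD = carrier_hder_tensor[OF assms, unfolded s] xi_zero[OF assms, unfolded s] xi_add[OF assms, unfolded s]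
    xi_smult[OF assms, unfolded s] xi_inj[OF assms, unfolded s]
  have sect: "carrier (sect (jmod ?D) B) = {T. homog (htensor B ?D) 0 T}" "zero (sect (jmod ?D) B) = \<zero>\<^bsub>tensor B ?D\<^esub>"
      "add (sect (jmod ?D) B) = add (tensor B ?D)"
      "smult (sect (jmod ?D) B) = (\<lambda>b. tlift (tensor B ?D) (\<lambda>b' v. tens B ?D (b \<otimes>\<^bsub>B\<^esub> b') v))"
      "restr (jmod ?D) B C f = tmap B ?D f id" for B C :: "('k, 'n, 'u) hobj" and f
    by (simp_all add: jmod_def coinv_homog)
  note g = hfp_galg
  show "xi R A ms fs \<phi> B \<zero>\<^bsub>sect (jmod ?D) B\<^esub> = \<zero>\<^bsub>sect (Dermod R A) B\<^esub>" if "hfp R B" for B :: "('k, 'n, 'u) hobj"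
    using xiD(2)[OF g[OF that]] by (simp add: sect Dermod_def)
  show "bij_betw (xi R A ms fs \<phi> B) (carrier (sect (jmod ?D) B)) (carrier (sect (Dermod R A) B))"
    if "hfp R B" for B :: "('k, 'n, 'u) hobj"
    unfolding bij_betw_def inj_on_def
    using xi_mem[OF assms g[OF that]] xi_surj[OF assms g[OF that]]
      xiD(5)[OF g[OF that] xiD(1)[OF g[OF that]] xiD(1)[OF g[OF that]]]
    by (auto simp only: sect Dermod_def mem_Collect_eq module.simps partial_object.simps kmod.simps) (blast, metis imageI mem_Collect_eq)
  show "xi R A ms fs \<phi> B (T \<oplus>\<^bsub>sect (jmod ?D) B\<^esub> T') = xi R A ms fs \<phi> B T \<oplus>\<^bsub>sect (Dermod R A) B\<^esub> xi R A ms fs \<phi> B T'"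
    if "hfp R B" "T \<in> carrier (sect (jmod ?D) B)" "T' \<in> carrier (sect (jmod ?D) B)"
    for B :: "('k, 'n, 'u) hobj" and T T'
    using xiD(3)[OF g[OF that(1)] xiD(1)[OF g[OF that(1)]] xiD(1)[OF g[OF that(1)]]] that(2,3)
    by (simp add: sect Dermod_def)
  show "xi R A ms fs \<phi> B (b \<odot>\<^bsub>sect (jmod ?D) B\<^esub> T) = b \<odot>\<^bsub>sect (Dermod R A) B\<^esub> xi R A ms fs \<phi> B T"
    if "hfp R B" "b \<in> coinv B" "T \<in> carrier (sect (jmod ?D) B)" for B :: "('k, 'n, 'u) hobj" and b T
    using xiD(4)[OF g[OF that(1)] homog_closed xiD(1)[OF g[OF that(1)]]] that(2,3)
    by (simp add: sect Dermod_def coinv_homog)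
  show "xi R A ms fs \<phi> B (restr (jmod ?D) B C f T) = restr (Dermod R A) B C f (xi R A ms fs \<phi> C T)"
    if "hfp R B" "hfp R C" "f \<in> halg_hom C B" "T \<in> carrier (sect (jmod ?D) C)" for B C :: "('k, 'n, 'u) hobj" and f T
    using xi_natural[OF assms g[OF that(1)] g[OF that(2)] halg_hom_ghom[OF g[OF that(2)] g[OF that(1)] that(3)]
        carrier_hder_tensor[OF assms g[OF that(2)]], of 0 T] that(4)
    by (simp add: sect Dermod_def tmap_def hder_simps(5,6)[OF assms])
qed

end
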